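(* Let $\Gamma$ be an irreducible lattice in a locally compact $\sigma$-compact group $G=G_1\times\cdots\times G_n$. Assume that $\Gamma$ is weakly cocompact and $p$-integrable for some $p>1$. Then any homomorphism $\Gamma\to\mathbf{R}$ extends continuously to $G$ (i.e. extends to a continuous homomorphism $G\to\mathbf{R}$).
   Context: Here $n\ge2$. The lattice $\Gamma<G$ is irreducible if its projection to each $G_i$ is dense. It is weakly cocompact if the $G$-representation on $L^2_0(G/\Gamma)$ (the orthogonal complement of the constants in $L^2(G/\Gamma)$) does not almost have non-zero invariant vectors, where a linear isometric representation $\varrho$ almost has invariant vectors if for every compact $K\subseteq G$, $\inf_{\|v\|=1}\mathrm{diam}(\varrho(K)v)=0$. For $p>0$, $\Gamma$ is $p$-integrable if either (i) it is uniform (cocompact), or (ii) it is finitely generated and for some (equivalently any) finite generating set $S\subseteq\Gamma$ there is a Borel fundamental domain $\mathcal{D}\subseteq G$ (with null boundary) such that $\int_{\mathcal{D}}\|\chi(g^{-1}h)\|_S^p\,dh<\infty$ for all $g\in G$, where $\|\cdot\|_S$ is the word-length associated to $S$ and $\chi:G\to\Gamma$ is defined by $\chi^{-1}(e)=\mathcal{D}$, $\chi(g\gamma^{-1})=\gamma\chi(g)$. *)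

theory Defs
  imports "HOL-Analysis.Analysis" "HOL-Algebra.Algebra"
begin

section \<open>Topological groups\<close>

definition topological_group :: "'a monoid \<Rightarrow> 'a topology \<Rightarrow> bool" where
  "topological_group G T \<longleftrightarrow>
     group G \<and> topspace T = carrier G \<and>
     continuous_map (prod_topology T T) T (\<lambda>(x, y). x \<otimes>\<^bsub>G\<^esub> y) \<and>
     continuous_map T T (\<lambda>x. inv\<^bsub>G\<^esub> x)"

definition sigma_compact_space :: "'a topology \<Rightarrow> bool" where
  "sigma_compact_space T \<longleftrightarrow>
     (\<exists>K :: nat \<Rightarrow> 'a set. (\<forall>n. compactin T (K n)) \<and> (\<Union>n. K n) = topspace T)"

definition discrete_subgroup :: "'a monoid \<Rightarrow> 'a topology \<Rightarrow> 'a set \<Rightarrow> bool" where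
  "discrete_subgroup G T \<Gamma> \<longleftrightarrow> subgroup \<Gamma> G \<and> subtopology T \<Gamma> = discrete_topology \<Gamma>"


section \<open>The homogeneous space of left cosets\<close>

definition coset_topology :: "'a monoid \<Rightarrow> 'a topology \<Rightarrow> 'a set \<Rightarrow> 'a set topology" where
  "coset_topology G T \<Gamma> =
     topology (\<lambda>U. U \<subseteq> lcosets\<^bsub>G\<^esub> \<Gamma> \<and> openin T {g \<in> topspace T. g <#\<^bsub>G\<^esub> \<Gamma> \<in> U})"

lemma openin_coset_topology:
  "openin (coset_topology G T \<Gamma>) U \<longleftrightarrow>
     U \<subseteq> lcosets\<^bsub>G\<^esub> \<Gamma> \<and> openin T {g \<in> topspace T. g <#\<^bsub>G\<^esub> \<Gamma> \<in> U}"
proof -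
  have "istopology (\<lambda>U. U \<subseteq> lcosets\<^bsub>G\<^esub> \<Gamma> \<and> openin T {g \<in> topspace T. g <#\<^bsub>G\<^esub> \<Gamma> \<in> U})"
    unfolding istopology_def
  proof (intro conjI allI impI)
    fix S U assume "S \<subseteq> lcosets\<^bsub>G\<^esub> \<Gamma> \<and> openin T {g \<in> topspace T. g <#\<^bsub>G\<^esub> \<Gamma> \<in> S}"
      and "U \<subseteq> lcosets\<^bsub>G\<^esub> \<Gamma> \<and> openin T {g \<in> topspace T. g <#\<^bsub>G\<^esub> \<Gamma> \<in> U}"
    moreover have "{g \<in> topspace T. g <#\<^bsub>G\<^esub> \<Gamma> \<in> S \<inter> U} =
        {g \<in> topspace T. g <#\<^bsub>G\<^esub> \<Gamma> \<in> S} \<inter> {g \<in> topspace T. g <#\<^bsub>G\<^esub> \<Gamma> \<in> U}"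
      by blast
    ultimately show "S \<inter> U \<subseteq> lcosets\<^bsub>G\<^esub> \<Gamma>" "openin T {g \<in> topspace T. g <#\<^bsub>G\<^esub> \<Gamma> \<in> S \<inter> U}"
      by auto
  next
    fix \<U> assume *: "\<forall>U\<in>\<U>. U \<subseteq> lcosets\<^bsub>G\<^esub> \<Gamma> \<and> openin T {g \<in> topspace T. g <#\<^bsub>G\<^esub> \<Gamma> \<in> U}"
    then show "\<Union>\<U> \<subseteq> lcosets\<^bsub>G\<^esub> \<Gamma>" by blast
    have "{g \<in> topspace T. g <#\<^bsub>G\<^esub> \<Gamma> \<in> \<Union>\<U>} =
        \<Union>((\<lambda>U. {g \<in> topspace T. g <#\<^bsub>G\<^esub> \<Gamma> \<in> U}) ` \<U>)"
      by blast
    with * show "openin T {g \<in> topspace T. g <#\<^bsub>G\<^esub> \<Gamma> \<in> \<Union>\<U>}"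
      by (metis (no_types, lifting) imageE openin_Union)
  qed
  then show ?thesis
    unfolding coset_topology_def by (simp add: topology_inverse')
qed

lemma topspace_coset_topology:
  assumes "topspace T = carrier G"
  shows "topspace (coset_topology G T \<Gamma>) = lcosets\<^bsub>G\<^esub> \<Gamma>"
proof -
  have "{g \<in> topspace T. g <#\<^bsub>G\<^esub> \<Gamma> \<in> lcosets\<^bsub>G\<^esub> \<Gamma>} = topspace T"
    using assms by (auto simp: LCOSETS_def)
  then have "openin (coset_topology G T \<Gamma>) (lcosets\<^bsub>G\<^esub> \<Gamma>)"
    by (simp add: openin_coset_topology)
  then show ?thesis
    by (metis openin_coset_topology openin_subset openin_topspace subset_antisym)
qed

lemma quotient_map_coset_topology:
  assumes "topspace T = carrier G"
  shows "quotient_map T (coset_topology G T \<Gamma>) (\<lambda>g. g <#\<^bsub>G\<^esub> \<Gamma>)"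
  using assms
  by (auto simp: quotient_map_def topspace_coset_topology openin_coset_topology LCOSETS_def)


section \<open>Haar measure and lattices\<close>

definition borel_of :: "'a topology \<Rightarrow> 'a measure" where
  "borel_of T = sigma (topspace T) {U. openin T U}"

text \<open>Second countability is not assumed, so regularity has to be demanded explicitly:
  it is what makes invariant measures unique up to scaling.\<close>

definition radon_measure :: "'a topology \<Rightarrow> 'a measure \<Rightarrow> bool" where
  "radon_measure T \<mu> \<longleftrightarrow>
     sets \<mu> = sets (borel_of T) \<and>
     (\<forall>K. compactin T K \<longrightarrow> emeasure \<mu> K < \<infinity>) \<and>
     (\<forall>A \<in> sets \<mu>. emeasure \<mu> A = (INF U \<in> {U. openin T U \<and> A \<subseteq> U}. emeasure \<mu> U)) \<and>
     (\<forall>U. openin T U \<longrightarrow> emeasure \<mu> U = (SUP K \<in> {K. compactin T K \<and> K \<subseteq> U}. emeasure \<mu> K))"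

definition haar_measure :: "'a monoid \<Rightarrow> 'a topology \<Rightarrow> 'a measure \<Rightarrow> bool" where
  "haar_measure G T \<mu> \<longleftrightarrow>
     radon_measure T \<mu> \<and> emeasure \<mu> (space \<mu>) \<noteq> 0 \<and>
     (\<forall>g \<in> carrier G. \<forall>A \<in> sets \<mu>. emeasure \<mu> (g <#\<^bsub>G\<^esub> A) = emeasure \<mu> A)"

text \<open>A coset \<open>x\<close> is a set of group elements, so \<open>g <# x\<close> is its translate by \<open>g\<close>,
  and the image of \<open>A\<close> below is the translate of the set of cosets \<open>A\<close>.\<close>

definition invariant_measure_on_cosets ::
    "'a monoid \<Rightarrow> 'a topology \<Rightarrow> 'a set \<Rightarrow> 'a set measure \<Rightarrow> bool" where
  "invariant_measure_on_cosets G T \<Gamma> \<nu> \<longleftrightarrow>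
     radon_measure (coset_topology G T \<Gamma>) \<nu> \<and>
     emeasure \<nu> (space \<nu>) \<noteq> 0 \<and> emeasure \<nu> (space \<nu>) < \<infinity> \<and>
     (\<forall>g \<in> carrier G. \<forall>A \<in> sets \<nu>. emeasure \<nu> ((\<lambda>x. g <#\<^bsub>G\<^esub> x) ` A) = emeasure \<nu> A)"

definition lattice_subgroup :: "'a monoid \<Rightarrow> 'a topology \<Rightarrow> 'a set \<Rightarrow> bool" where
  "lattice_subgroup G T \<Gamma> \<longleftrightarrow>
     discrete_subgroup G T \<Gamma> \<and> (\<exists>\<nu>. invariant_measure_on_cosets G T \<Gamma> \<nu>)"

definition irreducible_in_product ::
    "'i set \<Rightarrow> ('i \<Rightarrow> 'a topology) \<Rightarrow> ('i \<Rightarrow> 'a) set \<Rightarrow> bool" where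
  "irreducible_in_product I T \<Gamma> \<longleftrightarrow>
     (\<forall>i \<in> I. T i closure_of ((\<lambda>x. x i) ` \<Gamma>) = topspace (T i))"


section \<open>Weak cocompactness\<close>

definition diam_wrt :: "('v::minus \<Rightarrow> real) \<Rightarrow> 'v set \<Rightarrow> ennreal" where
  "diam_wrt N S = (SUP x \<in> S. SUP y \<in> S. ennreal (N (x - y)))"

text \<open>\<open>V\<close> is the representation space, \<open>N\<close> its (semi)norm and \<open>\<rho>\<close> the action.
  The infimum is taken in \<open>[0, \<infinity>]\<close>; it is \<open>\<infinity>\<close> if \<open>V\<close> has no unit vector.\<close>

definition almost_has_invariant_vectors ::
    "'a topology \<Rightarrow> 'v::minus set \<Rightarrow> ('v \<Rightarrow> real) \<Rightarrow> ('a \<Rightarrow> 'v \<Rightarrow> 'v) \<Rightarrow> bool" where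
  "almost_has_invariant_vectors T V N \<rho> \<longleftrightarrow>
     (\<forall>K. compactin T K \<longrightarrow>
        (INF v \<in> {v \<in> V. N v = 1}. diam_wrt N ((\<lambda>g. \<rho> g v) ` K)) = 0)"

text \<open>Elements of \<open>L\<^sup>2\<close> are represented by functions; functions that agree almost everywhere
  are at seminorm distance \<open>0\<close>.\<close>

definition L2_functions :: "'b measure \<Rightarrow> ('b \<Rightarrow> complex) set" where
  "L2_functions M = {f \<in> borel_measurable M. integrable M (\<lambda>x. (cmod (f x))\<^sup>2)}"

definition L2_seminorm :: "'b measure \<Rightarrow> ('b \<Rightarrow> complex) \<Rightarrow> real" where
  "L2_seminorm M f = sqrt (LINT x|M. (cmod (f x))\<^sup>2)"

definition L2_0_functions :: "'b measure \<Rightarrow> ('b \<Rightarrow> complex) set" where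
  "L2_0_functions M = {f \<in> L2_functions M. \<forall>c. (LINT x|M. f x * cnj c) = 0}"

definition coset_translation :: "'a monoid \<Rightarrow> 'a \<Rightarrow> ('a set \<Rightarrow> complex) \<Rightarrow> ('a set \<Rightarrow> complex)" where
  "coset_translation G g f = (\<lambda>x. f ((inv\<^bsub>G\<^esub> g) <#\<^bsub>G\<^esub> x))"

text \<open>The invariant measure is unique up to scaling, and rescaling it does not affect the
  condition, so the choice of \<open>\<nu>\<close> is immaterial.\<close>

definition weakly_cocompact :: "'a monoid \<Rightarrow> 'a topology \<Rightarrow> 'a set \<Rightarrow> bool" where
  "weakly_cocompact G T \<Gamma> \<longleftrightarrow>
     (\<exists>\<nu>. invariant_measure_on_cosets G T \<Gamma> \<nu> \<and>
        \<not> almost_has_invariant_vectors T (L2_0_functions \<nu>) (L2_seminorm \<nu>) (coset_translation G))"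


section \<open>Integrability\<close>

definition uniform_subgroup :: "'a monoid \<Rightarrow> 'a topology \<Rightarrow> 'a set \<Rightarrow> bool" where
  "uniform_subgroup G T \<Gamma> \<longleftrightarrow> compact_space (coset_topology G T \<Gamma>)"

definition word_length :: "'a monoid \<Rightarrow> 'a set \<Rightarrow> 'a \<Rightarrow> nat" where
  "word_length G S \<gamma> =
     (LEAST k. \<exists>ws. length ws = k \<and> set ws \<subseteq> S \<union> (\<lambda>s. inv\<^bsub>G\<^esub> s) ` S \<and>
                    foldr (\<lambda>x y. x \<otimes>\<^bsub>G\<^esub> y) ws \<one>\<^bsub>G\<^esub> = \<gamma>)"

definition borel_fundamental_domain ::
    "'a monoid \<Rightarrow> 'a topology \<Rightarrow> 'a measure \<Rightarrow> 'a set \<Rightarrow> 'a set \<Rightarrow> bool" where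
  "borel_fundamental_domain G T \<mu> \<Gamma> D \<longleftrightarrow>
     D \<in> sets (borel_of T) \<and>
     (\<forall>g \<in> carrier G. \<exists>!\<gamma>. \<gamma> \<in> \<Gamma> \<and> g \<otimes>\<^bsub>G\<^esub> \<gamma> \<in> D) \<and>
     emeasure \<mu> (T frontier_of D) = 0"

definition domain_cocycle :: "'a monoid \<Rightarrow> 'a set \<Rightarrow> 'a set \<Rightarrow> ('a \<Rightarrow> 'a) \<Rightarrow> bool" where
  "domain_cocycle G \<Gamma> D chi \<longleftrightarrow>
     chi \<in> carrier G \<rightarrow> \<Gamma> \<and>
     {g \<in> carrier G. chi g = \<one>\<^bsub>G\<^esub>} = D \<and>
     (\<forall>g \<in> carrier G. \<forall>\<gamma> \<in> \<Gamma>. chi (g \<otimes>\<^bsub>G\<^esub> inv\<^bsub>G\<^esub> \<gamma>) = \<gamma> \<otimes>\<^bsub>G\<^esub> chi g)"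

definition p_integrable :: "'a monoid \<Rightarrow> 'a topology \<Rightarrow> 'a set \<Rightarrow> real \<Rightarrow> bool" where
  "p_integrable G T \<Gamma> p \<longleftrightarrow>
     uniform_subgroup G T \<Gamma> \<or>
     (\<exists>S \<mu> D chi.
        finite S \<and> S \<subseteq> \<Gamma> \<and> generate G S = \<Gamma> \<and>
        haar_measure G T \<mu> \<and>
        borel_fundamental_domain G T \<mu> \<Gamma> D \<and>
        domain_cocycle G \<Gamma> D chi \<and>
        (\<forall>g \<in> carrier G.
           (\<integral>\<^sup>+h\<in>D. ennreal (real (word_length G S (chi (inv\<^bsub>G\<^esub> g \<otimes>\<^bsub>G\<^esub> h))) powr p) \<partial>\<mu>) < \<infinity>))"


section \<open>The additive group of the reals\<close>

definition real_group :: "real monoid" where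
  "real_group = \<lparr>carrier = UNIV, monoid.mult = (+), one = 0\<rparr>"

end

theory Submission
  imports Defs
begin

text \<open>
  For a homomorphism \<open>\<phi>\<close> on \<open>\<Gamma>\<close> put \<open>f = \<phi> \<circ> \<chi>\<close>, so that \<open>f(y \<gamma>) = f(y) - \<phi>(\<gamma>)\<close> and the differences
  \<open>f(g\<inverse> y) - f(y)\<close> descend to a cocycle with values in \<open>L\<^sup>p(G/\<Gamma>)\<close>. The mean of this cocycle is a
  measurable, hence continuous, homomorphism \<open>\<psi>\<close> on \<open>G\<close>; subtracting it from \<open>f\<close> leaves a cocycle of
  mean zero, and it remains to show that such a cocycle forces \<open>\<phi> = 0\<close>.

  Average over each factor \<open>G\<^sub>j\<close> to get operators \<open>P\<^sub>j\<close>, and let \<open>A\<close> be their mean. By weak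
  cocompactness \<open>A\<close> is a strict contraction of \<open>L\<^sup>2\<^sub>0(G/\<Gamma>)\<close>, and truncation makes its powers summable on
  mean-zero functions of \<open>L\<^sup>p\<close> with values in \<open>L\<^sup>1\<close>. Hence the affine averaging action has a fixed point
  \<open>u\<close>, which is also fixed by every single \<open>P\<^sub>j\<close>. For \<open>a\<close> in the \<open>i\<close>-th factor the translate of
  \<open>u\<close> by \<open>a\<close> minus \<open>u\<close> is invariant under the other factors, hence constant by irreducibility, hence
  zero. So \<open>f + u\<close> is invariant under \<open>G\<close>, i.e. constant.

  Since \<open>G\<close> need not be second countable, Fubini's theorem is needed for \<open>\<tau>\<close>-additive Borel measures on
  topological products.
\<close>


section \<open>Fubini's theorem without second countability\<close>

text \<open>Three obstacles shape the proof. The cocycle lies in \<open>L\<^sup>p\<close>, whereas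
  weak cocompactness speaks about \<open>L\<^sup>2\<close>, and no gap in \<open>L\<^sup>p\<close>
  is claimed. A mean-zero vector is cut at a height growing geometrically with the power of
  \<open>A\<close>; the \<open>L\<^sup>2\<close> decay of the bounded part then competes with the
  tail \<open>t powr (1 - p)\<close>, and \<open>p > 1\<close> makes both summable. The price is
  that \<open>u\<close> is only known to be integrable, so going from \<open>P j\<close>-fixed to
  invariant cannot use the Hilbert space argument; a strictly convex function of linear growth takes
  its place. Next, identities between functions on \<open>G/\<Gamma>\<close> hold only almost
  everywhere, with an exceptional set depending on the group element. Finally, Haar measure is built
  from the invariant measure on \<open>G/\<Gamma>\<close>, so that integrals unfold without
  constants. Right invariance then has to be proved, and it is what lets left and right translations
  be used side by side.\<close>

lemma space_borel_of [simp]: "space (borel_of T) = topspace T"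
  unfolding borel_of_def by (rule space_measure_of) (auto dest: openin_subset)

lemma sets_borel_of: "sets (borel_of T) = sigma_sets (topspace T) {U. openin T U}"
  unfolding borel_of_def by (rule sets_measure_of) (auto dest: openin_subset)

lemma borel_of_open: "openin T U \<Longrightarrow> U \<in> sets (borel_of T)"
  by (auto simp: sets_borel_of)

lemma continuous_map_measurable:
  assumes "continuous_map S T f"
  shows "f \<in> measurable (borel_of S) (borel_of T)"
  unfolding borel_of_def[of T]
proof (rule measurable_measure_of)
  show "f \<in> space (borel_of S) \<rightarrow> topspace T"
    using assms by (auto simp: continuous_map_def Pi_iff)
  fix U assume "U \<in> {U. openin T U}"
  then have "openin S {x \<in> topspace S. f x \<in> U}"
    using assms by (auto simp: continuous_map_def)
  then show "f -` U \<inter> space (borel_of S) \<in> sets (borel_of S)"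
    using borel_of_open by (auto simp: vimage_def Int_def conj_commute)
qed (auto dest: openin_subset)

text \<open>Stated through countable subfamilies instead of suprema over directed families; for
  finite measures the two agree. This form turns uncountable unions of open sets into countable ones
  and mentions only null sets, so it survives a change to an equivalent measure.\<close>

definition tau_additive :: "'a topology \<Rightarrow> 'a measure \<Rightarrow> bool" where
  "tau_additive T M \<longleftrightarrow> sets M = sets (borel_of T) \<and> sigma_finite_measure M \<and>
     (\<forall>\<U>. (\<forall>U\<in>\<U>. openin T U) \<longrightarrow>
        (\<exists>\<V>. \<V> \<subseteq> \<U> \<and> countable \<V> \<and> \<Union>\<U> - \<Union>\<V> \<in> null_sets M))"

lemma tau_additive_sets: "tau_additive T M \<Longrightarrow> sets M = sets (borel_of T)"
  and tau_additive_sigma_finite: "tau_additive T M \<Longrightarrow> sigma_finite_measure M"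
  by (auto simp: tau_additive_def)

lemma tau_additive_space: "tau_additive T M \<Longrightarrow> space M = topspace T"
  using sets_eq_imp_space_eq[OF tau_additive_sets] by simp

lemma tau_additive_measurable: "tau_additive T M \<Longrightarrow> measurable M L = measurable (borel_of T) L"
  by (rule measurable_cong_sets[OF tau_additive_sets refl])

text \<open>The covering clause mentions only null sets, and null sets of \<open>M\<close> remain
  null for a density, so only sigma-finiteness has to be supplied.\<close>

lemma tau_additive_density:
  assumes M: "tau_additive T M" and h: "h \<in> borel_measurable M"
    and "sigma_finite_measure (density M h)"
  shows "tau_additive T (density M h)"
  unfolding tau_additive_def
proof (intro conjI allI impI)
  fix \<U> assume "\<forall>U\<in>\<U>. openin T U"
  then obtain \<V> where \<V>: "\<V> \<subseteq> \<U>" "countable \<V>" "\<Union>\<U> - \<Union>\<V> \<in> null_sets M"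
    using M by (meson tau_additive_def)
  have "\<Union>\<U> - \<Union>\<V> \<in> null_sets (density M h)"
    using absolutely_continuousI_density[OF h] \<V>(3) by (auto simp: absolutely_continuous_def)
  with \<V> show "\<exists>\<V>. \<V> \<subseteq> \<U> \<and> countable \<V> \<and> \<Union>\<U> - \<Union>\<V> \<in> null_sets (density M h)"
    by blast
qed (use assms in \<open>auto simp: tau_additive_def\<close>)

text \<open>The slice of \<open>W\<close> over \<open>x\<close> is the union of all open
  \<open>B\<close> such that \<open>A \<times> B\<close> lies in \<open>W\<close> for some
  neighbourhood \<open>A\<close> of \<open>x\<close>. Countably many such \<open>B\<close> exhaust
  it up to a null set, so finitely many already have a union of measure above \<open>t\<close>, and
  only finitely many neighbourhoods have to be intersected.\<close>

lemma tau_additive_rectangle: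
  assumes N: "tau_additive T N" and W: "openin (prod_topology S T) W"
    and x: "x \<in> topspace S" and t: "t < emeasure N (Pair x -` W)"
  obtains A B where "openin S A" "openin T B" "x \<in> A" "A \<times> B \<subseteq> W" "t < emeasure N B"
proof -
  define \<U> where "\<U> = {B. openin T B \<and> (\<exists>A. openin S A \<and> x \<in> A \<and> A \<times> B \<subseteq> W)}"
  have un: "\<Union>\<U> = Pair x -` W"
  proof
    show "\<Union>\<U> \<subseteq> Pair x -` W" by (auto simp: \<U>_def)
    show "Pair x -` W \<subseteq> \<Union>\<U>"
    proof
      fix y assume "y \<in> Pair x -` W"
      then show "y \<in> \<Union>\<U>"
        using W unfolding openin_prod_topology_alt \<U>_def by fastforce
    qed
  qed
  have "\<forall>U\<in>\<U>. openin T U" by (auto simp: \<U>_def)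
  then obtain \<V> where \<V>: "\<V> \<subseteq> \<U>" "countable \<V>" "\<Union>\<U> - \<Union>\<V> \<in> null_sets N"
    using N by (meson tau_additive_def)
  have op: "\<And>U. openin T U \<Longrightarrow> U \<in> sets N"
    by (simp add: tau_additive_sets[OF N] borel_of_open)
  have "\<Union>\<U> \<in> sets N" "\<Union>\<V> \<in> sets N"
    using \<V>(1) by (auto simp: \<U>_def intro!: op openin_Union)
  then have eq: "emeasure N (\<Union>\<V>) = emeasure N (\<Union>\<U>)"
    using \<V> by (metis Diff_Diff_Int Sup_subset_mono emeasure_Diff_null_set inf.absorb_iff2)
  with t un have t': "t < emeasure N (\<Union>\<V>)" by simp
  then have ne: "\<V> \<noteq> {}" by auto
  define V where "V = from_nat_into \<V>"
  have rng: "range V = \<V>" unfolding V_def by (rule range_from_nat_into[OF ne \<V>(2)])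
  then have VU: "V i \<in> \<U>" for i using \<V>(1) by auto
  define Z where "Z n = (\<Union>i<n. V i)" for n
  have Vs: "openin T (V i)" for i using VU[of i] by (auto simp: \<U>_def)
  have "incseq Z" unfolding Z_def by (rule incseq_SucI) (auto simp: lessThan_Suc)
  moreover have "range Z \<subseteq> sets N" using Vs by (auto simp: Z_def intro!: op openin_Union)
  ultimately have "(SUP n. emeasure N (Z n)) = emeasure N (\<Union>n. Z n)"
    by (rule SUP_emeasure_incseq[rotated])
  moreover have "(\<Union>n. Z n) = \<Union>\<V>" unfolding Z_def rng[symmetric] by blast
  ultimately obtain n where n: "t < emeasure N (Z n)"
    using t' by (metis less_SUP_iff)
  obtain A where A: "\<And>i. openin S (A i) \<and> x \<in> A i \<and> A i \<times> V i \<subseteq> W"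
  proof -
    have "\<forall>i. \<exists>A. openin S A \<and> x \<in> A \<and> A \<times> V i \<subseteq> W" using VU unfolding \<U>_def by auto
    then show ?thesis using that by metis
  qed
  \<comment> \<open>Meeting with \<open>topspace S\<close> keeps \<open>A'\<close> open also for
    \<open>n = 0\<close>, where the intersection is over the empty set.\<close>
  define A' where "A' = topspace S \<inter> (\<Inter>i\<in>{..<n}. A i)"
  have "openin S A'"
    unfolding A'_def
    by (cases "n = 0") (use A in \<open>auto intro!: openin_Int openin_INT2\<close>)
  moreover have "x \<in> A'" using A x by (auto simp: A'_def)
  moreover have "A' \<times> Z n \<subseteq> W" using A unfolding A'_def Z_def by blast
  moreover have "openin T (Z n)" using Vs by (auto simp: Z_def)
  ultimately show ?thesis using that n by blast
qed

text \<open>A rectangle inside \<open>W\<close> bounds the slices over all points of its base from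
  below at once, which is lower semicontinuity. The Steinhaus lemma relies on it as well.\<close>

lemma tau_additive_slice_lsc:
  assumes N: "tau_additive T N" and W: "openin (prod_topology S T) W"
  shows "openin S {x \<in> topspace S. t < emeasure N (Pair x -` W)}"
proof (subst openin_subopen, intro ballI)
  fix x assume "x \<in> {x \<in> topspace S. t < emeasure N (Pair x -` W)}"
  then have x: "x \<in> topspace S" "t < emeasure N (Pair x -` W)" by auto
  obtain A B where AB: "openin S A" "openin T B" "x \<in> A" "A \<times> B \<subseteq> W" "t < emeasure N B"
    by (rule tau_additive_rectangle[OF N W x])
  have "t < emeasure N (Pair z -` W)" if "z \<in> A" for z
  proof -
    have "openin T (Pair z -` W)"
    proof -
      have "z \<in> topspace S" using that AB(1) openin_subset by blast
      then have "continuous_map T (prod_topology S T) (\<lambda>y. (z, y))"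
        by (intro continuous_map_pairedI) auto
      from openin_continuous_map_preimage[OF this W]
      moreover have "{y \<in> topspace T. (z, y) \<in> W} = Pair z -` W" using openin_subset[OF W] by auto
      ultimately show ?thesis by simp
    qed
    then have "emeasure N B \<le> emeasure N (Pair z -` W)"
      using AB that by (intro emeasure_mono) (auto simp: tau_additive_sets[OF N] borel_of_open)
    with AB show ?thesis by simp
  qed
  with AB show "\<exists>A. openin S A \<and> x \<in> A \<and> A \<subseteq> {x \<in> topspace S. t < emeasure N (Pair x -` W)}"
    using openin_subset[OF AB(1)] by blast
qed

lemma tau_additive_slice_measurable:
  assumes N: "tau_additive T N" and W: "openin (prod_topology S T) W"
  shows "(\<lambda>x. emeasure N (Pair x -` W)) \<in> borel_measurable (borel_of S)"
proof (rule borel_measurableI_greater)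
  fix t
  show "{x \<in> space (borel_of S). t < emeasure N (Pair x -` W)} \<in> sets (borel_of S)"
    using borel_of_open[OF tau_additive_slice_lsc[OF N W, of t]] by simp
qed

text \<open>An open \<open>W\<close> need not belong to the product sigma-algebra, so the Tonelli
  theorem for \<open>M \<Otimes>\<^sub>M N\<close> is applied to a countable union \<open>W'\<close>
  of open rectangles inside \<open>W\<close>. It is chosen so that almost every slice over
  \<open>S\<close> keeps its measure. Slices over \<open>T\<close> may shrink, hence only an
  inequality; symmetry makes it an equality later.\<close>

lemma tau_additive_iterated_le:
  assumes M: "tau_additive S M" and N: "tau_additive T N" and W: "openin (prod_topology S T) W"
  shows "(\<integral>\<^sup>+x. emeasure N (Pair x -` W) \<partial>M) \<le> (\<integral>\<^sup>+y. emeasure M ((\<lambda>x. (x, y)) -` W) \<partial>N)"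
proof -
  interpret M: sigma_finite_measure M by (rule tau_additive_sigma_finite[OF M])
  interpret N: sigma_finite_measure N by (rule tau_additive_sigma_finite[OF N])
  interpret pair_sigma_finite M N ..
  \<comment> \<open>Bases of rectangles in \<open>W\<close> whose other side has measure above
    \<open>t\<close>; by the rectangle lemma they cover every point whose slice has measure above
    \<open>t\<close>.\<close>
  define \<U> where "\<U> t = {A. openin S A \<and> (\<exists>B. openin T B \<and> A \<times> B \<subseteq> W \<and> t < emeasure N B)}" for t
  have "\<exists>\<V>. \<V> \<subseteq> \<U> t \<and> countable \<V> \<and> \<Union>(\<U> t) - \<Union>\<V> \<in> null_sets M" for t
    using M unfolding tau_additive_def \<U>_def by auto
  then obtain \<V> where \<V>: "\<And>t. \<V> t \<subseteq> \<U> t" "\<And>t. countable (\<V> t)"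
      "\<And>t. \<Union>(\<U> t) - \<Union>(\<V> t) \<in> null_sets M"
    by metis
  \<comment> \<open>Each base is tagged with its rational level, because the side \<open>B\<close>
    chosen below depends on both.\<close>
  define D where "D = (\<Union>q::rat. (\<lambda>A. (q, A)) ` \<V> (ennreal (of_rat q)))"
  have cD: "countable D" unfolding D_def using \<V>(2) by blast
  have DU: "snd p \<in> \<U> (ennreal (of_rat (fst p)))" if "p \<in> D" for p
    using that subsetD[OF \<V>(1)] unfolding D_def by auto
  have "\<forall>p\<in>D. \<exists>B. openin T B \<and> snd p \<times> B \<subseteq> W \<and> ennreal (of_rat (fst p)) < emeasure N B"
    using DU unfolding \<U>_def by auto
  then obtain B where B: "\<And>p. p \<in> D \<Longrightarrow>
      openin T (B p) \<and> snd p \<times> B p \<subseteq> W \<and> ennreal (of_rat (fst p)) < emeasure N (B p)"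
    by metis
  have A: "openin S (snd p)" if "p \<in> D" for p using DU[OF that] unfolding \<U>_def by auto
  define W' where "W' = (\<Union>p\<in>D. snd p \<times> B p)"
  have W'W: "W' \<subseteq> W" using B unfolding W'_def by blast
  have W'[measurable]: "W' \<in> sets (M \<Otimes>\<^sub>M N)"
    unfolding W'_def
    by (intro sets.countable_UN'[OF cD] pair_measureI)
      (auto simp: tau_additive_sets[OF M] tau_additive_sets[OF N] intro!: borel_of_open A B[THEN conjunct1])
  have "AE x in M. \<forall>q::rat. x \<notin> \<Union>(\<U> (ennreal (of_rat q))) - \<Union>(\<V> (ennreal (of_rat q)))"
    unfolding AE_all_countable by (intro allI AE_not_in \<V>(3))
  then have le: "AE x in M. emeasure N (Pair x -` W) \<le> emeasure N (Pair x -` W')"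
  proof eventually_elim
    case (elim x)
    show ?case
    proof (cases "x \<in> topspace S")
      case False
      then have "Pair x -` W = {}" using openin_subset[OF W] by auto
      then show ?thesis by simp
    next
      case True
      show ?thesis
      proof (rule ccontr)
        assume "\<not> ?thesis"
        then obtain q :: rat where q: "emeasure N (Pair x -` W') < ennreal (of_rat q)"
            and "ennreal (of_rat q) < emeasure N (Pair x -` W)"
          using ennreal_rat_dense[of "emeasure N (Pair x -` W')" "emeasure N (Pair x -` W)"] by (auto simp: not_le)
        note this(2)
        from tau_additive_rectangle[OF N W True this]
        obtain A0 B0 where "openin S A0" "openin T B0" "x \<in> A0" "A0 \<times> B0 \<subseteq> W" "ennreal (of_rat q) < emeasure N B0"
          by blast
        then have "x \<in> \<Union>(\<U> (ennreal (of_rat q)))" unfolding \<U>_def by blast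
        with elim obtain A1 where A1: "A1 \<in> \<V> (ennreal (of_rat q))" "x \<in> A1" by blast
        then have D: "(q, A1) \<in> D" by (auto simp: D_def)
        have "B (q, A1) \<subseteq> Pair x -` W'" using D A1 unfolding W'_def by (auto intro!: bexI[of _ "(q, A1)"])
        moreover have "Pair x -` W' \<in> sets N" by (rule sets_Pair1[OF W'])
        ultimately have "emeasure N (B (q, A1)) \<le> emeasure N (Pair x -` W')"
          by (rule emeasure_mono)
        moreover have "ennreal (of_rat q) < emeasure N (B (q, A1))" using B[OF D] by simp
        ultimately show False using q by (meson order.asym order.strict_trans1 order.strict_trans)
      qed
    qed
  qed
  have "(\<integral>\<^sup>+x. emeasure N (Pair x -` W) \<partial>M) \<le> (\<integral>\<^sup>+x. emeasure N (Pair x -` W') \<partial>M)"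
    by (rule nn_integral_mono_AE[OF le])
  also have "\<dots> = (\<integral>\<^sup>+y. emeasure M ((\<lambda>x. (x, y)) -` W') \<partial>N)"
    by (simp add: N.emeasure_pair_measure_alt[symmetric] emeasure_pair_measure_alt2[symmetric])
  also have "\<dots> \<le> (\<integral>\<^sup>+y. emeasure M ((\<lambda>x. (x, y)) -` W) \<partial>N)"
  proof (rule nn_integral_mono)
    fix y assume "y \<in> space N"
    then have "y \<in> topspace T" by (simp add: tau_additive_space[OF N])
    then have "continuous_map S (prod_topology S T) (\<lambda>x. (x, y))"
      by (intro continuous_map_pairedI) auto
    from openin_continuous_map_preimage[OF this W]
    moreover have "{x \<in> topspace S. (x, y) \<in> W} = (\<lambda>x. (x, y)) -` W" using openin_subset[OF W] by auto
    ultimately have "openin S ((\<lambda>x. (x, y)) -` W)" by simp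
    then show "emeasure M ((\<lambda>x. (x, y)) -` W') \<le> emeasure M ((\<lambda>x. (x, y)) -` W)"
      using W'W by (intro emeasure_mono) (auto simp: tau_additive_sets[OF M] borel_of_open)
  qed
  finally show ?thesis .
qed

lemma continuous_map_prod_swap: "continuous_map (prod_topology S T) (prod_topology T S) (\<lambda>(x, y). (y, x))"
  unfolding case_prod_unfold
  by (intro continuous_map_pairedI continuous_map_fst continuous_map_snd)

lemma tau_additive_iterated_open:
  assumes M: "tau_additive S M" and N: "tau_additive T N" and W: "openin (prod_topology S T) W"
  shows "(\<integral>\<^sup>+x. emeasure N (Pair x -` W) \<partial>M) = (\<integral>\<^sup>+y. emeasure M ((\<lambda>x. (x, y)) -` W) \<partial>N)"
    and "(\<lambda>y. emeasure M ((\<lambda>x. (x, y)) -` W)) \<in> borel_measurable (borel_of T)"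
proof -
  define W' where "W' = {(y, x). (x, y) \<in> W}"
  have W': "openin (prod_topology T S) W'"
  proof -
    have "W' = {p \<in> topspace (prod_topology T S). (case p of (x, y) \<Rightarrow> (y, x)) \<in> W}"
      using openin_subset[OF W] by (auto simp: W'_def)
    then show ?thesis
      using openin_continuous_map_preimage[OF continuous_map_prod_swap W] by simp
  qed
  have 1: "Pair y -` W' = (\<lambda>x. (x, y)) -` W" "(\<lambda>y. (y, x)) -` W' = Pair x -` W" for x y
    by (auto simp: W'_def)
  show "(\<integral>\<^sup>+x. emeasure N (Pair x -` W) \<partial>M) = (\<integral>\<^sup>+y. emeasure M ((\<lambda>x. (x, y)) -` W) \<partial>N)"
    using tau_additive_iterated_le[OF M N W] tau_additive_iterated_le[OF N M W']
    by (simp add: 1)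
  show "(\<lambda>y. emeasure M ((\<lambda>x. (x, y)) -` W)) \<in> borel_measurable (borel_of T)"
    using tau_additive_slice_measurable[OF M W'] by (simp add: 1)
qed

section \<open>Tonelli and Fubini for Borel functions on the product space\<close>

lemma slice_measurable:
  assumes "f \<in> measurable (borel_of (prod_topology S T)) L"
  shows "x \<in> topspace S \<Longrightarrow> (\<lambda>y. f (x, y)) \<in> measurable (borel_of T) L"
    and "y \<in> topspace T \<Longrightarrow> (\<lambda>x. f (x, y)) \<in> measurable (borel_of S) L"
  by (rule measurable_compose[OF continuous_map_measurable assms];
      intro continuous_map_pairedI; simp)+

lemma slice_sets:
  assumes "E \<in> sets (borel_of (prod_topology S T))"
  shows "Pair x -` E \<in> sets (borel_of T)" and "(\<lambda>x. (x, y)) -` E \<in> sets (borel_of S)"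
proof -
  have E: "E \<subseteq> topspace S \<times> topspace T" using sets.sets_into_space[OF assms] by simp
  show "Pair x -` E \<in> sets (borel_of T)"
  proof (cases "x \<in> topspace S")
    case True
    then have "(\<lambda>y. (x, y)) \<in> measurable (borel_of T) (borel_of (prod_topology S T))"
      by (intro continuous_map_measurable continuous_map_pairedI) auto
    from measurable_sets[OF this assms]
    have "Pair x -` E \<inter> topspace T \<in> sets (borel_of T)" by simp
    moreover have "Pair x -` E \<inter> topspace T = Pair x -` E" using E by auto
    ultimately show ?thesis by simp
  next
    case False
    then have "Pair x -` E = {}" using E by auto
    then show ?thesis by simp
  qed
  show "(\<lambda>x. (x, y)) -` E \<in> sets (borel_of S)"
  proof (cases "y \<in> topspace T")
    case True
    then have "(\<lambda>x. (x, y)) \<in> measurable (borel_of S) (borel_of (prod_topology S T))"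
      by (intro continuous_map_measurable continuous_map_pairedI) auto
    from measurable_sets[OF this assms]
    have "(\<lambda>x. (x, y)) -` E \<inter> topspace S \<in> sets (borel_of S)" by simp
    moreover have "(\<lambda>x. (x, y)) -` E \<inter> topspace S = (\<lambda>x. (x, y)) -` E" using E by auto
    ultimately show ?thesis by simp
  next
    case False
    then have "(\<lambda>x. (x, y)) -` E = {}" using E by auto
    then show ?thesis by simp
  qed
qed

text \<open>Open sets are stable under intersection and generate the Borel sets of the product
  topology, so the open case extends by a Dynkin argument. Finiteness enters where slices of a
  complement are measured by subtraction.\<close>

lemma tau_additive_iterated_sets:
  assumes M: "tau_additive S M" and N: "tau_additive T N"
    and fin: "finite_measure M" "finite_measure N"
    and E: "E \<in> sets (borel_of (prod_topology S T))"
  shows "(\<lambda>x. emeasure N (Pair x -` E)) \<in> borel_measurable (borel_of S) \<and>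
    (\<lambda>y. emeasure M ((\<lambda>x. (x, y)) -` E)) \<in> borel_measurable (borel_of T) \<and>
    (\<integral>\<^sup>+x. emeasure N (Pair x -` E) \<partial>M) = (\<integral>\<^sup>+y. emeasure M ((\<lambda>x. (x, y)) -` E) \<partial>N)"
proof -
  interpret M: finite_measure M by fact
  interpret N: finite_measure N by fact
  have sM: "sets M = sets (borel_of S)" "space M = topspace S" 
    using tau_additive_sets[OF M] tau_additive_space[OF M] by auto
  have sN: "sets N = sets (borel_of T)" "space N = topspace T" 
    using tau_additive_sets[OF N] tau_additive_space[OF N] by auto
  have mM: "borel_measurable M = borel_measurable (borel_of S)"
    and mN: "borel_measurable N = borel_measurable (borel_of T)"
    using sM(1) sN(1) by (auto intro: measurable_cong_sets)
  let ?\<Omega> = "topspace (prod_topology S T)"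
  have stab: "Int_stable {U. openin (prod_topology S T) U}" by (auto simp: Int_stable_def)
  have pow: "{U. openin (prod_topology S T) U} \<subseteq> Pow ?\<Omega>" using openin_subset by blast
  have E': "E \<in> sigma_sets ?\<Omega> {U. openin (prod_topology S T) U}"
    using E by (simp add: sets_borel_of)
  show ?thesis
    using stab pow E'
  proof (induction rule: sigma_sets_induct_disjoint)
    case (basic A)
    then show ?case
      using tau_additive_iterated_open[OF M N] tau_additive_slice_measurable[OF N] by auto
  next
    case empty
    then show ?case by simp
  next
    case (compl A)
    then have A: "A \<in> sets (borel_of (prod_topology S T))" by (simp add: sets_borel_of)
    note sl = slice_sets[OF A]
    have 1: "emeasure N (Pair x -` (?\<Omega> - A)) = emeasure N (space N) - emeasure N (Pair x -` A)"
      if "x \<in> space M" for x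
    proof -
      have "Pair x -` (?\<Omega> - A) = space N - Pair x -` A" using that by (auto simp: sM sN)
      then show ?thesis using sl(1)[of x] by (simp add: emeasure_compl sN(1))
    qed
    have 2: "emeasure M ((\<lambda>x. (x, y)) -` (?\<Omega> - A)) = emeasure M (space M) - emeasure M ((\<lambda>x. (x, y)) -` A)"
      if "y \<in> space N" for y
    proof -
      have "(\<lambda>x. (x, y)) -` (?\<Omega> - A) = space M - (\<lambda>x. (x, y)) -` A" using that by (auto simp: sM sN)
      then show ?thesis using sl(2)[of y] by (simp add: emeasure_compl sM(1))
    qed
    have m1: "(\<lambda>x. emeasure N (Pair x -` A)) \<in> borel_measurable M"
      and m2: "(\<lambda>y. emeasure M ((\<lambda>x. (x, y)) -` A)) \<in> borel_measurable N"
      and eq: "(\<integral>\<^sup>+x. emeasure N (Pair x -` A) \<partial>M) = (\<integral>\<^sup>+y. emeasure M ((\<lambda>x. (x, y)) -` A) \<partial>N)"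
      using compl by (auto simp: mM mN)
    have b1: "emeasure N (Pair x -` A) \<le> emeasure N (space N)" for x
      by (rule emeasure_space)
    have b2: "emeasure M ((\<lambda>x. (x, y)) -` A) \<le> emeasure M (space M)" for y
      by (rule emeasure_space)
    have f1: "(\<integral>\<^sup>+x. emeasure N (Pair x -` A) \<partial>M) \<noteq> \<infinity>"
    proof -
      have "(\<integral>\<^sup>+x. emeasure N (Pair x -` A) \<partial>M) \<le> (\<integral>\<^sup>+x. emeasure N (space N) \<partial>M)"
        by (intro nn_integral_mono b1)
      also have "\<dots> < \<infinity>"
        using M.emeasure_finite N.emeasure_finite by (simp add: ennreal_mult_less_top ennreal_mult_eq_top_iff less_top[symmetric])
      finally show ?thesis by simp
    qed
    have "(\<integral>\<^sup>+x. emeasure N (Pair x -` (?\<Omega> - A)) \<partial>M)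
        = (\<integral>\<^sup>+x. emeasure N (space N) - emeasure N (Pair x -` A) \<partial>M)"
      by (rule nn_integral_cong) (rule 1)
    also have "\<dots> = emeasure N (space N) * emeasure M (space M) - (\<integral>\<^sup>+x. emeasure N (Pair x -` A) \<partial>M)"
      using m1 f1 b1 by (subst nn_integral_diff) auto
    also have "\<dots> = (\<integral>\<^sup>+y. emeasure M (space M) - emeasure M ((\<lambda>x. (x, y)) -` A) \<partial>N)"
      using m2 f1 b2 eq by (subst nn_integral_diff) (auto simp: mult.commute)
    also have "\<dots> = (\<integral>\<^sup>+y. emeasure M ((\<lambda>x. (x, y)) -` (?\<Omega> - A)) \<partial>N)"
      by (rule nn_integral_cong) (rule 2[symmetric])
    finally have eq': "(\<integral>\<^sup>+x. emeasure N (Pair x -` (?\<Omega> - A)) \<partial>M) = (\<integral>\<^sup>+y. emeasure M ((\<lambda>x. (x, y)) -` (?\<Omega> - A)) \<partial>N)" .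
    have "(\<lambda>x. emeasure N (Pair x -` (?\<Omega> - A))) \<in> borel_measurable M"
      using m1 by (subst measurable_cong[OF 1]) auto
    moreover have "(\<lambda>y. emeasure M ((\<lambda>x. (x, y)) -` (?\<Omega> - A))) \<in> borel_measurable N"
      using m2 by (subst measurable_cong[OF 2]) auto
    ultimately show ?case using eq' by (simp add: mM mN)
  next
    case (union A)
    then have A: "A i \<in> sets (borel_of (prod_topology S T))" for i by (auto simp: sets_borel_of)
    note sl = slice_sets[OF A]
    have 1: "emeasure N (Pair x -` (\<Union>i. A i)) = suminf (\<lambda>i. emeasure N (Pair x -` A i))" for x
    proof -
      have "disjoint_family (\<lambda>i. Pair x -` A i)"
        using union.hyps(1) unfolding disjoint_family_on_def by blast
      then show ?thesis
        unfolding vimage_UN using sl by (intro suminf_emeasure[symmetric]) (auto simp: sN)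
    qed
    have 2: "emeasure M ((\<lambda>x. (x, y)) -` (\<Union>i. A i)) = suminf (\<lambda>i. emeasure M ((\<lambda>x. (x, y)) -` A i))" for y
    proof -
      have "disjoint_family (\<lambda>i. (\<lambda>x. (x, y)) -` A i)"
        using union.hyps(1) unfolding disjoint_family_on_def by blast
      then show ?thesis
        unfolding vimage_UN using sl by (intro suminf_emeasure[symmetric]) (auto simp: sM)
    qed
    have [measurable]: "(\<lambda>x. emeasure N (Pair x -` A i)) \<in> borel_measurable (borel_of S)"
      "(\<lambda>y. emeasure M ((\<lambda>x. (x, y)) -` A i)) \<in> borel_measurable (borel_of T)" for i
      using union(3) by auto
    show ?case
      unfolding 1 2 using union(3)
      by (simp add: nn_integral_suminf mM mN)
  qed
qed

lemma tau_additive_Tonelli_finite: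
  fixes F :: "'a \<times> 'b \<Rightarrow> ennreal"
  assumes M: "tau_additive S M" and N: "tau_additive T N"
    and fin: "finite_measure M" "finite_measure N"
    and F: "F \<in> borel_measurable (borel_of (prod_topology S T))"
  shows "(\<lambda>x. \<integral>\<^sup>+y. F (x, y) \<partial>N) \<in> borel_measurable M \<and>
    (\<lambda>y. \<integral>\<^sup>+x. F (x, y) \<partial>M) \<in> borel_measurable N \<and>
    (\<integral>\<^sup>+x. \<integral>\<^sup>+y. F (x, y) \<partial>N \<partial>M) = (\<integral>\<^sup>+y. \<integral>\<^sup>+x. F (x, y) \<partial>M \<partial>N)"
proof -
  have mM: "borel_measurable M = borel_measurable (borel_of S)"
    and mN: "borel_measurable N = borel_measurable (borel_of T)"
    using tau_additive_sets[OF M] tau_additive_sets[OF N] by (auto intro: measurable_cong_sets)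
  have spM: "space M = topspace S" and spN: "space N = topspace T"
    using tau_additive_space[OF M] tau_additive_space[OF N] by auto
  have sl: "(\<lambda>y. f (x, y)) \<in> borel_measurable N" "(\<lambda>x. f (x, y)) \<in> borel_measurable M"
    if "f \<in> borel_measurable (borel_of (prod_topology S T))" "x \<in> space M" "y \<in> space N" 
    for f :: "'a \<times> 'b \<Rightarrow> ennreal" and x y
    using slice_measurable[OF that(1)] that(2,3) by (simp_all add: mM mN spM spN)
  from F show ?thesis
  proof (induction rule: borel_measurable_induct)
    case (cong f g)
    have eq: "f (x, y) = g (x, y)" if "x \<in> space M" "y \<in> space N" for x y
      using cong.hyps(3) that by (simp add: spM spN)
    have "(\<integral>\<^sup>+y. f (x, y) \<partial>N) = (\<integral>\<^sup>+y. g (x, y) \<partial>N)" if "x \<in> space M" for x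
      by (rule nn_integral_cong) (use eq that in auto)
    moreover have "(\<integral>\<^sup>+x. f (x, y) \<partial>M) = (\<integral>\<^sup>+x. g (x, y) \<partial>M)" if "y \<in> space N" for y
      by (rule nn_integral_cong) (use eq that in auto)
    ultimately show ?case using cong.IH
      by (simp cong: measurable_cong nn_integral_cong)
  next
    case (set A)
    have 1: "(\<integral>\<^sup>+y. indicator A (x, y) \<partial>N) = emeasure N (Pair x -` A)" for x
    proof -
      have "(\<integral>\<^sup>+y. indicator A (x, y) \<partial>N) = (\<integral>\<^sup>+y. indicator (Pair x -` A) y \<partial>N)"
        by (rule nn_integral_cong) (auto simp: indicator_def)
      then show ?thesis using slice_sets[OF set] tau_additive_sets[OF N] by simp
    qed
    have 2: "(\<integral>\<^sup>+x. indicator A (x, y) \<partial>M) = emeasure M ((\<lambda>x. (x, y)) -` A)" for y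
    proof -
      have "(\<integral>\<^sup>+x. indicator A (x, y) \<partial>M) = (\<integral>\<^sup>+x. indicator ((\<lambda>x. (x, y)) -` A) x \<partial>M)"
        by (rule nn_integral_cong) (auto simp: indicator_def)
      then show ?thesis using slice_sets[OF set] tau_additive_sets[OF M] by simp
    qed
    show ?case
      using tau_additive_iterated_sets[OF M N fin set] by (simp add: 1 2 mM mN)
  next
    case (mult u c)
    have 1: "(\<integral>\<^sup>+y. c * u (x, y) \<partial>N) = c * (\<integral>\<^sup>+y. u (x, y) \<partial>N)" if "x \<in> space M" for x
      by (rule nn_integral_cmult)
        (use slice_measurable(1)[OF mult.hyps(2)] that in \<open>simp add: mN spM\<close>)
    have 2: "(\<integral>\<^sup>+x. c * u (x, y) \<partial>M) = c * (\<integral>\<^sup>+x. u (x, y) \<partial>M)" if "y \<in> space N" for y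
      by (rule nn_integral_cmult)
        (use slice_measurable(2)[OF mult.hyps(2)] that in \<open>simp add: mM spN\<close>)
    have [measurable]: "(\<lambda>x. \<integral>\<^sup>+y. u (x, y) \<partial>N) \<in> borel_measurable M" "(\<lambda>y. \<integral>\<^sup>+x. u (x, y) \<partial>M) \<in> borel_measurable N"
      using mult.IH by auto
    show ?case
      using mult.IH by (simp add: 1 2 nn_integral_cmult cong: measurable_cong nn_integral_cong)
  next
    case (add u v)
    have 1: "(\<integral>\<^sup>+y. v (x, y) + u (x, y) \<partial>N) = (\<integral>\<^sup>+y. v (x, y) \<partial>N) + (\<integral>\<^sup>+y. u (x, y) \<partial>N)" if "x \<in> space M" for x
      by (rule nn_integral_add)
        (use slice_measurable(1)[OF add.hyps(1)] slice_measurable(1)[OF add.hyps(3)] that in \<open>simp_all add: mN spM\<close>)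
    have 2: "(\<integral>\<^sup>+x. v (x, y) + u (x, y) \<partial>M) = (\<integral>\<^sup>+x. v (x, y) \<partial>M) + (\<integral>\<^sup>+x. u (x, y) \<partial>M)" if "y \<in> space N" for y
      by (rule nn_integral_add)
        (use slice_measurable(2)[OF add.hyps(1)] slice_measurable(2)[OF add.hyps(3)] that in \<open>simp_all add: mM spN\<close>)
    have [measurable]: "(\<lambda>x. \<integral>\<^sup>+y. u (x, y) \<partial>N) \<in> borel_measurable M" "(\<lambda>y. \<integral>\<^sup>+x. u (x, y) \<partial>M) \<in> borel_measurable N"
      "(\<lambda>x. \<integral>\<^sup>+y. v (x, y) \<partial>N) \<in> borel_measurable M" "(\<lambda>y. \<integral>\<^sup>+x. v (x, y) \<partial>M) \<in> borel_measurable N"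
      using add.IH by auto
    show ?case
      using add.IH by (simp add: 1 2 nn_integral_add cong: measurable_cong nn_integral_cong)
  next
    case (seq U)
    have 1: "(\<integral>\<^sup>+y. (SUP i. U i) (x, y) \<partial>N) = (SUP i. \<integral>\<^sup>+y. U i (x, y) \<partial>N)" if "x \<in> space M" for x
      unfolding SUP_apply
      by (rule nn_integral_monotone_convergence_SUP)
        (use seq.hyps(3) slice_measurable(1)[OF seq.hyps(1)] that in \<open>auto simp: mN spM incseq_def le_fun_def\<close>)
    have 2: "(\<integral>\<^sup>+x. (SUP i. U i) (x, y) \<partial>M) = (SUP i. \<integral>\<^sup>+x. U i (x, y) \<partial>M)" if "y \<in> space N" for y
      unfolding SUP_apply
      by (rule nn_integral_monotone_convergence_SUP)
        (use seq.hyps(3) slice_measurable(2)[OF seq.hyps(1)] that in \<open>auto simp: mM spN incseq_def le_fun_def\<close>)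
    have mono1: "incseq (\<lambda>i x. \<integral>\<^sup>+y. U i (x, y) \<partial>N)"
      using seq.hyps(3) by (auto simp: incseq_def le_fun_def intro!: nn_integral_mono)
    have mono2: "incseq (\<lambda>i y. \<integral>\<^sup>+x. U i (x, y) \<partial>M)"
      using seq.hyps(3) by (auto simp: incseq_def le_fun_def intro!: nn_integral_mono)
    have IH: "(\<lambda>x. \<integral>\<^sup>+y. U i (x, y) \<partial>N) \<in> borel_measurable M"
       "(\<lambda>y. \<integral>\<^sup>+x. U i (x, y) \<partial>M) \<in> borel_measurable N"
       "(\<integral>\<^sup>+x. \<integral>\<^sup>+y. U i (x, y) \<partial>N \<partial>M) = (\<integral>\<^sup>+y. \<integral>\<^sup>+x. U i (x, y) \<partial>M \<partial>N)" for i
      using seq.IH by auto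
    show ?case
    proof (intro conjI)
      show "(\<lambda>x. \<integral>\<^sup>+y. (SUP i. U i) (x, y) \<partial>N) \<in> borel_measurable M"
        by (subst measurable_cong[OF 1]) (auto intro!: borel_measurable_SUP IH)
      show "(\<lambda>y. \<integral>\<^sup>+x. (SUP i. U i) (x, y) \<partial>M) \<in> borel_measurable N"
        by (subst measurable_cong[OF 2]) (auto intro!: borel_measurable_SUP IH)
      have "(\<integral>\<^sup>+x. \<integral>\<^sup>+y. (SUP i. U i) (x, y) \<partial>N \<partial>M) = (\<integral>\<^sup>+x. (SUP i. \<integral>\<^sup>+y. U i (x, y) \<partial>N) \<partial>M)"
        by (rule nn_integral_cong) (rule 1)
      also have "\<dots> = (SUP i. \<integral>\<^sup>+x. \<integral>\<^sup>+y. U i (x, y) \<partial>N \<partial>M)"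
        by (rule nn_integral_monotone_convergence_SUP[OF mono1 IH(1)])
      also have "\<dots> = (SUP i. \<integral>\<^sup>+y. \<integral>\<^sup>+x. U i (x, y) \<partial>M \<partial>N)" by (simp add: IH(3))
      also have "\<dots> = (\<integral>\<^sup>+y. (SUP i. \<integral>\<^sup>+x. U i (x, y) \<partial>M) \<partial>N)"
        by (rule nn_integral_monotone_convergence_SUP[OF mono2 IH(2), symmetric])
      also have "\<dots> = (\<integral>\<^sup>+y. \<integral>\<^sup>+x. (SUP i. U i) (x, y) \<partial>M \<partial>N)"
        by (rule nn_integral_cong) (rule 2[symmetric])
      finally show "(\<integral>\<^sup>+x. \<integral>\<^sup>+y. (SUP i. U i) (x, y) \<partial>N \<partial>M) = (\<integral>\<^sup>+y. \<integral>\<^sup>+x. (SUP i. U i) (x, y) \<partial>M \<partial>N)" .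
    qed
  qed
qed

text \<open>Reduces the sigma-finite case to the finite one: the measure is multiplied by an
  integrable weight \<open>h\<close> that is neither \<open>0\<close> nor infinite, and the
  integrand is divided by it.\<close>

lemma tau_additive_finite_density:
  assumes M: "tau_additive T M"
  obtains h where "h \<in> borel_measurable M" "\<forall>x\<in>space M. 0 < h x \<and> h x < \<infinity>"
    "tau_additive T (density M h)" "finite_measure (density M h)"
    "\<forall>F\<in>borel_measurable M. (\<integral>\<^sup>+x. F x \<partial>M) = (\<integral>\<^sup>+x. F x / h x \<partial>density M h)"
proof -
  interpret sigma_finite_measure M by (rule tau_additive_sigma_finite[OF M])
  obtain h where h: "h \<in> borel_measurable M" "integral\<^sup>N M h \<noteq> \<infinity>"
    "\<forall>x\<in>space M. 0 < h x \<and> h x < \<infinity>"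
    using Ex_finite_integrable_function by blast
  have fin: "finite_measure (density M h)"
  proof
    have "(\<integral>\<^sup>+x. h x * indicator (space M) x \<partial>M) = integral\<^sup>N M h"
      by (rule nn_integral_cong) auto
    then show "emeasure (density M h) (space (density M h)) \<noteq> \<infinity>"
      using h by (simp add: emeasure_density)
  qed
  have "(\<integral>\<^sup>+x. F x \<partial>M) = (\<integral>\<^sup>+x. F x / h x \<partial>density M h)" if [measurable]: "F \<in> borel_measurable M" for F
  proof -
    note h(1)[measurable]
    have "(\<integral>\<^sup>+x. F x / h x \<partial>density M h) = (\<integral>\<^sup>+x. h x * (F x / h x) \<partial>M)"
      by (rule nn_integral_density) auto
    also have "\<dots> = (\<integral>\<^sup>+x. F x \<partial>M)"
    proof (rule nn_integral_cong)
      fix x assume "x \<in> space M"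
      then have "h x \<noteq> 0" "h x \<noteq> \<infinity>" using h(3) by force+
      then show "h x * (F x / h x) = F x"
        by (simp add: ennreal_times_divide mult_divide_eq_ennreal mult.commute[of "h x"])
    qed
    finally show ?thesis by simp
  qed
  then show ?thesis
    using that[OF h(1,3) tau_additive_density[OF M h(1)] fin] fin
    by (simp add: finite_measure_def)
qed

proposition tau_additive_Tonelli:
  fixes F :: "'a \<Rightarrow> 'b \<Rightarrow> ennreal"
  assumes M: "tau_additive S M" and N: "tau_additive T N"
    and F: "case_prod F \<in> borel_measurable (borel_of (prod_topology S T))"
  shows "(\<lambda>x. \<integral>\<^sup>+y. F x y \<partial>N) \<in> borel_measurable M"
    and "(\<lambda>y. \<integral>\<^sup>+x. F x y \<partial>M) \<in> borel_measurable N"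
    and "(\<integral>\<^sup>+x. \<integral>\<^sup>+y. F x y \<partial>N \<partial>M) = (\<integral>\<^sup>+y. \<integral>\<^sup>+x. F x y \<partial>M \<partial>N)"
proof -
  obtain h where h: "h \<in> borel_measurable M" "\<forall>x\<in>space M. 0 < h x \<and> h x < \<infinity>"
    "tau_additive S (density M h)" "finite_measure (density M h)"
    "\<forall>F\<in>borel_measurable M. (\<integral>\<^sup>+x. F x \<partial>M) = (\<integral>\<^sup>+x. F x / h x \<partial>density M h)"
    by (rule tau_additive_finite_density[OF M])
  obtain k where k: "k \<in> borel_measurable N" "\<forall>x\<in>space N. 0 < k x \<and> k x < \<infinity>"
    "tau_additive T (density N k)" "finite_measure (density N k)"
    "\<forall>F\<in>borel_measurable N. (\<integral>\<^sup>+x. F x \<partial>N) = (\<integral>\<^sup>+x. F x / k x \<partial>density N k)"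
    by (rule tau_additive_finite_density[OF N])
  have mM: "borel_measurable M = borel_measurable (borel_of S)"
    and mN: "borel_measurable N = borel_measurable (borel_of T)"
    using tau_additive_sets[OF M] tau_additive_sets[OF N] by (auto intro: measurable_cong_sets)
  have spM: "space M = topspace S" and spN: "space N = topspace T"
    using tau_additive_space[OF M] tau_additive_space[OF N] by auto
  have [measurable]: "h \<in> borel_measurable (borel_of S)" "k \<in> borel_measurable (borel_of T)"
    using h(1) k(1) by (simp_all add: mM mN)
  have [measurable]: "fst \<in> measurable (borel_of (prod_topology S T)) (borel_of S)"
     "snd \<in> measurable (borel_of (prod_topology S T)) (borel_of T)"
    by (auto intro!: continuous_map_measurable continuous_map_fst continuous_map_snd)
  note F[measurable]
  define F' where "F' = (\<lambda>p. case_prod F p / k (snd p) / h (fst p))"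
  have F': "F' \<in> borel_measurable (borel_of (prod_topology S T))"
    unfolding F'_def by measurable
  have F'': "(\<lambda>p. case_prod F p / k (snd p)) \<in> borel_measurable (borel_of (prod_topology S T))"
    by measurable
  have F''': "(\<lambda>p. case_prod F p / h (fst p)) \<in> borel_measurable (borel_of (prod_topology S T))"
    by measurable
  note T = tau_additive_Tonelli_finite[OF h(3) k(3) h(4) k(4)]
  have slN: "(\<lambda>y. F x y) \<in> borel_measurable N" if "x \<in> space M" for x
    using slice_measurable(1)[OF F, of x] that by (simp add: mN spM)
  have slM: "(\<lambda>x. F x y) \<in> borel_measurable M" if "y \<in> space N" for y
    using slice_measurable(2)[OF F, of y] that by (simp add: mM spN)
  have 1: "(\<integral>\<^sup>+y. F x y \<partial>N) = (\<integral>\<^sup>+y. F x y / k y \<partial>density N k)" if "x \<in> space M" for x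
    by (rule k(5)[rule_format, OF slN[OF that]])
  have 2: "(\<integral>\<^sup>+x. F x y \<partial>M) = (\<integral>\<^sup>+x. F x y / h x \<partial>density M h)" if "y \<in> space N" for y
    by (rule h(5)[rule_format, OF slM[OF that]])
  show m1: "(\<lambda>x. \<integral>\<^sup>+y. F x y \<partial>N) \<in> borel_measurable M"
    using T[OF F''] by (subst measurable_cong[OF 1]) auto
  show m2: "(\<lambda>y. \<integral>\<^sup>+x. F x y \<partial>M) \<in> borel_measurable N"
    using T[OF F'''] by (subst measurable_cong[OF 2]) auto
  have d1: "(\<integral>\<^sup>+y. F x y / k y \<partial>density N k) / h x = (\<integral>\<^sup>+y. F x y / k y / h x \<partial>density N k)" if "x \<in> space M" for x
    using slN[OF that] k(1) by (intro nn_integral_divide[symmetric]) simp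
  have d2: "(\<integral>\<^sup>+x. F x y / h x \<partial>density M h) / k y = (\<integral>\<^sup>+x. F x y / k y / h x \<partial>density M h)" if "y \<in> space N" for y
  proof -
    have "(\<integral>\<^sup>+x. F x y / h x \<partial>density M h) / k y = (\<integral>\<^sup>+x. F x y / h x / k y \<partial>density M h)"
      using slM[OF that] h(1) by (intro nn_integral_divide[symmetric]) simp
    also have "\<dots> = (\<integral>\<^sup>+x. F x y / k y / h x \<partial>density M h)"
      by (simp add: divide_ennreal_def mult.assoc mult.commute mult.left_commute)
    finally show ?thesis .
  qed
  have "(\<integral>\<^sup>+x. \<integral>\<^sup>+y. F x y \<partial>N \<partial>M) = (\<integral>\<^sup>+x. (\<integral>\<^sup>+y. F x y \<partial>N) / h x \<partial>density M h)"
    by (rule h(5)[rule_format, OF m1])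
  also have "\<dots> = (\<integral>\<^sup>+x. \<integral>\<^sup>+y. F' (x, y) \<partial>density N k \<partial>density M h)"
    by (rule nn_integral_cong) (simp add: 1 d1 F'_def)
  also have "\<dots> = (\<integral>\<^sup>+y. \<integral>\<^sup>+x. F' (x, y) \<partial>density M h \<partial>density N k)"
    using T[OF F'] by blast
  also have "\<dots> = (\<integral>\<^sup>+y. (\<integral>\<^sup>+x. F x y \<partial>M) / k y \<partial>density N k)"
    by (rule nn_integral_cong) (simp add: 2 d2 F'_def)
  also have "\<dots> = (\<integral>\<^sup>+y. \<integral>\<^sup>+x. F x y \<partial>M \<partial>N)"
    by (rule k(5)[rule_format, OF m2, symmetric])
  finally show "(\<integral>\<^sup>+x. \<integral>\<^sup>+y. F x y \<partial>N \<partial>M) = (\<integral>\<^sup>+y. \<integral>\<^sup>+x. F x y \<partial>M \<partial>N)" .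
qed

text \<open>Both sides say that the set where \<open>P\<close> fails has iterated measure zero, in
  one order or the other. That set only has to be Borel for the product topology.\<close>

lemma tau_additive_AE_swap:
  assumes M: "tau_additive S M" and N: "tau_additive T N"
    and P: "{p \<in> topspace (prod_topology S T). P (fst p) (snd p)} \<in> sets (borel_of (prod_topology S T))"
  shows "(AE x in M. AE y in N. P x y) \<longleftrightarrow> (AE y in N. AE x in M. P x y)"
proof -
  define E where "E = {p \<in> topspace (prod_topology S T). \<not> P (fst p) (snd p)}"
  have E: "E \<in> sets (borel_of (prod_topology S T))"
  proof -
    have "E = space (borel_of (prod_topology S T)) - {p \<in> topspace (prod_topology S T). P (fst p) (snd p)}"
      by (auto simp: E_def)
    then show ?thesis using sets.compl_sets[OF P] by simp
  qed
  have spM: "space M = topspace S" and spN: "space N = topspace T"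
    using tau_additive_space[OF M] tau_additive_space[OF N] by auto
  have I: "(\<lambda>(x, y). indicator E (x, y) :: ennreal) \<in> borel_measurable (borel_of (prod_topology S T))"
    using E by simp
  note T = tau_additive_Tonelli[OF M N I]
  have mN: "(\<lambda>y. indicator E (x, y) :: ennreal) \<in> borel_measurable N" if "x \<in> space M" for x
    using slice_measurable(1)[OF I, of x] that by (simp add: tau_additive_measurable[OF N] spM)
  have mM: "(\<lambda>x. indicator E (x, y) :: ennreal) \<in> borel_measurable M" if "y \<in> space N" for y
    using slice_measurable(2)[OF I, of y] that by (simp add: tau_additive_measurable[OF M] spN)
  have "(AE x in M. AE y in N. P x y) \<longleftrightarrow> (AE x in M. (\<integral>\<^sup>+y. indicator E (x, y) \<partial>N) = 0)"
    by (intro AE_cong, subst nn_integral_0_iff_AE[OF mN])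
      (auto intro!: AE_cong simp: E_def spM spN indicator_def)
  also have "\<dots> \<longleftrightarrow> (\<integral>\<^sup>+x. \<integral>\<^sup>+y. indicator E (x, y) \<partial>N \<partial>M) = 0"
    using T(1) by (subst nn_integral_0_iff_AE) auto
  also have "\<dots> \<longleftrightarrow> (\<integral>\<^sup>+y. \<integral>\<^sup>+x. indicator E (x, y) \<partial>M \<partial>N) = 0"
    using T(3) by simp
  also have "\<dots> \<longleftrightarrow> (AE y in N. (\<integral>\<^sup>+x. indicator E (x, y) \<partial>M) = 0)"
    using T(2) by (subst nn_integral_0_iff_AE) auto
  also have "\<dots> \<longleftrightarrow> (AE y in N. AE x in M. P x y)"
    by (intro AE_cong, subst nn_integral_0_iff_AE[OF mM])
      (auto intro!: AE_cong simp: E_def spM spN indicator_def)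
  finally show ?thesis .
qed

text \<open>Covers every measurable \<open>f\<close>, because a non-integrable function has integral
  \<open>0\<close> by convention. Hence an integral depending on a parameter is measurable in it
  without any integrability assumption.\<close>

lemma lebesgue_integral_enn2real_diff:
  fixes f :: "'a \<Rightarrow> real"
  assumes "f \<in> borel_measurable M"
  shows "(\<integral>x. f x \<partial>M) = (if (\<integral>\<^sup>+x. ennreal \<bar>f x\<bar> \<partial>M) < \<infinity>
    then enn2real (\<integral>\<^sup>+x. ennreal (f x) \<partial>M) - enn2real (\<integral>\<^sup>+x. ennreal (- f x) \<partial>M) else 0)"
proof (cases "integrable M f")
  case True
  then show ?thesis by (simp add: real_lebesgue_integral_def integrable_iff_bounded)
next
  case False
  then show ?thesis using assms by (simp add: not_integrable_integral_eq integrable_iff_bounded)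
qed

lemma tau_additive_integral_measurable:
  fixes F :: "'a \<Rightarrow> 'b \<Rightarrow> real"
  assumes M: "tau_additive S M" and N: "tau_additive T N"
    and F: "case_prod F \<in> borel_measurable (borel_of (prod_topology S T))"
  shows "(\<lambda>x. \<integral>y. F x y \<partial>N) \<in> borel_measurable M"
proof -
  have slN: "(\<lambda>y. F x y) \<in> borel_measurable N" if "x \<in> space M" for x
    using slice_measurable(1)[OF F, of x] that by (simp add: tau_additive_measurable[OF N] tau_additive_space[OF M])
  note F' = F[unfolded case_prod_unfold, measurable]
  have [measurable]: "(\<lambda>x. \<integral>\<^sup>+y. ennreal \<bar>F x y\<bar> \<partial>N) \<in> borel_measurable M"
    "(\<lambda>x. \<integral>\<^sup>+y. ennreal (F x y) \<partial>N) \<in> borel_measurable M"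
    "(\<lambda>x. \<integral>\<^sup>+y. ennreal (- F x y) \<partial>N) \<in> borel_measurable M"
    by (rule tau_additive_Tonelli(1)[OF M N], unfold case_prod_unfold, measurable)+
  show ?thesis
    by (subst measurable_cong[OF lebesgue_integral_enn2real_diff[OF slN]]) auto
qed

lemma borel_measurable_prod_swap:
  assumes "case_prod F \<in> measurable (borel_of (prod_topology S T)) L"
  shows "(\<lambda>(y, x). F x y) \<in> measurable (borel_of (prod_topology T S)) L"
  using measurable_compose[OF continuous_map_measurable[OF continuous_map_prod_swap] assms]
  by (simp add: case_prod_unfold)

proposition tau_additive_Fubini:
  fixes F :: "'a \<Rightarrow> 'b \<Rightarrow> real"
  assumes M: "tau_additive S M" and N: "tau_additive T N"
    and F: "case_prod F \<in> borel_measurable (borel_of (prod_topology S T))"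
    and fin: "(\<integral>\<^sup>+x. \<integral>\<^sup>+y. ennreal \<bar>F x y\<bar> \<partial>N \<partial>M) < \<infinity>"
  shows "AE x in M. integrable N (\<lambda>y. F x y)"
    and "integrable M (\<lambda>x. \<integral>y. F x y \<partial>N)"
    and "(\<integral>x. \<integral>y. F x y \<partial>N \<partial>M) = (\<integral>y. \<integral>x. F x y \<partial>M \<partial>N)"
proof -
  have slN: "(\<lambda>y. F x y) \<in> borel_measurable N" if "x \<in> space M" for x
    using slice_measurable(1)[OF F, of x] that by (simp add: tau_additive_measurable[OF N] tau_additive_space[OF M])
  have slM: "(\<lambda>x. F x y) \<in> borel_measurable M" if "y \<in> space N" for y
    using slice_measurable(2)[OF F, of y] that by (simp add: tau_additive_measurable[OF M] tau_additive_space[OF N])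
  note F' = F[unfolded case_prod_unfold, measurable]
  have A: "(\<lambda>(x, y). ennreal \<bar>F x y\<bar>) \<in> borel_measurable (borel_of (prod_topology S T))"
    and P: "(\<lambda>(x, y). ennreal (F x y)) \<in> borel_measurable (borel_of (prod_topology S T))"
    and Q: "(\<lambda>(x, y). ennreal (- F x y)) \<in> borel_measurable (borel_of (prod_topology S T))"
    unfolding case_prod_unfold by measurable
  note TA = tau_additive_Tonelli[OF M N A] and TP = tau_additive_Tonelli[OF M N P]
    and TQ = tau_additive_Tonelli[OF M N Q]
  note [measurable] = TA(1,2) TP(1,2) TQ(1,2)
  have leP: "ennreal (F x y) \<le> ennreal \<bar>F x y\<bar>" and leQ: "ennreal (- F x y) \<le> ennreal \<bar>F x y\<bar>" for x y
    by (auto intro: ennreal_leI)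
  have AEM: "AE x in M. (\<integral>\<^sup>+y. ennreal \<bar>F x y\<bar> \<partial>N) \<noteq> \<infinity>"
    by (rule nn_integral_PInf_AE) (use fin in auto)
  have AEN: "AE y in N. (\<integral>\<^sup>+x. ennreal \<bar>F x y\<bar> \<partial>M) \<noteq> \<infinity>"
    by (rule nn_integral_PInf_AE) (use fin TA(3) in auto)
  show int: "AE x in M. integrable N (\<lambda>y. F x y)"
    using AEM AE_space
    by eventually_elim (use slN in \<open>auto simp: integrable_iff_bounded top.not_eq_extremum\<close>)
  \<comment> \<open>\<open>G\<close> stands for the positive or the negative part of
    \<open>F\<close>. Its inner integral is finite for almost every \<open>x\<close>, so passing to
    real values changes nothing that the outer integral sees.\<close>
  have aux: "(\<integral>x. enn2real (\<integral>\<^sup>+y. G x y \<partial>N) \<partial>M) = enn2real (\<integral>\<^sup>+x. \<integral>\<^sup>+y. G x y \<partial>N \<partial>M) \<and>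
      integrable M (\<lambda>x. enn2real (\<integral>\<^sup>+y. G x y \<partial>N))"
    if G: "\<And>x y. G x y \<le> ennreal \<bar>F x y\<bar>" and [measurable]: "(\<lambda>x. \<integral>\<^sup>+y. G x y \<partial>N) \<in> borel_measurable M" for G
  proof -
    have *: "AE x in M. ennreal (enn2real (\<integral>\<^sup>+y. G x y \<partial>N)) = (\<integral>\<^sup>+y. G x y \<partial>N)"
      using AEM
    proof eventually_elim
      case (elim x)
      have "(\<integral>\<^sup>+y. G x y \<partial>N) \<le> (\<integral>\<^sup>+y. ennreal \<bar>F x y\<bar> \<partial>N)" by (intro nn_integral_mono G)
      with elim show ?case by (auto intro!: ennreal_enn2real simp: top.not_eq_extremum)
    qed
    have 1: "(\<integral>\<^sup>+x. ennreal (enn2real (\<integral>\<^sup>+y. G x y \<partial>N)) \<partial>M) = (\<integral>\<^sup>+x. \<integral>\<^sup>+y. G x y \<partial>N \<partial>M)"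
      by (rule nn_integral_cong_AE[OF *])
    have 2: "(\<integral>\<^sup>+x. \<integral>\<^sup>+y. G x y \<partial>N \<partial>M) < \<infinity>"
      using fin by (rule order.strict_trans1[rotated]) (intro nn_integral_mono G)
    show ?thesis
      using 1 2 by (auto simp: integral_eq_nn_integral integrable_iff_bounded)
  qed
  have aux': "(\<integral>y. enn2real (\<integral>\<^sup>+x. G x y \<partial>M) \<partial>N) = enn2real (\<integral>\<^sup>+y. \<integral>\<^sup>+x. G x y \<partial>M \<partial>N) \<and>
      integrable N (\<lambda>y. enn2real (\<integral>\<^sup>+x. G x y \<partial>M))"
    if G: "\<And>x y. G x y \<le> ennreal \<bar>F x y\<bar>" and [measurable]: "(\<lambda>y. \<integral>\<^sup>+x. G x y \<partial>M) \<in> borel_measurable N" for G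
  proof -
    have *: "AE y in N. ennreal (enn2real (\<integral>\<^sup>+x. G x y \<partial>M)) = (\<integral>\<^sup>+x. G x y \<partial>M)"
      using AEN
    proof eventually_elim
      case (elim y)
      have "(\<integral>\<^sup>+x. G x y \<partial>M) \<le> (\<integral>\<^sup>+x. ennreal \<bar>F x y\<bar> \<partial>M)" by (intro nn_integral_mono G)
      with elim show ?case by (auto intro!: ennreal_enn2real simp: top.not_eq_extremum)
    qed
    have 1: "(\<integral>\<^sup>+y. ennreal (enn2real (\<integral>\<^sup>+x. G x y \<partial>M)) \<partial>N) = (\<integral>\<^sup>+y. \<integral>\<^sup>+x. G x y \<partial>M \<partial>N)"
      by (rule nn_integral_cong_AE[OF *])
    have 2: "(\<integral>\<^sup>+y. \<integral>\<^sup>+x. G x y \<partial>M \<partial>N) < \<infinity>"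
      using fin unfolding TA(3) by (rule order.strict_trans1[rotated]) (intro nn_integral_mono G)
    show ?thesis
      using 1 2 by (auto simp: integral_eq_nn_integral integrable_iff_bounded)
  qed
  have eqM: "AE x in M. (\<integral>y. F x y \<partial>N) = enn2real (\<integral>\<^sup>+y. ennreal (F x y) \<partial>N) - enn2real (\<integral>\<^sup>+y. ennreal (- F x y) \<partial>N)"
    using int by eventually_elim (simp add: real_lebesgue_integral_def)
  have eqN: "AE y in N. (\<integral>x. F x y \<partial>M) = enn2real (\<integral>\<^sup>+x. ennreal (F x y) \<partial>M) - enn2real (\<integral>\<^sup>+x. ennreal (- F x y) \<partial>M)"
    using AEN AE_space
    by eventually_elim (use slM in \<open>auto simp: lebesgue_integral_enn2real_diff top.not_eq_extremum\<close>)
  have mN[measurable]: "(\<lambda>x. \<integral>y. F x y \<partial>N) \<in> borel_measurable M"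
    by (rule tau_additive_integral_measurable[OF M N F])
  have mM[measurable]: "(\<lambda>y. \<integral>x. F x y \<partial>M) \<in> borel_measurable N"
    by (rule tau_additive_integral_measurable[OF N M borel_measurable_prod_swap[OF F]])
  have iM: "integrable M (\<lambda>x. enn2real (\<integral>\<^sup>+y. ennreal (F x y) \<partial>N) - enn2real (\<integral>\<^sup>+y. ennreal (- F x y) \<partial>N))"
    using aux[OF leP] aux[OF leQ] by simp
  then show "integrable M (\<lambda>x. \<integral>y. F x y \<partial>N)"
    using integrable_cong_AE[OF mN _ eqM] by simp
  have "(\<integral>x. \<integral>y. F x y \<partial>N \<partial>M) = (\<integral>x. enn2real (\<integral>\<^sup>+y. ennreal (F x y) \<partial>N) - enn2real (\<integral>\<^sup>+y. ennreal (- F x y) \<partial>N) \<partial>M)"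
    using eqM by (intro integral_cong_AE) auto
  also have "\<dots> = enn2real (\<integral>\<^sup>+x. \<integral>\<^sup>+y. ennreal (F x y) \<partial>N \<partial>M) - enn2real (\<integral>\<^sup>+x. \<integral>\<^sup>+y. ennreal (- F x y) \<partial>N \<partial>M)"
    using aux[OF leP] aux[OF leQ] by simp
  also have "\<dots> = (\<integral>y. enn2real (\<integral>\<^sup>+x. ennreal (F x y) \<partial>M) - enn2real (\<integral>\<^sup>+x. ennreal (- F x y) \<partial>M) \<partial>N)"
    using aux'[OF leP] aux'[OF leQ] TP(3) TQ(3) by simp
  also have "\<dots> = (\<integral>y. \<integral>x. F x y \<partial>M \<partial>N)"
    using eqN by (intro integral_cong_AE[symmetric]) auto
  finally show "(\<integral>x. \<integral>y. F x y \<partial>N \<partial>M) = (\<integral>y. \<integral>x. F x y \<partial>M \<partial>N)" .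
qed

section \<open>Lattices and their invariant measures\<close>

lemma openin_prod_topologyE:
  assumes "openin (prod_topology S T) U" "(x, y) \<in> U"
  obtains A B where "openin S A" "openin T B" "x \<in> A" "y \<in> B" "A \<times> B \<subseteq> U"
proof -
  have "\<exists>A B. openin S A \<and> openin T B \<and> x \<in> A \<and> y \<in> B \<and> A \<times> B \<subseteq> U"
    using assms(1)[unfolded openin_prod_topology_alt, rule_format, OF assms(2)] .
  then show ?thesis using that by (elim exE conjE)
qed

text \<open>Images commute with complements only where the map is injective. For each
  \<open>U i\<close>, the sets \<open>E\<close> whose part in \<open>U i\<close> has a Borel image
  therefore form a sigma-algebra, which contains the open sets because \<open>r\<close> is open;
  countably many \<open>U i\<close> cover the space.\<close>

lemma borel_image_of_open_locally_injective:
  assumes r: "continuous_map S T r" "open_map S T r"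
    and A: "countable A" "\<And>i. i \<in> A \<Longrightarrow> openin S (U i)" "topspace S \<subseteq> (\<Union>i\<in>A. U i)"
      "\<And>i. i \<in> A \<Longrightarrow> inj_on r (U i)"
    and E: "E \<in> sets (borel_of S)"
  shows "r ` E \<in> sets (borel_of T)"
proof -
  have 1: "r ` (E \<inter> U i) \<in> sets (borel_of T)" if i: "i \<in> A" for i
  proof -
    have "E \<in> sigma_sets (topspace S) {U. openin S U}" using E by (simp add: sets_borel_of)
    then show ?thesis
    proof induction
      case (Basic V)
      then have "openin S (V \<inter> U i)" using A(2) i by auto
      then show ?case using r(2) by (auto simp: open_map_def intro: borel_of_open)
    next
      case Empty
      then show ?case by simp
    next
      case (Compl V)
      have V: "V \<subseteq> topspace S" using Compl.hyps sigma_sets_into_sp[of "{U. openin S U}" "topspace S" V] openin_subset by blast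
      have "r ` ((topspace S - V) \<inter> U i) = r ` (U i) - r ` (V \<inter> U i)"
        using A(4)[OF i] openin_subset[OF A(2)[OF i]] V by (auto simp: inj_on_def)
      moreover have "r ` (U i) \<in> sets (borel_of T)"
        using r(2) A(2)[OF i] by (auto simp: open_map_def intro: borel_of_open)
      ultimately show ?case using Compl.IH by auto
    next
      case (Union V)
      have "r ` (\<Union> (range V) \<inter> U i) = (\<Union>j. r ` (V j \<inter> U i))" by auto
      then show ?case using Union.IH by auto
    qed
  qed
  have "E \<subseteq> topspace S" using sets.sets_into_space[OF E] by simp
  then have "r ` E = (\<Union>i\<in>A. r ` (E \<inter> U i))" using A(3) by blast
  then show ?thesis using 1 A(1) by auto
qed

section \<open>Topological groups and left-invariant measures\<close>

locale top_group =
  fixes G :: "'a monoid" (structure) and T :: "'a topology"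
  assumes topological_group: "topological_group G T"
begin

sublocale group G
  using topological_group by (simp add: topological_group_def)

lemma topspace_eq [simp]: "topspace T = carrier G"
  using topological_group by (simp add: topological_group_def)

lemma continuous_map_mult:
  assumes "continuous_map S T f" "continuous_map S T g"
  shows "continuous_map S T (\<lambda>x. f x \<otimes> g x)"
proof -
  have "continuous_map S (prod_topology T T) (\<lambda>x. (f x, g x))"
    using assms by (rule continuous_map_pairedI)
  moreover have "continuous_map (prod_topology T T) T (\<lambda>(x, y). x \<otimes> y)"
    using topological_group by (simp add: topological_group_def)
  ultimately have "continuous_map S T ((\<lambda>(x, y). x \<otimes> y) \<circ> (\<lambda>x. (f x, g x)))"
    by (rule continuous_map_compose)
  then show ?thesis by (simp add: o_def)
qed

lemma continuous_map_inv:
  assumes "continuous_map S T f"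
  shows "continuous_map S T (\<lambda>x. inv (f x))"
proof -
  have "continuous_map T T (\<lambda>x. inv x)"
    using topological_group by (simp add: topological_group_def)
  from continuous_map_compose[OF assms this] show ?thesis by (simp add: o_def)
qed

lemmas continuous_intros_group =
  continuous_map_mult continuous_map_inv continuous_map_fst continuous_map_snd
  continuous_map_pairedI continuous_map_id[unfolded id_def]

lemma continuous_map_const_carrier: "g \<in> carrier G \<Longrightarrow> continuous_map S T (\<lambda>_. g)"
  by simp

lemma borel_compose:
  assumes "f \<in> measurable (borel_of T) L" "continuous_map S T g"
  shows "(\<lambda>x. f (g x)) \<in> measurable (borel_of S) L"
  using measurable_compose[OF continuous_map_measurable[OF assms(2)] assms(1)] .

lemma openin_left_translate:
  assumes g: "g \<in> carrier G" and U: "openin T U"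
  shows "openin T ((\<lambda>u. g \<otimes> u) ` U)"
proof -
  have Us: "U \<subseteq> carrier G" using openin_subset[OF U] by simp
  have "(\<lambda>u. g \<otimes> u) ` U = {x \<in> topspace T. inv g \<otimes> x \<in> U}"
  proof (intro equalityI subsetI)
    fix x assume "x \<in> (\<lambda>u. g \<otimes> u) ` U"
    then show "x \<in> {x \<in> topspace T. inv g \<otimes> x \<in> U}" using g Us by (auto simp: m_assoc[symmetric])
  next
    fix x assume x: "x \<in> {x \<in> topspace T. inv g \<otimes> x \<in> U}"
    then have "x = g \<otimes> (inv g \<otimes> x)" using g by (simp add: m_assoc[symmetric])
    then show "x \<in> (\<lambda>u. g \<otimes> u) ` U" using x by blast
  qed
  moreover have "continuous_map T T (\<lambda>x. inv g \<otimes> x)"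
    using g by (intro continuous_intros_group continuous_map_const_carrier) auto
  ultimately show ?thesis using openin_continuous_map_preimage[OF _ U] by metis
qed

lemma openin_right_translate:
  assumes g: "g \<in> carrier G" and U: "openin T U"
  shows "openin T ((\<lambda>u. u \<otimes> g) ` U)"
proof -
  have Us: "U \<subseteq> carrier G" using openin_subset[OF U] by simp
  have "(\<lambda>u. u \<otimes> g) ` U = {x \<in> topspace T. x \<otimes> inv g \<in> U}"
  proof (intro equalityI subsetI)
    fix x assume "x \<in> (\<lambda>u. u \<otimes> g) ` U"
    then show "x \<in> {x \<in> topspace T. x \<otimes> inv g \<in> U}" using g Us by (auto simp: m_assoc)
  next
    fix x assume x: "x \<in> {x \<in> topspace T. x \<otimes> inv g \<in> U}"
    then have "x = (x \<otimes> inv g) \<otimes> g" using g by (simp add: m_assoc)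
    then show "x \<in> (\<lambda>u. u \<otimes> g) ` U" using x by blast
  qed
  moreover have "continuous_map T T (\<lambda>x. x \<otimes> inv g)"
    using g by (intro continuous_intros_group continuous_map_const_carrier) auto
  ultimately show ?thesis using openin_continuous_map_preimage[OF _ U] by metis
qed

lemma compactin_mult:
  assumes "compactin T K" "compactin T L"
  shows "compactin T ((\<lambda>(x, y). x \<otimes> y) ` (K \<times> L))"
  using image_compactin[OF iffD2[OF compactin_Times]] assms topological_group
  unfolding topological_group_def by metis

lemma compactin_inv: "compactin T K \<Longrightarrow> compactin T ((\<lambda>x. inv x) ` K)"
  using image_compactin topological_group unfolding topological_group_def by metis

definition left_invariant :: "'a measure \<Rightarrow> bool" where
  "left_invariant M \<longleftrightarrow> (\<forall>g\<in>carrier G. \<forall>f\<in>borel_measurable (borel_of T).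
     (\<integral>\<^sup>+x. (f (g \<otimes> x) :: ennreal) \<partial>M) = (\<integral>\<^sup>+x. f x \<partial>M))"

lemma left_invariantD:
  "left_invariant M \<Longrightarrow> g \<in> carrier G \<Longrightarrow> f \<in> borel_measurable (borel_of T) \<Longrightarrow>
     (\<integral>\<^sup>+x. (f (g \<otimes> x) :: ennreal) \<partial>M) = (\<integral>\<^sup>+x. f x \<partial>M)"
  by (simp add: left_invariant_def)

text \<open>This identity, applied to suitable pairs of measures, yields both unimodularity and the
  uniqueness of Haar measure.\<close>

lemma left_invariant_pair:
  fixes f h :: "'a \<Rightarrow> ennreal"
  assumes M: "tau_additive T M" "left_invariant M" and N: "tau_additive T N" "left_invariant N"
    and f: "f \<in> borel_measurable (borel_of T)" and h: "h \<in> borel_measurable (borel_of T)"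
  shows "(\<integral>\<^sup>+x. f x \<partial>M) * (\<integral>\<^sup>+y. h (inv y) \<partial>N) = (\<integral>\<^sup>+x. h x * (\<integral>\<^sup>+y. f (y \<otimes> x) \<partial>N) \<partial>M)"
proof -
  have spM: "space M = carrier G" and spN: "space N = carrier G"
    using tau_additive_space[OF M(1)] tau_additive_space[OF N(1)] by auto
  note mb = tau_additive_measurable[OF M(1)] tau_additive_measurable[OF N(1)]
  have hi: "(\<lambda>y. h (inv y)) \<in> borel_measurable (borel_of T)"
    by (intro borel_compose[OF h] continuous_intros_group)
  \<comment> \<open>Left translation by \<open>inv x\<close> under \<open>N\<close> replaces
    \<open>inv y\<close> by \<open>inv y \<otimes> x\<close>, which couples the two
    variables.\<close>
  have 1: "(\<integral>\<^sup>+y. h (inv y) \<partial>N) = (\<integral>\<^sup>+y. h (inv y \<otimes> x) \<partial>N)" if x: "x \<in> carrier G" for x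
  proof -
    have "(\<integral>\<^sup>+y. h (inv y) \<partial>N) = (\<integral>\<^sup>+y. h (inv (inv x \<otimes> y)) \<partial>N)"
      by (rule left_invariantD[OF N(2) _ hi, symmetric]) (use x in auto)
    also have "\<dots> = (\<integral>\<^sup>+y. h (inv y \<otimes> x) \<partial>N)"
      by (rule nn_integral_cong) (use x in \<open>simp add: spN inv_mult_group\<close>)
    finally show ?thesis .
  qed
  have m1: "(\<lambda>(x, y). f x * h (inv y \<otimes> x)) \<in> borel_measurable (borel_of (prod_topology T T))"
    unfolding case_prod_unfold
    by (intro borel_measurable_times_ennreal borel_compose[OF f] borel_compose[OF h] continuous_intros_group)
  have m2: "(\<lambda>(x, y). f (y \<otimes> x) * h x) \<in> borel_measurable (borel_of (prod_topology T T))"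
    unfolding case_prod_unfold
    by (intro borel_measurable_times_ennreal borel_compose[OF f] borel_compose[OF h] continuous_intros_group)
  have "(\<integral>\<^sup>+x. f x \<partial>M) * (\<integral>\<^sup>+y. h (inv y) \<partial>N) = (\<integral>\<^sup>+x. f x * (\<integral>\<^sup>+y. h (inv y) \<partial>N) \<partial>M)"
    using f by (subst nn_integral_multc) (simp_all add: mb)
  also have "\<dots> = (\<integral>\<^sup>+x. \<integral>\<^sup>+y. f x * h (inv y \<otimes> x) \<partial>N \<partial>M)"
  proof (rule nn_integral_cong)
    fix x assume "x \<in> space M"
    then have x: "x \<in> carrier G" by (simp add: spM)
    have "(\<lambda>y. h (inv y \<otimes> x)) \<in> borel_measurable N"
      unfolding mb using x by (intro borel_compose[OF h] continuous_intros_group continuous_map_const_carrier) auto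
    then show "f x * (\<integral>\<^sup>+y. h (inv y) \<partial>N) = (\<integral>\<^sup>+y. f x * h (inv y \<otimes> x) \<partial>N)"
      by (simp add: 1[OF x] nn_integral_cmult)
  qed
  also have "\<dots> = (\<integral>\<^sup>+y. \<integral>\<^sup>+x. f x * h (inv y \<otimes> x) \<partial>M \<partial>N)"
    by (rule tau_additive_Tonelli(3)[OF M(1) N(1) m1])
  \<comment> \<open>With \<open>y\<close> fixed, the substitution
    \<open>x \<mapsto> y \<otimes> x\<close> under \<open>M\<close> cancels the factor
    \<open>inv y\<close>.\<close>
  also have "\<dots> = (\<integral>\<^sup>+y. \<integral>\<^sup>+x. f (y \<otimes> x) * h x \<partial>M \<partial>N)"
  proof (rule nn_integral_cong)
    fix y assume "y \<in> space N"
    then have y: "y \<in> carrier G" by (simp add: spN)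
    have "(\<lambda>x. f x * h (inv y \<otimes> x)) \<in> borel_measurable (borel_of T)"
      using y by (intro borel_measurable_times_ennreal f borel_compose[OF h] continuous_intros_group continuous_map_const_carrier) auto
    from left_invariantD[OF M(2) y this, symmetric]
    moreover have "inv y \<otimes> (y \<otimes> x) = x" if "x \<in> space M" for x
      using y that by (simp add: spM m_assoc[symmetric])
    ultimately show "(\<integral>\<^sup>+x. f x * h (inv y \<otimes> x) \<partial>M) = (\<integral>\<^sup>+x. f (y \<otimes> x) * h x \<partial>M)"
      by (simp cong: nn_integral_cong)
  qed
  also have "\<dots> = (\<integral>\<^sup>+x. \<integral>\<^sup>+y. f (y \<otimes> x) * h x \<partial>N \<partial>M)"
    by (rule tau_additive_Tonelli(3)[OF M(1) N(1) m2, symmetric])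
  also have "\<dots> = (\<integral>\<^sup>+x. h x * (\<integral>\<^sup>+y. f (y \<otimes> x) \<partial>N) \<partial>M)"
  proof (rule nn_integral_cong)
    fix x assume "x \<in> space M"
    then have x: "x \<in> carrier G" by (simp add: spM)
    have "(\<lambda>y. f (y \<otimes> x)) \<in> borel_measurable N"
      unfolding mb using x by (intro borel_compose[OF f] continuous_intros_group continuous_map_const_carrier) auto
    then show "(\<integral>\<^sup>+y. f (y \<otimes> x) * h x \<partial>N) = h x * (\<integral>\<^sup>+y. f (y \<otimes> x) \<partial>N)"
      by (simp add: nn_integral_cmult mult.commute[of _ "h x"])
  qed
  finally show ?thesis .
qed

end

section \<open>The coset space and its local sections\<close>

locale group_lattice = top_group G T for G :: "'a monoid" (structure) and T :: "'a topology" +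
  fixes \<Gamma> :: "'a set" and \<nu> :: "'a set measure"
  assumes Hausdorff: "Hausdorff_space T"
    and locally_compact: "locally_compact_space T"
    and sigma_compact: "sigma_compact_space T"
    and discrete: "discrete_subgroup G T \<Gamma>"
    and invariant: "invariant_measure_on_cosets G T \<Gamma> \<nu>"
begin

abbreviation Xs :: "'a set topology" where "Xs \<equiv> coset_topology G T \<Gamma>"

abbreviation q :: "'a \<Rightarrow> 'a set" where "q g \<equiv> g <# \<Gamma>"

lemma subgroup_Gamma: "subgroup \<Gamma> G"
  using discrete by (simp add: discrete_subgroup_def)

lemma Gamma_carrier: "\<gamma> \<in> \<Gamma> \<Longrightarrow> \<gamma> \<in> carrier G"
  using subgroup.subset[OF subgroup_Gamma] by blast

lemma topspace_X: "topspace Xs = q ` carrier G"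
  by (auto simp: topspace_coset_topology LCOSETS_def)

lemma q_mem: "y \<in> q g \<longleftrightarrow> (\<exists>\<gamma>\<in>\<Gamma>. y = g \<otimes> \<gamma>)"
  by (auto simp: l_coset_def)

lemma q_mult_Gamma [simp]:
  assumes "g \<in> carrier G" "\<gamma> \<in> \<Gamma>"
  shows "q (g \<otimes> \<gamma>) = q g"
proof (intro equalityI subsetI)
  fix y assume "y \<in> q (g \<otimes> \<gamma>)"
  then show "y \<in> q g" using assms Gamma_carrier subgroup.m_closed[OF subgroup_Gamma]
    by (auto simp: q_mem m_assoc)
next
  fix y assume "y \<in> q g"
  then obtain \<delta> where \<delta>: "\<delta> \<in> \<Gamma>" "y = g \<otimes> \<delta>" by (auto simp: q_mem)
  then have "y = (g \<otimes> \<gamma>) \<otimes> (inv \<gamma> \<otimes> \<delta>)"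
    using assms Gamma_carrier inv_solve_left by (simp add: m_assoc) (simp add: m_assoc[symmetric])
  moreover have "inv \<gamma> \<otimes> \<delta> \<in> \<Gamma>"
    using assms \<delta> subgroup_Gamma by (meson subgroup.m_closed subgroup.m_inv_closed)
  ultimately show "y \<in> q (g \<otimes> \<gamma>)" by (auto simp: q_mem)
qed

lemma q_self: "g \<in> carrier G \<Longrightarrow> g \<in> q g"
  using subgroup.one_closed[OF subgroup_Gamma] by (auto simp: q_mem intro!: bexI[of _ \<one>])

lemma q_eq_iff:
  assumes "g \<in> carrier G" "h \<in> carrier G"
  shows "q g = q h \<longleftrightarrow> inv g \<otimes> h \<in> \<Gamma>"
proof
  assume "q g = q h"
  then have "h \<in> q g" using q_self[OF assms(2)] by simp
  then obtain \<gamma> where "\<gamma> \<in> \<Gamma>" "h = g \<otimes> \<gamma>" by (auto simp: q_mem)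
  then show "inv g \<otimes> h \<in> \<Gamma>" using assms Gamma_carrier by (simp add: m_assoc[symmetric])
next
  assume *: "inv g \<otimes> h \<in> \<Gamma>"
  have "h = g \<otimes> (inv g \<otimes> h)" using assms by (simp add: m_assoc[symmetric])
  then show "q g = q h" using q_mult_Gamma[OF assms(1) *] by simp
qed

lemma q_mem_iff: "g \<in> carrier G \<Longrightarrow> y \<in> q g \<longleftrightarrow> y \<in> carrier G \<and> q y = q g"
  using q_self Gamma_carrier by (auto simp: q_mem)

lemma act_q: "g \<in> carrier G \<Longrightarrow> h \<in> carrier G \<Longrightarrow> g <# q h = q (g \<otimes> h)"
  using lcos_m_assoc[of \<Gamma> g h] Gamma_carrier by auto

lemma act_closed: "g \<in> carrier G \<Longrightarrow> x \<in> topspace Xs \<Longrightarrow> g <# x \<in> topspace Xs"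
  by (auto simp: topspace_X act_q)

lemma act_act: "g \<in> carrier G \<Longrightarrow> h \<in> carrier G \<Longrightarrow> x \<in> topspace Xs \<Longrightarrow> g <# (h <# x) = (g \<otimes> h) <# x"
  by (auto simp: topspace_X act_q m_assoc)

lemma act_one: "x \<in> topspace Xs \<Longrightarrow> \<one> <# x = x"
  by (auto simp: topspace_X act_q)

lemma continuous_q: "continuous_map T Xs q"
  using quotient_map_coset_topology[of T G \<Gamma>] quotient_imp_continuous_map by auto

text \<open>The saturation of an open set is the union of its right translates by elements of
  \<Gamma>.\<close>

lemma open_map_q: "open_map T Xs q"
  unfolding open_map_def
proof (intro allI impI)
  fix U assume U: "openin T U"
  have Us: "U \<subseteq> carrier G" using openin_subset[OF U] by simp
  have "{g \<in> topspace T. q g \<in> q ` U} = (\<Union>\<gamma>\<in>\<Gamma>. (\<lambda>u. u \<otimes> \<gamma>) ` U)"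
  proof (intro equalityI subsetI)
    fix g assume "g \<in> {g \<in> topspace T. q g \<in> q ` U}"
    then obtain u where u: "u \<in> U" "g \<in> carrier G" "q g = q u" by auto
    then have "g \<in> q u" using Us by (auto simp: q_mem_iff)
    then show "g \<in> (\<Union>\<gamma>\<in>\<Gamma>. (\<lambda>u. u \<otimes> \<gamma>) ` U)" using u by (auto simp: q_mem)
  next
    fix g assume "g \<in> (\<Union>\<gamma>\<in>\<Gamma>. (\<lambda>u. u \<otimes> \<gamma>) ` U)"
    then obtain u \<gamma> where *: "u \<in> U" "\<gamma> \<in> \<Gamma>" "g = u \<otimes> \<gamma>" by blast
    then have "u \<in> carrier G" "\<gamma> \<in> carrier G" using Us Gamma_carrier by auto
    then show "g \<in> {g \<in> topspace T. q g \<in> q ` U}" using * by simp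
  qed
  moreover have "openin T (\<Union>\<gamma>\<in>\<Gamma>. (\<lambda>u. u \<otimes> \<gamma>) ` U)"
    using U Gamma_carrier by (auto intro!: openin_Union openin_right_translate)
  ultimately show "openin Xs (q ` U)"
    using Us by (auto simp: openin_coset_topology LCOSETS_def)
qed

text \<open>Discreteness gives an open \<open>V\<close> that meets \<Gamma> only in the identity. By
  continuity of \<open>inv x \<otimes> y\<close> there is a neighbourhood all of whose quotients lie
  in \<open>V\<close>, so no two of its points share a coset; local compactness shrinks it into a
  compact set.\<close>

lemma obtain_injective_neighbourhood:
  obtains U K where "openin T U" "\<one> \<in> U" "inj_on q U" "compactin T K" "U \<subseteq> K"
proof -
  have "subtopology T \<Gamma> = discrete_topology \<Gamma>" using discrete by (simp add: discrete_subgroup_def)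
  then have "openin (subtopology T \<Gamma>) {\<one>}"
    using subgroup.one_closed[OF subgroup_Gamma] by simp
  then obtain V where V: "openin T V" "V \<inter> \<Gamma> = {\<one>}" by (auto simp: openin_subtopology)
  have c: "continuous_map (prod_topology T T) T (\<lambda>p. inv (fst p) \<otimes> snd p)"
    by (intro continuous_intros_group)
  have "openin (prod_topology T T) {p \<in> topspace (prod_topology T T). inv (fst p) \<otimes> snd p \<in> V}"
    by (rule openin_continuous_map_preimage[OF c V(1)])
  moreover have "(\<one>, \<one>) \<in> {p \<in> topspace (prod_topology T T). inv (fst p) \<otimes> snd p \<in> V}"
    using V by auto
  ultimately obtain A B where AB: "openin T A" "openin T B" "\<one> \<in> A" "\<one> \<in> B"
      "A \<times> B \<subseteq> {p \<in> topspace (prod_topology T T). inv (fst p) \<otimes> snd p \<in> V}"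
    by (rule openin_prod_topologyE)
  have "\<exists>W K. openin T W \<and> compactin T K \<and> \<one> \<in> W \<and> W \<subseteq> K"
    using locally_compact unfolding locally_compact_space_def by simp
  then obtain W K where WK: "openin T W" "compactin T K" "\<one> \<in> W" "W \<subseteq> K"
    by blast
  have "inj_on q (A \<inter> B \<inter> W)"
  proof (rule inj_onI)
    fix x y assume xy: "x \<in> A \<inter> B \<inter> W" "y \<in> A \<inter> B \<inter> W" "q x = q y"
    have c: "x \<in> carrier G" "y \<in> carrier G" using xy openin_subset[OF AB(1)] by auto
    have "(x, y) \<in> A \<times> B" using xy by auto
    then have "inv x \<otimes> y \<in> V" using AB(5) by auto
    moreover have "inv x \<otimes> y \<in> \<Gamma>" using q_eq_iff c xy by auto
    ultimately have "inv x \<otimes> y = \<one>" using V by blast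
    then show "x = y" using c by (metis inv_closed inv_equality inv_inv)
  qed
  moreover have "openin T (A \<inter> B \<inter> W)" using AB WK by auto
  ultimately show ?thesis using that[of "A \<inter> B \<inter> W" K] AB WK by auto
qed

text \<open>Sigma-compactness does the work of a countable base: finitely many left translates of an
  injective neighbourhood cover each compact piece. Left translation does not change
  \<open>inv x \<otimes> y\<close>, so \<open>q\<close> stays injective on the translates.\<close>

lemma countable_injective_cover:
  "\<exists>W :: nat \<Rightarrow> 'a set. (\<forall>i. openin T (W i)) \<and> (\<forall>i. inj_on q (W i)) \<and> (\<Union>i. W i) = carrier G \<and>
     (\<forall>i. \<exists>K. compactin T K \<and> W i \<subseteq> K)"
proof -
  obtain U K where U: "openin T U" "\<one> \<in> U" "inj_on q U" "compactin T K" "U \<subseteq> K"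
    by (rule obtain_injective_neighbourhood)
  define W where "W g = (\<lambda>u. g \<otimes> u) ` U" for g
  have Us: "U \<subseteq> carrier G" using openin_subset[OF U(1)] by simp
  have W: "openin T (W g)" "g \<in> W g" "inj_on q (W g)" "\<exists>K. compactin T K \<and> W g \<subseteq> K" if g: "g \<in> carrier G" for g
  proof -
    show "openin T (W g)" unfolding W_def by (rule openin_left_translate[OF g U(1)])
    show "g \<in> W g" unfolding W_def using U(2) g by (metis imageI r_one)
    show "inj_on q (W g)"
    proof (rule inj_onI)
      fix x y assume "x \<in> W g" "y \<in> W g" and eq: "q x = q y"
      then obtain u v where uv: "u \<in> U" "v \<in> U" "x = g \<otimes> u" "y = g \<otimes> v" by (auto simp: W_def)
      then have c: "u \<in> carrier G" "v \<in> carrier G" using Us by auto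
      have "inv x \<otimes> y = inv u \<otimes> v"
        using c g uv by (simp add: inv_mult_group m_assoc) (simp add: m_assoc[symmetric])
      then have "q u = q v" using eq q_eq_iff[of x y] q_eq_iff[of u v] c g uv by simp
      then show "x = y" using U(3) uv by (auto simp: inj_on_def)
    qed
    have "compactin T ((\<lambda>u. g \<otimes> u) ` K)"
      using g by (intro image_compactin[OF U(4)] continuous_intros_group continuous_map_const_carrier) auto
    then show "\<exists>K. compactin T K \<and> W g \<subseteq> K" using U(5) unfolding W_def by blast
  qed
  obtain Kn :: "nat \<Rightarrow> 'a set" where Kn: "\<And>n. compactin T (Kn n)" "(\<Union>n. Kn n) = carrier G"
    using sigma_compact by (auto simp: sigma_compact_space_def)
  have "\<exists>F. finite F \<and> F \<subseteq> carrier G \<and> Kn n \<subseteq> (\<Union>g\<in>F. W g)" for n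
  proof -
    have Ks: "Kn n \<subseteq> carrier G" using compactin_subset_topspace[OF Kn(1)] by simp
    have "\<exists>\<F>. finite \<F> \<and> \<F> \<subseteq> W ` carrier G \<and> Kn n \<subseteq> \<Union>\<F>"
    proof (rule compactinD[OF Kn(1)])
      show "Kn n \<subseteq> \<Union>(W ` carrier G)" using W(2) Ks by blast
    qed (use W(1) in auto)
    then obtain \<F> where \<F>: "finite \<F>" "\<F> \<subseteq> W ` carrier G" "Kn n \<subseteq> \<Union>\<F>" by blast
    obtain F where "F \<subseteq> carrier G" "finite F" "\<F> = W ` F" using finite_subset_image[OF \<F>(1,2)] by blast
    then show ?thesis using \<F>(3) by blast
  qed
  then obtain F where F: "\<And>n. finite (F n)" "\<And>n. F n \<subseteq> carrier G" "\<And>n. Kn n \<subseteq> (\<Union>g\<in>F n. W g)"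
    by metis
  define C where "C = insert \<one> (\<Union>n. F n)"
  have C: "countable C" "C \<subseteq> carrier G" "C \<noteq> {}"
    using F(1,2) by (auto simp: C_def intro: countable_finite)
  define a where "a = from_nat_into C"
  have ra: "range a = C" unfolding a_def by (rule range_from_nat_into[OF C(3,1)])
  then have ac: "a i \<in> carrier G" for i using C(2) by auto
  have "carrier G \<subseteq> (\<Union>g\<in>C. W g)"
  proof
    fix x assume "x \<in> carrier G"
    then obtain n where "x \<in> Kn n" using Kn(2) by auto
    then obtain g where "g \<in> F n" "x \<in> W g" using F(3)[of n] by auto
    then show "x \<in> (\<Union>g\<in>C. W g)" unfolding C_def by auto
  qed
  moreover have "(\<Union>i. W (a i)) = (\<Union>g\<in>C. W g)" using ra by (metis image_image)
  moreover have "W (a i) \<subseteq> carrier G" for i using openin_subset[OF W(1)[OF ac]] by simp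
  ultimately have "(\<Union>i. W (a i)) = carrier G" by blast
  then show ?thesis using W ac by (intro exI[of _ "\<lambda>i. W (a i)"]) auto
qed

text \<open>Chosen once, so that all later decompositions of the group refer to the same
  cover.\<close>

definition W :: "nat \<Rightarrow> 'a set" where
  "W = (SOME W. (\<forall>i. openin T (W i)) \<and> (\<forall>i. inj_on q (W i)) \<and> (\<Union>i. W i) = carrier G \<and>
     (\<forall>i. \<exists>K. compactin T K \<and> W i \<subseteq> K))"

lemma W_open: "openin T (W i)" and W_inj: "inj_on q (W i)" and W_Union: "(\<Union>i. W i) = carrier G"
  and W_compact: "\<exists>K. compactin T K \<and> W i \<subseteq> K"
  using someI_ex[OF countable_injective_cover] unfolding W_def by blast+

lemma W_borel [measurable]: "W i \<in> sets (borel_of T)"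
  by (rule borel_of_open[OF W_open])

lemma compactin_finite_cover:
  assumes "compactin T K"
  obtains F where "finite F" "K \<subseteq> (\<Union>i\<in>F. W i)"
proof -
  have Ks: "K \<subseteq> carrier G" using compactin_subset_topspace[OF assms] by simp
  have "\<exists>\<F>. finite \<F> \<and> \<F> \<subseteq> range W \<and> K \<subseteq> \<Union>\<F>"
    by (rule compactinD[OF assms]) (use W_open W_Union Ks in auto)
  then obtain \<F> where \<F>: "finite \<F>" "\<F> \<subseteq> range W" "K \<subseteq> \<Union>\<F>" by blast
  obtain F where "finite F" "\<F> = W ` F" using finite_subset_image[OF \<F>(1,2)] by blast
  then show ?thesis using \<F>(3) that by blast
qed

text \<open>\<open>q\<close> maps all of \<Gamma> to one coset and is injective on
  \<open>W i\<close>. That each \<open>W i\<close> contains at most one element of \<Gamma> yields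
  countability of \<Gamma> and finiteness of its traces on compact sets.\<close>

lemma W_Int_Gamma: "\<gamma> \<in> W i \<Longrightarrow> \<delta> \<in> W i \<Longrightarrow> \<gamma> \<in> \<Gamma> \<Longrightarrow> \<delta> \<in> \<Gamma> \<Longrightarrow> \<gamma> = \<delta>"
proof -
  assume *: "\<gamma> \<in> W i" "\<delta> \<in> W i" "\<gamma> \<in> \<Gamma>" "\<delta> \<in> \<Gamma>"
  have "inv \<gamma> \<otimes> \<delta> \<in> \<Gamma>"
    using * subgroup_Gamma by (meson subgroup.m_closed subgroup.m_inv_closed)
  then have "q \<gamma> = q \<delta>" using q_eq_iff Gamma_carrier * by blast
  then show "\<gamma> = \<delta>" using W_inj[of i] * by (auto simp: inj_on_def)
qed

lemma countable_Gamma: "countable \<Gamma>"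
proof -
  have "countable (\<Gamma> \<inter> W i)" for i
  proof (cases "\<Gamma> \<inter> W i = {}")
    case False
    then obtain \<gamma> where "\<gamma> \<in> \<Gamma> \<inter> W i" by blast
    then have "\<Gamma> \<inter> W i \<subseteq> {\<gamma>}" using W_Int_Gamma by blast
    then show ?thesis using countable_subset[of "\<Gamma> \<inter> W i" "{\<gamma>}"] by simp
  qed auto
  then have "countable (\<Union>i. \<Gamma> \<inter> W i)" by (intro countable_UN) auto
  moreover have "\<Gamma> = (\<Union>i. \<Gamma> \<inter> W i)" using W_Union Gamma_carrier by blast
  ultimately show ?thesis by simp
qed

lemma finite_compact_Int_Gamma:
  assumes "compactin T K"
  shows "finite (K \<inter> \<Gamma>)"
proof -
  obtain F where F: "finite F" "K \<subseteq> (\<Union>i\<in>F. W i)" by (rule compactin_finite_cover[OF assms])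
  have "finite (\<Gamma> \<inter> W i)" for i
  proof (cases "\<Gamma> \<inter> W i = {}")
    case False
    then obtain \<gamma> where "\<gamma> \<in> \<Gamma> \<inter> W i" by blast
    then have "\<Gamma> \<inter> W i \<subseteq> {\<gamma>}" using W_Int_Gamma by blast
    then show ?thesis using finite_subset[of "\<Gamma> \<inter> W i" "{\<gamma>}"] by simp
  qed auto
  then have "finite (\<Union>i\<in>F. \<Gamma> \<inter> W i)" using F(1) by blast
  moreover have "K \<inter> \<Gamma> \<subseteq> (\<Union>i\<in>F. \<Gamma> \<inter> W i)" using F(2) by blast
  ultimately show ?thesis by (rule finite_subset[rotated])
qed

lemma q_image_borel: "E \<in> sets (borel_of T) \<Longrightarrow> q ` E \<in> sets (borel_of Xs)"
  by (rule borel_image_of_open_locally_injective[OF continuous_q open_map_q, of UNIV W])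
    (use W_open W_inj W_Union in auto)

lemma open_map_id_q: "open_map (prod_topology S T) (prod_topology S Xs) (\<lambda>(s, y). (s, q y))"
  unfolding open_map_def
proof (intro allI impI)
  fix U assume U: "openin (prod_topology S T) U"
  show "openin (prod_topology S Xs) ((\<lambda>(s, y). (s, q y)) ` U)"
    unfolding openin_prod_topology_alt
  proof (intro allI impI)
    fix s x assume "(s, x) \<in> (\<lambda>(s, y). (s, q y)) ` U"
    then obtain y where y: "(s, y) \<in> U" "x = q y" by auto
    obtain A B where AB: "openin S A" "openin T B" "s \<in> A" "y \<in> B" "A \<times> B \<subseteq> U"
      by (rule openin_prod_topologyE[OF U y(1)])
    have "openin Xs (q ` B)" using open_map_q AB(2) by (simp add: open_map_def)
    moreover have "A \<times> q ` B \<subseteq> (\<lambda>(s, y). (s, q y)) ` U" using AB(5) by force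
    ultimately show "\<exists>A B. openin S A \<and> openin Xs B \<and> s \<in> A \<and> x \<in> B \<and> A \<times> B \<subseteq> (\<lambda>(s, y). (s, q y)) ` U"
      using AB y by blast
  qed
qed

lemma continuous_id_q: "continuous_map (prod_topology S T) (prod_topology S Xs) (\<lambda>(s, y). (s, q y))"
  unfolding case_prod_unfold
  by (intro continuous_map_pairedI continuous_map_fst
      continuous_map_compose[OF continuous_map_snd continuous_q, unfolded o_def])

text \<open>A preimage under \<open>F\<close> is the image, under the quotient in the second
  variable, of a Borel set upstairs. This quotient is open and injective on each of the countably
  many strips over the \<open>W i\<close>, so the image is Borel. Joint measurability of the cocycle
  rests on this.\<close>

lemma measurable_descend2:
  assumes F: "(\<lambda>(s, y). F s (q y)) \<in> measurable (borel_of (prod_topology S T)) L"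
  shows "case_prod F \<in> measurable (borel_of (prod_topology S Xs)) L"
proof (rule measurableI)
  fix p assume "p \<in> space (borel_of (prod_topology S Xs))"
  then obtain s y where "p = (s, q y)" "s \<in> topspace S" "y \<in> carrier G" by (auto simp: topspace_X)
  then show "case_prod F p \<in> space L" using measurable_space[OF F, of "(s, y)"] by auto
next
  fix A assume A: "A \<in> sets L"
  let ?E = "(\<lambda>(s, y). F s (q y)) -` A \<inter> space (borel_of (prod_topology S T))"
  have E: "?E \<in> sets (borel_of (prod_topology S T))" by (rule measurable_sets[OF F A])
  have "(\<lambda>(s, y). (s, q y)) ` ?E \<in> sets (borel_of (prod_topology S Xs))"
  proof (rule borel_image_of_open_locally_injective[OF continuous_id_q open_map_id_q, where A = UNIV and U = "\<lambda>i. topspace S \<times> W i" and E = ?E])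
    show "openin (prod_topology S T) (topspace S \<times> W i)" for i
      using W_open by (simp add: openin_prod_Times_iff)
    show "topspace (prod_topology S T) \<subseteq> (\<Union>i\<in>UNIV. topspace S \<times> W i)"
      using W_Union by auto
    show "inj_on (\<lambda>(s, y). (s, q y)) (topspace S \<times> W i)" for i
      using W_inj[of i] by (auto simp: inj_on_def)
  qed (use E in simp_all)
  moreover have "(\<lambda>(s, y). (s, q y)) ` ?E = case_prod F -` A \<inter> space (borel_of (prod_topology S Xs))"
    by (auto simp: topspace_X image_iff)
  ultimately show "case_prod F -` A \<inter> space (borel_of (prod_topology S Xs)) \<in> sets (borel_of (prod_topology S Xs))"
    by simp
qed

lemma measurable_descend:
  assumes F: "(\<lambda>y. F (q y)) \<in> measurable (borel_of T) L"
  shows "F \<in> measurable (borel_of Xs) L"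
proof (rule measurableI)
  fix p assume "p \<in> space (borel_of Xs)"
  then obtain y where "p = q y" "y \<in> carrier G" by (auto simp: topspace_X)
  then show "F p \<in> space L" using measurable_space[OF F, of y] by auto
next
  fix A assume A: "A \<in> sets L"
  let ?E = "(\<lambda>y. F (q y)) -` A \<inter> space (borel_of T)"
  have "q ` ?E \<in> sets (borel_of Xs)" by (rule q_image_borel) (rule measurable_sets[OF F A])
  moreover have "q ` ?E = F -` A \<inter> space (borel_of Xs)" by (auto simp: topspace_X)
  ultimately show "F -` A \<inter> space (borel_of Xs) \<in> sets (borel_of Xs)" by simp
qed

lemma q_measurable [measurable]: "q \<in> measurable (borel_of T) (borel_of Xs)"
  by (rule continuous_map_measurable[OF continuous_q])

text \<open>A product of quotient maps need not be a quotient map, but \<open>q\<close> is open, and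
  then so is its product with the identity.\<close>

lemma continuous_act: "continuous_map (prod_topology T Xs) Xs (\<lambda>(g, x). g <# x)"
  unfolding continuous_map_def
proof (intro conjI allI impI)
  show "(\<lambda>(g, x). g <# x) \<in> topspace (prod_topology T Xs) \<rightarrow> topspace Xs"
    using act_closed by auto
  fix U assume U: "openin Xs U"
  let ?V = "{p \<in> topspace (prod_topology T T). q (fst p \<otimes> snd p) \<in> U}"
  have "continuous_map (prod_topology T T) Xs (\<lambda>p. q (fst p \<otimes> snd p))"
    by (rule continuous_map_compose[OF _ continuous_q, unfolded o_def]) (intro continuous_intros_group)
  then have V: "openin (prod_topology T T) ?V" by (rule openin_continuous_map_preimage[OF _ U])
  then have "openin (prod_topology T Xs) ((\<lambda>(s, y). (s, q y)) ` ?V)"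
    using open_map_id_q unfolding open_map_def by blast
  moreover have "(\<lambda>(s, y). (s, q y)) ` ?V = {p \<in> topspace (prod_topology T Xs). (case p of (g, x) \<Rightarrow> g <# x) \<in> U}"
    by (auto simp: topspace_X act_q image_iff)
  ultimately show "openin (prod_topology T Xs) {p \<in> topspace (prod_topology T Xs). (case p of (g, x) \<Rightarrow> g <# x) \<in> U}"
    by simp
qed

lemma continuous_map_act:
  assumes "continuous_map S T f" "continuous_map S Xs g"
  shows "continuous_map S Xs (\<lambda>s. f s <# g s)"
  using continuous_map_compose[OF continuous_map_pairedI[OF assms] continuous_act] by (simp add: o_def)

lemma borel_compose_X:
  assumes "f \<in> measurable (borel_of Xs) L" "continuous_map S Xs g"
  shows "(\<lambda>x. f (g x)) \<in> measurable (borel_of S) L"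
  using measurable_compose[OF continuous_map_measurable[OF assms(2)] assms(1)] .

lemma radon_nu: "radon_measure Xs \<nu>"
  and sets_nu: "sets \<nu> = sets (borel_of Xs)"
  and nu_nonzero: "emeasure \<nu> (space \<nu>) \<noteq> 0"
  and finite_measure_nu: "finite_measure \<nu>"
  using invariant unfolding invariant_measure_on_cosets_def radon_measure_def
  by (auto intro!: finite_measureI)

sublocale finite_measure \<nu> by (rule finite_measure_nu)

lemma space_nu: "space \<nu> = topspace Xs"
  using sets_eq_imp_space_eq[OF sets_nu] by simp

lemma measurable_nu: "measurable \<nu> L = measurable (borel_of Xs) L"
  by (rule measurable_cong_sets[OF sets_nu refl])

lemma act_measurable: "g \<in> carrier G \<Longrightarrow> (\<lambda>x. g <# x) \<in> measurable \<nu> \<nu>"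
  using continuous_map_measurable[OF continuous_map_act[of Xs "\<lambda>_. g" "\<lambda>x. x"]]
  by (simp add: measurable_cong_sets[OF sets_nu sets_nu] continuous_map_id[unfolded id_def])

lemma distr_act:
  assumes g: "g \<in> carrier G"
  shows "distr \<nu> \<nu> (\<lambda>x. g <# x) = \<nu>"
proof (rule measure_eqI)
  fix A assume "A \<in> sets (distr \<nu> \<nu> (\<lambda>x. g <# x))"
  then have A: "A \<in> sets \<nu>" by simp
  have As: "A \<subseteq> topspace Xs" using sets.sets_into_space[OF A] by (simp add: space_nu)
  have "(\<lambda>x. g <# x) -` A \<inter> space \<nu> = (\<lambda>x. inv g <# x) ` A"
  proof (intro equalityI subsetI)
    fix x assume x: "x \<in> (\<lambda>x. g <# x) -` A \<inter> space \<nu>"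
    then have "x = inv g <# (g <# x)" using g by (simp add: act_act act_one space_nu)
    then show "x \<in> (\<lambda>x. inv g <# x) ` A" using x by blast
  next
    fix x assume "x \<in> (\<lambda>x. inv g <# x) ` A"
    then show "x \<in> (\<lambda>x. g <# x) -` A \<inter> space \<nu>"
      using g As by (auto simp: act_act act_one act_closed space_nu subset_iff)
  qed
  then show "emeasure (distr \<nu> \<nu> (\<lambda>x. g <# x)) A = emeasure \<nu> A"
    using invariant A g
    by (simp add: emeasure_distr[OF act_measurable[OF g] A] invariant_measure_on_cosets_def)
qed simp

lemma nn_integral_act:
  assumes "g \<in> carrier G" "f \<in> borel_measurable (borel_of Xs)"
  shows "(\<integral>\<^sup>+x. f (g <# x) \<partial>\<nu>) = (\<integral>\<^sup>+x. f x \<partial>\<nu>)"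
  using nn_integral_distr[OF act_measurable[OF assms(1)], of f] assms(2)
  by (simp add: distr_act[OF assms(1)] measurable_nu)

lemma integral_act:
  fixes f :: "'a set \<Rightarrow> real"
  assumes "g \<in> carrier G" "f \<in> borel_measurable (borel_of Xs)"
  shows "(\<integral>x. f (g <# x) \<partial>\<nu>) = (\<integral>x. f x \<partial>\<nu>)"
  using integral_distr[OF act_measurable[OF assms(1)], of f] assms(2)
  by (simp add: distr_act[OF assms(1)] measurable_nu)

lemma integrable_act:
  fixes f :: "'a set \<Rightarrow> real"
  assumes "g \<in> carrier G" "integrable \<nu> f"
  shows "integrable \<nu> (\<lambda>x. f (g <# x))"
  using integrable_distr[OF act_measurable[OF assms(1)], of f] assms(2)
  by (simp add: distr_act[OF assms(1)])

lemma AE_act: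
  assumes g: "g \<in> carrier G" and "AE x in \<nu>. P x"
  shows "AE x in \<nu>. P (g <# x)"
proof -
  have "AE x in distr \<nu> \<nu> (\<lambda>x. g <# x). P x" unfolding distr_act[OF g] by (rule assms(2))
  then show ?thesis by (rule AE_distrD[OF act_measurable[OF g]])
qed

end

lemma borel_of_closed: "closedin T C \<Longrightarrow> C \<in> sets (borel_of T)"
  using sets.compl_sets[OF borel_of_open[of T "topspace T - C"]]
  by (simp add: closedin_def double_diff)

text \<open>Inner regularity on open sets: a compact subset of
  \<open>W i \<inter> \<Union>\<U>\<close> that misses little measure is covered by finitely many
  members of \<open>\<U>\<close>. Letting the defect tend to \<open>0\<close> produces a countable
  subfamily for each \<open>i\<close>.\<close>

lemma radon_tau_additive:
  fixes W :: "nat \<Rightarrow> 'a set"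
  assumes M: "radon_measure T M"
    and W: "\<And>i. openin T (W i)" "\<And>i. emeasure M (W i) < \<infinity>" "(\<Union>i. W i) = topspace T"
  shows "tau_additive T M"
proof -
  have sM: "sets M = sets (borel_of T)" using M by (simp add: radon_measure_def)
  have spM: "space M = topspace T" using sets_eq_imp_space_eq[OF sM] by simp
  have op: "openin T U \<Longrightarrow> U \<in> sets M" for U by (simp add: sM borel_of_open)
  have ex: "\<exists>\<V>. \<V> \<subseteq> \<U> \<and> countable \<V> \<and> W i \<inter> \<Union>\<U> - \<Union>\<V> \<in> null_sets M"
    if \<U>: "\<forall>U\<in>\<U>. openin T U" for \<U> i
  proof -
    define P where "P = W i \<inter> \<Union>\<U>"
    have oP: "openin T P" unfolding P_def using \<U> W(1) by auto
    have fP: "emeasure M P < \<infinity>"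
      using emeasure_mono[of P "W i" M] W(2)[of i] op[OF W(1)] by (simp add: P_def order.strict_trans1)
    have finP: "emeasure M A = ennreal (measure M A)" if "A \<subseteq> P" for A
      using fP emeasure_mono[OF that op[OF oP]] by (intro emeasure_eq_ennreal_measure) auto
    have eq: "emeasure M P = (SUP K \<in> {K. compactin T K \<and> K \<subseteq> P}. emeasure M K)"
      by (rule M[unfolded radon_measure_def, THEN conjunct2, THEN conjunct2, THEN conjunct2, rule_format, OF oP])
    have *: "\<exists>F. finite F \<and> F \<subseteq> \<U> \<and> measure M (P - \<Union>F) < e" if e: "e > 0" for e :: real
    proof (cases "measure M P = 0")
      case True
      then show ?thesis using e by (intro exI[of _ "{}"]) auto
    next
      case False
      then have "0 < measure M P" using measure_nonneg[of M P] by linarith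
      then have "ennreal (measure M P - e) < emeasure M P"
        using e unfolding finP[OF order_refl] by (intro ennreal_lessI) auto
      then obtain K where K: "compactin T K" "K \<subseteq> P" "ennreal (measure M P - e) < emeasure M K"
        unfolding eq less_SUP_iff by blast
      have "\<exists>F. finite F \<and> F \<subseteq> \<U> \<and> K \<subseteq> \<Union>F"
        by (rule compactinD[OF K(1)]) (use \<U> K(2) in \<open>auto simp: P_def\<close>)
      then obtain F where F: "finite F" "F \<subseteq> \<U>" "K \<subseteq> \<Union>F" by blast
      have oF: "P \<inter> \<Union>F \<in> sets M" using F(2) \<U> by (intro sets.Int op oP openin_Union) auto
      have "K \<subseteq> P \<inter> \<Union>F" using K(2) F(3) by blast
      then have "ennreal (measure M P - e) < emeasure M (P \<inter> \<Union>F)"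
        using K(3) emeasure_mono[OF _ oF] by (meson order.strict_trans2)
      also have "\<dots> = ennreal (measure M (P \<inter> \<Union>F))" by (rule finP) simp
      finally have "measure M P - e < measure M (P \<inter> \<Union>F)"
        by (rule contrapos_pp) (simp add: ennreal_leI not_less)
      moreover have "measure M (P - P \<inter> \<Union>F) = measure M P - measure M (P \<inter> \<Union>F)"
        using oF op[OF oP] fP by (intro measure_Diff) auto
      moreover have "P - P \<inter> \<Union>F = P - \<Union>F" by blast
      ultimately show ?thesis using F by (intro exI[of _ F]) auto
    qed
    have "\<exists>F. finite F \<and> F \<subseteq> \<U> \<and> measure M (P - \<Union>F) < 1 / real (Suc n)" for n
      by (rule *) simp
    then obtain F where F: "\<And>n. finite (F n)" "\<And>n. F n \<subseteq> \<U>"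
        "\<And>n. measure M (P - \<Union>(F n)) < 1 / real (Suc n)" by metis
    define \<V> where "\<V> = (\<Union>n. F n)"
    have V: "\<V> \<subseteq> \<U>" "countable \<V>" unfolding \<V>_def using F(1,2) by (auto intro: countable_finite)
    have oU: "openin T U" if "U \<in> \<U>" for U using that \<U> by blast
    have sV: "P - \<Union>\<V> \<in> sets M" using V(1) by (intro sets.Diff op oP openin_Union oU) auto
    have "measure M (P - \<Union>\<V>) \<le> 1 / real (Suc n)" for n
    proof -
      have "P - \<Union>(F n) \<in> sets M" using F(2) by (intro sets.Diff op oP openin_Union oU) auto
      then have "measure M (P - \<Union>\<V>) \<le> measure M (P - \<Union>(F n))"
        using sV finP[of "P - \<Union>(F n)"]
        by (intro measure_mono_fmeasurable) (auto simp: \<V>_def fmeasurable_def)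
      with F(3)[of n] show ?thesis by simp
    qed
    moreover have "(\<lambda>n. 1 / real (Suc n)) \<longlonglongrightarrow> 0" by (rule LIMSEQ_Suc[OF lim_1_over_n])
    ultimately have "measure M (P - \<Union>\<V>) \<le> 0"
      by (intro LIMSEQ_le_const) auto
    then have "measure M (P - \<Union>\<V>) = 0" using measure_nonneg[of M "P - \<Union>\<V>"] by linarith
    then have "P - \<Union>\<V> \<in> null_sets M" using sV finP[of "P - \<Union>\<V>"] by (auto simp: null_sets_def)
    then show ?thesis using V unfolding P_def by blast
  qed
  show ?thesis
    unfolding tau_additive_def
  proof (intro conjI allI impI)
    show "sigma_finite_measure M"
    proof
      show "\<exists>A. countable A \<and> A \<subseteq> sets M \<and> \<Union>A = space M \<and> (\<forall>a\<in>A. emeasure M a \<noteq> \<infinity>)"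
        using W op spM by (intro exI[of _ "range W"]) (auto simp: less_top)
    qed
    fix \<U> assume \<U>: "\<forall>U\<in>\<U>. openin T U"
    have "\<forall>i. \<exists>\<V>. \<V> \<subseteq> \<U> \<and> countable \<V> \<and> W i \<inter> \<Union>\<U> - \<Union>\<V> \<in> null_sets M"
      using ex[OF \<U>] by blast
    then obtain \<V> where \<V>: "\<And>i. \<V> i \<subseteq> \<U>" "\<And>i. countable (\<V> i)" "\<And>i. W i \<inter> \<Union>\<U> - \<Union>(\<V> i) \<in> null_sets M"
      by metis
    have "(\<Union>i. W i \<inter> \<Union>\<U> - \<Union>(\<V> i)) \<in> null_sets M" using \<V>(3) by (intro null_sets_UN) auto
    moreover have "\<Union>\<U> - \<Union>(\<Union>i. \<V> i) \<subseteq> (\<Union>i. W i \<inter> \<Union>\<U> - \<Union>(\<V> i))"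
    proof
      fix x assume x: "x \<in> \<Union>\<U> - \<Union>(\<Union>i. \<V> i)"
      then obtain U where "U \<in> \<U>" "x \<in> U" by blast
      then have "x \<in> topspace T" using \<U> openin_subset by blast
      then obtain i where "x \<in> W i" using W(3) by blast
      then show "x \<in> (\<Union>i. W i \<inter> \<Union>\<U> - \<Union>(\<V> i))" using x by blast
    qed
    moreover have "\<Union>\<U> - \<Union>(\<Union>i. \<V> i) \<in> sets M"
    proof (intro sets.Diff op openin_Union)
      fix S assume "S \<in> (\<Union>i. \<V> i)"
      then show "openin T S" using \<V>(1) \<U> by blast
    qed (use \<U> in auto)
    ultimately have "\<Union>\<U> - \<Union>(\<Union>i. \<V> i) \<in> null_sets M" by (metis null_sets_subset)
    then show "\<exists>\<V>. \<V> \<subseteq> \<U> \<and> countable \<V> \<and> \<Union>\<U> - \<Union>\<V> \<in> null_sets M"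
      using \<V>(1,2) by (intro exI[of _ "\<Union>i. \<V> i"]) auto
  qed (rule sM)
qed

context top_group
begin

lemma left_invariant_emeasure:
  assumes M: "left_invariant M" "sets M = sets (borel_of T)" and g: "g \<in> carrier G"
    and U: "U \<in> sets (borel_of T)"
  shows "emeasure M ((\<lambda>u. g \<otimes> u) ` U) = emeasure M U" "(\<lambda>u. g \<otimes> u) ` U \<in> sets (borel_of T)"
proof -
  have spM: "space M = carrier G" using sets_eq_imp_space_eq[OF M(2)] by simp
  have Us: "U \<subseteq> carrier G" using sets.sets_into_space[OF U] by simp
  have eq: "(\<lambda>u. g \<otimes> u) ` U = (\<lambda>x. inv g \<otimes> x) -` U \<inter> space (borel_of T)"
  proof (intro equalityI subsetI)
    fix x assume "x \<in> (\<lambda>u. g \<otimes> u) ` U"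
    then show "x \<in> (\<lambda>x. inv g \<otimes> x) -` U \<inter> space (borel_of T)" using g Us by (auto simp: m_assoc[symmetric])
  next
    fix x assume x: "x \<in> (\<lambda>x. inv g \<otimes> x) -` U \<inter> space (borel_of T)"
    then have "x = g \<otimes> (inv g \<otimes> x)" using g by (simp add: m_assoc[symmetric])
    then show "x \<in> (\<lambda>u. g \<otimes> u) ` U" using x by blast
  qed
  have m: "(\<lambda>x. inv g \<otimes> x) \<in> measurable (borel_of T) (borel_of T)"
    using g by (intro continuous_map_measurable continuous_intros_group continuous_map_const_carrier) auto
  show s: "(\<lambda>u. g \<otimes> u) ` U \<in> sets (borel_of T)"
    unfolding eq by (rule measurable_sets[OF m U])
  have "emeasure M ((\<lambda>u. g \<otimes> u) ` U) = (\<integral>\<^sup>+x. indicator U (inv g \<otimes> x) \<partial>M)"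
  proof -
    have "(\<integral>\<^sup>+x. indicator U (inv g \<otimes> x) \<partial>M) = (\<integral>\<^sup>+x. indicator ((\<lambda>u. g \<otimes> u) ` U) x \<partial>M)"
      unfolding eq by (rule nn_integral_cong) (simp add: spM indicator_def)
    then show ?thesis using s by (simp add: M(2))
  qed
  also have "\<dots> = emeasure M U"
    using left_invariantD[OF M(1), of "inv g" "indicator U"] g U by (simp add: M(2))
  finally show "emeasure M ((\<lambda>u. g \<otimes> u) ` U) = emeasure M U" .
qed

text \<open>If \<open>U\<close> were null, so would be its left translates. They cover the group,
  and by tau-additivity countably many of them cover almost all of it, so the whole measure would
  vanish.\<close>

lemma left_invariant_open_pos:
  assumes M: "tau_additive T M" "left_invariant M" "emeasure M (space M) \<noteq> 0"
    and U: "openin T U" "U \<noteq> {}"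
  shows "emeasure M U \<noteq> 0"
proof
  assume 0: "emeasure M U = 0"
  obtain u where u: "u \<in> U" using U(2) by auto
  have Us: "U \<subseteq> carrier G" using openin_subset[OF U(1)] by simp
  define \<U> where "\<U> = (\<lambda>g. (\<lambda>x. g \<otimes> x) ` U) ` carrier G"
  have op: "\<forall>V\<in>\<U>. openin T V" unfolding \<U>_def using openin_left_translate[OF _ U(1)] by auto
  have un: "\<Union>\<U> = carrier G"
  proof
    show "\<Union>\<U> \<subseteq> carrier G" using op openin_subset by fastforce
    show "carrier G \<subseteq> \<Union>\<U>"
    proof
      fix x assume x: "x \<in> carrier G"
      have "x = (x \<otimes> inv u) \<otimes> u" using x u Us by (auto simp: m_assoc)
      moreover have "x \<otimes> inv u \<in> carrier G" using x u Us by auto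
      ultimately show "x \<in> \<Union>\<U>" using u unfolding \<U>_def by blast
    qed
  qed
  obtain \<V> where \<V>: "\<V> \<subseteq> \<U>" "countable \<V>" "\<Union>\<U> - \<Union>\<V> \<in> null_sets M"
    using M(1) op unfolding tau_additive_def by meson
  have sM: "sets M = sets (borel_of T)" by (rule tau_additive_sets[OF M(1)])
  have "V \<in> null_sets M" if "V \<in> \<V>" for V
  proof -
    have "V \<in> \<U>" using that \<V>(1) by blast
    then obtain g where g: "g \<in> carrier G" "V = (\<lambda>x. g \<otimes> x) ` U" unfolding \<U>_def by auto
    show ?thesis
      using left_invariant_emeasure[OF M(2) sM g(1) borel_of_open[OF U(1)]] 0 g(2) by (auto simp: null_sets_def sM)
  qed
  then have "(\<Union>V\<in>\<V>. V) \<in> null_sets M" by (intro null_sets_UN' \<V>(2))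
  then have "(\<Union>\<U> - \<Union>\<V>) \<union> \<Union>\<V> \<in> null_sets M" using \<V>(3) by (intro null_sets.Un) auto
  moreover have "(\<Union>\<U> - \<Union>\<V>) \<union> \<Union>\<V> = space M" using \<V>(1) un tau_additive_space[OF M(1)] by auto
  ultimately show False using M(3) by (auto simp: null_sets_def)
qed

lemma haar_measure_left_invariant:
  assumes "haar_measure G T \<mu>"
  shows "left_invariant \<mu>"
  unfolding left_invariant_def
proof (intro ballI)
  fix g and f :: "'a \<Rightarrow> ennreal" assume g: "g \<in> carrier G" and f: "f \<in> borel_measurable (borel_of T)"
  have sM: "sets \<mu> = sets (borel_of T)" using assms by (simp add: haar_measure_def radon_measure_def)
  have spM: "space \<mu> = carrier G" using sets_eq_imp_space_eq[OF sM] by simp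
  have "(\<lambda>x. g \<otimes> x) \<in> measurable (borel_of T) (borel_of T)"
    using g by (intro continuous_map_measurable continuous_intros_group continuous_map_const_carrier) auto
  then have m: "(\<lambda>x. g \<otimes> x) \<in> measurable \<mu> \<mu>" by (simp add: measurable_cong_sets[OF sM sM])
  have "distr \<mu> \<mu> (\<lambda>x. g \<otimes> x) = \<mu>"
  proof (rule measure_eqI)
    fix A assume "A \<in> sets (distr \<mu> \<mu> (\<lambda>x. g \<otimes> x))"
    then have A: "A \<in> sets \<mu>" by simp
    have As: "A \<subseteq> carrier G" using sets.sets_into_space[OF A] by (simp add: spM)
    have "(\<lambda>x. g \<otimes> x) -` A \<inter> space \<mu> = inv g <# A"
    proof (intro equalityI subsetI)
      fix x assume x: "x \<in> (\<lambda>x. g \<otimes> x) -` A \<inter> space \<mu>"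
      then have "x = inv g \<otimes> (g \<otimes> x)" using g by (simp add: m_assoc[symmetric] spM)
      then show "x \<in> inv g <# A" using x unfolding l_coset_def by blast
    next
      fix x assume "x \<in> inv g <# A"
      then show "x \<in> (\<lambda>x. g \<otimes> x) -` A \<inter> space \<mu>"
        using g As by (auto simp: l_coset_def spM subset_iff m_assoc[symmetric])
    qed
    then show "emeasure (distr \<mu> \<mu> (\<lambda>x. g \<otimes> x)) A = emeasure \<mu> A"
      using assms g A by (simp add: emeasure_distr[OF m A] haar_measure_def)
  qed simp
  then show "(\<integral>\<^sup>+x. f (g \<otimes> x) \<partial>\<mu>) = (\<integral>\<^sup>+x. f x \<partial>\<mu>)"
    using nn_integral_distr[OF m, of f] f by (simp add: measurable_cong_sets[OF sM refl])
qed

end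

section \<open>Haar measure as the lift of the invariant measure along the cosets\<close>

context group_lattice
begin

lemma tau_additive_nu: "tau_additive Xs \<nu>"
  by (rule radon_tau_additive[OF radon_nu, of "\<lambda>_. topspace Xs"])
    (simp_all add: emeasure_finite less_top[symmetric])

lemma coset_mem: "x \<in> topspace Xs \<Longrightarrow> y \<in> x \<Longrightarrow> y \<in> carrier G \<and> q y = x"
  by (auto simp: topspace_X q_mem_iff)

lemma inj_on_q_unique:
  assumes "inj_on q A" "x \<in> topspace Xs" "y \<in> x" "z \<in> x" "y \<in> A" "z \<in> A"
  shows "y = z"
  using coset_mem[OF assms(2,3)] coset_mem[OF assms(2,4)] inj_onD[OF assms(1) _ assms(5,6)] by simp

lemma fibre_sum_inj:
  fixes F :: "'a \<Rightarrow> ennreal"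
  assumes A: "inj_on q A" "A \<subseteq> carrier G" and x: "x \<in> topspace Xs"
  shows "y \<in> A \<Longrightarrow> y \<in> x \<Longrightarrow> (\<integral>\<^sup>+z. F z * indicator A z \<partial>count_space x) = F y"
    and "A \<inter> x = {} \<Longrightarrow> (\<integral>\<^sup>+z. F z * indicator A z \<partial>count_space x) = 0"
proof -
  assume y: "y \<in> A" "y \<in> x"
  have "(\<integral>\<^sup>+z. F z * indicator A z \<partial>count_space x) = (\<Sum>z\<in>{y}. F z * indicator A z)"
    by (rule nn_integral_count_space') (use y inj_on_q_unique[OF A(1) x] in \<open>auto simp: indicator_def\<close>)
  then show "(\<integral>\<^sup>+z. F z * indicator A z \<partial>count_space x) = F y" using y by simp
next
  assume "A \<inter> x = {}"
  then have "(\<integral>\<^sup>+z. F z * indicator A z \<partial>count_space x) = (\<integral>\<^sup>+z. 0 \<partial>count_space x)"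
    by (intro nn_integral_cong) (auto simp: indicator_def)
  then show "(\<integral>\<^sup>+z. F z * indicator A z \<partial>count_space x) = 0" by simp
qed

text \<open>The group splits into countably many disjoint Borel pieces on which \<open>q\<close> is
  injective. On each piece the fibre sum has at most one term, and its superlevel sets are images
  under \<open>q\<close> of Borel sets.\<close>

lemma fibre_sum_measurable:
  fixes F :: "'a \<Rightarrow> ennreal"
  assumes F: "F \<in> borel_measurable (borel_of T)"
  shows "(\<lambda>x. \<integral>\<^sup>+y. F y \<partial>count_space x) \<in> borel_measurable (borel_of Xs)"
proof -
  define V where "V = disjointed W"
  have "range V \<subseteq> sets (borel_of T)"
    unfolding V_def by (rule sets.range_disjointed_sets) auto
  then have V: "disjoint_family V" "(\<Union>i. V i) = carrier G" "\<And>i. V i \<in> sets (borel_of T)" "\<And>i. V i \<subseteq> W i"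
    unfolding V_def using W_Union
    by (auto simp: disjoint_family_disjointed UN_disjointed_eq disjointed_subset[THEN subsetD])
  have Vi: "inj_on q (V i)" "V i \<subseteq> carrier G" for i
    using inj_on_subset[OF W_inj V(4)] V(2) by auto
  have eq: "(\<integral>\<^sup>+y. F y \<partial>count_space x) = suminf (\<lambda>i. \<integral>\<^sup>+y. F y * indicator (V i) y \<partial>count_space x)"
    if x: "x \<in> space (borel_of Xs)" for x
  proof -
    have "suminf (\<lambda>i. \<integral>\<^sup>+y. F y * indicator (V i) y \<partial>count_space x) = (\<integral>\<^sup>+y. suminf (\<lambda>i. F y * indicator (V i) y) \<partial>count_space x)"
      by (rule nn_integral_suminf[symmetric]) simp
    also have "\<dots> = (\<integral>\<^sup>+y. F y \<partial>count_space x)"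
    proof (rule nn_integral_cong)
      fix y assume "y \<in> space (count_space x)"
      then have "y \<in> carrier G" using coset_mem x by auto
      then obtain i where "y \<in> V i" using V(2) by blast
      then show "suminf (\<lambda>i. F y * indicator (V i) y) = F y"
        by (rule suminf_cmult_indicator[OF V(1), of _ _ "\<lambda>_. F y"])
    qed
    finally show ?thesis by simp
  qed
  have meas: "(\<lambda>x. \<integral>\<^sup>+y. F y * indicator (V i) y \<partial>count_space x) \<in> borel_measurable (borel_of Xs)" for i
  proof (rule borel_measurableI_greater)
    fix t :: ennreal
    have "{x \<in> space (borel_of Xs). t < (\<integral>\<^sup>+y. F y * indicator (V i) y \<partial>count_space x)} = q ` {y \<in> space (borel_of T). y \<in> V i \<and> t < F y}"
    proof (intro equalityI subsetI)
      fix x assume "x \<in> {x \<in> space (borel_of Xs). t < (\<integral>\<^sup>+y. F y * indicator (V i) y \<partial>count_space x)}"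
      then have x: "x \<in> topspace Xs" "t < (\<integral>\<^sup>+y. F y * indicator (V i) y \<partial>count_space x)" by auto
      then have "V i \<inter> x \<noteq> {}" using fibre_sum_inj(2)[OF Vi x(1)] by auto
      then obtain y where y: "y \<in> V i" "y \<in> x" by auto
      then have "t < F y" using x(2) fibre_sum_inj(1)[OF Vi x(1) y] by simp
      moreover have "y \<in> carrier G" "q y = x" using coset_mem[OF x(1) y(2)] by auto
      ultimately show "x \<in> q ` {y \<in> space (borel_of T). y \<in> V i \<and> t < F y}" using y by auto
    next
      fix x assume "x \<in> q ` {y \<in> space (borel_of T). y \<in> V i \<and> t < F y}"
      then obtain y where y: "y \<in> carrier G" "y \<in> V i" "t < F y" "x = q y" by auto
      then have x: "x \<in> topspace Xs" "y \<in> x" using q_self by (auto simp: topspace_X)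
      then show "x \<in> {x \<in> space (borel_of Xs). t < (\<integral>\<^sup>+y. F y * indicator (V i) y \<partial>count_space x)}"
        using y fibre_sum_inj(1)[OF Vi x(1) y(2) x(2)] by simp
    qed
    moreover have "{y \<in> space (borel_of T). y \<in> V i \<and> t < F y} \<in> sets (borel_of T)"
      using F V(3)[of i] by measurable
    ultimately show "{x \<in> space (borel_of Xs). t < (\<integral>\<^sup>+y. F y * indicator (V i) y \<partial>count_space x)} \<in> sets (borel_of Xs)"
      using q_image_borel by simp
  qed
  show ?thesis
    by (subst measurable_cong[OF eq]) (auto intro!: borel_measurable_suminf_order meas)
qed

text \<open>The measure \<open>\<nu>\<close> integrated against counting measure on the fibres of
  \<open>q\<close>. With this definition Weil's unfolding formula carries no normalising
  constant.\<close>

definition haar :: "'a measure" where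
  "haar = measure_of (carrier G) (sets (borel_of T))
     (\<lambda>A. \<integral>\<^sup>+x. \<integral>\<^sup>+y. indicator A y \<partial>count_space x \<partial>\<nu>)"

lemma borel_subset_Pow: "sets (borel_of T) \<subseteq> Pow (carrier G)"
  using sets.space_closed[of "borel_of T"] by simp

lemma sets_haar: "sets haar = sets (borel_of T)"
  using sets.sets_measure_of_eq[of "borel_of T"] by (simp add: haar_def borel_subset_Pow)

lemma space_haar: "space haar = carrier G"
  using sets_eq_imp_space_eq[OF sets_haar] by simp

lemma measurable_haar: "measurable haar L = measurable (borel_of T) L"
  by (rule measurable_cong_sets[OF sets_haar refl])

lemma emeasure_haar:
  assumes A: "A \<in> sets (borel_of T)"
  shows "emeasure haar A = (\<integral>\<^sup>+x. \<integral>\<^sup>+y. indicator A y \<partial>count_space x \<partial>\<nu>)"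
proof (rule emeasure_measure_of[OF haar_def borel_subset_Pow])
  show "positive (sets haar) (\<lambda>A. \<integral>\<^sup>+x. \<integral>\<^sup>+y. indicator A y \<partial>count_space x \<partial>\<nu>)"
    by (simp add: positive_def)
  show "countably_additive (sets haar) (\<lambda>A. \<integral>\<^sup>+x. \<integral>\<^sup>+y. indicator A y \<partial>count_space x \<partial>\<nu>)"
  proof (rule countably_additiveI)
    fix A :: "nat \<Rightarrow> 'a set" assume A: "range A \<subseteq> sets haar" "disjoint_family A"
    have "suminf (\<lambda>i. \<integral>\<^sup>+x. \<integral>\<^sup>+y. indicator (A i) y \<partial>count_space x \<partial>\<nu>) =
       (\<integral>\<^sup>+x. suminf (\<lambda>i. \<integral>\<^sup>+y. indicator (A i) y \<partial>count_space x) \<partial>\<nu>)"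
      using A(1) by (intro nn_integral_suminf[symmetric]) (auto simp: measurable_nu sets_haar intro!: fibre_sum_measurable)
    also have "\<dots> = (\<integral>\<^sup>+x. \<integral>\<^sup>+y. suminf (\<lambda>i. indicator (A i) y) \<partial>count_space x \<partial>\<nu>)"
      by (intro nn_integral_cong nn_integral_suminf[symmetric]) simp
    also have "\<dots> = (\<integral>\<^sup>+x. \<integral>\<^sup>+y. indicator (\<Union>i. A i) y \<partial>count_space x \<partial>\<nu>)"
      by (simp add: suminf_indicator[OF A(2)])
    finally show "suminf (\<lambda>i. \<integral>\<^sup>+x. \<integral>\<^sup>+y. indicator (A i) y \<partial>count_space x \<partial>\<nu>) =
       (\<integral>\<^sup>+x. \<integral>\<^sup>+y. indicator (\<Union>i. A i) y \<partial>count_space x \<partial>\<nu>)" .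
  qed
  show "A \<in> sets haar" using A by (simp add: sets_haar)
qed

text \<open>Weil's unfolding formula. It holds for indicators by definition and passes to limits of
  simple functions.\<close>

lemma nn_integral_haar:
  fixes F :: "'a \<Rightarrow> ennreal"
  assumes F: "F \<in> borel_measurable (borel_of T)"
  shows "(\<integral>\<^sup>+y. F y \<partial>haar) = (\<integral>\<^sup>+x. \<integral>\<^sup>+y. F y \<partial>count_space x \<partial>\<nu>)"
  using F
proof (induction rule: borel_measurable_induct)
  case (cong f g)
  have "(\<integral>\<^sup>+y. f y \<partial>haar) = (\<integral>\<^sup>+y. g y \<partial>haar)"
    by (rule nn_integral_cong) (use cong.hyps(3) in \<open>simp add: space_haar\<close>)
  moreover have "(\<integral>\<^sup>+x. \<integral>\<^sup>+y. f y \<partial>count_space x \<partial>\<nu>) = (\<integral>\<^sup>+x. \<integral>\<^sup>+y. g y \<partial>count_space x \<partial>\<nu>)"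
    by (intro nn_integral_cong) (use cong.hyps(3) coset_mem in \<open>auto simp: space_nu\<close>)
  ultimately show ?case using cong.IH by simp
next
  case (set A)
  then show ?case by (simp add: emeasure_haar sets_haar)
next
  case (mult u c)
  then show ?case by (simp add: nn_integral_cmult measurable_haar measurable_nu fibre_sum_measurable)
next
  case (add u v)
  then show ?case by (simp add: nn_integral_add measurable_haar measurable_nu fibre_sum_measurable)
next
  case (seq U)
  have inc: "incseq (\<lambda>i x. \<integral>\<^sup>+y. U i y \<partial>count_space x)"
    using seq.hyps(3) by (auto simp: incseq_def le_fun_def intro!: nn_integral_mono)
  have "(\<integral>\<^sup>+y. (SUP i. U i) y \<partial>haar) = (SUP i. \<integral>\<^sup>+y. U i y \<partial>haar)"
    unfolding SUP_apply by (rule nn_integral_monotone_convergence_SUP[OF seq.hyps(3)])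
      (use seq.hyps(1) in \<open>simp add: measurable_haar\<close>)
  also have "\<dots> = (SUP i. \<integral>\<^sup>+x. \<integral>\<^sup>+y. U i y \<partial>count_space x \<partial>\<nu>)" by (simp add: seq.IH)
  also have "\<dots> = (\<integral>\<^sup>+x. (SUP i. \<integral>\<^sup>+y. U i y \<partial>count_space x) \<partial>\<nu>)"
    by (rule nn_integral_monotone_convergence_SUP[OF inc, symmetric])
      (use seq.hyps(1) in \<open>simp add: measurable_nu fibre_sum_measurable\<close>)
  also have "\<dots> = (\<integral>\<^sup>+x. \<integral>\<^sup>+y. (SUP i. U i) y \<partial>count_space x \<partial>\<nu>)"
    unfolding SUP_apply
    by (intro nn_integral_cong nn_integral_monotone_convergence_SUP[OF seq.hyps(3), symmetric]) simp
  finally show ?case .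
qed

text \<open>Left translation by \<open>g\<close> maps the fibre over \<open>x\<close> bijectively
  onto the fibre over \<open>g <# x\<close>, and \<open>\<nu>\<close> does not see the change of
  base point.\<close>

lemma left_invariant_haar: "left_invariant haar"
  unfolding left_invariant_def
proof (intro ballI)
  fix g and f :: "'a \<Rightarrow> ennreal" assume g: "g \<in> carrier G" and f: "f \<in> borel_measurable (borel_of T)"
  have fg: "(\<lambda>x. f (g \<otimes> x)) \<in> borel_measurable (borel_of T)"
    using g by (intro borel_compose[OF f] continuous_intros_group continuous_map_const_carrier) auto
  have "(\<integral>\<^sup>+x. f (g \<otimes> x) \<partial>haar) = (\<integral>\<^sup>+x. \<integral>\<^sup>+y. f (g \<otimes> y) \<partial>count_space x \<partial>\<nu>)"
    by (rule nn_integral_haar[OF fg])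
  also have "\<dots> = (\<integral>\<^sup>+x. \<integral>\<^sup>+y. f y \<partial>count_space (g <# x) \<partial>\<nu>)"
  proof (rule nn_integral_cong)
    fix x assume "x \<in> space \<nu>"
    then have x: "x \<in> topspace Xs" by (simp add: space_nu)
    have "bij_betw (\<lambda>y. g \<otimes> y) x (g <# x)"
      unfolding bij_betw_def l_coset_def using g coset_mem[OF x] by (auto simp: inj_on_def)
    from nn_integral_bij_count_space[OF this, of f]
    show "(\<integral>\<^sup>+y. f (g \<otimes> y) \<partial>count_space x) = (\<integral>\<^sup>+y. f y \<partial>count_space (g <# x))" .
  qed
  also have "\<dots> = (\<integral>\<^sup>+x. \<integral>\<^sup>+y. f y \<partial>count_space x \<partial>\<nu>)"
    by (rule nn_integral_act[OF g fibre_sum_measurable[OF f]])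
  also have "\<dots> = (\<integral>\<^sup>+x. f x \<partial>haar)" by (rule nn_integral_haar[OF f, symmetric])
  finally show "(\<integral>\<^sup>+x. f (g \<otimes> x) \<partial>haar) = (\<integral>\<^sup>+x. f x \<partial>haar)" .
qed

text \<open>Right multiplication by an element of \<Gamma> permutes each fibre. This is the part of
  right invariance that is visible before unimodularity is known.\<close>

lemma haar_right_Gamma:
  fixes f :: "'a \<Rightarrow> ennreal"
  assumes \<gamma>: "\<gamma> \<in> \<Gamma>" and f: "f \<in> borel_measurable (borel_of T)"
  shows "(\<integral>\<^sup>+x. f (x \<otimes> \<gamma>) \<partial>haar) = (\<integral>\<^sup>+x. f x \<partial>haar)"
proof -
  have g: "\<gamma> \<in> carrier G" using Gamma_carrier[OF \<gamma>] .
  have fg: "(\<lambda>x. f (x \<otimes> \<gamma>)) \<in> borel_measurable (borel_of T)"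
    using g by (intro borel_compose[OF f] continuous_intros_group continuous_map_const_carrier) auto
  have "(\<integral>\<^sup>+y. f (y \<otimes> \<gamma>) \<partial>count_space x) = (\<integral>\<^sup>+y. f y \<partial>count_space x)" if x: "x \<in> topspace Xs" for x
  proof (rule nn_integral_bij_count_space)
    obtain z where z: "z \<in> carrier G" "x = q z" using x by (auto simp: topspace_X)
    show "bij_betw (\<lambda>y. y \<otimes> \<gamma>) x x"
      unfolding bij_betw_def
    proof (intro conjI equalityI subsetI)
      show "inj_on (\<lambda>y. y \<otimes> \<gamma>) x" using coset_mem[OF x] g by (auto simp: inj_on_def)
      fix y assume "y \<in> (\<lambda>y. y \<otimes> \<gamma>) ` x"
      then show "y \<in> x" using \<gamma> z g by (auto simp: q_mem_iff)
    next
      fix y assume y: "y \<in> x"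
      have "inv \<gamma> \<in> \<Gamma>" using subgroup_Gamma \<gamma> by (rule subgroup.m_inv_closed)
      then have "y \<otimes> inv \<gamma> \<in> x" using y z by (auto simp: q_mem_iff Gamma_carrier)
      moreover have "y = (y \<otimes> inv \<gamma>) \<otimes> \<gamma>" using y z g by (auto simp: q_mem_iff m_assoc)
      ultimately show "y \<in> (\<lambda>y. y \<otimes> \<gamma>) ` x" by blast
    qed
  qed
  then show ?thesis unfolding nn_integral_haar[OF f] nn_integral_haar[OF fg]
    by (rule nn_integral_cong) (simp add: space_nu)
qed

lemma emeasure_haar_inj:
  assumes A: "A \<in> sets (borel_of T)" "inj_on q A"
  shows "emeasure haar A = emeasure \<nu> (q ` A)"
proof -
  have As: "A \<subseteq> carrier G" using sets.sets_into_space[OF A(1)] by simp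
  have "emeasure haar A = (\<integral>\<^sup>+x. indicator (q ` A) x \<partial>\<nu>)"
    unfolding emeasure_haar[OF A(1)]
  proof (rule nn_integral_cong)
    fix x assume "x \<in> space \<nu>"
    then have x: "x \<in> topspace Xs" by (simp add: space_nu)
    show "(\<integral>\<^sup>+y. indicator A y \<partial>count_space x) = indicator (q ` A) x"
    proof (cases "x \<in> q ` A")
      case True
      then obtain y where y: "y \<in> A" "x = q y" by auto
      then have "y \<in> x" using As q_self by auto
      then show ?thesis using True fibre_sum_inj(1)[OF A(2) As x y(1), of "\<lambda>_. 1"] by simp
    next
      case False
      then have "A \<inter> x = {}" using coset_mem[OF x] by auto
      then show ?thesis using False fibre_sum_inj(2)[OF A(2) As x, of "\<lambda>_. 1"] by simp
    qed
  qed
  then show ?thesis using q_image_borel[OF A(1)] by (simp add: sets_nu)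
qed

lemma haar_W_finite: "emeasure haar (W i) < \<infinity>"
  unfolding emeasure_haar_inj[OF W_borel W_inj] using emeasure_finite by (simp add: less_top[symmetric])

lemma haar_compact_finite:
  assumes K: "compactin T K"
  shows "emeasure haar K < \<infinity>"
proof -
  obtain F where F: "finite F" "K \<subseteq> (\<Union>i\<in>F. W i)" by (rule compactin_finite_cover[OF K])
  have "emeasure haar K \<le> emeasure haar (\<Union>i\<in>F. W i)"
    using F by (intro emeasure_mono) (auto simp: sets_haar)
  also have "\<dots> \<le> (\<Sum>i\<in>F. emeasure haar (W i))"
    using F(1) by (intro emeasure_subadditive_finite) (auto simp: sets_haar)
  also have "\<dots> < \<infinity>" using F(1) haar_W_finite by (simp add: ennreal_sum_less_top)
  finally show ?thesis .
qed

text \<open>Regularity is known for \<open>\<nu>\<close> only. On \<open>W i\<close> the map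
  \<open>q\<close> is an open injection under which \<open>haar\<close> and \<open>\<nu>\<close>
  correspond, so the countable subfamilies are chosen downstairs, one for each
  \<open>i\<close>.\<close>

lemma tau_additive_haar: "tau_additive T haar"
  unfolding tau_additive_def
proof (intro conjI allI impI)
  show "sigma_finite_measure haar"
  proof
    show "\<exists>A. countable A \<and> A \<subseteq> sets haar \<and> \<Union>A = space haar \<and> (\<forall>a\<in>A. emeasure haar a \<noteq> \<infinity>)"
      using W_Union haar_W_finite by (intro exI[of _ "range W"]) (auto simp: less_top sets_haar space_haar)
  qed
  fix \<U> assume \<U>: "\<forall>U\<in>\<U>. openin T U"
  have "\<exists>\<V>. \<V> \<subseteq> \<U> \<and> countable \<V> \<and> \<Union>((\<lambda>U. q ` (U \<inter> W i)) ` \<U>) - \<Union>((\<lambda>U. q ` (U \<inter> W i)) ` \<V>) \<in> null_sets \<nu>" for i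
  proof -
    have "\<forall>V\<in>(\<lambda>U. q ` (U \<inter> W i)) ` \<U>. openin Xs V"
    proof
      fix V assume "V \<in> (\<lambda>U. q ` (U \<inter> W i)) ` \<U>"
      then obtain U where "U \<in> \<U>" "V = q ` (U \<inter> W i)" by blast
      then show "openin Xs V" using \<U> W_open[of i] open_map_q by (simp add: open_map_def openin_Int)
    qed
    then obtain \<V>' where \<V>': "\<V>' \<subseteq> (\<lambda>U. q ` (U \<inter> W i)) ` \<U>" "countable \<V>'"
        "\<Union>((\<lambda>U. q ` (U \<inter> W i)) ` \<U>) - \<Union>\<V>' \<in> null_sets \<nu>"
      using tau_additive_nu unfolding tau_additive_def by meson
    obtain \<V> where "countable \<V>" "\<V> \<subseteq> \<U>" "\<V>' = (\<lambda>U. q ` (U \<inter> W i)) ` \<V>"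
      using \<V>'(1,2) by (meson countable_subset_image)
    then show ?thesis using \<V>'(3) by blast
  qed
  then obtain \<V> where \<V>: "\<And>i. \<V> i \<subseteq> \<U>" "\<And>i. countable (\<V> i)"
     "\<And>i. \<Union>((\<lambda>U. q ` (U \<inter> W i)) ` \<U>) - \<Union>((\<lambda>U. q ` (U \<inter> W i)) ` \<V> i) \<in> null_sets \<nu>" by metis
  define N where "N i = W i \<inter> \<Union>\<U> - \<Union>(\<V> i)" for i
  have Ns: "N i \<in> sets (borel_of T)" for i
    unfolding N_def using \<U> \<V>(1)[of i] by (intro sets.Diff sets.Int W_borel borel_of_open openin_Union) auto
  have Ni: "inj_on q (N i)" for i
    unfolding N_def by (rule inj_on_subset[OF W_inj[of i]]) blast
  have "N i \<in> null_sets haar" for i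
  proof -
    have "q ` N i \<subseteq> \<Union>((\<lambda>U. q ` (U \<inter> W i)) ` \<U>) - \<Union>((\<lambda>U. q ` (U \<inter> W i)) ` \<V> i)"
    proof
      fix x assume "x \<in> q ` N i"
      then obtain y where y: "x = q y" "y \<in> W i" "y \<in> \<Union>\<U>" "y \<notin> \<Union>(\<V> i)" by (auto simp: N_def)
      have yV: "y \<in> \<Union>(\<V> i)" if qy: "q y \<in> q ` (V \<inter> W i)" and V: "V \<in> \<V> i" for V
      proof -
        obtain z where z: "q y = q z" "z \<in> V \<inter> W i" using qy by (rule imageE)
        then have "y = z" by (intro inj_onD[OF W_inj[of i] z(1) y(2)]) simp
        then show ?thesis using z(2) V by auto
      qed
      have "q y \<notin> \<Union>((\<lambda>U. q ` (U \<inter> W i)) ` \<V> i)"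
      proof
        assume "q y \<in> \<Union>((\<lambda>U. q ` (U \<inter> W i)) ` \<V> i)"
        then obtain V where "V \<in> \<V> i" "q y \<in> q ` (V \<inter> W i)" by (rule UN_E)
        then show False using yV y(4) by simp
      qed
      moreover have "q y \<in> \<Union>((\<lambda>U. q ` (U \<inter> W i)) ` \<U>)" using y(2,3) by blast
      ultimately show "x \<in> \<Union>((\<lambda>U. q ` (U \<inter> W i)) ` \<U>) - \<Union>((\<lambda>U. q ` (U \<inter> W i)) ` \<V> i)"
        using y(1) by simp
    qed
    moreover have "q ` N i \<in> sets \<nu>" using q_image_borel[OF Ns] by (simp add: sets_nu)
    ultimately have "q ` N i \<in> null_sets \<nu>" by (metis null_sets_subset \<V>(3))
    then show ?thesis using emeasure_haar_inj[OF Ns Ni] Ns by (auto simp: null_sets_def sets_haar)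
  qed
  then have "(\<Union>i. N i) \<in> null_sets haar" by (intro null_sets_UN)
  moreover have "\<Union>\<U> - \<Union>(\<Union>i. \<V> i) \<subseteq> (\<Union>i. N i)"
  proof
    fix x assume x: "x \<in> \<Union>\<U> - \<Union>(\<Union>i. \<V> i)"
    then obtain U where "U \<in> \<U>" "x \<in> U" by blast
    then have "x \<in> topspace T" using \<U> openin_subset by blast
    then obtain i where "x \<in> W i" using W_Union by auto
    then show "x \<in> (\<Union>i. N i)" using x unfolding N_def by blast
  qed
  moreover have "\<Union>\<U> - \<Union>(\<Union>i. \<V> i) \<in> sets haar"
    unfolding sets_haar
  proof (intro sets.Diff borel_of_open openin_Union)
    fix S assume "S \<in> (\<Union>i. \<V> i)"
    then show "openin T S" using \<V>(1) \<U> by blast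
  qed (use \<U> in auto)
  ultimately have "\<Union>\<U> - \<Union>(\<Union>i. \<V> i) \<in> null_sets haar" by (metis null_sets_subset)
  then show "\<exists>\<V>. \<V> \<subseteq> \<U> \<and> countable \<V> \<and> \<Union>\<U> - \<Union>\<V> \<in> null_sets haar"
    using \<V>(1,2) by (intro exI[of _ "\<Union>i. \<V> i"]) auto
qed (rule sets_haar)

text \<open>No fibre is empty, and counting measure on it has no non-empty null sets. So a property
  of cosets fails on a null set downstairs exactly when it does upstairs.\<close>

lemma AE_haar_iff:
  assumes P: "{x \<in> topspace Xs. P x} \<in> sets (borel_of Xs)"
  shows "(AE y in haar. P (q y)) \<longleftrightarrow> (AE x in \<nu>. P x)"
proof -
  define N where "N = topspace Xs - {x \<in> topspace Xs. P x}"
  have N: "N \<in> sets (borel_of Xs)"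
    using sets.compl_sets[OF P] by (simp add: N_def)
  have I: "(\<lambda>y. indicator N (q y) :: ennreal) \<in> borel_measurable (borel_of T)"
    using N by (intro borel_compose_X[OF _ continuous_q]) auto
  have "(AE y in haar. P (q y)) \<longleftrightarrow> (AE y in haar. (indicator N (q y) :: ennreal) = 0)"
    by (rule AE_cong) (auto simp: N_def space_haar topspace_X indicator_def)
  also have "\<dots> \<longleftrightarrow> (\<integral>\<^sup>+y. indicator N (q y) \<partial>haar) = 0"
    by (rule nn_integral_0_iff_AE[symmetric]) (use I in \<open>simp add: measurable_haar\<close>)
  also have "\<dots> \<longleftrightarrow> (AE x in \<nu>. (\<integral>\<^sup>+y. indicator N (q y) \<partial>count_space x) = 0)"
    unfolding nn_integral_haar[OF I]
    by (rule nn_integral_0_iff_AE) (use fibre_sum_measurable[OF I] in \<open>simp add: measurable_nu\<close>)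
  also have "\<dots> \<longleftrightarrow> (AE x in \<nu>. P x)"
  proof (rule AE_cong)
    fix x assume "x \<in> space \<nu>"
    then have x: "x \<in> topspace Xs" by (simp add: space_nu)
    then obtain y where "y \<in> x" using q_self by (auto simp: topspace_X)
    have "(\<integral>\<^sup>+y. indicator N (q y) \<partial>count_space x) = 0 \<longleftrightarrow> (\<forall>y\<in>x. (indicator N (q y) :: ennreal) = 0)"
      by (simp add: nn_integral_0_iff_AE AE_count_space)
    also have "\<dots> \<longleftrightarrow> x \<notin> N" using coset_mem[OF x] \<open>y \<in> x\<close> by (auto simp: indicator_def)
    finally show "(\<integral>\<^sup>+y. indicator N (q y) \<partial>count_space x) = 0 \<longleftrightarrow> P x" using x by (simp add: N_def)
  qed
  finally show ?thesis .
qed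

lemma haar_nonzero: "emeasure haar (space haar) \<noteq> 0"
proof
  assume "emeasure haar (space haar) = 0"
  then have "AE y in haar. False" by (intro AE_I[of _ _ "space haar"]) auto
  then have "AE x in \<nu>. False" using AE_haar_iff[of "\<lambda>_. False"] by simp
  then show False using nu_nonzero AE_iff_measurable[of "space \<nu>" \<nu> "\<lambda>_. False"] by simp
qed

lemma haar_open_pos: "openin T U \<Longrightarrow> U \<noteq> {} \<Longrightarrow> emeasure haar U \<noteq> 0"
  by (rule left_invariant_open_pos[OF tau_additive_haar left_invariant_haar haar_nonzero])

end

context group_lattice
begin

section \<open>Unimodularity and uniqueness of Haar measure\<close>

text \<open>With the indicator of a null set as \<open>h\<close>, the right side of
  \<open>left_invariant_pair\<close> vanishes, while the first factor on the left can be made the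
  positive measure of an open set. So inversion preserves null sets before it is known to preserve
  the measure.\<close>

lemma haar_inverse_AE:
  assumes "AE x in haar. P x"
  shows "AE x in haar. P (inv x)"
proof -
  obtain N where N: "{x \<in> space haar. \<not> P x} \<subseteq> N" "emeasure haar N = 0" "N \<in> sets haar"
    using AE_E[OF assms] .
  have Nm: "(indicator N :: 'a \<Rightarrow> ennreal) \<in> borel_measurable (borel_of T)"
    using N(3) by (simp add: sets_haar)
  obtain U where U: "openin T U" "\<one> \<in> U" by (rule obtain_injective_neighbourhood)
  have Um: "(indicator U :: 'a \<Rightarrow> ennreal) \<in> borel_measurable (borel_of T)"
    using borel_of_open[OF U(1)] by simp
  have ii: "(\<lambda>y. indicator N (inv y) :: ennreal) \<in> borel_measurable (borel_of T)"
    by (intro borel_compose[OF Nm] continuous_intros_group)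
  have "AE x in haar. (indicator N x :: ennreal) = 0"
    using N(2,3) AE_not_in[of N haar] by (auto simp: null_sets_def)
  then have "(\<integral>\<^sup>+x. indicator N x * (\<integral>\<^sup>+y. indicator U (y \<otimes> x) \<partial>haar) \<partial>haar) = (\<integral>\<^sup>+x. 0 \<partial>haar)"
    by (intro nn_integral_cong_AE) auto
  then have "(\<integral>\<^sup>+x. indicator U x \<partial>haar) * (\<integral>\<^sup>+y. indicator N (inv y) \<partial>haar) = 0"
    using left_invariant_pair[OF tau_additive_haar left_invariant_haar tau_additive_haar left_invariant_haar Um Nm]
    by simp
  moreover have "(\<integral>\<^sup>+x. indicator U x \<partial>haar) \<noteq> 0"
    using haar_open_pos[OF U(1)] U(2) borel_of_open[OF U(1)] by (auto simp: sets_haar)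
  ultimately have "(\<integral>\<^sup>+y. indicator N (inv y) \<partial>haar) = 0" by simp
  then have "AE y in haar. (indicator N (inv y) :: ennreal) = 0"
    using ii by (subst (asm) nn_integral_0_iff_AE) (auto simp: measurable_haar)
  then show ?thesis
    using AE_space
  proof eventually_elim
    case (elim y)
    then have "inv y \<notin> N" "inv y \<in> space haar" by (auto simp: indicator_def space_haar split: if_splits)
    then show ?case using N(1) by blast
  qed
qed

lemma compact_borel: "compactin T K \<Longrightarrow> K \<in> sets (borel_of T)"
  using compactin_imp_closedin[OF Hausdorff] by (rule borel_of_closed)

text \<open>Meaningful for functions constant on cosets, where the representative picked by choice
  does not matter.\<close>

definition descend :: "('a \<Rightarrow> 'b) \<Rightarrow> 'a set \<Rightarrow> 'b" where
  "descend F x = F (SOME y. y \<in> x)"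

lemma descend_q:
  assumes F: "\<And>y \<gamma>. y \<in> carrier G \<Longrightarrow> \<gamma> \<in> \<Gamma> \<Longrightarrow> F (y \<otimes> \<gamma>) = F y" and y: "y \<in> carrier G"
  shows "descend F (q y) = F y"
proof -
  have "(SOME z. z \<in> q y) \<in> q y" by (rule someI[of _ y]) (rule q_self[OF y])
  then obtain \<gamma> where "\<gamma> \<in> \<Gamma>" "(SOME z. z \<in> q y) = y \<otimes> \<gamma>" by (auto simp: q_mem)
  then show ?thesis using F y by (simp add: descend_def)
qed

text \<open>One compact neighbourhood of the identity with everything that is asked of it later. The
  last clause quantifies over measures because the Haar measure in the integrability hypothesis is
  not \<open>haar\<close>.\<close>

lemma compact_neighbourhood:
  obtains K where "compactin T K" "\<forall>a\<in>carrier G. compactin T ((\<lambda>k. k \<otimes> a) ` K)"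
    "\<forall>a\<in>carrier G. 0 < emeasure haar ((\<lambda>k. k \<otimes> a) ` K)"
    "\<forall>M. tau_additive T M \<longrightarrow> left_invariant M \<longrightarrow> emeasure M (space M) \<noteq> 0 \<longrightarrow> emeasure M K \<noteq> 0"
proof -
  obtain U K where U: "openin T U" "\<one> \<in> U" "compactin T K" "U \<subseteq> K"
    by (rule obtain_injective_neighbourhood)
  have c: "compactin T ((\<lambda>k. k \<otimes> a) ` K)" if "a \<in> carrier G" for a
    using that by (intro image_compactin[OF U(3)] continuous_intros_group continuous_map_const_carrier) auto
  have p: "0 < emeasure haar ((\<lambda>k. k \<otimes> a) ` K)" if a: "a \<in> carrier G" for a
  proof -
    have "emeasure haar ((\<lambda>k. k \<otimes> a) ` U) \<noteq> 0"
      using U by (intro haar_open_pos openin_right_translate a) auto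
    moreover have "emeasure haar ((\<lambda>k. k \<otimes> a) ` U) \<le> emeasure haar ((\<lambda>k. k \<otimes> a) ` K)"
      using compact_borel[OF c[OF a]] U(4) by (intro emeasure_mono) (auto simp: sets_haar)
    ultimately show ?thesis by (metis not_gr_zero le_zero_eq)
  qed
  have m: "emeasure M K \<noteq> 0" if "tau_additive T M" "left_invariant M" "emeasure M (space M) \<noteq> 0" for M
  proof -
    have "emeasure M U \<noteq> 0" using left_invariant_open_pos[OF that U(1)] U(2) by blast
    moreover have "emeasure M U \<le> emeasure M K"
      using compact_borel[OF U(3)] U(4) by (intro emeasure_mono) (simp_all add: tau_additive_sets[OF that(1)])
    ultimately show ?thesis by auto
  qed
  show ?thesis using that[OF U(3)] c p m by simp
qed

text \<open>The function \<open>y \<mapsto> haar (K y)\<close> lives on the finite measure space \<open>G/\<Gamma>\<close>, and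
  translation by \<open>a\<close> multiplies it by a constant; invariance of \<open>\<nu>\<close> forces that constant to be \<open>1\<close>.\<close>

lemma haar_right_translate_compact:
  assumes K: "compactin T K" "\<And>a. a \<in> carrier G \<Longrightarrow> compactin T ((\<lambda>k. k \<otimes> a) ` K)"
    "\<And>a. a \<in> carrier G \<Longrightarrow> 0 < emeasure haar ((\<lambda>k. k \<otimes> a) ` K)"
    and a: "a \<in> carrier G"
  shows "emeasure haar ((\<lambda>k. k \<otimes> a) ` K) = emeasure haar K"
proof -
  have Ks: "K \<subseteq> carrier G" using compactin_subset_topspace[OF K(1)] by simp
  \<comment> \<open>Up to the constant factor \<open>emeasure haar K\<close> this is the modular
    function.\<close>
  define \<theta> where "\<theta> y = emeasure haar ((\<lambda>k. k \<otimes> y) ` K)" for y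
  have mem: "z \<in> (\<lambda>k. k \<otimes> y) ` K \<longleftrightarrow> z \<otimes> inv y \<in> K" if "y \<in> carrier G" "z \<in> carrier G" for y z
  proof
    assume "z \<in> (\<lambda>k. k \<otimes> y) ` K"
    then obtain k where "k \<in> K" "z = k \<otimes> y" by blast
    then show "z \<otimes> inv y \<in> K" using that Ks by (auto simp: m_assoc)
  next
    assume "z \<otimes> inv y \<in> K"
    moreover have "z = (z \<otimes> inv y) \<otimes> y" using that by (simp add: m_assoc)
    ultimately show "z \<in> (\<lambda>k. k \<otimes> y) ` K" by blast
  qed
  have sKy: "(\<lambda>k. k \<otimes> y) ` K \<in> sets haar" if "y \<in> carrier G" for y
    using compact_borel[OF K(2)[OF that]] by (simp add: sets_haar)
  have Km: "(indicator K :: 'a \<Rightarrow> ennreal) \<in> borel_measurable (borel_of T)"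
    using compact_borel[OF K(1)] by simp
  have \<theta>: "\<theta> y = (\<integral>\<^sup>+z. indicator K (z \<otimes> inv y) \<partial>haar)" if y: "y \<in> carrier G" for y
  proof -
    have "\<theta> y = (\<integral>\<^sup>+z. indicator ((\<lambda>k. k \<otimes> y) ` K) z \<partial>haar)"
      using sKy[OF y] by (simp add: \<theta>_def)
    also have "\<dots> = (\<integral>\<^sup>+z. indicator K (z \<otimes> inv y) \<partial>haar)"
      by (rule nn_integral_cong) (use mem[OF y] in \<open>simp add: space_haar indicator_def\<close>)
    finally show ?thesis .
  qed
  have \<theta>_pos: "0 < \<theta> y" and \<theta>_fin: "\<theta> y < \<infinity>" if "y \<in> carrier G" for y
    using K(3)[OF that] haar_compact_finite[OF K(2)[OF that]] by (auto simp: \<theta>_def)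
  have \<theta>1: "\<theta> \<one> = emeasure haar K"
    using Ks by (auto simp: \<theta>_def subset_iff image_iff intro!: arg_cong[where f="emeasure haar"])
  have \<theta>_meas: "\<theta> \<in> borel_measurable (borel_of T)"
  proof -
    have "(\<lambda>(y, z). indicator K (z \<otimes> inv y) :: ennreal) \<in> borel_measurable (borel_of (prod_topology T T))"
      unfolding case_prod_unfold by (intro borel_compose[OF Km] continuous_intros_group)
    from tau_additive_Tonelli(1)[OF tau_additive_haar tau_additive_haar this]
    have "(\<lambda>y. \<integral>\<^sup>+z. indicator K (z \<otimes> inv y) \<partial>haar) \<in> borel_measurable (borel_of T)"
      by (simp add: measurable_haar)
    then show ?thesis by (subst measurable_cong[OF \<theta>]) auto
  qed
  have \<theta>_inv: "\<theta> (y \<otimes> \<gamma>) = \<theta> y" if y: "y \<in> carrier G" and \<gamma>: "\<gamma> \<in> \<Gamma>" for y \<gamma>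
  proof -
    have g: "\<gamma> \<in> carrier G" "inv \<gamma> \<in> \<Gamma>"
      using \<gamma> Gamma_carrier subgroup.m_inv_closed[OF subgroup_Gamma] by auto
    have m: "(\<lambda>z. indicator K (z \<otimes> inv y) :: ennreal) \<in> borel_measurable (borel_of T)"
      using y by (intro borel_compose[OF Km] continuous_intros_group continuous_map_const_carrier) auto
    have "\<theta> (y \<otimes> \<gamma>) = (\<integral>\<^sup>+z. indicator K (z \<otimes> inv (y \<otimes> \<gamma>)) \<partial>haar)" using y g by (intro \<theta>) auto
    also have "\<dots> = (\<integral>\<^sup>+z. indicator K ((z \<otimes> inv \<gamma>) \<otimes> inv y) \<partial>haar)"
      by (rule nn_integral_cong) (use y g in \<open>simp add: space_haar inv_mult_group m_assoc\<close>)
    also have "\<dots> = \<theta> y"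
      unfolding \<theta>[OF y] by (rule haar_right_Gamma[OF g(2) m])
    finally show ?thesis .
  qed
  have pair: "\<theta> b * (\<integral>\<^sup>+y. h (inv y) \<partial>haar) = (\<integral>\<^sup>+x. h x * \<theta> (b \<otimes> inv x) \<partial>haar)"
    if b: "b \<in> carrier G" and h: "h \<in> borel_measurable (borel_of T)" for b h
  proof -
    have m: "(\<lambda>z. indicator K (z \<otimes> inv b) :: ennreal) \<in> borel_measurable (borel_of T)"
      using b by (intro borel_compose[OF Km] continuous_intros_group continuous_map_const_carrier) auto
    have "\<theta> b * (\<integral>\<^sup>+y. h (inv y) \<partial>haar) = (\<integral>\<^sup>+x. h x * (\<integral>\<^sup>+z. indicator K ((z \<otimes> x) \<otimes> inv b) \<partial>haar) \<partial>haar)"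
      unfolding \<theta>[OF b]
      by (rule left_invariant_pair[OF tau_additive_haar left_invariant_haar tau_additive_haar left_invariant_haar m h])
    also have "\<dots> = (\<integral>\<^sup>+x. h x * \<theta> (b \<otimes> inv x) \<partial>haar)"
    proof (rule nn_integral_cong)
      fix x assume "x \<in> space haar"
      then have x: "x \<in> carrier G" by (simp add: space_haar)
      have "(\<integral>\<^sup>+z. indicator K ((z \<otimes> x) \<otimes> inv b) \<partial>haar) = (\<integral>\<^sup>+z. indicator K (z \<otimes> inv (b \<otimes> inv x)) \<partial>haar)"
        by (rule nn_integral_cong) (use x b in \<open>simp add: space_haar inv_mult_group m_assoc\<close>)
      then show "h x * (\<integral>\<^sup>+z. indicator K ((z \<otimes> x) \<otimes> inv b) \<partial>haar) = h x * \<theta> (b \<otimes> inv x)"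
        using \<theta>[of "b \<otimes> inv x"] x b by simp
    qed
    finally show ?thesis .
  qed
  have \<theta>_comp: "(\<lambda>x. \<theta> (b \<otimes> inv x)) \<in> borel_measurable haar" if "b \<in> carrier G" for b
    unfolding measurable_haar
    using that by (intro borel_compose[OF \<theta>_meas] continuous_intros_group continuous_map_const_carrier) auto
  \<comment> \<open>By \<open>pair\<close>, both densities give every set the same measure, since
    \<open>\<theta> a\<close> and \<open>\<theta> \<one>\<close> enter symmetrically. After
    inversion this becomes the multiplicative law of the modular function, almost
    everywhere.\<close>
  have "AE x in haar. \<theta> a * \<theta> (\<one> \<otimes> inv x) = \<theta> \<one> * \<theta> (a \<otimes> inv x)"
  proof (rule sigma_finite_measure.density_unique[OF tau_additive_sigma_finite[OF tau_additive_haar]])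
    show m1: "(\<lambda>x. \<theta> a * \<theta> (\<one> \<otimes> inv x)) \<in> borel_measurable haar"
      and m2: "(\<lambda>x. \<theta> \<one> * \<theta> (a \<otimes> inv x)) \<in> borel_measurable haar"
      using a by (intro borel_measurable_times_ennreal \<theta>_comp; simp)+
    show "density haar (\<lambda>x. \<theta> a * \<theta> (\<one> \<otimes> inv x)) = density haar (\<lambda>x. \<theta> \<one> * \<theta> (a \<otimes> inv x))"
    proof (rule measure_eqI)
      fix A assume "A \<in> sets (density haar (\<lambda>x. \<theta> a * \<theta> (\<one> \<otimes> inv x)))"
      then have A: "A \<in> sets haar" by simp
      have Am: "(indicator A :: 'a \<Rightarrow> ennreal) \<in> borel_measurable (borel_of T)" using A by (simp add: sets_haar)
      have *: "emeasure (density haar (\<lambda>x. \<theta> c * \<theta> (b \<otimes> inv x))) A = \<theta> c * (\<theta> b * (\<integral>\<^sup>+y. indicator A (inv y) \<partial>haar))"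
        if b: "b \<in> carrier G" for b c
      proof -
        have "emeasure (density haar (\<lambda>x. \<theta> c * \<theta> (b \<otimes> inv x))) A = (\<integral>\<^sup>+x. \<theta> c * (indicator A x * \<theta> (b \<otimes> inv x)) \<partial>haar)"
          using \<theta>_comp[OF b] A by (subst emeasure_density) (auto simp: mult_ac)
        also have "\<dots> = \<theta> c * (\<integral>\<^sup>+x. indicator A x * \<theta> (b \<otimes> inv x) \<partial>haar)"
          using \<theta>_comp[OF b] A by (intro nn_integral_cmult) auto
        finally show ?thesis by (simp add: pair[OF b Am])
      qed
      show "emeasure (density haar (\<lambda>x. \<theta> a * \<theta> (\<one> \<otimes> inv x))) A = emeasure (density haar (\<lambda>x. \<theta> \<one> * \<theta> (a \<otimes> inv x))) A"
        using *[OF one_closed, of a] *[OF a, of \<one>] by (simp add: mult_ac)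
    qed simp
  qed
  from haar_inverse_AE[OF this] AE_space
  have AE1: "AE x in haar. \<theta> a * \<theta> x = \<theta> \<one> * \<theta> (a \<otimes> x)"
    by eventually_elim (simp add: space_haar)
  define t where "t x = enn2real (descend \<theta> x)" for x
  have t: "t (q y) = enn2real (\<theta> y)" if "y \<in> carrier G" for y
    using descend_q[of \<theta>, OF \<theta>_inv that] by (simp add: t_def)
  have t_meas[measurable]: "t \<in> borel_measurable (borel_of Xs)"
  proof (rule measurable_descend)
    have "(\<lambda>y. enn2real (\<theta> y)) \<in> borel_measurable (borel_of T)" using \<theta>_meas by measurable
    then show "(\<lambda>y. t (q y)) \<in> borel_measurable (borel_of T)" by (subst measurable_cong[OF t]) auto
  qed
  have ta_meas: "(\<lambda>x. t (a <# x)) \<in> borel_measurable (borel_of Xs)"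
    using a by (intro borel_compose_X[OF t_meas] continuous_map_act) (auto simp: continuous_map_id[unfolded id_def])
  \<comment> \<open>The factor by which translation by \<open>a\<close> scales \<open>t\<close>; it
    has to be shown to be \<open>1\<close>.\<close>
  define r where "r = t (q a) / t (q \<one>)"
  have t_pos: "0 < t x" if x: "x \<in> topspace Xs" for x
  proof -
    obtain y where "y \<in> carrier G" "x = q y" using x by (auto simp: topspace_X)
    then show ?thesis using \<theta>_pos[of y] \<theta>_fin[of y] by (simp add: t enn2real_positive_iff)
  qed
  have t1: "0 < t (q \<one>)" "0 < t (q a)" using a by (auto intro!: t_pos simp: topspace_X)
  have AE2: "AE x in \<nu>. t (q a) * t x = t (q \<one>) * t (a <# x)"
  proof (subst AE_haar_iff[symmetric])
    have "(\<lambda>x. t (q a) * t x - t (q \<one>) * t (a <# x)) \<in> borel_measurable (borel_of Xs)"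
      using t_meas ta_meas by measurable
    then have "(\<lambda>x. t (q a) * t x - t (q \<one>) * t (a <# x)) -` {0} \<inter> space (borel_of Xs) \<in> sets (borel_of Xs)"
      by (rule measurable_sets) simp
    then show "{x \<in> topspace Xs. t (q a) * t x = t (q \<one>) * t (a <# x)} \<in> sets (borel_of Xs)"
      by (simp add: vimage_def Int_def conj_commute)
    show "AE y in haar. t (q a) * t (q y) = t (q \<one>) * t (a <# q y)"
      using AE1 AE_space
      by eventually_elim (use a in \<open>simp add: space_haar t act_q enn2real_mult[symmetric]\<close>)
  qed
  have AE3: "AE x in \<nu>. t (a <# x) = r * t x"
    using AE2 by eventually_elim (use t1 in \<open>simp add: r_def field_simps\<close>)
  \<comment> \<open>\<open>t\<close> is not known to be integrable over \<open>G/\<Gamma>\<close>.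
    Composing with \<open>arctan\<close>, which is bounded and strictly increasing, makes the
    integrals of \<open>t\<close> and of its translate finite and still comparable.\<close>
  have bd: "integrable \<nu> (\<lambda>x. arctan (f x))" if f: "f \<in> borel_measurable (borel_of Xs)" for f
  proof (rule integrable_const_bound[where B = "pi/2"])
    have "\<bar>arctan y\<bar> \<le> pi / 2" for y using arctan_bounded[of y] by linarith
    then show "AE x in \<nu>. norm (arctan (f x)) \<le> pi / 2" by simp
    show "(\<lambda>x. arctan (f x)) \<in> borel_measurable \<nu>"
      unfolding measurable_nu
      by (rule measurable_compose[OF f borel_measurable_continuous_onI]) (intro continuous_intros)
  qed
  have "(\<integral>x. arctan (r * t x) - arctan (t x) \<partial>\<nu>) = (\<integral>x. arctan (r * t x) \<partial>\<nu>) - (\<integral>x. arctan (t x) \<partial>\<nu>)"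
    by (intro Bochner_Integration.integral_diff bd) measurable
  also have "(\<integral>x. arctan (r * t x) \<partial>\<nu>) = (\<integral>x. arctan (t (a <# x)) \<partial>\<nu>)"
    using AE3 bd[of "\<lambda>x. r * t x"] bd[OF ta_meas] by (intro integral_cong_AE) (auto dest: borel_measurable_integrable)
  also have "\<dots> = (\<integral>x. arctan (t x) \<partial>\<nu>)"
    using borel_measurable_integrable[OF bd[OF t_meas]]
    by (intro integral_act[OF a, of "\<lambda>x. arctan (t x)"]) (simp add: measurable_nu)
  finally have I0: "(\<integral>x. arctan (r * t x) - arctan (t x) \<partial>\<nu>) = 0" by simp
  have I: "integrable \<nu> (\<lambda>x. arctan (r * t x) - arctan (t x))"
    by (intro Bochner_Integration.integrable_diff bd) measurable
  have r1: "r = 1"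
  proof (rule ccontr)
    \<comment> \<open>The integrand then has a constant sign and integral \<open>0\<close>, so it
      vanishes almost everywhere, which positivity of \<open>t\<close> forbids.\<close>
    assume "r \<noteq> 1"
    have "AE x in \<nu>. arctan (r * t x) - arctan (t x) = 0"
    proof (cases "r > 1")
      case True
      have "AE x in \<nu>. 0 \<le> arctan (r * t x) - arctan (t x)"
      proof (rule AE_I2)
        fix x assume "x \<in> space \<nu>"
        then show "0 \<le> arctan (r * t x) - arctan (t x)"
          using t_pos[of x] True mult_right_mono[of 1 r "t x"] arctan_monotone'[of "t x" "r * t x"]
          by (simp add: space_nu)
      qed
      then show ?thesis using integral_nonneg_eq_0_iff_AE[OF I] I0 by blast
    next
      case False
      have I': "integrable \<nu> (\<lambda>x. - (arctan (r * t x) - arctan (t x)))"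
        by (rule Bochner_Integration.integrable_minus[OF I])
      have "AE x in \<nu>. 0 \<le> - (arctan (r * t x) - arctan (t x))"
      proof (rule AE_I2)
        fix x assume "x \<in> space \<nu>"
        then show "0 \<le> - (arctan (r * t x) - arctan (t x))"
          using t_pos[of x] False mult_right_mono[of r 1 "t x"] arctan_monotone'[of "r * t x" "t x"]
          by (simp add: space_nu)
      qed
      moreover have "(\<integral>x. - (arctan (r * t x) - arctan (t x)) \<partial>\<nu>) = 0"
        using I0 by (simp only: Bochner_Integration.integral_minus minus_zero)
      ultimately have "AE x in \<nu>. - (arctan (r * t x) - arctan (t x)) = 0"
        using integral_nonneg_eq_0_iff_AE[OF I'] by blast
      then show ?thesis by eventually_elim simp
    qed
    then have "AE x in \<nu>. False"
      using AE_space
    proof eventually_elim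
      case (elim x)
      then have "r * t x = t x" by (simp add: arctan_eq_iff)
      then show ?case using t_pos[of x] elim \<open>r \<noteq> 1\<close> by (simp add: space_nu)
    qed
    then show False using nu_nonzero AE_iff_measurable[of "space \<nu>" \<nu> "\<lambda>_. False"] by simp
  qed
  then have "t (q a) = t (q \<one>)" using t1 by (simp add: r_def)
  then have "enn2real (\<theta> a) = enn2real (\<theta> \<one>)" using a by (simp only: t one_closed)
  then have "\<theta> a = \<theta> \<one>" using \<theta>_fin[OF a] \<theta>_fin[OF one_closed]
    by (metis ennreal_enn2real infinity_ennreal_def)
  then show ?thesis by (simp add: \<theta>1) (simp add: \<theta>_def)
qed

text \<open>For the indicator of \<open>K\<close>, the inner integral in
  \<open>left_invariant_pair\<close> is the measure of a right translate of \<open>K\<close>, which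
  no longer depends on the translation. Cancelling \<open>emeasure haar K\<close>, positive and
  finite, leaves the claim for every \<open>h\<close>.\<close>

proposition haar_inverse:
  fixes h :: "'a \<Rightarrow> ennreal"
  assumes h: "h \<in> borel_measurable (borel_of T)"
  shows "(\<integral>\<^sup>+y. h (inv y) \<partial>haar) = (\<integral>\<^sup>+y. h y \<partial>haar)"
proof -
  obtain K where K: "compactin T K" "\<forall>a\<in>carrier G. compactin T ((\<lambda>k. k \<otimes> a) ` K)"
    "\<forall>a\<in>carrier G. 0 < emeasure haar ((\<lambda>k. k \<otimes> a) ` K)"
    by (rule compact_neighbourhood)
  have tr: "emeasure haar ((\<lambda>k. k \<otimes> a) ` K) = emeasure haar K" if a: "a \<in> carrier G" for a
    by (rule haar_right_translate_compact) (use K a in simp_all)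
  have Ks: "K \<subseteq> carrier G" using compactin_subset_topspace[OF K(1)] by simp
  have Km: "(indicator K :: 'a \<Rightarrow> ennreal) \<in> borel_measurable (borel_of T)"
    using compact_borel[OF K(1)] by simp
  have *: "(\<integral>\<^sup>+z. indicator K (z \<otimes> x) \<partial>haar) = emeasure haar K" if x: "x \<in> carrier G" for x
  proof -
    have "(\<integral>\<^sup>+z. indicator K (z \<otimes> x) \<partial>haar) = (\<integral>\<^sup>+z. indicator ((\<lambda>k. k \<otimes> inv x) ` K) z \<partial>haar)"
    proof (rule nn_integral_cong)
      fix z assume "z \<in> space haar"
      then have z: "z \<in> carrier G" by (simp add: space_haar)
      have "z \<otimes> x \<in> K \<longleftrightarrow> z \<in> (\<lambda>k. k \<otimes> inv x) ` K"
      proof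
        assume "z \<otimes> x \<in> K"
        moreover have "z = (z \<otimes> x) \<otimes> inv x" using z x by (simp add: m_assoc)
        ultimately show "z \<in> (\<lambda>k. k \<otimes> inv x) ` K" by blast
      next
        assume "z \<in> (\<lambda>k. k \<otimes> inv x) ` K"
        then obtain k where "k \<in> K" "z = k \<otimes> inv x" by blast
        then show "z \<otimes> x \<in> K" using x Ks by (auto simp: m_assoc)
      qed
      then show "indicator K (z \<otimes> x) = (indicator ((\<lambda>k. k \<otimes> inv x) ` K) z :: ennreal)"
        by (simp add: indicator_def)
    qed
    also have "\<dots> = emeasure haar ((\<lambda>k. k \<otimes> inv x) ` K)"
      using compact_borel[OF K(2)[rule_format, of "inv x"]] x by (simp add: sets_haar)
    also have "\<dots> = emeasure haar K" by (rule tr) (use x in auto)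
    finally show ?thesis .
  qed
  have "emeasure haar K * (\<integral>\<^sup>+y. h (inv y) \<partial>haar) = (\<integral>\<^sup>+x. h x * (\<integral>\<^sup>+z. indicator K (z \<otimes> x) \<partial>haar) \<partial>haar)"
    using left_invariant_pair[OF tau_additive_haar left_invariant_haar tau_additive_haar left_invariant_haar Km h]
      compact_borel[OF K(1)] by (simp add: sets_haar)
  also have "\<dots> = (\<integral>\<^sup>+x. h x * emeasure haar K \<partial>haar)"
    by (rule nn_integral_cong) (simp add: space_haar *)
  also have "\<dots> = emeasure haar K * (\<integral>\<^sup>+x. h x \<partial>haar)"
    using h by (simp add: nn_integral_multc measurable_haar mult.commute)
  finally have "emeasure haar K * (\<integral>\<^sup>+y. h (inv y) \<partial>haar) = emeasure haar K * (\<integral>\<^sup>+x. h x \<partial>haar)" .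
  moreover have "emeasure haar K \<noteq> 0" using tr[OF one_closed] K(3)[rule_format, OF one_closed] by simp
  moreover have "emeasure haar K \<noteq> \<infinity>" using haar_compact_finite[OF K(1)] by simp
  ultimately show ?thesis by (simp add: ennreal_mult_cancel_left)
qed

text \<open>Inversion exchanges right translation by \<open>x\<close> with left translation by
  \<open>inv x\<close>.\<close>

proposition haar_right_invariant:
  fixes h :: "'a \<Rightarrow> ennreal"
  assumes h: "h \<in> borel_measurable (borel_of T)" and x: "x \<in> carrier G"
  shows "(\<integral>\<^sup>+y. h (y \<otimes> x) \<partial>haar) = (\<integral>\<^sup>+y. h y \<partial>haar)"
proof -
  have hi: "(\<lambda>y. h (inv y)) \<in> borel_measurable (borel_of T)"
    by (intro borel_compose[OF h] continuous_intros_group)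
  have hx: "(\<lambda>y. h (y \<otimes> x)) \<in> borel_measurable (borel_of T)"
    using x by (intro borel_compose[OF h] continuous_intros_group continuous_map_const_carrier) auto
  have "(\<integral>\<^sup>+y. h (y \<otimes> x) \<partial>haar) = (\<integral>\<^sup>+y. h (inv y \<otimes> x) \<partial>haar)"
    by (rule haar_inverse[OF hx, symmetric])
  also have "\<dots> = (\<integral>\<^sup>+y. h (inv (inv x \<otimes> y)) \<partial>haar)"
    by (rule nn_integral_cong) (use x in \<open>simp add: space_haar inv_mult_group\<close>)
  also have "\<dots> = (\<integral>\<^sup>+y. h (inv y) \<partial>haar)"
    by (rule left_invariantD[OF left_invariant_haar _ hi]) (use x in auto)
  also have "\<dots> = (\<integral>\<^sup>+y. h y \<partial>haar)" by (rule haar_inverse[OF h])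
  finally show ?thesis .
qed

lemma haar_AE_right:
  assumes "AE y in haar. P y" and x: "x \<in> carrier G"
  shows "AE y in haar. P (y \<otimes> x)"
proof -
  obtain N where N: "{x \<in> space haar. \<not> P x} \<subseteq> N" "emeasure haar N = 0" "N \<in> sets haar"
    using AE_E[OF assms(1)] .
  have Nm: "(indicator N :: 'a \<Rightarrow> ennreal) \<in> borel_measurable (borel_of T)"
    using N(3) by (simp add: sets_haar)
  have Nx: "(\<lambda>y. indicator N (y \<otimes> x) :: ennreal) \<in> borel_measurable (borel_of T)"
    using x by (intro borel_compose[OF Nm] continuous_intros_group continuous_map_const_carrier) auto
  have "(\<integral>\<^sup>+y. indicator N (y \<otimes> x) \<partial>haar) = 0"
    using haar_right_invariant[OF Nm x] N by simp
  then have "AE y in haar. (indicator N (y \<otimes> x) :: ennreal) = 0"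
    using Nx by (subst (asm) nn_integral_0_iff_AE) (auto simp: measurable_haar)
  then show ?thesis
    using AE_space
  proof eventually_elim
    case (elim y)
    then have "y \<otimes> x \<notin> N" "y \<otimes> x \<in> space haar" using x by (auto simp: indicator_def space_haar split: if_splits)
    then show ?case using N(1) by blast
  qed
qed

lemma haar_AE_left:
  assumes "AE y in haar. P y" and x: "x \<in> carrier G"
  shows "AE y in haar. P (x \<otimes> y)"
proof -
  have "AE y in haar. P (inv y)" by (rule haar_inverse_AE[OF assms(1)])
  from haar_AE_right[OF this, of "inv x"] x
  have "AE y in haar. P (inv (y \<otimes> inv x))" by simp
  from haar_inverse_AE[OF this] AE_space show ?thesis
    by eventually_elim (use x in \<open>simp add: space_haar inv_mult_group\<close>)
qed

text \<open>The integrability hypothesis speaks of an arbitrary Haar measure, and all that has to be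
  carried over to \<open>haar\<close> is the finiteness of an integral.
  \<open>left_invariant_pair\<close> for the two measures, with right invariance of
  \<open>haar\<close> in the inner integral, relates the two integrals: the factor at the first is
  finite and the factor at the second is non-zero.\<close>

proposition haar_unique_finite:
  fixes f :: "'a \<Rightarrow> ennreal"
  assumes \<mu>: "haar_measure G T \<mu>" and f: "f \<in> borel_measurable (borel_of T)" and fin: "(\<integral>\<^sup>+x. f x \<partial>\<mu>) < \<infinity>"
  shows "(\<integral>\<^sup>+x. f x \<partial>haar) < \<infinity>"
proof -
  have rad: "radon_measure T \<mu>" and nz: "emeasure \<mu> (space \<mu>) \<noteq> 0" using \<mu> by (auto simp: haar_measure_def)
  have s: "sets \<mu> = sets (borel_of T)" using rad by (simp add: radon_measure_def)
  obtain Kn :: "nat \<Rightarrow> 'a set" where Kn: "\<And>n. compactin T (Kn n)" "(\<Union>n. Kn n) = carrier G"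
    using sigma_compact by (auto simp: sigma_compact_space_def)
  \<comment> \<open>Outer regularity thickens each compact piece to an open set of finite measure;
    these sets are what \<open>radon_tau_additive\<close> asks for.\<close>
  have "\<exists>V. openin T V \<and> Kn n \<subseteq> V \<and> emeasure \<mu> V < \<infinity>" for n
  proof -
    have "emeasure \<mu> (Kn n) < \<infinity>" using rad Kn(1) by (simp add: radon_measure_def)
    moreover have "emeasure \<mu> (Kn n) = (INF U \<in> {U. openin T U \<and> Kn n \<subseteq> U}. emeasure \<mu> U)"
      using rad compact_borel[OF Kn(1)[of n]] s unfolding radon_measure_def by blast
    ultimately have "(INF U \<in> {U. openin T U \<and> Kn n \<subseteq> U}. emeasure \<mu> U) < \<infinity>" by simp
    then show ?thesis unfolding INF_less_iff by blast
  qed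
  then obtain V where V: "\<And>n. openin T (V n)" "\<And>n. Kn n \<subseteq> V n" "\<And>n. emeasure \<mu> (V n) < \<infinity>" by metis
  have "(\<Union>n. V n) = topspace T"
    using V(1,2) Kn(2) openin_subset[OF V(1)] by (auto simp: subset_iff) blast
  then have tau: "tau_additive T \<mu>" by (intro radon_tau_additive[OF rad V(1) V(3)])
  have li: "left_invariant \<mu>" by (rule haar_measure_left_invariant[OF \<mu>])
  obtain K where K': "compactin T K" "\<forall>a\<in>carrier G. compactin T ((\<lambda>k. k \<otimes> a) ` K)"
    "\<forall>a\<in>carrier G. 0 < emeasure haar ((\<lambda>k. k \<otimes> a) ` K)"
    "\<forall>M. tau_additive T M \<longrightarrow> left_invariant M \<longrightarrow> emeasure M (space M) \<noteq> 0 \<longrightarrow> emeasure M K \<noteq> 0"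
    by (rule compact_neighbourhood)
  have K: "compactin T K" "emeasure \<mu> K \<noteq> 0"
    using K'(1) K'(4)[rule_format, OF tau li nz] by auto
  have Km: "(indicator K :: 'a \<Rightarrow> ennreal) \<in> borel_measurable (borel_of T)"
    using compact_borel[OF K(1)] by simp
  have "(\<integral>\<^sup>+x. f x \<partial>\<mu>) * (\<integral>\<^sup>+y. indicator K (inv y) \<partial>haar) = (\<integral>\<^sup>+x. indicator K x * (\<integral>\<^sup>+y. f (y \<otimes> x) \<partial>haar) \<partial>\<mu>)"
    by (rule left_invariant_pair[OF tau li tau_additive_haar left_invariant_haar f Km])
  also have "\<dots> = (\<integral>\<^sup>+x. indicator K x * (\<integral>\<^sup>+y. f y \<partial>haar) \<partial>\<mu>)"
    by (rule nn_integral_cong) (use haar_right_invariant[OF f] in \<open>simp add: tau_additive_space[OF tau]\<close>)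
  also have "\<dots> = emeasure \<mu> K * (\<integral>\<^sup>+y. f y \<partial>haar)"
    using compact_borel[OF K(1)] by (subst nn_integral_multc) (auto simp: s tau_additive_measurable[OF tau])
  finally have "(\<integral>\<^sup>+x. f x \<partial>\<mu>) * (\<integral>\<^sup>+y. indicator K (inv y) \<partial>haar) = emeasure \<mu> K * (\<integral>\<^sup>+y. f y \<partial>haar)" .
  moreover have "(\<integral>\<^sup>+y. indicator K (inv y) \<partial>haar) < \<infinity>"
    using haar_inverse[OF Km] haar_compact_finite[OF K(1)] compact_borel[OF K(1)] by (simp add: sets_haar)
  ultimately have "emeasure \<mu> K * (\<integral>\<^sup>+y. f y \<partial>haar) < \<infinity>"
    using fin by (metis ennreal_mult_less_top infinity_ennreal_def)
  then show ?thesis using K(2) by (auto simp: ennreal_mult_less_top)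
qed

section \<open>A Steinhaus lemma\<close>

text \<open>A piece of \<open>L\<close> is approximated from outside by an open \<open>U\<close>.
  The measure of \<open>{y \<in> U. y \<otimes> k \<in> U}\<close> is lower semicontinuous in
  \<open>k\<close>, so near the identity it stays close to that of \<open>U\<close>, and the part of
  \<open>U\<close> outside \<open>L\<close> is too small to account for such an overlap.\<close>

lemma steinhaus:
  assumes L: "L \<in> sets (borel_of T)" "emeasure haar L \<noteq> 0"
  obtains V where "openin T V" "\<one> \<in> V" "\<And>k. k \<in> V \<Longrightarrow> emeasure haar {y \<in> L. y \<otimes> k \<in> L} \<noteq> 0"
proof -
  have Ls: "L \<subseteq> carrier G" using sets.sets_into_space[OF L(1)] by simp
  have "\<exists>i. emeasure haar (L \<inter> W i) \<noteq> 0"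
  proof (rule ccontr)
    assume "\<nexists>i. emeasure haar (L \<inter> W i) \<noteq> 0"
    then have "(\<Union>i. L \<inter> W i) \<in> null_sets haar"
      using L(1) by (intro null_sets_UN) (auto simp: null_sets_def sets_haar)
    moreover have "(\<Union>i. L \<inter> W i) = L" using Ls W_Union by blast
    ultimately show False using L(2) by (simp add: null_sets_def)
  qed
  then obtain i where i: "emeasure haar (L \<inter> W i) \<noteq> 0" by blast
  define L' where "L' = L \<inter> W i"
  have L': "L' \<in> sets (borel_of T)" "inj_on q L'" "L' \<subseteq> W i"
    unfolding L'_def using L(1) by (auto intro: inj_on_subset[OF W_inj[of i]])
  have fm: "A \<in> fmeasurable haar" if "A \<in> sets (borel_of T)" "A \<subseteq> W i" for A
    using that haar_W_finite[of i] emeasure_mono[of A "W i" haar] W_borel[of i]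
    by (auto simp: fmeasurable_def sets_haar)
  \<comment> \<open>A quarter of the measure: \<open>U\<close> will have measure at least
    \<open>4 * e\<close>, whereas a null overlap would force it below \<open>3 * e\<close>.\<close>
  define e where "e = measure haar L' / 4"
  have e: "e > 0"
    using i fm[OF L'(1,3)] unfolding e_def L'_def[symmetric]
    by (auto simp: emeasure_eq_measure2 zero_less_measure_iff)
  \<comment> \<open>Outer regularity is available for \<open>\<nu>\<close> only, so the open set is
    found downstairs and pulled back into \<open>W i\<close>, where \<open>q\<close> is
    injective.\<close>
  have "emeasure \<nu> (q ` L') < emeasure \<nu> (q ` L') + ennreal e"
    using e by (simp add: emeasure_eq_measure ennreal_plus[symmetric] ennreal_less_iff del: ennreal_plus)
  moreover have "emeasure \<nu> (q ` L') = (INF U \<in> {U. openin Xs U \<and> q ` L' \<subseteq> U}. emeasure \<nu> U)"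
    by (rule radon_nu[unfolded radon_measure_def, THEN conjunct2, THEN conjunct2, THEN conjunct1, rule_format])
      (use q_image_borel[OF L'(1)] sets_nu in simp)
  ultimately have "(INF U \<in> {U. openin Xs U \<and> q ` L' \<subseteq> U}. emeasure \<nu> U) < emeasure \<nu> (q ` L') + ennreal e" by simp
  then obtain D where D: "openin Xs D" "q ` L' \<subseteq> D" "emeasure \<nu> D < emeasure \<nu> (q ` L') + ennreal e"
    unfolding INF_less_iff by blast
  define U where "U = W i \<inter> {y \<in> topspace T. q y \<in> D}"
  have U: "openin T U" unfolding U_def
    using W_open openin_continuous_map_preimage[OF continuous_q D(1)] by (intro openin_Int)
  have UW: "U \<subseteq> W i" and LU: "L' \<subseteq> U" and Us: "U \<subseteq> carrier G"
    using L'(3) D(2) openin_subset[OF U] openin_subset[OF W_open[of i]] by (auto simp: U_def)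
  have Ub: "U \<in> sets (borel_of T)" by (rule borel_of_open[OF U])
  have "emeasure haar U = emeasure \<nu> (q ` U)"
    by (rule emeasure_haar_inj[OF Ub inj_on_subset[OF W_inj UW]])
  also have "\<dots> \<le> emeasure \<nu> D"
    using D(1) by (intro emeasure_mono) (auto simp: U_def sets_nu borel_of_open)
  also have "\<dots> < emeasure haar L' + ennreal e" using D(3) emeasure_haar_inj[OF L'(1,2)] by simp
  finally have "ennreal (measure haar U) < ennreal (measure haar L' + e)"
    using e emeasure_eq_measure2[OF fm[OF Ub UW]] emeasure_eq_measure2[OF fm[OF L'(1,3)]] by (simp add: ennreal_plus)
  then have UL: "measure haar U < measure haar L' + e" by (simp add: ennreal_less_iff)
  define P where "P = {p \<in> topspace (prod_topology T T). snd p \<in> U} \<inter> {p \<in> topspace (prod_topology T T). snd p \<otimes> fst p \<in> U}"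
  have P: "openin (prod_topology T T) P"
    unfolding P_def by (intro openin_Int openin_continuous_map_preimage[OF _ U] continuous_intros_group)
  define V where "V = {k \<in> topspace T. ennreal (measure haar U - e) < emeasure haar (Pair k -` P)}"
  have V: "openin T V" unfolding V_def by (rule tau_additive_slice_lsc[OF tau_additive_haar P])
  have Pk: "Pair k -` P = {y \<in> U. y \<otimes> k \<in> U}" if "k \<in> carrier G" for k
    using that Us by (auto simp: P_def)
  have "measure haar U > 0" using UL e measure_mono_fmeasurable[OF LU _ fm[OF Ub UW]] L'(1)
    by (auto simp: e_def sets_haar)
  then have "ennreal (measure haar U - e) < ennreal (measure haar U)" using e by (intro ennreal_lessI) auto
  moreover have "Pair \<one> -` P = U" using Pk[OF one_closed] Us by auto
  ultimately have 1: "\<one> \<in> V" using emeasure_eq_measure2[OF fm[OF Ub UW]] by (simp add: V_def)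
  have "emeasure haar {y \<in> L. y \<otimes> k \<in> L} \<noteq> 0" if k: "k \<in> V" for k
  proof
    assume 0: "emeasure haar {y \<in> L. y \<otimes> k \<in> L} = 0"
    have kc: "k \<in> carrier G" using k by (simp add: V_def)
    have tr: "{y \<in> carrier G. y \<otimes> k \<in> A} \<in> sets (borel_of T) \<and> emeasure haar {y \<in> carrier G. y \<otimes> k \<in> A} = emeasure haar A"
      if A: "A \<in> sets (borel_of T)" for A
    proof -
      have Am: "(indicator A :: 'a \<Rightarrow> ennreal) \<in> borel_measurable (borel_of T)" using A by simp
      have "(\<lambda>y. y \<otimes> k) \<in> measurable (borel_of T) (borel_of T)"
        using kc by (intro continuous_map_measurable continuous_intros_group continuous_map_const_carrier) auto
      from measurable_sets[OF this A] have s: "{y \<in> carrier G. y \<otimes> k \<in> A} \<in> sets (borel_of T)"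
        by (simp add: vimage_def Int_def conj_commute)
      then have "emeasure haar {y \<in> carrier G. y \<otimes> k \<in> A} = (\<integral>\<^sup>+y. indicator {y \<in> carrier G. y \<otimes> k \<in> A} y \<partial>haar)"
        by (simp add: sets_haar)
      also have "\<dots> = (\<integral>\<^sup>+y. indicator A (y \<otimes> k) \<partial>haar)"
        by (rule nn_integral_cong) (simp add: space_haar indicator_def)
      also have "\<dots> = emeasure haar A" using haar_right_invariant[OF Am kc] A by (simp add: sets_haar)
      finally show ?thesis using s by simp
    qed
    define A where "A = {y \<in> L. y \<otimes> k \<in> L}"
    define B where "B = U - L'"
    define C where "C = {y \<in> carrier G. y \<otimes> k \<in> B}"
    have sA: "A \<in> sets haar"
    proof -
      have "A = L \<inter> {y \<in> carrier G. y \<otimes> k \<in> L}" using Ls by (auto simp: A_def)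
      then show ?thesis using tr[OF L(1)] L(1) by (auto simp: sets_haar)
    qed
    have Bb: "B \<in> sets (borel_of T)" "B \<subseteq> W i" using Ub L'(1) UW by (auto simp: B_def)
    have mB: "measure haar B < e"
    proof -
      have "measure haar B = measure haar U - measure haar L'"
        unfolding B_def using fm[OF Ub UW] L'(1) LU
        by (intro measure_Diff) (auto simp: sets_haar fmeasurable_def)
      then show ?thesis using UL by simp
    qed
    have sC: "C \<in> sets haar" and mC: "emeasure haar C = emeasure haar B"
      using tr[OF Bb(1)] by (auto simp: C_def sets_haar)
    have "ennreal (measure haar U - e) < emeasure haar {y \<in> U. y \<otimes> k \<in> U}"
      using k Pk[OF kc] by (simp add: V_def)
    also have "\<dots> \<le> emeasure haar (A \<union> (B \<union> C))"
      using sA Bb(1) sC Us by (intro emeasure_mono) (auto simp: A_def B_def C_def L'_def sets_haar)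
    also have "\<dots> \<le> emeasure haar A + (emeasure haar B + emeasure haar C)"
      using sA Bb(1) sC by (intro order_trans[OF emeasure_subadditive] add_left_mono emeasure_subadditive) (auto simp: sets_haar)
    also have "\<dots> = ennreal (measure haar B + measure haar B)"
      using 0 mC emeasure_eq_measure2[OF fm[OF Bb]] by (simp add: A_def ennreal_plus[symmetric] del: ennreal_plus)
    finally have "ennreal (measure haar U - e) < ennreal (measure haar B + measure haar B)" .
    then have "measure haar U - e < measure haar B + measure haar B"
      by (rule contrapos_pp) (simp add: ennreal_leI not_less)
    moreover have "measure haar L' \<le> measure haar U"
      using measure_mono_fmeasurable[OF LU _ fm[OF Ub UW]] L'(1) by (simp add: sets_haar)
    ultimately show False using mB e by (simp add: e_def)
  qed
  then show ?thesis using that[OF V 1] by blast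
qed

end

section \<open>Ergodicity\<close>

context group_lattice
begin

lemma haar_AE_False: "\<not> (AE x in haar. False)"
  using haar_nonzero AE_iff_measurable[of "space haar" haar "\<lambda>_. False"] by auto

lemma haar_AE_ex: "(AE x in haar. P x) \<Longrightarrow> \<exists>x\<in>carrier G. P x"
proof (rule ccontr)
  assume "AE x in haar. P x" "\<not> (\<exists>x\<in>carrier G. P x)"
  then have "AE x in haar. False" using AE_space by (auto simp: space_haar elim: eventually_mono)
  then show False using haar_AE_False by simp
qed

lemma haar_AE_swap_eq:
  fixes F :: "'a \<Rightarrow> real"
  assumes F: "F \<in> borel_measurable (borel_of T)"
    and f: "continuous_map (prod_topology T T) T (\<lambda>p. f (fst p) (snd p))"
    and f': "continuous_map (prod_topology T T) T (\<lambda>p. f' (fst p) (snd p))"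
    and ae: "\<And>g. g \<in> carrier G \<Longrightarrow> AE y in haar. F (f g y) = F (f' g y)"
  shows "AE y in haar. AE g in haar. F (f g y) = F (f' g y)"
proof -
  have m: "(\<lambda>p. F (f (fst p) (snd p))) \<in> borel_measurable (borel_of (prod_topology T T))"
     "(\<lambda>p. F (f' (fst p) (snd p))) \<in> borel_measurable (borel_of (prod_topology T T))"
    by (intro borel_compose[OF F] f f')+
  have "{p \<in> space (borel_of (prod_topology T T)). F (f (fst p) (snd p)) = F (f' (fst p) (snd p))}
     \<in> sets (borel_of (prod_topology T T))"
    by (intro borel_measurable_eq m)
  then have "{p \<in> topspace (prod_topology T T). F (f (fst p) (snd p)) = F (f' (fst p) (snd p))}
     \<in> sets (borel_of (prod_topology T T))" by simp
  from tau_additive_AE_swap[OF tau_additive_haar tau_additive_haar this]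
  show ?thesis using ae AE_I2[of haar] by (auto simp: space_haar)
qed

text \<open>After the quantifiers are exchanged, a single \<open>y\<close> satisfies the equation
  for almost all \<open>g\<close>. Since inversion and right translation preserve null sets,
  \<open>inv g \<otimes> y\<close> then runs through almost the whole group.\<close>

lemma left_invariant_function_constant:
  fixes F :: "'a \<Rightarrow> real"
  assumes F: "F \<in> borel_measurable (borel_of T)"
    and ae: "\<And>g. g \<in> carrier G \<Longrightarrow> AE y in haar. F (inv g \<otimes> y) = F y"
  obtains c where "AE y in haar. F y = c"
proof -
  have "AE y in haar. AE g in haar. F (inv g \<otimes> y) = F y"
    using ae by (intro haar_AE_swap_eq[OF F] continuous_intros_group) auto
  then obtain y where y: "y \<in> carrier G" "AE g in haar. F (inv g \<otimes> y) = F y"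
    using haar_AE_ex by blast
  have "AE g in haar. F (inv (inv g) \<otimes> y) = F y" by (rule haar_inverse_AE[OF y(2)])
  from haar_AE_right[OF this, of "inv y"] y(1)
  have "AE g in haar. F (inv (inv (g \<otimes> inv y)) \<otimes> y) = F y" by simp
  then have "AE g in haar. F g = F y"
    using AE_space by eventually_elim (use y(1) in \<open>simp add: space_haar m_assoc\<close>)
  then show ?thesis using that by blast
qed

lemma right_invariant_function_constant:
  fixes F :: "'a \<Rightarrow> real"
  assumes F: "F \<in> borel_measurable (borel_of T)"
    and ae: "\<And>g. g \<in> carrier G \<Longrightarrow> AE y in haar. F (y \<otimes> g) = F y"
  obtains c where "AE y in haar. F y = c"
proof -
  have "AE y in haar. AE g in haar. F (y \<otimes> g) = F y"
    using ae by (intro haar_AE_swap_eq[OF F] continuous_intros_group) auto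
  then obtain y where y: "y \<in> carrier G" "AE g in haar. F (y \<otimes> g) = F y"
    using haar_AE_ex by blast
  from haar_AE_left[OF y(2), of "inv y"] y(1)
  have "AE g in haar. F (y \<otimes> (inv y \<otimes> g)) = F y" by simp
  then have "AE g in haar. F g = F y"
    using AE_space by eventually_elim (use y(1) in \<open>simp add: space_haar m_assoc[symmetric]\<close>)
  then show ?thesis using that by blast
qed

text \<open>No continuity or integrability of \<open>F\<close> is at hand, so the Steinhaus lemma
  takes over. Suppose \<open>P\<close> holds for \<open>F y\<close> but not for
  \<open>F (y \<otimes> h)\<close> when \<open>y\<close> is in a non-null set \<open>L\<close>.
  Density gives some \<open>s = k \<otimes> h\<close> in \<open>S\<close> with \<open>k\<close> near
  the identity, and a non-null set of \<open>y\<close> has both \<open>y\<close> and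
  \<open>y \<otimes> k\<close> in \<open>L\<close>; this contradicts
  \<open>F (y \<otimes> s) = F y\<close>.\<close>

lemma right_stabilizer_closed:
  fixes F :: "'a \<Rightarrow> real"
  assumes F: "F \<in> borel_measurable (borel_of T)"
    and S: "\<And>s. s \<in> S \<Longrightarrow> s \<in> carrier G" "\<And>s. s \<in> S \<Longrightarrow> AE y in haar. F (y \<otimes> s) = F y"
    and dense: "\<And>U. openin T U \<Longrightarrow> U \<noteq> {} \<Longrightarrow> S \<inter> U \<noteq> {}"
    and h: "h \<in> carrier G"
  shows "AE y in haar. F (y \<otimes> h) = F y"
proof -
  have Fh: "(\<lambda>y. F (y \<otimes> h)) \<in> borel_measurable (borel_of T)"
    using h by (intro borel_compose[OF F] continuous_intros_group continuous_map_const_carrier) auto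
  have *: "emeasure haar {y \<in> carrier G. P (F y) \<and> \<not> P (F (y \<otimes> h))} = 0"
    if [measurable]: "{x. P x} \<in> sets borel" for P :: "real \<Rightarrow> bool"
  proof (rule ccontr)
    define L where "L = {y \<in> carrier G. P (F y) \<and> \<not> P (F (y \<otimes> h))}"
    assume "emeasure haar {y \<in> carrier G. P (F y) \<and> \<not> P (F (y \<otimes> h))} \<noteq> 0"
    then have nz: "emeasure haar L \<noteq> 0" by (simp add: L_def)
    have "L = (F -` {x. P x} \<inter> space (borel_of T)) - ((\<lambda>y. F (y \<otimes> h)) -` {x. P x} \<inter> space (borel_of T))"
      by (auto simp: L_def)
    then have L: "L \<in> sets (borel_of T)" using measurable_sets[OF F that] measurable_sets[OF Fh that] by (simp only: sets.Diff)
    obtain V where V: "openin T V" "\<one> \<in> V" "\<And>k. k \<in> V \<Longrightarrow> emeasure haar {y \<in> L. y \<otimes> k \<in> L} \<noteq> 0"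
      using steinhaus[OF L nz] by metis
    have "openin T ((\<lambda>k. k \<otimes> h) ` V)" by (rule openin_right_translate[OF h V(1)])
    then obtain s where s: "s \<in> S" "s \<in> (\<lambda>k. k \<otimes> h) ` V" using dense V(2) by blast
    then obtain k where k: "k \<in> V" "s = k \<otimes> h" by blast
    have kc: "k \<in> carrier G" using k(1) openin_subset[OF V(1)] by auto
    have "AE y in haar. \<not> (y \<in> L \<and> y \<otimes> k \<in> L)"
      using S(2)[OF s(1)]
    proof eventually_elim
      case (elim y)
      then show ?case using k(2) kc h by (auto simp: L_def m_assoc)
    qed
    then have "emeasure haar {y \<in> space haar. y \<in> L \<and> y \<otimes> k \<in> L} = 0"
      by (rule emeasure_eq_0_AE)
    moreover have "{y \<in> space haar. y \<in> L \<and> y \<otimes> k \<in> L} = {y \<in> L. y \<otimes> k \<in> L}"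
      by (auto simp: L_def space_haar)
    ultimately have "emeasure haar {y \<in> L. y \<otimes> k \<in> L} = 0" by simp
    then show False using V(3)[OF k(1)] by simp
  qed
  \<comment> \<open>Rational half-lines in both directions separate any two different values, so
    countably many choices of \<open>P\<close> suffice.\<close>
  have 1: "AE y in haar. \<forall>t::rat. \<not> (F y < of_rat t \<and> \<not> F (y \<otimes> h) < of_rat t)"
   and 2: "AE y in haar. \<forall>t::rat. \<not> (F y > of_rat t \<and> \<not> F (y \<otimes> h) > of_rat t)"
    unfolding AE_all_countable
  proof (safe)
    have sub: "AE y in haar. \<not> (P (F y) \<and> \<not> P (F (y \<otimes> h)))" if P: "{x. P x} \<in> sets borel" for P :: "real \<Rightarrow> bool"
    proof -
      have "{y \<in> carrier G. P (F y) \<and> \<not> P (F (y \<otimes> h))}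
         = (F -` {x. P x} \<inter> space (borel_of T)) - ((\<lambda>y. F (y \<otimes> h)) -` {x. P x} \<inter> space (borel_of T))"
        by auto
      then have "{y \<in> carrier G. P (F y) \<and> \<not> P (F (y \<otimes> h))} \<in> sets haar"
        using measurable_sets[OF F P] measurable_sets[OF Fh P] by (simp only: sets.Diff sets_haar)
      then show ?thesis using *[OF P] by (intro AE_I[of _ _ "{y \<in> carrier G. P (F y) \<and> \<not> P (F (y \<otimes> h))}"]) (auto simp: space_haar)
    qed
    show "AE y in haar. \<not> (F y < of_rat t \<and> \<not> F (y \<otimes> h) < of_rat t)" for t
      by (rule sub[of "\<lambda>x. x < of_rat t"]) simp
    show "AE y in haar. \<not> (F y > of_rat t \<and> \<not> F (y \<otimes> h) > of_rat t)" for t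
      by (rule sub[of "\<lambda>x. x > of_rat t"]) simp
  qed
  from 1 2 show ?thesis
  proof eventually_elim
    case (elim y)
    show ?case
    proof (rule ccontr)
      assume "F (y \<otimes> h) \<noteq> F y"
      then consider "F y < F (y \<otimes> h)" | "F (y \<otimes> h) < F y" by linarith
      then show False
      proof cases
        case 1
        then obtain t :: rat where "F y < of_rat t" "of_rat t < F (y \<otimes> h)" using of_rat_dense by blast
        then show False using elim(1) by force
      next
        case 2
        then obtain t :: rat where "F (y \<otimes> h) < of_rat t" "of_rat t < F y" using of_rat_dense by blast
        then show False using elim(2) by force
      qed
    qed
  qed
qed

end

text \<open>The product structure is recorded by endomorphisms \<open>\<pi> i\<close> of the one
  group \<open>G\<close>, the retractions onto its factors, so that everything stays in one carrier.
  \<open>proj_dense\<close> is irreducibility in this language: the products of elements of \<Gamma>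
  with elements of the kernel of \<open>\<pi> i\<close> are dense.\<close>

locale lattice_product = group_lattice G T \<Gamma> \<nu>
  for G :: "'a monoid" (structure) and T :: "'a topology" and \<Gamma> :: "'a set" and \<nu> :: "'a set measure" +
  fixes n :: nat and \<pi> :: "nat \<Rightarrow> 'a \<Rightarrow> 'a"
  assumes n_pos: "n \<ge> 1"
    and proj_hom: "i \<in> {1..n} \<Longrightarrow> \<pi> i \<in> hom G G"
    and proj_continuous: "i \<in> {1..n} \<Longrightarrow> continuous_map T T (\<pi> i)"
    and proj_idem: "i \<in> {1..n} \<Longrightarrow> g \<in> carrier G \<Longrightarrow> \<pi> i (\<pi> i g) = \<pi> i g"
    and proj_commute: "i \<in> {1..n} \<Longrightarrow> j \<in> {1..n} \<Longrightarrow> i \<noteq> j \<Longrightarrow> g \<in> carrier G \<Longrightarrow> h \<in> carrier G \<Longrightarrow>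
      \<pi> i g \<otimes> \<pi> j h = \<pi> j h \<otimes> \<pi> i g"
    and proj_decompose: "g \<in> carrier G \<Longrightarrow> foldr (\<lambda>j h. \<pi> j g \<otimes> h) [1..<Suc n] \<one> = g"
    and proj_dense: "i \<in> {1..n} \<Longrightarrow> openin T U \<Longrightarrow> U \<noteq> {} \<Longrightarrow>
      \<exists>\<gamma>\<in>\<Gamma>. \<exists>b\<in>carrier G. \<pi> i b = \<one> \<and> \<gamma> \<otimes> b \<in> U"
begin

lemma proj_closed [simp]: "i \<in> {1..n} \<Longrightarrow> g \<in> carrier G \<Longrightarrow> \<pi> i g \<in> carrier G"
  using proj_hom by (auto simp: hom_def)

lemma proj_mult: "i \<in> {1..n} \<Longrightarrow> g \<in> carrier G \<Longrightarrow> h \<in> carrier G \<Longrightarrow> \<pi> i (g \<otimes> h) = \<pi> i g \<otimes> \<pi> i h"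
  using proj_hom by (auto simp: hom_def)

lemma proj_inv: "i \<in> {1..n} \<Longrightarrow> g \<in> carrier G \<Longrightarrow> \<pi> i (inv g) = inv (\<pi> i g)"
  using group_hom.hom_inv[of G G "\<pi> i" g] proj_hom by (simp add: group_hom_def group_hom_axioms_def is_group)

lemma continuous_map_proj:
  "i \<in> {1..n} \<Longrightarrow> continuous_map S T f \<Longrightarrow> continuous_map S T (\<lambda>x. \<pi> i (f x))"
  using continuous_map_compose[OF _ proj_continuous] by (simp add: o_def)

lemma decompose_induct:
  assumes g: "g \<in> carrier G" and one: "P \<one>"
    and mult: "\<And>a b. a \<in> carrier G \<Longrightarrow> b \<in> carrier G \<Longrightarrow> P a \<Longrightarrow> P b \<Longrightarrow> P (a \<otimes> b)"
    and proj: "\<And>j. j \<in> {1..n} \<Longrightarrow> P (\<pi> j g)"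
  shows "P g"
proof -
  have "foldr (\<lambda>j h. \<pi> j g \<otimes> h) js \<one> \<in> carrier G \<and> P (foldr (\<lambda>j h. \<pi> j g \<otimes> h) js \<one>)"
    if "set js \<subseteq> {1..n}" for js
    using that by (induction js) (auto intro!: one mult proj simp: g)
  moreover have "set [1..<Suc n] \<subseteq> {1..n}" by auto
  ultimately show ?thesis by (metis proj_decompose[OF g])
qed

text \<open>The pullback \<open>F\<close> of \<open>v\<close> is left invariant under the kernel of
  \<open>\<pi> i\<close>. As the kernel is normal, \<open>F\<close> is also right invariant under
  it, and under \<Gamma> by construction. Products of the two kinds of elements are dense, so
  \<open>right_stabilizer_closed\<close> gives right invariance under the whole group.\<close>

lemma ergodic:
  fixes v :: "'a set \<Rightarrow> real"
  assumes i: "i \<in> {1..n}" and v: "v \<in> borel_measurable (borel_of Xs)"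
    and inv_v: "\<And>j k. j \<in> {1..n} \<Longrightarrow> j \<noteq> i \<Longrightarrow> k \<in> carrier G \<Longrightarrow> AE x in \<nu>. v (inv (\<pi> j k) <# x) = v x"
  obtains c where "AE x in \<nu>. v x = c"
proof -
  have act_m: "(\<lambda>x. v (g <# x)) \<in> borel_measurable (borel_of Xs)" if "g \<in> carrier G" for g
    using that by (intro borel_compose_X[OF v] continuous_map_act) (auto simp: continuous_map_id[unfolded id_def])
  have kernel: "AE x in \<nu>. v (inv b <# x) = v x" if b: "b \<in> carrier G" "\<pi> i b = \<one>" for b
  proof (rule decompose_induct[OF b(1)])
    show "AE x in \<nu>. v (inv \<one> <# x) = v x" by (rule AE_I2) (simp add: space_nu act_one)
    show "AE x in \<nu>. v (inv (\<pi> j b) <# x) = v x" if "j \<in> {1..n}" for j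
    proof (cases "j = i")
      case True
      then show ?thesis using b(2) by (intro AE_I2) (simp add: space_nu act_one)
    next
      case False
      then show ?thesis using inv_v[OF that False b(1)] by simp
    qed
    fix a c assume ac: "a \<in> carrier G" "c \<in> carrier G" "AE x in \<nu>. v (inv a <# x) = v x" "AE x in \<nu>. v (inv c <# x) = v x"
    have "AE x in \<nu>. v (inv c <# (inv a <# x)) = v (inv a <# x)"
      using AE_act[of "inv a", OF _ ac(4)] ac(1) by simp
    with ac(3) AE_space show "AE x in \<nu>. v (inv (a \<otimes> c) <# x) = v x"
      by eventually_elim (use ac in \<open>simp add: space_nu act_act inv_mult_group\<close>)
  qed
  define F where "F y = v (q y)" for y
  have F: "F \<in> borel_measurable (borel_of T)" unfolding F_def by (rule borel_compose_X[OF v continuous_q])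
  have FG: "F (y \<otimes> \<gamma>) = F y" if "y \<in> carrier G" "\<gamma> \<in> \<Gamma>" for y \<gamma> using that by (simp add: F_def)
  have left: "AE y in haar. F (b \<otimes> y) = F y" if b: "b \<in> carrier G" "\<pi> i b = \<one>" for b
  proof -
    have "inv b \<in> carrier G" "\<pi> i (inv b) = \<one>" using b i by (auto simp: proj_inv)
    from kernel[OF this] b have "AE x in \<nu>. v (b <# x) = v x" by simp
    moreover have "{x \<in> topspace Xs. v (b <# x) = v x} \<in> sets (borel_of Xs)"
      using borel_measurable_eq[OF act_m[OF b(1)] v] by simp
    ultimately have "AE y in haar. v (b <# q y) = v (q y)" by (subst AE_haar_iff)
    then show ?thesis using AE_space
      by eventually_elim (use b in \<open>simp add: F_def space_haar act_q\<close>)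
  qed
  \<comment> \<open>The component of \<open>g\<close> in the kernel of \<open>\<pi> i\<close>. It
    parametrises the kernel by the group itself, so that statements about almost all kernel elements
    need no second Haar measure.\<close>
  define \<beta> where "\<beta> g = inv (\<pi> i g) \<otimes> g" for g
  have \<beta>: "\<beta> g \<in> carrier G" "\<pi> i (\<beta> g) = \<one>" if "g \<in> carrier G" for g
    using that i by (auto simp: \<beta>_def proj_mult proj_inv proj_idem)
  have "AE y in haar. AE g in haar. F (\<beta> g \<otimes> y) = F y"
    unfolding \<beta>_def using left[OF \<beta>] unfolding \<beta>_def
    by (intro haar_AE_swap_eq[OF F] continuous_intros_group continuous_map_proj i) auto
  note good = this
  have right: "AE y in haar. F (y \<otimes> b) = F y" if b: "b \<in> carrier G" "\<pi> i b = \<one>" for b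
    using good haar_AE_right[OF good b(1)] AE_space
  proof eventually_elim
    case (elim y)
    then have y: "y \<in> carrier G" by (simp add: space_haar)
    \<comment> \<open>The conjugate of \<open>b\<close> depends on \<open>y\<close>, whereas left
      invariance under one kernel element holds only for almost every \<open>y\<close>. A generic
      \<open>g\<close> bridges this: \<open>\<beta> (g \<otimes> ?b) \<otimes> y\<close> and
      \<open>\<beta> g \<otimes> (y \<otimes> b)\<close> are the same point, and \<open>F\<close> is
      under control at both.\<close>
    let ?b = "y \<otimes> b \<otimes> inv y"
    have bc: "?b \<in> carrier G" using y b by simp
    have "AE g in haar. F (\<beta> (g \<otimes> ?b) \<otimes> y) = F y" by (rule haar_AE_right[OF elim(1) bc])
    with elim(2) have "AE g in haar. F (\<beta> (g \<otimes> ?b) \<otimes> y) = F y \<and> F (\<beta> g \<otimes> (y \<otimes> b)) = F (y \<otimes> b)"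
      by eventually_elim simp
    then obtain g where g: "g \<in> carrier G" "F (\<beta> (g \<otimes> ?b) \<otimes> y) = F y" "F (\<beta> g \<otimes> (y \<otimes> b)) = F (y \<otimes> b)"
      using haar_AE_ex by blast
    have "\<pi> i ?b = \<one>" using y b i by (simp add: proj_mult proj_inv)
    then have "\<beta> (g \<otimes> ?b) = \<beta> g \<otimes> ?b" using g(1) bc i by (simp add: \<beta>_def proj_mult m_assoc)
    then have "\<beta> (g \<otimes> ?b) \<otimes> y = \<beta> g \<otimes> (y \<otimes> b)" using y b \<beta>[OF g(1)] by (simp add: m_assoc)
    then show "F (y \<otimes> b) = F y" using g by simp
  qed
  define S where "S = {\<gamma> \<otimes> b | \<gamma> b. \<gamma> \<in> \<Gamma> \<and> b \<in> carrier G \<and> \<pi> i b = \<one>}"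
  have "AE y in haar. F (y \<otimes> h) = F y" if h: "h \<in> carrier G" for h
  proof (rule right_stabilizer_closed[OF F _ _ _ h, where S = S])
    show "s \<in> carrier G" if "s \<in> S" for s using that Gamma_carrier by (auto simp: S_def)
    show "S \<inter> U \<noteq> {}" if "openin T U" "U \<noteq> {}" for U
      using proj_dense[OF i that] by (auto simp: S_def)
    fix s assume "s \<in> S"
    then obtain \<gamma> b where s: "\<gamma> \<in> \<Gamma>" "b \<in> carrier G" "\<pi> i b = \<one>" "s = \<gamma> \<otimes> b" by (auto simp: S_def)
    have "AE y in haar. F ((y \<otimes> \<gamma>) \<otimes> b) = F (y \<otimes> \<gamma>)"
      by (rule haar_AE_right[OF right[OF s(2,3)] Gamma_carrier[OF s(1)]])
    then show "AE y in haar. F (y \<otimes> s) = F y"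
      using AE_space by eventually_elim (use s Gamma_carrier[OF s(1)] in \<open>simp add: space_haar FG m_assoc\<close>)
  qed
  then obtain c where "AE y in haar. F y = c" using right_invariant_function_constant[OF F] by blast
  then have "AE y in haar. v (q y) = c" by (simp add: F_def)
  moreover have "{x \<in> topspace Xs. v x = c} \<in> sets (borel_of Xs)"
    using borel_measurable_eq[OF v, of "\<lambda>_. c"] by simp
  ultimately have "AE x in \<nu>. v x = c" using AE_haar_iff[of "\<lambda>x. v x = c"] by simp
  then show ?thesis using that by blast
qed

section \<open>Averaging measures\<close>

text \<open>The weight must be strictly positive, to have the null sets of Haar measure, and small
  where \<open>l\<close> is large, since \<open>l\<close> will measure the cocycle. Dividing an
  integrable positive \<open>h\<close> by \<open>1 + l\<close> achieves both.\<close>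

lemma averaging_density:
  fixes l :: "'a \<Rightarrow> ennreal"
  assumes l: "l \<in> borel_measurable (borel_of T)" "\<And>g. g \<in> carrier G \<Longrightarrow> l g < \<infinity>"
  obtains \<rho> where "\<rho> \<in> borel_measurable (borel_of T)" "\<forall>g\<in>carrier G. 0 < \<rho> g \<and> \<rho> g < \<infinity>"
    "(\<integral>\<^sup>+g. \<rho> g \<partial>haar) = 1" "(\<integral>\<^sup>+g. \<rho> g * l g \<partial>haar) < \<infinity>"
proof -
  interpret sigma_finite_measure haar by (rule tau_additive_sigma_finite[OF tau_additive_haar])
  obtain h where h: "h \<in> borel_measurable haar" "integral\<^sup>N haar h \<noteq> \<infinity>"
    "\<And>x. x \<in> space haar \<Longrightarrow> 0 < h x \<and> h x < \<infinity>"
    using Ex_finite_integrable_function by blast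
  have hb[measurable]: "h \<in> borel_measurable (borel_of T)" using h(1) by (simp add: measurable_haar)
  note l(1)[measurable]
  define k where "k g = h g / (1 + l g)" for g
  have k[measurable]: "k \<in> borel_measurable (borel_of T)" unfolding k_def by measurable
  have l1: "1 + l g \<noteq> 0" "1 + l g \<noteq> \<infinity>" if "g \<in> carrier G" for g
    using l(2)[OF that] by (auto simp: add_eq_0_iff_both_eq_0 ennreal_add_eq_top)
  have kp: "0 < k g" "k g \<le> h g" "k g * l g \<le> h g" if g: "g \<in> carrier G" for g
  proof -
    show "0 < k g" using h(3)[of g] g l1[OF g] by (auto simp: k_def ennreal_zero_less_divide space_haar less_top)
    have e: "k g * (1 + l g) = h g"
      unfolding k_def using l1[OF g] 
      by (simp add: mult.commute[of "h g / _"] ennreal_times_divide mult.commute[of _ "h g"] mult_divide_eq_ennreal)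
    have "k g * 1 \<le> k g * (1 + l g)" "k g * l g \<le> k g * (1 + l g)"
      by (intro mult_left_mono; simp)+
    then show "k g \<le> h g" "k g * l g \<le> h g" using e by auto
  qed
  define I where "I = (\<integral>\<^sup>+g. k g \<partial>haar)"
  have "I \<le> integral\<^sup>N haar h" unfolding I_def by (rule nn_integral_mono) (simp add: kp space_haar)
  then have I_fin: "I < \<infinity>" using h(2) by (auto simp: less_top[symmetric] top_unique)
  have I_pos: "0 < I"
  proof (rule ccontr)
    assume "\<not> 0 < I"
    then have "AE g in haar. k g = 0"
      unfolding I_def using k by (subst nn_integral_0_iff_AE[symmetric]) (auto simp: measurable_haar)
    then obtain g where "g \<in> carrier G" "k g = 0" using haar_AE_ex by blast
    then show False using kp(1)[of g] by simp
  qed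
  define \<rho> where "\<rho> g = k g / I" for g
  have "\<rho> \<in> borel_measurable (borel_of T)" unfolding \<rho>_def by measurable
  moreover have "\<forall>g\<in>carrier G. 0 < \<rho> g \<and> \<rho> g < \<infinity>"
  proof
    fix g assume g: "g \<in> carrier G"
    have "k g < \<infinity>" using kp(2)[OF g] h(3)[of g] g by (simp add: space_haar order.strict_trans1)
    then show "0 < \<rho> g \<and> \<rho> g < \<infinity>"
      using kp(1)[OF g] I_fin I_pos
      by (auto simp: \<rho>_def ennreal_zero_less_divide ennreal_divide_eq_top_iff less_top[symmetric])
  qed
  moreover have "(\<integral>\<^sup>+g. \<rho> g \<partial>haar) = 1"
    unfolding \<rho>_def using I_fin I_pos k by (subst nn_integral_divide) (auto simp: I_def[symmetric] measurable_haar)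
  moreover have "(\<integral>\<^sup>+g. \<rho> g * l g \<partial>haar) < \<infinity>"
  proof -
    have "(\<integral>\<^sup>+g. \<rho> g * l g \<partial>haar) \<le> (\<integral>\<^sup>+g. h g / I \<partial>haar)"
    proof (rule nn_integral_mono)
      fix g assume "g \<in> space haar"
      then have "k g * l g \<le> h g" by (simp add: kp space_haar)
      then show "\<rho> g * l g \<le> h g / I"
        using divide_right_mono_ennreal[of "k g * l g" "h g" I] by (simp add: \<rho>_def divide_ennreal_def mult_ac)
    qed
    also have "\<dots> = integral\<^sup>N haar h / I" using h(1) by (rule nn_integral_divide)
    also have "\<dots> < \<infinity>" using h(2) I_pos by (auto simp: less_top[symmetric] ennreal_divide_eq_top_iff)
    finally show ?thesis .
  qed
  ultimately show ?thesis by (rule that)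
qed

end

locale averaging = lattice_product G T \<Gamma> \<nu> n \<pi>
  for G :: "'a monoid" (structure) and T :: "'a topology" and \<Gamma> :: "'a set" and \<nu> :: "'a set measure"
    and n :: nat and \<pi> :: "nat \<Rightarrow> 'a \<Rightarrow> 'a" +
  fixes \<rho> :: "'a \<Rightarrow> ennreal"
  assumes rho_measurable: "\<rho> \<in> borel_measurable (borel_of T)"
    and rho_pos: "g \<in> carrier G \<Longrightarrow> 0 < \<rho> g \<and> \<rho> g < \<infinity>"
    and rho_total: "(\<integral>\<^sup>+g. \<rho> g \<partial>haar) = 1"
begin

definition avg :: "'a measure" where "avg = density haar \<rho>"

lemma rho_haar: "\<rho> \<in> borel_measurable haar"
  using rho_measurable by (simp add: measurable_haar)

lemma sets_avg: "sets avg = sets (borel_of T)"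
  by (simp add: avg_def sets_haar)

lemma space_avg: "space avg = carrier G"
  by (simp add: avg_def space_haar)

lemma measurable_avg: "measurable avg L = measurable (borel_of T) L"
  by (rule measurable_cong_sets[OF sets_avg refl])

lemma emeasure_avg_space: "emeasure avg (space avg) = 1"
proof -
  have "emeasure avg (space avg) = (\<integral>\<^sup>+g. \<rho> g * indicator (space haar) g \<partial>haar)"
    using rho_haar by (simp add: avg_def emeasure_density)
  also have "\<dots> = (\<integral>\<^sup>+g. \<rho> g \<partial>haar)" by (rule nn_integral_cong) simp
  finally show ?thesis by (simp add: rho_total)
qed

sublocale avg: finite_measure avg
  by (rule finite_measureI) (simp add: emeasure_avg_space)

lemma measure_avg_space [simp]: "measure avg (space avg) = 1"
  using emeasure_avg_space by (simp add: measure_def)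

lemma tau_additive_avg: "tau_additive T avg"
  unfolding avg_def
proof (rule tau_additive_density[OF tau_additive_haar rho_haar])
  show "sigma_finite_measure (density haar \<rho>)"
    using avg.sigma_finite_measure_axioms by (simp add: avg_def)
qed

lemma AE_avg: "(AE g in avg. P g) \<longleftrightarrow> (AE g in haar. P g)"
  unfolding avg_def AE_density[OF rho_haar]
  by (rule AE_cong) (use rho_pos in \<open>simp add: space_haar\<close>)

lemma full_overlap:
  assumes "AE g in avg. \<theta> g" and k: "k \<in> carrier G"
  shows "\<exists>g\<in>carrier G. \<theta> g \<and> \<theta> (k \<otimes> g)"
proof -
  have 1: "AE g in haar. \<theta> g" using assms(1) by (simp add: AE_avg)
  have "AE g in haar. \<theta> g \<and> \<theta> (k \<otimes> g)"
    using 1 haar_AE_left[OF 1 k] by eventually_elim simp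
  then show ?thesis using haar_AE_ex by blast
qed

text \<open>\<open>avg\<close> is not invariant, so smallness of the complement is transferred to
  Haar measure on the compact set \<open>Q\<close>, where the density is bounded below off a small
  set. The bound \<open>\<tau>\<close> serves all of \<open>K\<close> at once, as the spectral gap
  requires.\<close>

lemma compact_overlap:
  assumes K: "compactin T K"
  obtains \<tau> where "0 < \<tau>" "\<forall>\<theta>\<in>sets (borel_of T). emeasure avg (carrier G - \<theta>) < ennreal \<tau> \<longrightarrow>
     (\<forall>k\<in>K. \<exists>g\<in>\<theta>. k \<otimes> g \<in> \<theta>)"
proof -
  obtain L where L: "compactin T L" "\<forall>a\<in>carrier G. compactin T ((\<lambda>k. k \<otimes> a) ` L)"
    "\<forall>a\<in>carrier G. 0 < emeasure haar ((\<lambda>k. k \<otimes> a) ` L)"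
    "\<forall>M. tau_additive T M \<longrightarrow> left_invariant M \<longrightarrow> emeasure M (space M) \<noteq> 0 \<longrightarrow> emeasure M L \<noteq> 0"
    by (rule compact_neighbourhood)
  have Lpos: "emeasure haar L \<noteq> 0"
    using L(4) tau_additive_haar left_invariant_haar haar_nonzero by blast
  define Q where "Q = L \<union> (\<lambda>(x, y). x \<otimes> y) ` (K \<times> L)"
  have Q: "compactin T Q" unfolding Q_def by (intro compactin_Un L(1) compactin_mult K)
  have Ls: "L \<subseteq> carrier G" and Ks: "K \<subseteq> carrier G" and Qs: "Q \<subseteq> carrier G"
    using compactin_subset_topspace[OF L(1)] compactin_subset_topspace[OF K] compactin_subset_topspace[OF Q] by simp_all
  have Lb: "L \<in> sets (borel_of T)" and Qb: "Q \<in> sets (borel_of T)" using L(1) Q by (auto intro: compact_borel)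
  have Qfin: "emeasure haar Q < \<infinity>" by (rule haar_compact_finite[OF Q])
  have Lfin: "emeasure haar L < \<infinity>" by (rule haar_compact_finite[OF L(1)])
  \<comment> \<open>\<open>L\<close> has measure \<open>4 * \<delta>\<close>. The part
    \<open>B\<close> of \<open>Q\<close> outside \<open>\<theta>\<close> will have measure below
    \<open>2 * \<delta>\<close>, and if \<open>\<theta>\<close> contained no pair \<open>g\<close>,
    \<open>k \<otimes> g\<close>, then \<open>B\<close> and a translate of it would cover
    \<open>L\<close>.\<close>
  define \<delta> where "\<delta> = measure haar L / 4"
  have eL: "emeasure haar L = ennreal (measure haar L)" using Lfin by (intro emeasure_eq_ennreal_measure) auto
  then have \<delta>: "\<delta> > 0" using Lpos by (auto simp: \<delta>_def zero_less_measure_iff)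
  \<comment> \<open>Because \<open>\<rho>\<close> is positive, these sets decrease to the empty set
    inside \<open>Q\<close>, which has finite measure; so some \<open>Z m\<close> has measure below
    \<open>\<delta>\<close>.\<close>
  define Z where "Z m = {g \<in> Q. \<rho> g < ennreal (1 / real (Suc m))}" for m
  have Zs: "Z m \<in> sets haar" for m
  proof -
    have "Z m = Q \<inter> (\<rho> -` {..<ennreal (1 / real (Suc m))} \<inter> space haar)"
      using Qs by (auto simp: Z_def space_haar)
    then show ?thesis using measurable_sets[OF rho_haar, of "{..<ennreal (1 / real (Suc m))}"] Qb
      by (simp add: sets_haar)
  qed
  have "(\<lambda>m. emeasure haar (Z m)) \<longlonglongrightarrow> emeasure haar (\<Inter>m. Z m)"
  proof (rule Lim_emeasure_decseq)
    show "decseq Z"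
    proof (rule decseq_SucI)
      fix m
      have "ennreal (1 / real (Suc (Suc m))) \<le> ennreal (1 / real (Suc m))"
        by (intro ennreal_leI) (simp add: field_simps)
      then show "Z (Suc m) \<subseteq> Z m" by (auto simp: Z_def intro: order.strict_trans2)
    qed
    show "emeasure haar (Z m) \<noteq> \<infinity>" for m
      using emeasure_mono[of "Z m" Q haar] Qfin Qb by (auto simp: Z_def sets_haar top_unique)
  qed (use Zs in auto)
  moreover have "(\<Inter>m. Z m) = {}"
  proof (rule ccontr)
    assume "(\<Inter>m. Z m) \<noteq> {}"
    then obtain g where g: "\<And>m. g \<in> Z m" by blast
    then have gc: "g \<in> carrier G" using Qs by (auto simp: Z_def)
    obtain r where r: "\<rho> g = ennreal r" "0 \<le> r" using rho_pos[OF gc] by (cases "\<rho> g") auto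
    then have "0 < r" using rho_pos[OF gc] by (cases "r = 0") auto
    then obtain m where "1 / real (Suc m) < r" using nat_approx_posE by blast
    then show False using g[of m] r by (simp add: Z_def ennreal_less_iff)
  qed
  ultimately have "(\<lambda>m. emeasure haar (Z m)) \<longlonglongrightarrow> 0" by simp
  then have "\<forall>\<^sub>F m in sequentially. emeasure haar (Z m) < ennreal \<delta>"
    by (rule order_tendstoD) (use \<delta> in simp)
  then obtain m where m: "emeasure haar (Z m) < ennreal \<delta>" by (auto simp: eventually_sequentially)
  define r where "r = 1 / real (Suc m)"
  have r: "r > 0" by (simp add: r_def)
  show ?thesis
  proof (rule that[of "\<delta> * r"])
    show "0 < \<delta> * r" using \<delta> r by simp
    show "\<forall>\<theta>\<in>sets (borel_of T). emeasure avg (carrier G - \<theta>) < ennreal (\<delta> * r) \<longrightarrow>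
       (\<forall>k\<in>K. \<exists>g\<in>\<theta>. k \<otimes> g \<in> \<theta>)"
    proof (intro ballI impI)
      fix \<theta> k assume \<theta>: "\<theta> \<in> sets (borel_of T)" and small: "emeasure avg (carrier G - \<theta>) < ennreal (\<delta> * r)" and k: "k \<in> K"
      define B where "B = Q - \<theta>"
      have B: "B \<in> sets (borel_of T)" using Qb \<theta> by (auto simp: B_def)
      have C: "carrier G - \<theta> \<in> sets haar" using sets.compl_sets[OF \<theta>] by (simp add: sets_haar)
      have "ennreal r * emeasure haar (B - Z m) \<le> emeasure avg (carrier G - \<theta>)"
      proof -
        have "ennreal r * emeasure haar (B - Z m) = (\<integral>\<^sup>+g. ennreal r * indicator (B - Z m) g \<partial>haar)"
          using B Zs by (subst nn_integral_cmult_indicator) (auto simp: sets_haar)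
        also have "\<dots> \<le> (\<integral>\<^sup>+g. \<rho> g * indicator (carrier G - \<theta>) g \<partial>haar)"
          by (rule nn_integral_mono) (auto simp: indicator_def B_def Z_def r_def space_haar not_less)
        also have "\<dots> = emeasure avg (carrier G - \<theta>)" unfolding avg_def using C by (simp add: emeasure_density[OF rho_haar])
        finally show ?thesis .
      qed
      with small have *: "ennreal r * emeasure haar (B - Z m) < ennreal (\<delta> * r)" by simp
      have "emeasure haar (B - Z m) < ennreal \<delta>"
      proof (rule ccontr)
        assume "\<not> ?thesis"
        then have "ennreal r * ennreal \<delta> \<le> ennreal r * emeasure haar (B - Z m)" by (intro mult_left_mono) auto
        then show False using * r \<delta> by (simp add: ennreal_mult[symmetric] mult.commute)
      qed
      have "emeasure haar B \<le> emeasure haar ((B - Z m) \<union> Z m)"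
        using B Zs by (intro emeasure_mono) (auto simp: sets_haar)
      also have "\<dots> \<le> emeasure haar (B - Z m) + emeasure haar (Z m)"
        using B Zs by (intro emeasure_subadditive) (auto simp: sets_haar)
      also have "\<dots> < ennreal \<delta> + ennreal \<delta>" by (intro add_strict_mono m) fact
      finally have Bsmall: "emeasure haar B < ennreal (2 * \<delta>)" using \<delta> by (simp add: ennreal_plus[symmetric] del: ennreal_plus)
      show "\<exists>g\<in>\<theta>. k \<otimes> g \<in> \<theta>"
      proof (rule ccontr)
        assume no: "\<not> (\<exists>g\<in>\<theta>. k \<otimes> g \<in> \<theta>)"
        have kc: "k \<in> carrier G" using k Ks by blast
        define D where "D = (\<lambda>u. inv k \<otimes> u) ` B"
        have D: "emeasure haar D = emeasure haar B" "D \<in> sets (borel_of T)"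
          unfolding D_def by (rule left_invariant_emeasure[OF left_invariant_haar sets_haar _ B]; use kc in simp)+
        have "L \<subseteq> B \<union> D"
        proof
          fix g assume g: "g \<in> L"
          then have gc: "g \<in> carrier G" using Ls by blast
          show "g \<in> B \<union> D"
          proof (cases "g \<in> \<theta>")
            case True
            then have "k \<otimes> g \<notin> \<theta>" using no by blast
            moreover have "k \<otimes> g \<in> Q" using g k by (auto simp: Q_def)
            ultimately have "k \<otimes> g \<in> B" by (simp add: B_def)
            moreover have "g = inv k \<otimes> (k \<otimes> g)" using gc kc by (simp add: m_assoc[symmetric])
            ultimately show ?thesis unfolding D_def by blast
          qed (use g in \<open>simp add: B_def Q_def\<close>)
        qed
        then have "emeasure haar L \<le> emeasure haar (B \<union> D)"
          using B D by (intro emeasure_mono) (auto simp: sets_haar)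
        also have "\<dots> \<le> emeasure haar B + emeasure haar D"
          using B D by (intro emeasure_subadditive) (auto simp: sets_haar)
        also have "\<dots> < ennreal (2 * \<delta>) + ennreal (2 * \<delta>)" unfolding D(1) by (intro add_strict_mono Bsmall)
        also have "\<dots> = ennreal (4 * \<delta>)" using \<delta> by (simp add: ennreal_plus[symmetric] del: ennreal_plus)
        finally show False using eL by (simp add: \<delta>_def)
      qed
    qed
  qed
qed

section \<open>Averaging operators\<close>

text \<open>\<open>g\<close> runs over the whole group but acts only through its \<open>j\<close>-th
  component, so one probability measure serves all factors. Where the slice is not integrable the
  value is \<open>0\<close>; for integrable \<open>v\<close> this concerns a null set of
  \<open>x\<close>.\<close>

definition P :: "nat \<Rightarrow> ('a set \<Rightarrow> real) \<Rightarrow> 'a set \<Rightarrow> real" where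
  "P j v x = (\<integral>g. v (inv (\<pi> j g) <# x) \<partial>avg)"

lemma continuous_shift:
  assumes "j \<in> {1..n}" "continuous_map S T f" "continuous_map S Xs h"
  shows "continuous_map S Xs (\<lambda>s. inv (\<pi> j (f s)) <# h s)"
  using assms by (intro continuous_map_act continuous_map_inv continuous_map_proj)

lemma shift_measurable:
  assumes j: "j \<in> {1..n}" and v: "v \<in> measurable (borel_of Xs) L"
  shows "(\<lambda>(x, g). v (inv (\<pi> j g) <# x)) \<in> measurable (borel_of (prod_topology Xs T)) L"
    and "(\<lambda>(g, x). v (inv (\<pi> j g) <# x)) \<in> measurable (borel_of (prod_topology T Xs)) L"
  unfolding case_prod_unfold
  by (intro borel_compose_X[OF v] continuous_shift[OF j] continuous_map_fst continuous_map_snd)+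

lemma act_borel:
  assumes "v \<in> measurable (borel_of Xs) L" "g \<in> carrier G"
  shows "(\<lambda>x. v (g <# x)) \<in> measurable (borel_of Xs) L"
  using assms(2) by (intro borel_compose_X[OF assms(1)] continuous_map_act) (auto simp: continuous_map_id[unfolded id_def])

lemma slice_borel:
  assumes "j \<in> {1..n}" "v \<in> measurable (borel_of Xs) L" "x \<in> topspace Xs"
  shows "(\<lambda>g. v (inv (\<pi> j g) <# x)) \<in> measurable (borel_of T) L"
  using assms(1,3) by (intro borel_compose_X[OF assms(2)] continuous_shift) (auto simp: continuous_map_id[unfolded id_def])

text \<open>Each translation preserves \<open>\<nu>\<close>, and \<open>avg\<close> has mass
  \<open>1\<close>. Applied to absolute values it yields integrability of almost every slice and the
  contraction property in \<open>L\<^sup>1\<close>.\<close>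

lemma nn_integral_shift:
  fixes f :: "'a set \<Rightarrow> ennreal"
  assumes j: "j \<in> {1..n}" and f: "f \<in> borel_measurable (borel_of Xs)"
  shows "(\<integral>\<^sup>+x. \<integral>\<^sup>+g. f (inv (\<pi> j g) <# x) \<partial>avg \<partial>\<nu>) = (\<integral>\<^sup>+x. f x \<partial>\<nu>)"
    and "(\<lambda>x. \<integral>\<^sup>+g. f (inv (\<pi> j g) <# x) \<partial>avg) \<in> borel_measurable (borel_of Xs)"
proof -
  have "(\<integral>\<^sup>+x. \<integral>\<^sup>+g. f (inv (\<pi> j g) <# x) \<partial>avg \<partial>\<nu>) = (\<integral>\<^sup>+g. \<integral>\<^sup>+x. f (inv (\<pi> j g) <# x) \<partial>\<nu> \<partial>avg)"
    by (rule tau_additive_Tonelli(3)[OF tau_additive_nu tau_additive_avg shift_measurable(1)[OF j f]])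
  also have "\<dots> = (\<integral>\<^sup>+g. \<integral>\<^sup>+x. f x \<partial>\<nu> \<partial>avg)"
    by (intro nn_integral_cong nn_integral_act f) (use j in \<open>simp add: space_avg\<close>)
  also have "\<dots> = (\<integral>\<^sup>+x. f x \<partial>\<nu>)" by (simp add: emeasure_avg_space)
  finally show "(\<integral>\<^sup>+x. \<integral>\<^sup>+g. f (inv (\<pi> j g) <# x) \<partial>avg \<partial>\<nu>) = (\<integral>\<^sup>+x. f x \<partial>\<nu>)" .
  show "(\<lambda>x. \<integral>\<^sup>+g. f (inv (\<pi> j g) <# x) \<partial>avg) \<in> borel_measurable (borel_of Xs)"
    using tau_additive_Tonelli(1)[OF tau_additive_nu tau_additive_avg shift_measurable(1)[OF j f]]
    by (simp add: measurable_nu)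
qed

lemma integrable_borel: "integrable \<nu> v \<Longrightarrow> v \<in> borel_measurable (borel_of Xs)"
  using borel_measurable_integrable measurable_nu by blast

lemma P_borel:
  assumes "j \<in> {1..n}" "v \<in> borel_measurable (borel_of Xs)"
  shows "P j v \<in> borel_measurable (borel_of Xs)"
  using tau_additive_integral_measurable[OF tau_additive_nu tau_additive_avg shift_measurable(1)[OF assms]]
  unfolding P_def by (simp add: measurable_nu)

lemma P_Fubini:
  assumes j: "j \<in> {1..n}" and v: "integrable \<nu> v"
  shows "AE x in \<nu>. integrable avg (\<lambda>g. v (inv (\<pi> j g) <# x))"
    and "integrable \<nu> (P j v)" and "(\<integral>x. P j v x \<partial>\<nu>) = (\<integral>x. v x \<partial>\<nu>)"
    and "(\<integral>x. \<bar>P j v x\<bar> \<partial>\<nu>) \<le> (\<integral>x. \<bar>v x\<bar> \<partial>\<nu>)"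
proof -
  have vb: "v \<in> borel_measurable (borel_of Xs)" by (rule integrable_borel[OF v])
  have nb: "(\<lambda>x. ennreal \<bar>v x\<bar>) \<in> borel_measurable (borel_of Xs)" using vb by measurable
  have eq: "(\<integral>\<^sup>+x. \<integral>\<^sup>+g. ennreal \<bar>v (inv (\<pi> j g) <# x)\<bar> \<partial>avg \<partial>\<nu>) = (\<integral>\<^sup>+x. ennreal \<bar>v x\<bar> \<partial>\<nu>)"
    by (rule nn_integral_shift(1)[OF j nb])
  also have "\<dots> < \<infinity>" using v by (simp add: integrable_iff_bounded)
  finally have fin: "(\<integral>\<^sup>+x. \<integral>\<^sup>+g. ennreal \<bar>v (inv (\<pi> j g) <# x)\<bar> \<partial>avg \<partial>\<nu>) < \<infinity>" .
  note F = tau_additive_Fubini[OF tau_additive_nu tau_additive_avg shift_measurable(1)[OF j vb] fin]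
  show "AE x in \<nu>. integrable avg (\<lambda>g. v (inv (\<pi> j g) <# x))" by (rule F(1))
  show i: "integrable \<nu> (P j v)" using F(2) unfolding P_def .
  have "(\<integral>x. P j v x \<partial>\<nu>) = (\<integral>g. \<integral>x. v (inv (\<pi> j g) <# x) \<partial>\<nu> \<partial>avg)"
    using F(3) unfolding P_def .
  also have "\<dots> = (\<integral>g. \<integral>x. v x \<partial>\<nu> \<partial>avg)"
    by (intro Bochner_Integration.integral_cong refl integral_act vb) (use j in \<open>simp add: space_avg\<close>)
  finally show "(\<integral>x. P j v x \<partial>\<nu>) = (\<integral>x. v x \<partial>\<nu>)" by simp
  have "ennreal (\<integral>x. \<bar>P j v x\<bar> \<partial>\<nu>) = (\<integral>\<^sup>+x. ennreal \<bar>P j v x\<bar> \<partial>\<nu>)"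
    using i by (intro nn_integral_eq_integral[symmetric]) auto
  also have "\<dots> \<le> (\<integral>\<^sup>+x. \<integral>\<^sup>+g. ennreal \<bar>v (inv (\<pi> j g) <# x)\<bar> \<partial>avg \<partial>\<nu>)"
  proof (rule nn_integral_mono)
    fix x
    show "ennreal \<bar>P j v x\<bar> \<le> (\<integral>\<^sup>+g. ennreal \<bar>v (inv (\<pi> j g) <# x)\<bar> \<partial>avg)"
      using integral_norm_bound_ennreal[of avg "\<lambda>g. v (inv (\<pi> j g) <# x)"]
      by (cases "integrable avg (\<lambda>g. v (inv (\<pi> j g) <# x))") (auto simp: P_def not_integrable_integral_eq)
  qed
  also have "\<dots> = ennreal (\<integral>x. \<bar>v x\<bar> \<partial>\<nu>)" unfolding eq using v by (intro nn_integral_eq_integral) auto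
  finally show "(\<integral>x. \<bar>P j v x\<bar> \<partial>\<nu>) \<le> (\<integral>x. \<bar>v x\<bar> \<partial>\<nu>)" by simp
qed

lemma P_diff:
  assumes j: "j \<in> {1..n}" and u: "integrable \<nu> u" and v: "integrable \<nu> v"
  shows "AE x in \<nu>. P j (\<lambda>x. u x - v x) x = P j u x - P j v x"
  using P_Fubini(1)[OF j u] P_Fubini(1)[OF j v]
  by eventually_elim (simp add: P_def)

lemma P_add:
  assumes j: "j \<in> {1..n}" and u: "integrable \<nu> u" and v: "integrable \<nu> v"
  shows "AE x in \<nu>. P j (\<lambda>x. u x + v x) x = P j u x + P j v x"
  using P_Fubini(1)[OF j u] P_Fubini(1)[OF j v]
  by eventually_elim (simp add: P_def)

lemma AE_zero_if_integral_abs: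
  fixes v :: "'b \<Rightarrow> real"
  assumes "integrable M v" "(\<integral>x. \<bar>v x\<bar> \<partial>M) \<le> 0"
  shows "AE x in M. v x = 0"
proof -
  have "(\<integral>x. \<bar>v x\<bar> \<partial>M) = 0" using assms(2) by (intro antisym) auto
  then have "AE x in M. \<bar>v x\<bar> = 0"
    using assms(1) by (subst integral_nonneg_eq_0_iff_AE[symmetric]) auto
  then show ?thesis by simp
qed

lemma P_cong_AE:
  assumes j: "j \<in> {1..n}" and u: "integrable \<nu> u" and v: "integrable \<nu> v" and ae: "AE x in \<nu>. u x = v x"
  shows "AE x in \<nu>. P j u x = P j v x"
proof -
  have d: "integrable \<nu> (\<lambda>x. u x - v x)" using u v by simp
  have "(\<integral>x. \<bar>P j (\<lambda>x. u x - v x) x\<bar> \<partial>\<nu>) \<le> (\<integral>x. \<bar>u x - v x\<bar> \<partial>\<nu>)" by (rule P_Fubini(4)[OF j d])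
  also have "\<dots> = (\<integral>x. 0 \<partial>\<nu>)" using ae u v by (intro integral_cong_AE) auto
  finally have "AE x in \<nu>. P j (\<lambda>x. u x - v x) x = 0"
    by (intro AE_zero_if_integral_abs P_Fubini(2)[OF j d]) simp
  with P_diff[OF j u v] show ?thesis by eventually_elim simp
qed

text \<open>Elements of different factors commute. \<open>H\<close> is kept general because the same
  exchange serves the operators \<open>P\<close> and the averaged cocycle. For \<open>i = j\<close>
  the two sides differ only in the names of bound variables.\<close>

lemma average_swap:
  fixes H :: "'a \<Rightarrow> 'a set \<Rightarrow> real"
  assumes i: "i \<in> {1..n}" and j: "j \<in> {1..n}" and x: "x \<in> topspace Xs"
    and H: "case_prod H \<in> borel_measurable (borel_of (prod_topology T Xs))"
    and fin: "(\<integral>\<^sup>+g. \<integral>\<^sup>+h. ennreal \<bar>H (\<pi> i g \<otimes> \<pi> j h) x\<bar> \<partial>avg \<partial>avg) < \<infinity>"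
  shows "(\<integral>g. \<integral>h. H (\<pi> i g \<otimes> \<pi> j h) x \<partial>avg \<partial>avg) = (\<integral>h. \<integral>g. H (\<pi> j h \<otimes> \<pi> i g) x \<partial>avg \<partial>avg)"
proof (cases "i = j")
  case False
  have "(\<lambda>(g, h). H (\<pi> i g \<otimes> \<pi> j h) x) \<in> borel_measurable (borel_of (prod_topology T T))"
  proof -
    have "continuous_map (prod_topology T T) (prod_topology T Xs) (\<lambda>p. (\<pi> i (fst p) \<otimes> \<pi> j (snd p), x))"
      using x i j by (intro continuous_intros_group continuous_map_proj) auto
    from measurable_compose[OF continuous_map_measurable[OF this] H] show ?thesis by (simp add: case_prod_unfold)
  qed
  from tau_additive_Fubini(3)[OF tau_additive_avg tau_additive_avg this fin]
  have "(\<integral>g. \<integral>h. H (\<pi> i g \<otimes> \<pi> j h) x \<partial>avg \<partial>avg) = (\<integral>h. \<integral>g. H (\<pi> i g \<otimes> \<pi> j h) x \<partial>avg \<partial>avg)" .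
  also have "\<dots> = (\<integral>h. \<integral>g. H (\<pi> j h \<otimes> \<pi> i g) x \<partial>avg \<partial>avg)"
    using proj_commute[OF i j False] by (intro Bochner_Integration.integral_cong refl) (simp add: space_avg)
  finally show ?thesis .
qed simp

lemma P_commute:
  assumes i: "i \<in> {1..n}" and j: "j \<in> {1..n}" and v: "integrable \<nu> v"
  shows "AE x in \<nu>. P i (P j v) x = P j (P i v) x"
proof -
  have vb: "v \<in> borel_measurable (borel_of Xs)" by (rule integrable_borel[OF v])
  have nb: "(\<lambda>x. ennreal \<bar>v x\<bar>) \<in> borel_measurable (borel_of Xs)" using vb by measurable
  have H: "case_prod (\<lambda>g x. v (inv g <# x)) \<in> borel_measurable (borel_of (prod_topology T Xs))"
    unfolding case_prod_unfold by (intro borel_compose_X[OF vb] continuous_map_act continuous_intros_group)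
  have "(\<integral>\<^sup>+x. \<integral>\<^sup>+g. \<integral>\<^sup>+h. ennreal \<bar>v (inv (\<pi> j h) <# (inv (\<pi> i g) <# x))\<bar> \<partial>avg \<partial>avg \<partial>\<nu>) = (\<integral>\<^sup>+x. ennreal \<bar>v x\<bar> \<partial>\<nu>)"
    using nn_integral_shift(1)[OF i nn_integral_shift(2)[OF j nb]] nn_integral_shift(1)[OF j nb] by simp
  also have "\<dots> \<noteq> \<infinity>" using v by (auto simp: integrable_iff_bounded)
  finally have "AE x in \<nu>. (\<integral>\<^sup>+g. \<integral>\<^sup>+h. ennreal \<bar>v (inv (\<pi> j h) <# (inv (\<pi> i g) <# x))\<bar> \<partial>avg \<partial>avg) \<noteq> \<infinity>"
    using nn_integral_shift(2)[OF i nn_integral_shift(2)[OF j nb]]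
    by (intro nn_integral_PInf_AE) (simp_all add: measurable_nu)
  then show ?thesis
    using AE_space
  proof eventually_elim
    case (elim x)
    then have x: "x \<in> topspace Xs" by (simp add: space_nu)
    have eq: "inv (\<pi> l h) <# (inv (\<pi> k g) <# x) = inv (\<pi> k g \<otimes> \<pi> l h) <# x"
      if "k \<in> {1..n}" "l \<in> {1..n}" "g \<in> carrier G" "h \<in> carrier G" for k l g h
      using that x by (simp add: act_act inv_mult_group)
    have "P i (P j v) x = (\<integral>g. \<integral>h. v (inv (\<pi> i g \<otimes> \<pi> j h) <# x) \<partial>avg \<partial>avg)"
      unfolding P_def by (intro Bochner_Integration.integral_cong refl) (simp add: space_avg eq[OF i j])
    also have "\<dots> = (\<integral>h. \<integral>g. v (inv (\<pi> j h \<otimes> \<pi> i g) <# x) \<partial>avg \<partial>avg)"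
    proof (rule average_swap[OF i j x H])
      have "(\<integral>\<^sup>+g. \<integral>\<^sup>+h. ennreal \<bar>v (inv (\<pi> i g \<otimes> \<pi> j h) <# x)\<bar> \<partial>avg \<partial>avg)
         = (\<integral>\<^sup>+g. \<integral>\<^sup>+h. ennreal \<bar>v (inv (\<pi> j h) <# (inv (\<pi> i g) <# x))\<bar> \<partial>avg \<partial>avg)"
        by (intro nn_integral_cong) (simp add: space_avg eq[OF i j])
      then show "(\<integral>\<^sup>+g. \<integral>\<^sup>+h. ennreal \<bar>v (inv (\<pi> i g \<otimes> \<pi> j h) <# x)\<bar> \<partial>avg \<partial>avg) < \<infinity>"
        using elim(1) by (simp add: less_top)
    qed
    also have "\<dots> = P j (P i v) x"
      unfolding P_def by (intro Bochner_Integration.integral_cong refl) (simp add: space_avg eq[OF j i])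
    finally show ?case .
  qed
qed

text \<open>The quantity is the distance of a convex function from its tangent at \<open>t\<close>.
  Multiplied by \<open>sqrt (1 + t\<^sup>2)\<close>, both claims follow from \<open>(1 + s\<^sup>2)
  (1 + t\<^sup>2) = (1 + s t)\<^sup>2 + (s - t)\<^sup>2\<close>. The function grows linearly, so
  composing it with an integrable function gives an integrable one.\<close>

lemma strict_convexity_sqrt:
  fixes s t :: real
  shows "0 \<le> sqrt (1 + s\<^sup>2) - sqrt (1 + t\<^sup>2) - t / sqrt (1 + t\<^sup>2) * (s - t)"
    and "sqrt (1 + s\<^sup>2) - sqrt (1 + t\<^sup>2) - t / sqrt (1 + t\<^sup>2) * (s - t) = 0 \<Longrightarrow> s = t"
proof -
  define a where "a = sqrt (1 + s\<^sup>2)"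
  define b where "b = sqrt (1 + t\<^sup>2)"
  have a: "a > 0" "a\<^sup>2 = 1 + s\<^sup>2" and b: "b > 0" "b\<^sup>2 = 1 + t\<^sup>2"
    unfolding a_def b_def by (auto simp: add_pos_nonneg)
  have "(a - b - t / b * (s - t)) * b = a * b - b\<^sup>2 - t * (s - t)"
    using b(1) by (simp add: field_simps power2_eq_square)
  then have e: "(a - b - t / b * (s - t)) * b = a * b - (1 + s * t)"
    using b(2) by (simp add: algebra_simps power2_eq_square)
  have sq: "(a * b)\<^sup>2 = (1 + s * t)\<^sup>2 + (s - t)\<^sup>2"
    unfolding power_mult_distrib a(2) b(2) by (simp add: power2_eq_square algebra_simps)
  have ab: "a * b > 0" using a b by simp
  have "1 + s * t \<le> a * b"
    by (rule power2_le_imp_le) (use sq ab in auto)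
  then have "0 \<le> (a - b - t / b * (s - t)) * b" using e by simp
  then show "0 \<le> sqrt (1 + s\<^sup>2) - sqrt (1 + t\<^sup>2) - t / sqrt (1 + t\<^sup>2) * (s - t)"
    using b(1) unfolding a_def b_def by (simp add: zero_le_mult_iff)
  assume "sqrt (1 + s\<^sup>2) - sqrt (1 + t\<^sup>2) - t / sqrt (1 + t\<^sup>2) * (s - t) = 0"
  then have "a * b = 1 + s * t" using e unfolding a_def b_def by simp
  then have "(s - t)\<^sup>2 = 0" using sq by simp
  then show "s = t" by simp
qed

text \<open>The equality case of Jensen's inequality. \<open>v\<close> is the average of its
  translates, and averaging keeps the integral of \<open>\<Phi> (v x)\<close>, so the non-negative
  tangent gap \<open>\<Psi>\<close> integrates to zero. \<open>v\<close> is only integrable, hence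
  \<open>\<Phi>\<close> in place of the square.\<close>

lemma fixed_imp_invariant:
  assumes j: "j \<in> {1..n}" and v: "integrable \<nu> v" and fix_v: "AE x in \<nu>. P j v x = v x"
    and k: "k \<in> carrier G"
  shows "AE x in \<nu>. v (inv (\<pi> j k) <# x) = v x"
proof -
  define \<Phi> where "\<Phi> t = sqrt (1 + t\<^sup>2)" for t :: real
  define \<phi> where "\<phi> t = t / sqrt (1 + t\<^sup>2)" for t :: real
  have vb[measurable]: "v \<in> borel_measurable (borel_of Xs)" by (rule integrable_borel[OF v])
  have vn[measurable]: "v \<in> borel_measurable \<nu>" using v by auto
  have \<Phi>_bound: "\<bar>\<Phi> t\<bar> \<le> 1 + \<bar>t\<bar>" for t
  proof -
    have "sqrt (1 + t\<^sup>2) \<le> sqrt ((1 + \<bar>t\<bar>)\<^sup>2)" by (rule real_sqrt_le_mono) (simp add: power2_eq_square algebra_simps)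
    then show ?thesis by (simp add: \<Phi>_def)
  qed
  have \<Phi>v: "integrable \<nu> (\<lambda>x. \<Phi> (v x))"
  proof (rule Bochner_Integration.integrable_bound[of _ "\<lambda>x. 1 + \<bar>v x\<bar>"])
    show "integrable \<nu> (\<lambda>x. 1 + \<bar>v x\<bar>)" using v by simp
    show "(\<lambda>x. \<Phi> (v x)) \<in> borel_measurable \<nu>" unfolding \<Phi>_def by measurable
    show "AE x in \<nu>. norm (\<Phi> (v x)) \<le> norm (1 + \<bar>v x\<bar>)" using \<Phi>_bound by auto
  qed
  define \<Psi> where "\<Psi> g x = \<Phi> (v (inv (\<pi> j g) <# x)) - \<Phi> (v x) - \<phi> (v x) * (v (inv (\<pi> j g) <# x) - v x)" for g x
  have \<Psi>_nonneg: "0 \<le> \<Psi> g x" for g x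
    unfolding \<Psi>_def \<Phi>_def \<phi>_def by (rule strict_convexity_sqrt(1))
  have inner: "AE x in \<nu>. integrable avg (\<lambda>g. \<Psi> g x) \<and> (\<integral>g. \<Psi> g x \<partial>avg) = P j (\<lambda>x. \<Phi> (v x)) x - \<Phi> (v x)"
    using P_Fubini(1)[OF j v] P_Fubini(1)[OF j \<Phi>v] fix_v
  proof eventually_elim
    case (elim x)
    then show ?case by (simp add: \<Psi>_def P_def)
  qed
  have I: "integrable \<nu> (\<lambda>x. P j (\<lambda>x. \<Phi> (v x)) x - \<Phi> (v x))"
    using P_Fubini(2)[OF j \<Phi>v] \<Phi>v by simp
  have "(\<integral>x. P j (\<lambda>x. \<Phi> (v x)) x - \<Phi> (v x) \<partial>\<nu>) = 0"
    using P_Fubini(2,3)[OF j \<Phi>v] \<Phi>v by simp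
  moreover have "AE x in \<nu>. 0 \<le> P j (\<lambda>x. \<Phi> (v x)) x - \<Phi> (v x)"
    using inner by eventually_elim (metis integral_nonneg_AE AE_I2 \<Psi>_nonneg)
  ultimately have "AE x in \<nu>. P j (\<lambda>x. \<Phi> (v x)) x - \<Phi> (v x) = 0"
    using integral_nonneg_eq_0_iff_AE[OF I] by blast
  with inner have "AE x in \<nu>. AE g in avg. v (inv (\<pi> j g) <# x) = v x"
  proof eventually_elim
    case (elim x)
    then have "AE g in avg. \<Psi> g x = 0"
      using integral_nonneg_eq_0_iff_AE[of avg "\<lambda>g. \<Psi> g x"] \<Psi>_nonneg by auto
    then show ?case
      by eventually_elim (rule strict_convexity_sqrt(2), simp only: \<Psi>_def \<Phi>_def \<phi>_def)
  qed
  moreover have "{p \<in> topspace (prod_topology Xs T). v (inv (\<pi> j (snd p)) <# fst p) = v (fst p)} \<in> sets (borel_of (prod_topology Xs T))"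
  proof -
    have "(\<lambda>p. v (inv (\<pi> j (snd p)) <# fst p)) \<in> borel_measurable (borel_of (prod_topology Xs T))"
      using shift_measurable(1)[OF j vb] by (simp add: case_prod_unfold)
    moreover have "(\<lambda>p. v (fst p)) \<in> borel_measurable (borel_of (prod_topology Xs T))"
      by (intro borel_compose_X[OF vb] continuous_map_fst)
    ultimately have "{p \<in> space (borel_of (prod_topology Xs T)). v (inv (\<pi> j (snd p)) <# fst p) = v (fst p)} \<in> sets (borel_of (prod_topology Xs T))"
      by (rule borel_measurable_eq)
    then show ?thesis by simp
  qed
  ultimately have ae: "AE g in avg. AE x in \<nu>. v (inv (\<pi> j g) <# x) = v x"
    using tau_additive_AE_swap[OF tau_additive_nu tau_additive_avg, of "\<lambda>x g. v (inv (\<pi> j g) <# x) = v x"] by simp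
  \<comment> \<open>Invariance is known under \<open>\<pi> j g\<close> for almost all
    \<open>g\<close>; an arbitrary \<open>k\<close> is a quotient of two such elements,
    \<open>k \<otimes> g\<close> and \<open>g\<close>.\<close>
  obtain g where g: "g \<in> carrier G" "AE x in \<nu>. v (inv (\<pi> j g) <# x) = v x" "AE x in \<nu>. v (inv (\<pi> j (k \<otimes> g)) <# x) = v x"
    using full_overlap[OF ae k] by blast
  have "inv (\<pi> j k) \<in> carrier G" using j k by simp
  from AE_act[OF this g(2)] g(3) AE_space show ?thesis
    by eventually_elim (use j k g(1) in \<open>simp add: space_nu act_act proj_mult inv_mult_group\<close>)
qed

end

section \<open>The mean of the averaging operators, its powers and the spectral gap\<close>

context averaging
begin

definition A :: "('a set \<Rightarrow> real) \<Rightarrow> 'a set \<Rightarrow> real" where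
  "A v x = (\<Sum>j=1..n. P j v x) / real n"

lemma A_borel: "v \<in> borel_measurable (borel_of Xs) \<Longrightarrow> A v \<in> borel_measurable (borel_of Xs)"
  unfolding A_def by (intro borel_measurable_divide borel_measurable_sum P_borel) auto

lemma A_integrable: "integrable \<nu> v \<Longrightarrow> integrable \<nu> (A v)"
  unfolding A_def by (intro integrable_divide Bochner_Integration.integrable_sum P_Fubini(2)) auto

lemma A_integral:
  assumes v: "integrable \<nu> v"
  shows "(\<integral>x. A v x \<partial>\<nu>) = (\<integral>x. v x \<partial>\<nu>)"
proof -
  have "(\<integral>x. A v x \<partial>\<nu>) = (\<Sum>j=1..n. \<integral>x. P j v x \<partial>\<nu>) / real n"
    unfolding A_def using P_Fubini(2)[OF _ v] by simp
  also have "\<dots> = (\<integral>x. v x \<partial>\<nu>)" using P_Fubini(3)[OF _ v] n_pos by simp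
  finally show ?thesis .
qed

lemma A_norm:
  assumes v: "integrable \<nu> v"
  shows "(\<integral>x. \<bar>A v x\<bar> \<partial>\<nu>) \<le> (\<integral>x. \<bar>v x\<bar> \<partial>\<nu>)"
proof -
  have i: "integrable \<nu> (\<lambda>x. \<Sum>j=1..n. \<bar>P j v x\<bar>)"
    using P_Fubini(2)[OF _ v] by (intro Bochner_Integration.integrable_sum) auto
  have "(\<integral>x. \<bar>A v x\<bar> \<partial>\<nu>) \<le> (\<integral>x. (\<Sum>j=1..n. \<bar>P j v x\<bar>) / real n \<partial>\<nu>)"
  proof (rule integral_mono)
    show "\<bar>A v x\<bar> \<le> (\<Sum>j=1..n. \<bar>P j v x\<bar>) / real n" for x
      unfolding A_def by (simp only: abs_divide abs_of_nat) (intro divide_right_mono sum_abs, simp)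
    show "integrable \<nu> (\<lambda>x. \<bar>A v x\<bar>)" using A_integrable[OF v] by (rule integrable_abs)
    show "integrable \<nu> (\<lambda>x. (\<Sum>j=1..n. \<bar>P j v x\<bar>) / real n)" using i by (rule integrable_divide)
  qed
  also have "\<dots> = (\<Sum>j=1..n. \<integral>x. \<bar>P j v x\<bar> \<partial>\<nu>) / real n"
    using P_Fubini(2)[OF _ v] by simp
  also have "\<dots> \<le> (\<Sum>j=1..n. \<integral>x. \<bar>v x\<bar> \<partial>\<nu>) / real n"
    using P_Fubini(4)[OF _ v] by (intro divide_right_mono sum_mono) auto
  also have "\<dots> = (\<integral>x. \<bar>v x\<bar> \<partial>\<nu>)" using n_pos by simp
  finally show ?thesis .
qed

lemma AE_all_index: "(\<And>j. j \<in> {1..n} \<Longrightarrow> AE x in M. Q j x) \<Longrightarrow> AE x in M. \<forall>j\<in>{1..n}. Q j x"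
  by (rule AE_finite_allI) auto

lemma A_add:
  assumes u: "integrable \<nu> u" and v: "integrable \<nu> v"
  shows "AE x in \<nu>. A (\<lambda>x. u x + v x) x = A u x + A v x"
proof -
  have "AE x in \<nu>. \<forall>j\<in>{1..n}. P j (\<lambda>x. u x + v x) x = P j u x + P j v x"
    by (rule AE_all_index) (rule P_add[OF _ u v])
  then show ?thesis
    by eventually_elim (simp add: A_def sum.distrib add_divide_distrib)
qed

lemma A_diff:
  assumes u: "integrable \<nu> u" and v: "integrable \<nu> v"
  shows "AE x in \<nu>. A (\<lambda>x. u x - v x) x = A u x - A v x"
proof -
  have "AE x in \<nu>. \<forall>j\<in>{1..n}. P j (\<lambda>x. u x - v x) x = P j u x - P j v x"
    by (rule AE_all_index) (rule P_diff[OF _ u v])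
  then show ?thesis
    by eventually_elim (simp add: A_def sum_subtractf diff_divide_distrib)
qed

lemma A_cong_AE:
  assumes u: "integrable \<nu> u" and v: "integrable \<nu> v" and ae: "AE x in \<nu>. u x = v x"
  shows "AE x in \<nu>. A u x = A v x"
proof -
  have "AE x in \<nu>. \<forall>j\<in>{1..n}. P j u x = P j v x"
    by (rule AE_all_index) (rule P_cong_AE[OF _ u v ae])
  then show ?thesis
    by eventually_elim (simp add: A_def)
qed

lemma P_average:
  assumes j: "j \<in> {1..n}" and f: "\<And>i. i \<in> {1..n} \<Longrightarrow> integrable \<nu> (f i)"
  shows "AE x in \<nu>. P j (\<lambda>x. (\<Sum>i=1..n. f i x) / real n) x = (\<Sum>i=1..n. P j (f i) x) / real n"
proof -
  have "AE x in \<nu>. \<forall>i\<in>{1..n}. integrable avg (\<lambda>g. f i (inv (\<pi> j g) <# x))"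
    by (rule AE_all_index) (rule P_Fubini(1)[OF j f])
  then show ?thesis
    by eventually_elim (simp add: P_def)
qed

lemma P_A_commute:
  assumes j: "j \<in> {1..n}" and v: "integrable \<nu> v"
  shows "AE x in \<nu>. P j (A v) x = A (P j v) x"
proof -
  have "AE x in \<nu>. \<forall>i\<in>{1..n}. P j (P i v) x = P i (P j v) x"
    by (rule AE_all_index) (rule P_commute[OF j _ v])
  moreover have "AE x in \<nu>. P j (\<lambda>x. (\<Sum>i=1..n. P i v x) / real n) x = (\<Sum>i=1..n. P j (P i v) x) / real n"
    by (rule P_average[OF j]) (rule P_Fubini(2)[OF _ v])
  ultimately show ?thesis
    unfolding A_def[abs_def] by eventually_elim simp
qed

lemma Apow_integrable: "integrable \<nu> v \<Longrightarrow> integrable \<nu> ((A ^^ k) v)"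
  by (induction k) (auto intro: A_integrable)

lemma Apow_integral: "integrable \<nu> v \<Longrightarrow> (\<integral>x. (A ^^ k) v x \<partial>\<nu>) = (\<integral>x. v x \<partial>\<nu>)"
  by (induction k) (auto simp: A_integral Apow_integrable)

lemma Apow_norm: "integrable \<nu> v \<Longrightarrow> (\<integral>x. \<bar>(A ^^ k) v x\<bar> \<partial>\<nu>) \<le> (\<integral>x. \<bar>v x\<bar> \<partial>\<nu>)"
proof (induction k)
  case (Suc k)
  then show ?case using A_norm[OF Apow_integrable[OF Suc.prems, of k]] by simp
qed simp

lemma Apow_cong_AE:
  assumes u: "integrable \<nu> u" and v: "integrable \<nu> v" and ae: "AE x in \<nu>. u x = v x"
  shows "AE x in \<nu>. (A ^^ k) u x = (A ^^ k) v x"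
proof (induction k)
  case (Suc k)
  then show ?case using A_cong_AE[OF Apow_integrable[OF u] Apow_integrable[OF v]] by simp
qed (use ae in simp)

lemma Apow_add:
  assumes u: "integrable \<nu> u" and v: "integrable \<nu> v"
  shows "AE x in \<nu>. (A ^^ k) (\<lambda>x. u x + v x) x = (A ^^ k) u x + (A ^^ k) v x"
proof (induction k)
  case (Suc k)
  have i: "integrable \<nu> ((A ^^ k) u)" "integrable \<nu> ((A ^^ k) v)" "integrable \<nu> ((A ^^ k) (\<lambda>x. u x + v x))"
    using u v by (auto intro!: Apow_integrable)
  have "AE x in \<nu>. A ((A ^^ k) (\<lambda>x. u x + v x)) x = A (\<lambda>x. (A ^^ k) u x + (A ^^ k) v x) x"
    using i Suc.IH by (intro A_cong_AE) auto
  with A_add[OF i(1,2)] show ?case by eventually_elim simp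
qed simp

lemma Apow_diff:
  assumes u: "integrable \<nu> u" and v: "integrable \<nu> v"
  shows "AE x in \<nu>. (A ^^ k) (\<lambda>x. u x - v x) x = (A ^^ k) u x - (A ^^ k) v x"
proof (induction k)
  case (Suc k)
  have i: "integrable \<nu> ((A ^^ k) u)" "integrable \<nu> ((A ^^ k) v)" "integrable \<nu> ((A ^^ k) (\<lambda>x. u x - v x))"
    using u v by (auto intro!: Apow_integrable)
  have "AE x in \<nu>. A ((A ^^ k) (\<lambda>x. u x - v x)) x = A (\<lambda>x. (A ^^ k) u x - (A ^^ k) v x) x"
    using i Suc.IH by (intro A_cong_AE) auto
  with A_diff[OF i(1,2)] show ?case by eventually_elim simp
qed simp

lemma P_Apow_commute:
  assumes j: "j \<in> {1..n}" and v: "integrable \<nu> v"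
  shows "AE x in \<nu>. P j ((A ^^ k) v) x = (A ^^ k) (P j v) x"
proof (induction k)
  case (Suc k)
  have i: "integrable \<nu> ((A ^^ k) v)" "integrable \<nu> (P j v)"
    using j v by (auto intro!: Apow_integrable P_Fubini(2))
  have "AE x in \<nu>. A (P j ((A ^^ k) v)) x = A ((A ^^ k) (P j v)) x"
    using i j Suc.IH by (intro A_cong_AE) (auto intro!: Apow_integrable P_Fubini(2))
  with P_A_commute[OF j i(1)] show ?case by eventually_elim simp
qed simp

text \<open>If \<open>A v\<close> is almost as long as \<open>v\<close>, most translates of \<open>v\<close> by \<open>\<pi> j g\<close> are close to the
  one vector \<open>A v\<close>, simultaneously for all \<open>j\<close>, so that \<open>A v\<close> is almost invariant.\<close>

lemma spectral_gap:
  assumes K: "compactin T K" and \<epsilon>: "0 < \<epsilon>"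
    and gap: "\<And>w. w \<in> borel_measurable (borel_of Xs) \<Longrightarrow> integrable \<nu> (\<lambda>x. (w x)\<^sup>2) \<Longrightarrow>
      (\<integral>x. w x \<partial>\<nu>) = 0 \<Longrightarrow> \<exists>k\<in>K. ennreal (\<epsilon> * (\<integral>x. (w x)\<^sup>2 \<partial>\<nu>)) \<le> (\<integral>\<^sup>+x. ennreal ((w (inv k <# x) - w x)\<^sup>2) \<partial>\<nu>)"
  obtains r where "0 < r" "r < 1" "\<forall>v. v \<in> borel_measurable (borel_of Xs) \<longrightarrow> integrable \<nu> (\<lambda>x. (v x)\<^sup>2) \<longrightarrow>
      (\<integral>x. v x \<partial>\<nu>) = 0 \<longrightarrow> integrable \<nu> (\<lambda>x. (A v x)\<^sup>2) \<and> (\<integral>x. (A v x)\<^sup>2 \<partial>\<nu>) \<le> r * (\<integral>x. (v x)\<^sup>2 \<partial>\<nu>)"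
proof -
  obtain \<tau> where \<tau>: "0 < \<tau>" "\<forall>\<theta>\<in>sets (borel_of T). emeasure avg (carrier G - \<theta>) < ennreal \<tau> \<longrightarrow>
     (\<forall>k\<in>K. \<exists>g\<in>\<theta>. k \<otimes> g \<in> \<theta>)"
    by (rule compact_overlap[OF K])
  \<comment> \<open>Calibrated so that the displacement bound
    \<open>4 ^ n * (4 * \<eta> * N)\<close> reached below equals
    \<open>\<epsilon> * N / 2\<close>.\<close>
  define \<eta> where "\<eta> = \<epsilon> / (2 * 4 ^ Suc n)"
  have \<eta>: "\<eta> > 0" using \<epsilon> by (simp add: \<eta>_def)
  \<comment> \<open>The bound \<open>1/2\<close> gives \<open>N / 2 \<le> (1 - \<delta>) * N\<close>
    at the end; the other one feeds the Markov estimate for the sets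
    \<open>\<theta> j\<close>.\<close>
  define \<delta> where "\<delta> = min (1/2) (\<eta> * \<tau> / real n)"
  have \<delta>: "\<delta> > 0" "\<delta> \<le> 1/2" "real n * \<delta> \<le> \<eta> * \<tau>"
    using \<eta> \<tau>(1) n_pos by (auto simp: \<delta>_def min_def field_simps)
  have main: "integrable \<nu> (\<lambda>x. (A v x)\<^sup>2) \<and> (\<integral>x. (A v x)\<^sup>2 \<partial>\<nu>) \<le> (1 - \<delta>) * (\<integral>x. (v x)\<^sup>2 \<partial>\<nu>)"
    if vb: "v \<in> borel_measurable (borel_of Xs)" and v2: "integrable \<nu> (\<lambda>x. (v x)\<^sup>2)" and v0: "(\<integral>x. v x \<partial>\<nu>) = 0" for v
  proof -
    have v: "integrable \<nu> v"
      by (rule square_integrable_imp_integrable[OF _ v2]) (use vb in \<open>simp add: measurable_nu\<close>)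
    define N where "N = (\<integral>x. (v x)\<^sup>2 \<partial>\<nu>)"
    have N0: "0 \<le> N" by (simp add: N_def)
    define w where "w = A v"
    have wb: "w \<in> borel_measurable (borel_of Xs)" unfolding w_def by (rule A_borel[OF vb])
    have w: "integrable \<nu> w" unfolding w_def by (rule A_integrable[OF v])
    have w0: "(\<integral>x. w x \<partial>\<nu>) = 0" unfolding w_def using A_integral[OF v] v0 by simp
    define F where "F j x g = (v (inv (\<pi> j g) <# x) - w x)\<^sup>2" for j x g
    have F_nonneg: "0 \<le> F j x g" for j x g by (simp add: F_def)
    have Fm: "case_prod (F j) \<in> borel_measurable (borel_of (prod_topology Xs T))" if j: "j \<in> {1..n}" for j
    proof -
      have "(\<lambda>p. v (inv (\<pi> j (snd p)) <# fst p)) \<in> borel_measurable (borel_of (prod_topology Xs T))"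
        using shift_measurable(1)[OF j vb] by (simp add: case_prod_unfold)
      moreover have "(\<lambda>p. w (fst p)) \<in> borel_measurable (borel_of (prod_topology Xs T))"
        by (intro borel_compose_X[OF wb] continuous_map_fst)
      ultimately show ?thesis unfolding F_def case_prod_unfold by measurable
    qed
    define R where "R j x = (\<integral>g. F j x g \<partial>avg)" for j x
    have R_nonneg: "0 \<le> R j x" for j x by (simp add: R_def F_def)
    have FR: "AE x in \<nu>. integrable avg (F j x) \<and> R j x = P j (\<lambda>x. (v x)\<^sup>2) x - 2 * w x * P j v x + (w x)\<^sup>2"
      if j: "j \<in> {1..n}" for j
      using P_Fubini(1)[OF j v] P_Fubini(1)[OF j v2]
    proof eventually_elim
      case (elim x)
      have "F j x = (\<lambda>g. (v (inv (\<pi> j g) <# x))\<^sup>2 - 2 * w x * v (inv (\<pi> j g) <# x) + (w x)\<^sup>2)"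
        by (auto simp: F_def power2_eq_square algebra_simps)
      then show ?case using elim by (simp add: R_def P_def)
    qed
    \<comment> \<open>A variance identity: \<open>w\<close> is the mean of all the translates, over
      \<open>g\<close> and over the factors, so the total squared deviation from \<open>w\<close> is
      the mean of the squares minus the square of the mean.\<close>
    have sumR: "AE x in \<nu>. (\<Sum>j=1..n. R j x) = real n * (A (\<lambda>x. (v x)\<^sup>2) x - (w x)\<^sup>2)"
    proof -
      have "AE x in \<nu>. \<forall>j\<in>{1..n}. R j x = P j (\<lambda>x. (v x)\<^sup>2) x - 2 * w x * P j v x + (w x)\<^sup>2"
        by (rule AE_all_index) (use FR in \<open>auto elim: eventually_mono\<close>)
      then show ?thesis
    proof eventually_elim
      case (elim x)
      have "(\<Sum>j=1..n. R j x) = (\<Sum>j=1..n. P j (\<lambda>x. (v x)\<^sup>2) x) - 2 * w x * (\<Sum>j=1..n. P j v x) + real n * (w x)\<^sup>2"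
        using elim by (simp add: sum.distrib sum_subtractf sum_distrib_left)
      also have "(\<Sum>j=1..n. P j v x) = real n * w x" using n_pos by (simp add: w_def A_def)
      also have "(\<Sum>j=1..n. P j (\<lambda>x. (v x)\<^sup>2) x) = real n * A (\<lambda>x. (v x)\<^sup>2) x" using n_pos by (simp add: A_def)
      finally show ?case by (simp add: power2_eq_square algebra_simps)
    qed
    qed
    have le: "AE x in \<nu>. (w x)\<^sup>2 \<le> A (\<lambda>x. (v x)\<^sup>2) x"
      using sumR
    proof eventually_elim
      case (elim x)
      have "0 \<le> (\<Sum>j=1..n. R j x)" by (intro sum_nonneg R_nonneg)
      then have "0 \<le> real n * (A (\<lambda>x. (v x)\<^sup>2) x - (w x)\<^sup>2)" using elim by simp
      then show ?case using n_pos by (simp add: zero_le_mult_iff)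
    qed
    have Av2: "integrable \<nu> (A (\<lambda>x. (v x)\<^sup>2))" by (rule A_integrable[OF v2])
    have w2: "integrable \<nu> (\<lambda>x. (w x)\<^sup>2)"
    proof (rule Bochner_Integration.integrable_bound[OF Av2])
      show "(\<lambda>x. (w x)\<^sup>2) \<in> borel_measurable \<nu>" using wb by (simp add: measurable_nu)
      show "AE x in \<nu>. norm ((w x)\<^sup>2) \<le> norm (A (\<lambda>x. (v x)\<^sup>2) x)" using le by eventually_elim auto
    qed
    have wN: "(\<integral>x. (w x)\<^sup>2 \<partial>\<nu>) \<le> N"
      using integral_mono_AE[OF w2 Av2 le] A_integral[OF v2] by (simp add: N_def)
    have "(\<integral>x. (w x)\<^sup>2 \<partial>\<nu>) \<le> (1 - \<delta>) * N"
    proof (rule ccontr)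
      assume "\<not> ?thesis"
      then have big: "(1 - \<delta>) * N < (\<integral>x. (w x)\<^sup>2 \<partial>\<nu>)" by simp
      have Npos: "0 < N"
      proof (rule ccontr)
        assume "\<not> 0 < N"
        then have "N = 0" using N0 by simp
        then show False using big wN by simp
      qed
      define E where "E j g = (\<integral>\<^sup>+x. ennreal (F j x g) \<partial>\<nu>)" for j g
      \<comment> \<open>The \<open>g\<close> for which the translate of \<open>v\<close> by
        \<open>\<pi> j g\<close> is close to \<open>w\<close>. By Markov's inequality and the
        variance bound, the complement has \<open>avg\<close>-measure below
        \<open>\<tau>\<close>.\<close>
      define \<theta> where "\<theta> j = {g \<in> carrier G. E j g \<le> ennreal (\<eta> * N)}" for j
      have Fe: "(\<lambda>(x, g). ennreal (F j x g)) \<in> borel_measurable (borel_of (prod_topology Xs T))" if "j \<in> {1..n}" for j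
        using Fm[OF that] by (simp add: case_prod_unfold)
      have Em: "E j \<in> borel_measurable avg" if "j \<in> {1..n}" for j
        unfolding E_def by (rule tau_additive_Tonelli(2)[OF tau_additive_nu tau_additive_avg Fe[OF that]])
      have \<theta>b: "\<theta> j \<in> sets (borel_of T)" if "j \<in> {1..n}" for j
      proof -
        have "\<theta> j = E j -` {..ennreal (\<eta> * N)} \<inter> space avg" by (auto simp: \<theta>_def space_avg)
        then show ?thesis using measurable_sets[OF Em[OF that], of "{..ennreal (\<eta> * N)}"] by (simp add: sets_avg)
      qed
      have strict: "(\<integral>\<^sup>+g. E j g \<partial>avg) < ennreal (\<eta> * N * \<tau>)" if j: "j \<in> {1..n}" for j
      proof -
        have "(\<integral>\<^sup>+g. E j g \<partial>avg) \<le> ennreal (real n * (N - (\<integral>x. (w x)\<^sup>2 \<partial>\<nu>)))"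
        proof -
          have bound: "AE x in \<nu>. (\<integral>\<^sup>+g. ennreal (F j x g) \<partial>avg) \<le> ennreal (real n * (A (\<lambda>x. (v x)\<^sup>2) x - (w x)\<^sup>2))"
            using FR[OF j] sumR
          proof eventually_elim
            case (elim x)
            have "(\<integral>\<^sup>+g. ennreal (F j x g) \<partial>avg) = ennreal (R j x)"
              unfolding R_def using elim by (intro nn_integral_eq_integral) (auto simp: F_nonneg)
            also have "R j x \<le> (\<Sum>j=1..n. R j x)" using j by (intro member_le_sum R_nonneg) auto
            finally show ?case using elim by (simp add: ennreal_leI)
          qed
          have "(\<integral>\<^sup>+g. E j g \<partial>avg) = (\<integral>\<^sup>+x. \<integral>\<^sup>+g. ennreal (F j x g) \<partial>avg \<partial>\<nu>)"
            unfolding E_def by (rule tau_additive_Tonelli(3)[OF tau_additive_nu tau_additive_avg Fe[OF j], symmetric])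
          also have "\<dots> \<le> (\<integral>\<^sup>+x. ennreal (real n * (A (\<lambda>x. (v x)\<^sup>2) x - (w x)\<^sup>2)) \<partial>\<nu>)"
            by (rule nn_integral_mono_AE[OF bound])
          also have "\<dots> = ennreal (\<integral>x. real n * (A (\<lambda>x. (v x)\<^sup>2) x - (w x)\<^sup>2) \<partial>\<nu>)"
            using Av2 w2 le by (intro nn_integral_eq_integral) auto
          also have "(\<integral>x. real n * (A (\<lambda>x. (v x)\<^sup>2) x - (w x)\<^sup>2) \<partial>\<nu>) = real n * (N - (\<integral>x. (w x)\<^sup>2 \<partial>\<nu>))"
            using Av2 w2 A_integral[OF v2] by (simp add: N_def)
          finally show ?thesis .
        qed
        also have "ennreal (real n * (N - (\<integral>x. (w x)\<^sup>2 \<partial>\<nu>))) < ennreal (\<eta> * N * \<tau>)"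
        proof (rule ennreal_lessI)
          have "N - (\<integral>x. (w x)\<^sup>2 \<partial>\<nu>) < \<delta> * N" using big by (simp add: algebra_simps)
          then have "real n * (N - (\<integral>x. (w x)\<^sup>2 \<partial>\<nu>)) < real n * (\<delta> * N)" using n_pos by simp
          also have "\<dots> \<le> \<eta> * \<tau> * N" using mult_right_mono[OF \<delta>(3) N0] by (simp add: mult.assoc)
          finally show "real n * (N - (\<integral>x. (w x)\<^sup>2 \<partial>\<nu>)) < \<eta> * N * \<tau>" by (simp add: mult_ac)
        qed (use \<eta> \<tau>(1) Npos in simp)
        finally show ?thesis .
      qed
      have small: "emeasure avg (carrier G - \<theta> j) < ennreal \<tau>" if j: "j \<in> {1..n}" for j
      proof (rule ccontr)
        assume "\<not> ?thesis"
        then have "ennreal (\<eta> * N) * ennreal \<tau> \<le> ennreal (\<eta> * N) * emeasure avg (carrier G - \<theta> j)"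
          by (intro mult_left_mono) auto
        also have "\<dots> = (\<integral>\<^sup>+g. ennreal (\<eta> * N) * indicator (carrier G - \<theta> j) g \<partial>avg)"
          using sets.compl_sets[OF \<theta>b[OF j]] by (subst nn_integral_cmult_indicator) (auto simp: sets_avg)
        also have "\<dots> \<le> (\<integral>\<^sup>+g. E j g \<partial>avg)"
          by (rule nn_integral_mono) (auto simp: indicator_def \<theta>_def not_le)
        finally have "ennreal (\<eta> * N) * ennreal \<tau> \<le> (\<integral>\<^sup>+g. E j g \<partial>avg)" .
        moreover have "ennreal (\<eta> * N) * ennreal \<tau> = ennreal (\<eta> * N * \<tau>)"
          using \<eta> N0 \<tau>(1) by (subst ennreal_mult[symmetric]) auto
        ultimately show False using strict[OF j] by (simp add: not_less[symmetric])
      qed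
      define D where "D g = (\<integral>\<^sup>+x. ennreal ((w (inv g <# x) - w x)\<^sup>2) \<partial>\<nu>)" for g
      have sq: "(a - c)\<^sup>2 \<le> 2 * (a - b)\<^sup>2 + 2 * (b - c)\<^sup>2" for a b c :: real
        using zero_le_power2[of "a - b - (b - c)"] by (simp add: power2_eq_square algebra_simps)
      have tri: "(\<integral>\<^sup>+x. ennreal ((f x - h x)\<^sup>2) \<partial>\<nu>) \<le> 2 * (\<integral>\<^sup>+x. ennreal ((f x - g x)\<^sup>2) \<partial>\<nu>) + 2 * (\<integral>\<^sup>+x. ennreal ((g x - h x)\<^sup>2) \<partial>\<nu>)"
        if [measurable]: "f \<in> borel_measurable \<nu>" "g \<in> borel_measurable \<nu>" "h \<in> borel_measurable \<nu>" for f g h :: "'a set \<Rightarrow> real"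
      proof -
        have "(\<integral>\<^sup>+x. ennreal ((f x - h x)\<^sup>2) \<partial>\<nu>) \<le> (\<integral>\<^sup>+x. 2 * ennreal ((f x - g x)\<^sup>2) + 2 * ennreal ((g x - h x)\<^sup>2) \<partial>\<nu>)"
        proof (rule nn_integral_mono)
          fix x
          have "ennreal ((f x - h x)\<^sup>2) \<le> ennreal (2 * (f x - g x)\<^sup>2 + 2 * (g x - h x)\<^sup>2)" by (rule ennreal_leI[OF sq])
          then show "ennreal ((f x - h x)\<^sup>2) \<le> 2 * ennreal ((f x - g x)\<^sup>2) + 2 * ennreal ((g x - h x)\<^sup>2)"
            by (simp add: ennreal_plus ennreal_mult)
        qed
        then show ?thesis by (simp add: nn_integral_add nn_integral_cmult)
      qed
      have mw: "w \<in> borel_measurable \<nu>" and mwg: "g \<in> carrier G \<Longrightarrow> (\<lambda>x. w (g <# x)) \<in> borel_measurable \<nu>"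
        and mvg: "g \<in> carrier G \<Longrightarrow> (\<lambda>x. v (g <# x)) \<in> borel_measurable \<nu>" for g
        using wb act_borel[OF wb] act_borel[OF vb] by (simp_all add: measurable_nu)
      have Dproj: "D (\<pi> j k) \<le> ennreal (4 * \<eta> * N)" if j: "j \<in> {1..n}" and k: "k \<in> K" for j k
      proof -
        have kc: "k \<in> carrier G" using k compactin_subset_topspace[OF K] by auto
        \<comment> \<open>Both \<open>g\<close> and \<open>k \<otimes> g\<close> are good: the
          translates of \<open>v\<close> by their \<open>j\<close>-th components are close to
          \<open>w\<close>, and \<open>\<pi> j k\<close> carries the first translate to the second,
          so it moves \<open>w\<close> only a little.\<close>
        obtain g where g: "g \<in> \<theta> j" "k \<otimes> g \<in> \<theta> j" using \<tau>(2) \<theta>b[OF j] small[OF j] k by blast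
        then have gc: "g \<in> carrier G" by (simp add: \<theta>_def)
        define a where "a = \<pi> j k"
        have ac: "a \<in> carrier G" using j kc by (simp add: a_def)
        have "(\<integral>\<^sup>+x. ennreal ((w (inv a <# x) - v (inv (\<pi> j g) <# (inv a <# x)))\<^sup>2) \<partial>\<nu>) = (\<integral>\<^sup>+x. ennreal (F j x g) \<partial>\<nu>)"
        proof -
          have "(\<lambda>x. ennreal ((w x - v (inv (\<pi> j g) <# x))\<^sup>2)) \<in> borel_measurable (borel_of Xs)"
            using mw mvg[of "inv (\<pi> j g)"] j gc by (simp add: measurable_nu)
          from nn_integral_act[OF _ this, of "inv a"] ac show ?thesis by (simp add: F_def power2_commute)
        qed
        then have 1: "(\<integral>\<^sup>+x. ennreal ((w (inv a <# x) - v (inv (\<pi> j g) <# (inv a <# x)))\<^sup>2) \<partial>\<nu>) \<le> ennreal (\<eta> * N)"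
          using g(1) by (simp add: \<theta>_def E_def)
        have eq: "inv (\<pi> j g) <# (inv a <# x) = inv (\<pi> j (k \<otimes> g)) <# x" if "x \<in> topspace Xs" for x
          using that j kc gc ac by (simp add: act_act a_def proj_mult inv_mult_group)
        have "(\<integral>\<^sup>+x. ennreal ((v (inv (\<pi> j g) <# (inv a <# x)) - w x)\<^sup>2) \<partial>\<nu>) = E j (k \<otimes> g)"
          unfolding E_def F_def by (rule nn_integral_cong) (simp add: space_nu eq)
        then have 2: "(\<integral>\<^sup>+x. ennreal ((v (inv (\<pi> j g) <# (inv a <# x)) - w x)\<^sup>2) \<partial>\<nu>) \<le> ennreal (\<eta> * N)"
          using g(2) by (simp add: \<theta>_def)
        have m: "(\<lambda>x. v (inv (\<pi> j g) <# (inv a <# x))) \<in> borel_measurable \<nu>"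
          using act_borel[OF act_borel[OF vb, of "inv (\<pi> j g)"], of "inv a"] j gc ac by (simp add: measurable_nu)
        have "D a \<le> 2 * ennreal (\<eta> * N) + 2 * ennreal (\<eta> * N)"
          unfolding D_def using ac
          by (intro order_trans[OF tri[OF mwg m mw]] add_mono mult_left_mono 1 2) auto
        also have "\<dots> = ennreal (4 * \<eta> * N)"
        proof -
          have "2 * ennreal (\<eta> * N) = ennreal (2 * (\<eta> * N))" using \<eta> N0 by (simp add: ennreal_mult)
          then show ?thesis using \<eta> N0 by (simp add: ennreal_plus[symmetric] mult.assoc del: ennreal_plus)
        qed
        finally show ?thesis by (simp add: a_def)
      qed
      \<comment> \<open>The squared displacement is subadditive up to a factor \<open>2\<close>;
        over a product of \<open>n\<close> components this accumulates to at most
        \<open>4 ^ n\<close>.\<close>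
      have Dmult: "D (a \<otimes> b) \<le> 2 * D b + 2 * D a" if a: "a \<in> carrier G" and b: "b \<in> carrier G" for a b
      proof -
        have m: "(\<lambda>x. w (inv b <# (inv a <# x))) \<in> borel_measurable \<nu>"
          using act_borel[OF act_borel[OF wb, of "inv b"], of "inv a"] a b by (simp add: measurable_nu)
        have "D (a \<otimes> b) = (\<integral>\<^sup>+x. ennreal ((w (inv b <# (inv a <# x)) - w x)\<^sup>2) \<partial>\<nu>)"
          unfolding D_def by (rule nn_integral_cong) (use a b in \<open>simp add: space_nu act_act inv_mult_group\<close>)
        also have "\<dots> \<le> 2 * (\<integral>\<^sup>+x. ennreal ((w (inv b <# (inv a <# x)) - w (inv a <# x))\<^sup>2) \<partial>\<nu>) + 2 * D a"
          unfolding D_def using a by (intro tri m mwg mw) auto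
        also have "(\<integral>\<^sup>+x. ennreal ((w (inv b <# (inv a <# x)) - w (inv a <# x))\<^sup>2) \<partial>\<nu>) = D b"
        proof -
          have "(\<lambda>x. ennreal ((w (inv b <# x) - w x)\<^sup>2)) \<in> borel_measurable (borel_of Xs)"
            using mw mwg[of "inv b"] b by (simp add: measurable_nu)
          from nn_integral_act[OF _ this, of "inv a"] a show ?thesis by (simp add: D_def)
        qed
        finally show ?thesis .
      qed
      have D1: "D \<one> = 0"
      proof -
        have "D \<one> = (\<integral>\<^sup>+x. 0 \<partial>\<nu>)" unfolding D_def by (rule nn_integral_cong) (simp add: space_nu act_one)
        then show ?thesis by simp
      qed
      have Dk: "D k \<le> ennreal (4 ^ n * (4 * \<eta> * N))" if k: "k \<in> K" for k
      proof -
        have kc: "k \<in> carrier G" using k compactin_subset_topspace[OF K] by auto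
        have "foldr (\<lambda>j h. \<pi> j k \<otimes> h) js \<one> \<in> carrier G \<and>
            D (foldr (\<lambda>j h. \<pi> j k \<otimes> h) js \<one>) \<le> ennreal (4 ^ length js * (4 * \<eta> * N))" if "set js \<subseteq> {1..n}" for js
          using that
        proof (induction js)
          case Nil
          then show ?case by (simp add: D1)
        next
          case (Cons j js)
          define b where "b = foldr (\<lambda>j h. \<pi> j k \<otimes> h) js \<one>"
          have b: "b \<in> carrier G" "D b \<le> ennreal (4 ^ length js * (4 * \<eta> * N))" using Cons by (auto simp: b_def)
          have j: "j \<in> {1..n}" using Cons.prems by auto
          have M0: "0 \<le> 4 * \<eta> * N" using \<eta> N0 by simp
          have "D (\<pi> j k \<otimes> b) \<le> 2 * D b + 2 * D (\<pi> j k)" using j kc b by (intro Dmult) auto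
          also have "\<dots> \<le> 2 * ennreal (4 ^ length js * (4 * \<eta> * N)) + 2 * ennreal (4 * \<eta> * N)"
            using b(2) Dproj[OF j k] by (intro add_mono mult_left_mono) auto
          also have "\<dots> = ennreal (2 * (4 ^ length js * (4 * \<eta> * N)) + 2 * (4 * \<eta> * N))"
          proof -
            have *: "2 * ennreal s = ennreal (2 * s)" if "0 \<le> s" for s using that by (simp add: ennreal_mult)
            have A0: "0 \<le> 4 ^ length js * (4 * \<eta> * N)" by (rule mult_nonneg_nonneg[OF _ M0]) simp
            have "ennreal (2 * a) + ennreal (2 * b) = ennreal (2 * a + 2 * b)" if "0 \<le> a" "0 \<le> b" for a b
              using that by (subst ennreal_plus) auto
            from this[OF A0 M0] show ?thesis by (simp only: *[OF A0] *[OF M0])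
          qed
          also have "\<dots> \<le> ennreal (4 ^ length (j # js) * (4 * \<eta> * N))"
          proof (rule ennreal_leI)
            have "1 * (4 * \<eta> * N) \<le> 4 ^ length js * (4 * \<eta> * N)" using M0 by (intro mult_right_mono) auto
            then show "2 * (4 ^ length js * (4 * \<eta> * N)) + 2 * (4 * \<eta> * N) \<le> 4 ^ length (j # js) * (4 * \<eta> * N)"
              by (simp add: mult_ac)
          qed
          finally show ?case using j kc b(1) by (simp add: b_def)
        qed
        from this[of "[1..<Suc n]"] have "D (foldr (\<lambda>j h. \<pi> j k \<otimes> h) [1..<Suc n] \<one>) \<le> ennreal (4 ^ length [1..<Suc n] * (4 * \<eta> * N))"
          by (metis (no_types, lifting) atLeastLessThanSuc_atLeastAtMost order_refl set_upt)
        then show ?thesis by (simp only: proj_decompose[OF kc] length_upt) simp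
      qed
      obtain k where k: "k \<in> K" "ennreal (\<epsilon> * (\<integral>x. (w x)\<^sup>2 \<partial>\<nu>)) \<le> D k"
        using gap[OF wb w2 w0] unfolding D_def by blast
      have "ennreal (\<epsilon> * (\<integral>x. (w x)\<^sup>2 \<partial>\<nu>)) \<le> ennreal (4 ^ n * (4 * \<eta> * N))"
        using k(2) Dk[OF k(1)] by (rule order_trans)
      then have "\<epsilon> * (\<integral>x. (w x)\<^sup>2 \<partial>\<nu>) \<le> 4 ^ n * (4 * \<eta> * N)" using \<eta> N0 by (subst (asm) ennreal_le_iff) auto
      also have "\<dots> = \<epsilon> * (N / 2)" by (simp add: \<eta>_def)
      finally have "(\<integral>x. (w x)\<^sup>2 \<partial>\<nu>) \<le> N / 2" using \<epsilon> by simp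
      moreover have "N / 2 \<le> (1 - \<delta>) * N" using mult_right_mono[of "1/2" "1 - \<delta>" N] \<delta> N0 by simp
      ultimately show False using big by simp
    qed
    then show ?thesis using w2 by (simp add: w_def N_def)
  qed
  show ?thesis
    by (rule that[of "1 - \<delta>"]) (use \<delta> main in auto)
qed

end

context averaging
begin

section \<open>Vanishing of the cocycle\<close>

abbreviation V :: real where "V \<equiv> measure \<nu> (space \<nu>)"

lemma V_pos: "0 < V"
  using nu_nonzero by (simp add: emeasure_eq_measure zero_less_measure_iff)

text \<open>What is kept of a bound in \<open>L\<^sup>p\<close>: the excess over \<open>t\<close>
  decays like \<open>t powr (1 - p)\<close>. It is the quantity that enters the truncation estimate,
  and being convex in \<open>w\<close> it passes to averages.\<close>

definition tail :: "real \<Rightarrow> ('a set \<Rightarrow> real) \<Rightarrow> bool" where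
  "tail p w \<longleftrightarrow> (\<exists>C. \<forall>t\<ge>1. (\<integral>x. max 0 (\<bar>w x\<bar> - t) \<partial>\<nu>) \<le> C * t powr (1 - p))"

definition gap_constant :: "real \<Rightarrow> bool" where
  "gap_constant r \<longleftrightarrow> 0 < r \<and> r < 1 \<and> (\<forall>v. v \<in> borel_measurable (borel_of Xs) \<longrightarrow> integrable \<nu> (\<lambda>x. (v x)\<^sup>2) \<longrightarrow>
      (\<integral>x. v x \<partial>\<nu>) = 0 \<longrightarrow> integrable \<nu> (\<lambda>x. (A v x)\<^sup>2) \<and> (\<integral>x. (A v x)\<^sup>2 \<partial>\<nu>) \<le> r * (\<integral>x. (v x)\<^sup>2 \<partial>\<nu>))"

lemma Apow_gap:
  assumes r: "gap_constant r" and vb: "v \<in> borel_measurable (borel_of Xs)"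
    and v2: "integrable \<nu> (\<lambda>x. (v x)\<^sup>2)" and v0: "(\<integral>x. v x \<partial>\<nu>) = 0"
  shows "integrable \<nu> (\<lambda>x. ((A ^^ k) v x)\<^sup>2) \<and> (\<integral>x. ((A ^^ k) v x)\<^sup>2 \<partial>\<nu>) \<le> r ^ k * (\<integral>x. (v x)\<^sup>2 \<partial>\<nu>)"
proof (induction k)
  case (Suc k)
  have v: "integrable \<nu> v"
    by (rule square_integrable_imp_integrable[OF _ v2]) (use vb in \<open>simp add: measurable_nu\<close>)
  have b: "(A ^^ k) v \<in> borel_measurable (borel_of Xs)" by (rule integrable_borel[OF Apow_integrable[OF v]])
  have z: "(\<integral>x. (A ^^ k) v x \<partial>\<nu>) = 0" using Apow_integral[OF v] v0 by simp
  have "integrable \<nu> (\<lambda>x. (A ((A ^^ k) v) x)\<^sup>2) \<and> (\<integral>x. (A ((A ^^ k) v) x)\<^sup>2 \<partial>\<nu>) \<le> r * (\<integral>x. ((A ^^ k) v x)\<^sup>2 \<partial>\<nu>)"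
    using r b z Suc.IH unfolding gap_constant_def by blast
  moreover have "r * (\<integral>x. ((A ^^ k) v x)\<^sup>2 \<partial>\<nu>) \<le> r * (r ^ k * (\<integral>x. (v x)\<^sup>2 \<partial>\<nu>))"
    using Suc.IH r by (intro mult_left_mono) (auto simp: gap_constant_def)
  ultimately show ?case by (auto simp: mult.assoc intro: order_trans)
qed (use v2 in simp)

text \<open>Truncating \<open>w\<close> at level \<open>t\<close>, the bounded part is contracted in \<open>L\<^sup>2\<close> and the rest is
  small in \<open>L\<^sup>1\<close>; this replaces a spectral gap in \<open>L\<^sup>p\<close>.\<close>

lemma Apow_truncation:
  assumes r: "gap_constant r" and w: "integrable \<nu> w" and w0: "(\<integral>x. w x \<partial>\<nu>) = 0"
    and t: "0 < t" and s: "0 < s"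
  shows "(\<integral>x. \<bar>(A ^^ k) w x\<bar> \<partial>\<nu>) \<le> s * V + r ^ k * (4 * t\<^sup>2 * V) / s + 2 * (\<integral>x. max 0 (\<bar>w x\<bar> - t) \<partial>\<nu>)"
proof -
  have wb[measurable]: "w \<in> borel_measurable \<nu>" using w by auto
  define u where "u x = max (- t) (min t (w x))" for x
  have ub[measurable]: "u \<in> borel_measurable \<nu>" unfolding u_def by measurable
  have u_le: "\<bar>u x\<bar> \<le> t" for x using t by (auto simp: u_def)
  have u: "integrable \<nu> u" by (rule integrable_const_bound[of _ t]) (use u_le in auto)
  have wu: "\<bar>w x - u x\<bar> = max 0 (\<bar>w x\<bar> - t)" for x using t by (auto simp: u_def max_def min_def abs_if)
  define m where "m = (\<integral>x. u x \<partial>\<nu>) / V"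
  define I where "I = (\<integral>x. max 0 (\<bar>w x\<bar> - t) \<partial>\<nu>)"
  have I: "I = (\<integral>x. \<bar>w x - u x\<bar> \<partial>\<nu>)" by (simp add: I_def wu)
  have "m * V = (\<integral>x. u x - w x \<partial>\<nu>)" using u w w0 V_pos by (simp add: m_def)
  then have "\<bar>m\<bar> * V = \<bar>\<integral>x. u x - w x \<partial>\<nu>\<bar>" by (metis abs_mult abs_of_pos V_pos)
  also have "\<dots> \<le> (\<integral>x. \<bar>u x - w x\<bar> \<partial>\<nu>)" using integral_norm_bound[of \<nu> "\<lambda>x. u x - w x"] by simp
  also have "\<dots> = I" by (simp add: I abs_minus_commute)
  finally have mI: "\<bar>m\<bar> * V \<le> I" .
  have mt: "\<bar>m\<bar> \<le> t"
  proof -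
    have "\<bar>\<integral>x. u x \<partial>\<nu>\<bar> \<le> (\<integral>x. \<bar>u x\<bar> \<partial>\<nu>)" using integral_norm_bound[of \<nu> u] by simp
    also have "\<dots> \<le> (\<integral>x. t \<partial>\<nu>)" using u u_le by (intro integral_mono) auto
    finally have "\<bar>\<integral>x. u x \<partial>\<nu>\<bar> \<le> t * V" by (simp add: mult.commute)
    then show ?thesis using V_pos by (simp add: m_def abs_divide pos_divide_le_eq)
  qed
  \<comment> \<open>Clipping disturbs the mean, so the mean \<open>m\<close> is moved from the
    bounded part to the remainder. This at most doubles the bound on the remainder in
    \<open>L\<^sup>1\<close>.\<close>
  define u0 where "u0 x = u x - m" for x
  define d where "d x = (w x - u x) + m" for x
  have u0: "integrable \<nu> u0" unfolding u0_def using u by simp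
  have d: "integrable \<nu> d" unfolding d_def using u w by simp
  have weq: "w = (\<lambda>x. u0 x + d x)" by (auto simp: u0_def d_def)
  have u0_le: "\<bar>u0 x\<bar> \<le> 2 * t" for x using u_le[of x] mt by (auto simp: u0_def)
  have u0sq: "(u0 x)\<^sup>2 \<le> 4 * t\<^sup>2" for x
    using power_mono[OF u0_le[of x], of 2] by (simp add: power_mult_distrib)
  have u02: "integrable \<nu> (\<lambda>x. (u0 x)\<^sup>2)"
    by (rule integrable_const_bound[of _ "4 * t\<^sup>2"]) (use u0sq u0 in auto)
  have u0m: "(\<integral>x. u0 x \<partial>\<nu>) = 0" unfolding u0_def using u V_pos by (simp add: m_def)
  have u02I: "(\<integral>x. (u0 x)\<^sup>2 \<partial>\<nu>) \<le> 4 * t\<^sup>2 * V"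
  proof -
    have "(\<integral>x. (u0 x)\<^sup>2 \<partial>\<nu>) \<le> (\<integral>x. 4 * t\<^sup>2 \<partial>\<nu>)" using u02 u0sq by (intro integral_mono) auto
    then show ?thesis by (simp add: mult_ac)
  qed
  have dI: "(\<integral>x. \<bar>d x\<bar> \<partial>\<nu>) \<le> 2 * I"
  proof -
    have "(\<integral>x. \<bar>d x\<bar> \<partial>\<nu>) \<le> (\<integral>x. \<bar>w x - u x\<bar> + \<bar>m\<bar> \<partial>\<nu>)"
      using d u w by (intro integral_mono) (auto simp: d_def)
    also have "\<dots> = I + \<bar>m\<bar> * V" using u w by (simp add: I mult.commute)
    finally show ?thesis using mI by simp
  qed
  note G = Apow_gap[OF r integrable_borel[OF u0] u02 u0m, of k]
  have Au: "integrable \<nu> ((A ^^ k) u0)" "integrable \<nu> ((A ^^ k) d)" by (rule Apow_integrable[OF u0], rule Apow_integrable[OF d])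
  \<comment> \<open>Takes the place of the Cauchy-Schwarz inequality, with a parameter
    \<open>s\<close> that is later made to decay with \<open>k\<close>.\<close>
  have bd: "\<bar>y\<bar> \<le> s + y\<^sup>2 / s" for y :: real
  proof (cases "\<bar>y\<bar> \<le> s")
    case True
    then show ?thesis using s by (simp add: add_increasing2)
  next
    case False
    then have "\<bar>y\<bar> * s \<le> \<bar>y\<bar> * \<bar>y\<bar>" using s by (intro mult_left_mono) auto
    then have "\<bar>y\<bar> \<le> y\<^sup>2 / s" using s by (simp add: pos_le_divide_eq power2_eq_square)
    then show ?thesis using s by simp
  qed
  have "(\<integral>x. \<bar>(A ^^ k) u0 x\<bar> \<partial>\<nu>) \<le> (\<integral>x. s + ((A ^^ k) u0 x)\<^sup>2 / s \<partial>\<nu>)"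
    using Au(1) G bd by (intro integral_mono) auto
  also have "\<dots> = s * V + (\<integral>x. ((A ^^ k) u0 x)\<^sup>2 \<partial>\<nu>) / s" using G by (simp add: mult.commute)
  also have "(\<integral>x. ((A ^^ k) u0 x)\<^sup>2 \<partial>\<nu>) / s \<le> r ^ k * (4 * t\<^sup>2 * V) / s"
  proof (rule divide_right_mono)
    have "r ^ k * (\<integral>x. (u0 x)\<^sup>2 \<partial>\<nu>) \<le> r ^ k * (4 * t\<^sup>2 * V)"
      using r u02I by (intro mult_left_mono) (auto simp: gap_constant_def)
    then show "(\<integral>x. ((A ^^ k) u0 x)\<^sup>2 \<partial>\<nu>) \<le> r ^ k * (4 * t\<^sup>2 * V)" using G by linarith
  qed (use s in simp)
  finally have 1: "(\<integral>x. \<bar>(A ^^ k) u0 x\<bar> \<partial>\<nu>) \<le> s * V + r ^ k * (4 * t\<^sup>2 * V) / s" by simp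
  have 2: "(\<integral>x. \<bar>(A ^^ k) d x\<bar> \<partial>\<nu>) \<le> 2 * I" using Apow_norm[OF d, of k] dI by linarith
  have "AE x in \<nu>. \<bar>(A ^^ k) w x\<bar> \<le> \<bar>(A ^^ k) u0 x\<bar> + \<bar>(A ^^ k) d x\<bar>"
    using Apow_add[OF u0 d, of k] unfolding weq[symmetric] by eventually_elim simp
  then have "(\<integral>x. \<bar>(A ^^ k) w x\<bar> \<partial>\<nu>) \<le> (\<integral>x. \<bar>(A ^^ k) u0 x\<bar> + \<bar>(A ^^ k) d x\<bar> \<partial>\<nu>)"
    using Au Apow_integrable[OF w] by (intro integral_mono_AE) auto
  also have "\<dots> = (\<integral>x. \<bar>(A ^^ k) u0 x\<bar> \<partial>\<nu>) + (\<integral>x. \<bar>(A ^^ k) d x\<bar> \<partial>\<nu>)" using Au by simp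
  finally show ?thesis using 1 2 by (simp add: I_def)
qed

text \<open>With \<open>\<sigma> = r powr (1/4)\<close>, the choices \<open>s = \<sigma> ^ k\<close>
  and \<open>t = 1 / s\<close> turn \<open>r ^ k * t\<^sup>2 / s\<close> into
  \<open>\<sigma> ^ k\<close> and the tail into a multiple of
  \<open>(\<sigma> powr (p - 1)) ^ k\<close>. Both are geometric, the second because
  \<open>p > 1\<close>.\<close>

lemma Apow_summable:
  assumes r: "gap_constant r" and p: "1 < p" and w: "integrable \<nu> w" "(\<integral>x. w x \<partial>\<nu>) = 0" "tail p w"
  shows "summable (\<lambda>k. \<integral>x. \<bar>(A ^^ k) w x\<bar> \<partial>\<nu>)"
proof -
  obtain C where C: "\<And>t. t \<ge> 1 \<Longrightarrow> (\<integral>x. max 0 (\<bar>w x\<bar> - t) \<partial>\<nu>) \<le> C * t powr (1 - p)"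
    using w(3) unfolding tail_def by blast
  define \<sigma> where "\<sigma> = r powr (1/4)"
  have r01: "0 < r" "r < 1" using r by (auto simp: gap_constant_def)
  have \<sigma>: "0 < \<sigma>" "\<sigma> < 1"
    using r01 powr_less_mono2[of "1/4" r 1] by (auto simp: \<sigma>_def)
  have \<sigma>4: "\<sigma> ^ 4 = r" using r01 by (simp add: \<sigma>_def powr_power)
  define \<kappa> where "\<kappa> = \<sigma> powr (p - 1)"
  have \<kappa>: "0 < \<kappa>" "\<kappa> < 1" using \<sigma> p powr_less_mono2[of "p - 1" \<sigma> 1] by (auto simp: \<kappa>_def)
  have bound: "(\<integral>x. \<bar>(A ^^ k) w x\<bar> \<partial>\<nu>) \<le> 5 * V * \<sigma> ^ k + 2 * C * \<kappa> ^ k" for k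
  proof -
    define s where "s = \<sigma> ^ k"
    have s: "0 < s" "s \<le> 1" using \<sigma> by (auto simp: s_def power_le_one)
    define t where "t = 1 / s"
    have t: "t \<ge> 1" using s by (simp add: t_def)
    have rk: "r ^ k = s ^ 4" unfolding s_def \<sigma>4[symmetric] by (simp add: power_mult[symmetric] mult.commute)
    have e1: "r ^ k * (4 * t\<^sup>2 * V) / s = 4 * V * s"
      unfolding rk t_def using s by (simp add: field_simps power2_eq_square power4_eq_xxxx)
    have "t powr (1 - p) = s powr (p - 1)"
      unfolding t_def using s by (simp add: powr_divide powr_minus_divide[symmetric])
    also have "\<dots> = \<kappa> ^ k" unfolding s_def \<kappa>_def using \<sigma>
      by (simp add: powr_realpow[symmetric] powr_powr mult.commute)
    finally have e2: "t powr (1 - p) = \<kappa> ^ k" .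
    have "(\<integral>x. \<bar>(A ^^ k) w x\<bar> \<partial>\<nu>) \<le> s * V + r ^ k * (4 * t\<^sup>2 * V) / s + 2 * (\<integral>x. max 0 (\<bar>w x\<bar> - t) \<partial>\<nu>)"
      using t by (intro Apow_truncation r w s) auto
    also have "\<dots> \<le> s * V + 4 * V * s + 2 * (C * \<kappa> ^ k)" using C[OF t] unfolding e1 e2 by simp
    finally show ?thesis by (simp add: s_def algebra_simps)
  qed
  show ?thesis
  proof (rule summable_comparison_test')
    show "summable (\<lambda>k. 5 * V * \<sigma> ^ k + 2 * C * \<kappa> ^ k)"
      using \<sigma> \<kappa> by (intro summable_add summable_mult summable_geometric) auto
    show "norm (\<integral>x. \<bar>(A ^^ k) w x\<bar> \<partial>\<nu>) \<le> 5 * V * \<sigma> ^ k + 2 * C * \<kappa> ^ k" for k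
      using bound[of k] by simp
  qed
qed

text \<open>\<open>max 0 (\<bar>y\<bar> - t)\<close> is convex in \<open>y\<close>, so the excess of
  a finite mean is at most the mean of the excesses.\<close>

lemma tail_average:
  assumes w: "\<And>j. j \<in> {1..n} \<Longrightarrow> integrable \<nu> (w j) \<and> tail p (w j)"
  shows "tail p (\<lambda>x. (\<Sum>j=1..n. w j x) / real n)"
proof -
  have "\<forall>j\<in>{1..n}. \<exists>C. \<forall>t\<ge>1. (\<integral>x. max 0 (\<bar>w j x\<bar> - t) \<partial>\<nu>) \<le> C * t powr (1 - p)"
    using w by (auto simp: tail_def)
  then obtain C where C: "\<And>j t. j \<in> {1..n} \<Longrightarrow> t \<ge> 1 \<Longrightarrow> (\<integral>x. max 0 (\<bar>w j x\<bar> - t) \<partial>\<nu>) \<le> C j * t powr (1 - p)"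
    by metis
  have "(\<integral>x. max 0 (\<bar>(\<Sum>j=1..n. w j x) / real n\<bar> - t) \<partial>\<nu>) \<le> ((\<Sum>j=1..n. C j) / real n) * t powr (1 - p)" if t: "t \<ge> 1" for t
  proof -
    have i: "integrable \<nu> (\<lambda>x. max 0 (\<bar>w j x\<bar> - t))" if "j \<in> {1..n}" for j
      using w[OF that] by (intro integrable_max) auto
    have "(\<integral>x. max 0 (\<bar>(\<Sum>j=1..n. w j x) / real n\<bar> - t) \<partial>\<nu>) \<le> (\<integral>x. (\<Sum>j=1..n. max 0 (\<bar>w j x\<bar> - t)) / real n \<partial>\<nu>)"
    proof (rule integral_mono)
      show "integrable \<nu> (\<lambda>x. max 0 (\<bar>(\<Sum>j=1..n. w j x) / real n\<bar> - t))"
        using w by (intro integrable_max Bochner_Integration.integrable_diff integrable_abs integrable_divide Bochner_Integration.integrable_sum) auto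
      show "integrable \<nu> (\<lambda>x. (\<Sum>j=1..n. max 0 (\<bar>w j x\<bar> - t)) / real n)"
        using i by (intro integrable_divide Bochner_Integration.integrable_sum) auto
      fix x
      have "\<bar>(\<Sum>j=1..n. w j x)\<bar> - real n * t \<le> (\<Sum>j=1..n. \<bar>w j x\<bar> - t)"
        by (simp add: sum_subtractf)
      also have "\<dots> \<le> (\<Sum>j=1..n. max 0 (\<bar>w j x\<bar> - t))" by (intro sum_mono) simp
      finally have "(\<bar>(\<Sum>j=1..n. w j x)\<bar> - real n * t) / real n \<le> (\<Sum>j=1..n. max 0 (\<bar>w j x\<bar> - t)) / real n"
        by (intro divide_right_mono) auto
      moreover have "(\<bar>(\<Sum>j=1..n. w j x)\<bar> - real n * t) / real n = \<bar>(\<Sum>j=1..n. w j x) / real n\<bar> - t"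
        using n_pos by (simp add: diff_divide_distrib)
      moreover have "0 \<le> (\<Sum>j=1..n. max 0 (\<bar>w j x\<bar> - t)) / real n" by (intro divide_nonneg_nonneg sum_nonneg) auto
      ultimately show "max 0 (\<bar>(\<Sum>j=1..n. w j x) / real n\<bar> - t) \<le> (\<Sum>j=1..n. max 0 (\<bar>w j x\<bar> - t)) / real n" by simp
    qed
    also have "\<dots> = (\<Sum>j=1..n. \<integral>x. max 0 (\<bar>w j x\<bar> - t) \<partial>\<nu>) / real n"
      using i by simp
    also have "\<dots> \<le> (\<Sum>j=1..n. C j * t powr (1 - p)) / real n"
      using C t by (intro divide_right_mono sum_mono) auto
    finally show ?thesis by (simp add: sum_distrib_right)
  qed
  then show ?thesis unfolding tail_def by blast
qed

text \<open>Completeness of \<open>L\<^sup>1\<close> for series: exchanging sum and integral bounds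
  the integral of the sum of absolute values, which is therefore finite almost everywhere and
  dominates the series.\<close>

lemma integral_abs_suminf_le:
  fixes f :: "nat \<Rightarrow> 'b \<Rightarrow> real"
  assumes f: "\<And>k. integrable M (f k)" and s: "summable (\<lambda>k. \<integral>x. \<bar>f k x\<bar> \<partial>M)"
  shows "AE x in M. summable (\<lambda>k. f k x)" and "integrable M (\<lambda>x. suminf (\<lambda>k. f k x))"
    and "(\<integral>x. \<bar>suminf (\<lambda>k. f k x)\<bar> \<partial>M) \<le> suminf (\<lambda>k. \<integral>x. \<bar>f k x\<bar> \<partial>M)"
proof -
  have "(\<integral>\<^sup>+x. suminf (\<lambda>k. ennreal \<bar>f k x\<bar>) \<partial>M) = suminf (\<lambda>k. \<integral>\<^sup>+x. ennreal \<bar>f k x\<bar> \<partial>M)"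
    using f by (intro nn_integral_suminf) auto
  also have "\<dots> = suminf (\<lambda>k. ennreal (\<integral>x. \<bar>f k x\<bar> \<partial>M))"
    using f by (intro arg_cong[where f = suminf] ext nn_integral_eq_integral) auto
  also have "\<dots> = ennreal (suminf (\<lambda>k. \<integral>x. \<bar>f k x\<bar> \<partial>M))"
    using s by (intro suminf_ennreal2) auto
  finally have eq: "(\<integral>\<^sup>+x. suminf (\<lambda>k. ennreal \<bar>f k x\<bar>) \<partial>M) = ennreal (suminf (\<lambda>k. \<integral>x. \<bar>f k x\<bar> \<partial>M))" .
  have "AE x in M. suminf (\<lambda>k. ennreal \<bar>f k x\<bar>) \<noteq> \<infinity>"
  proof (rule nn_integral_PInf_AE)
    show "(\<lambda>x. suminf (\<lambda>k. ennreal \<bar>f k x\<bar>)) \<in> borel_measurable M"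
      using f by (intro borel_measurable_suminf_order) auto
  qed (simp add: eq)
  then have abs: "AE x in M. summable (\<lambda>k. \<bar>f k x\<bar>)"
    by eventually_elim (auto intro: summable_suminf_not_top)
  then show sm: "AE x in M. summable (\<lambda>k. f k x)"
    by eventually_elim (rule summable_rabs_cancel)
  show i: "integrable M (\<lambda>x. suminf (\<lambda>k. f k x))"
    using f s abs by (intro integrable_suminf) auto
  have "ennreal (\<integral>x. \<bar>suminf (\<lambda>k. f k x)\<bar> \<partial>M) = (\<integral>\<^sup>+x. ennreal \<bar>suminf (\<lambda>k. f k x)\<bar> \<partial>M)"
    using i by (intro nn_integral_eq_integral[symmetric]) auto
  also have "\<dots> \<le> (\<integral>\<^sup>+x. suminf (\<lambda>k. ennreal \<bar>f k x\<bar>) \<partial>M)"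
  proof (rule nn_integral_mono_AE)
    show "AE x in M. ennreal \<bar>suminf (\<lambda>k. f k x)\<bar> \<le> suminf (\<lambda>k. ennreal \<bar>f k x\<bar>)"
      using abs
    proof eventually_elim
      case (elim x)
      have "ennreal \<bar>suminf (\<lambda>k. f k x)\<bar> \<le> ennreal (suminf (\<lambda>k. \<bar>f k x\<bar>))"
        by (intro ennreal_leI summable_rabs elim)
      also have "\<dots> = suminf (\<lambda>k. ennreal \<bar>f k x\<bar>)" using elim by (intro suminf_ennreal2[symmetric]) auto
      finally show ?case .
    qed
  qed
  finally show "(\<integral>x. \<bar>suminf (\<lambda>k. f k x)\<bar> \<partial>M) \<le> suminf (\<lambda>k. \<integral>x. \<bar>f k x\<bar> \<partial>M)"
    unfolding eq using s by (subst (asm) ennreal_le_iff) (auto intro: suminf_nonneg)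
qed

end

text \<open>The cocycle identity is demanded at every point of the coset space, so that it can be
  integrated over the group with \<open>x\<close> fixed. \<open>c_avg\<close> is secured by the
  choice of the density \<open>\<rho>\<close>.\<close>

locale averaging_cocycle = averaging G T \<Gamma> \<nu> n \<pi> \<rho>
  for G :: "'a monoid" (structure) and T :: "'a topology" and \<Gamma> :: "'a set" and \<nu> :: "'a set measure"
    and n :: nat and \<pi> :: "nat \<Rightarrow> 'a \<Rightarrow> 'a" and \<rho> :: "'a \<Rightarrow> ennreal" +
  fixes c :: "'a \<Rightarrow> 'a set \<Rightarrow> real" and p r :: real
  assumes p: "1 < p" and r: "gap_constant r"
    and c_borel: "case_prod c \<in> borel_measurable (borel_of (prod_topology T Xs))"
    and c_mult: "g \<in> carrier G \<Longrightarrow> h \<in> carrier G \<Longrightarrow> x \<in> topspace Xs \<Longrightarrow>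
      c (g \<otimes> h) x = c g x + c h (inv g <# x)"
    and c_integrable: "g \<in> carrier G \<Longrightarrow> integrable \<nu> (c g)"
    and c_mean: "g \<in> carrier G \<Longrightarrow> (\<integral>x. c g x \<partial>\<nu>) = 0"
    and c_avg: "j \<in> {1..n} \<Longrightarrow> (\<integral>\<^sup>+g. \<integral>\<^sup>+x. ennreal (\<bar>c (\<pi> j g) x\<bar> powr p) \<partial>\<nu> \<partial>avg) < \<infinity>"
begin

text \<open>The translation part of the affine average \<open>v \<mapsto> P j v + w j\<close> over
  the \<open>j\<close>-th factor.\<close>

definition w :: "nat \<Rightarrow> 'a set \<Rightarrow> real" where
  "w j x = (\<integral>g. c (\<pi> j g) x \<partial>avg)"

lemma c_compose:
  assumes "continuous_map S T f" "continuous_map S Xs h"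
  shows "(\<lambda>s. c (f s) (h s)) \<in> borel_measurable (borel_of S)"
  using measurable_compose[OF continuous_map_measurable[OF continuous_map_pairedI[OF assms]] c_borel] by simp

lemma cpi_borel:
  assumes j: "j \<in> {1..n}"
  shows "(\<lambda>(x, g). c (\<pi> j g) x) \<in> borel_measurable (borel_of (prod_topology Xs T))"
  unfolding case_prod_unfold
  by (intro c_compose continuous_map_proj[OF j] continuous_map_fst continuous_map_snd)

lemma c_avg':
  assumes j: "j \<in> {1..n}"
  shows "(\<integral>\<^sup>+x. \<integral>\<^sup>+g. ennreal (\<bar>c (\<pi> j g) x\<bar> powr p) \<partial>avg \<partial>\<nu>) < \<infinity>"
proof -
  have "(\<lambda>(x, g). ennreal (\<bar>c (\<pi> j g) x\<bar> powr p)) \<in> borel_measurable (borel_of (prod_topology Xs T))"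
    using cpi_borel[OF j] by (simp add: case_prod_unfold)
  from tau_additive_Tonelli(3)[OF tau_additive_nu tau_additive_avg this] show ?thesis using c_avg[OF j] by simp
qed

lemma abs_le_powr: "\<bar>y :: real\<bar> \<le> 1 + \<bar>y\<bar> powr p"
proof (cases "\<bar>y\<bar> \<le> 1")
  case True
  then show ?thesis by (simp add: add_increasing2)
next
  case False
  then have "\<bar>y\<bar> powr 1 \<le> \<bar>y\<bar> powr p" using p by (intro powr_mono) auto
  then show ?thesis using False by simp
qed

lemma c_abs_avg:
  assumes j: "j \<in> {1..n}"
  shows "(\<integral>\<^sup>+x. \<integral>\<^sup>+g. ennreal \<bar>c (\<pi> j g) x\<bar> \<partial>avg \<partial>\<nu>) < \<infinity>"
proof -
  have m: "(\<lambda>(x, g). ennreal (\<bar>c (\<pi> j g) x\<bar> powr p)) \<in> borel_measurable (borel_of (prod_topology Xs T))"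
    using cpi_borel[OF j] by (simp add: case_prod_unfold)
  have "(\<integral>\<^sup>+x. \<integral>\<^sup>+g. ennreal \<bar>c (\<pi> j g) x\<bar> \<partial>avg \<partial>\<nu>) \<le> (\<integral>\<^sup>+x. 1 + (\<integral>\<^sup>+g. ennreal (\<bar>c (\<pi> j g) x\<bar> powr p) \<partial>avg) \<partial>\<nu>)"
  proof (rule nn_integral_mono)
    fix x assume "x \<in> space \<nu>"
    then have x: "x \<in> topspace Xs" by (simp add: space_nu)
    have "(\<integral>\<^sup>+g. ennreal \<bar>c (\<pi> j g) x\<bar> \<partial>avg) \<le> (\<integral>\<^sup>+g. 1 + ennreal (\<bar>c (\<pi> j g) x\<bar> powr p) \<partial>avg)"
    proof (rule nn_integral_mono)
      fix g
      have "ennreal \<bar>c (\<pi> j g) x\<bar> \<le> ennreal (1 + \<bar>c (\<pi> j g) x\<bar> powr p)" by (rule ennreal_leI[OF abs_le_powr])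
      then show "ennreal \<bar>c (\<pi> j g) x\<bar> \<le> 1 + ennreal (\<bar>c (\<pi> j g) x\<bar> powr p)" by (simp add: ennreal_plus)
    qed
    also have "\<dots> = 1 + (\<integral>\<^sup>+g. ennreal (\<bar>c (\<pi> j g) x\<bar> powr p) \<partial>avg)"
      using slice_measurable(1)[OF m x] by (subst nn_integral_add) (auto simp: measurable_avg emeasure_avg_space)
    finally show "(\<integral>\<^sup>+g. ennreal \<bar>c (\<pi> j g) x\<bar> \<partial>avg) \<le> 1 + (\<integral>\<^sup>+g. ennreal (\<bar>c (\<pi> j g) x\<bar> powr p) \<partial>avg)" .
  qed
  also have "\<dots> = emeasure \<nu> (space \<nu>) + (\<integral>\<^sup>+x. \<integral>\<^sup>+g. ennreal (\<bar>c (\<pi> j g) x\<bar> powr p) \<partial>avg \<partial>\<nu>)"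
    using tau_additive_Tonelli(1)[OF tau_additive_nu tau_additive_avg m] by (subst nn_integral_add) auto
  also have "\<dots> < \<infinity>" using c_avg'[OF j] emeasure_finite by (simp add: less_top[symmetric])
  finally show ?thesis .
qed

lemma w_Fubini:
  assumes j: "j \<in> {1..n}"
  shows "AE x in \<nu>. integrable avg (\<lambda>g. c (\<pi> j g) x)" and "integrable \<nu> (w j)" and "(\<integral>x. w j x \<partial>\<nu>) = 0"
proof -
  note F = tau_additive_Fubini[OF tau_additive_nu tau_additive_avg cpi_borel[OF j] c_abs_avg[OF j]]
  show "AE x in \<nu>. integrable avg (\<lambda>g. c (\<pi> j g) x)" by (rule F(1))
  show "integrable \<nu> (w j)" using F(2) unfolding w_def .
  have "(\<integral>x. w j x \<partial>\<nu>) = (\<integral>g. \<integral>x. c (\<pi> j g) x \<partial>\<nu> \<partial>avg)" using F(3) unfolding w_def .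
  also have "\<dots> = (\<integral>g. 0 \<partial>avg)"
    by (intro Bochner_Integration.integral_cong refl c_mean) (use j in \<open>simp add: space_avg\<close>)
  finally show "(\<integral>x. w j x \<partial>\<nu>) = 0" by simp
qed

text \<open>Jensen's inequality moves the excess over \<open>t\<close> inside the average over
  \<open>g\<close>, where \<open>max 0 (\<bar>y\<bar> - t) \<le> t powr (1 - p) * \<bar>y\<bar> powr
  p\<close> applies pointwise.\<close>

lemma w_tail:
  assumes j: "j \<in> {1..n}"
  shows "tail p (w j)"
proof -
  have m: "(\<lambda>(x, g). ennreal (\<bar>c (\<pi> j g) x\<bar> powr p)) \<in> borel_measurable (borel_of (prod_topology Xs T))"
    using cpi_borel[OF j] by (simp add: case_prod_unfold)
  define C where "C = (\<integral>\<^sup>+x. \<integral>\<^sup>+g. ennreal (\<bar>c (\<pi> j g) x\<bar> powr p) \<partial>avg \<partial>\<nu>)"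
  have C: "C < \<infinity>" unfolding C_def by (rule c_avg'[OF j])
  have "(\<integral>x. max 0 (\<bar>w j x\<bar> - t) \<partial>\<nu>) \<le> enn2real C * t powr (1 - p)" if t: "t \<ge> 1" for t
  proof -
    have pt: "max 0 (\<bar>y\<bar> - t) \<le> t powr (1 - p) * \<bar>y\<bar> powr p" for y :: real
    proof (cases "\<bar>y\<bar> \<le> t")
      case False
      then have "\<bar>y\<bar> = \<bar>y\<bar> powr (1 - p) * \<bar>y\<bar> powr p" using t by (simp add: powr_add[symmetric])
      also have "\<dots> \<le> t powr (1 - p) * \<bar>y\<bar> powr p"
        using False t p by (intro mult_right_mono powr_mono2') auto
      finally show ?thesis using t False by simp
    qed simp
    have i: "integrable \<nu> (\<lambda>x. max 0 (\<bar>w j x\<bar> - t))" using w_Fubini(2)[OF j] by (intro integrable_max) auto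
    have "ennreal (\<integral>x. max 0 (\<bar>w j x\<bar> - t) \<partial>\<nu>) = (\<integral>\<^sup>+x. ennreal (max 0 (\<bar>w j x\<bar> - t)) \<partial>\<nu>)"
      using i by (intro nn_integral_eq_integral[symmetric]) auto
    also have "\<dots> \<le> (\<integral>\<^sup>+x. ennreal (t powr (1 - p)) * (\<integral>\<^sup>+g. ennreal (\<bar>c (\<pi> j g) x\<bar> powr p) \<partial>avg) \<partial>\<nu>)"
    proof (rule nn_integral_mono_AE)
      show "AE x in \<nu>. ennreal (max 0 (\<bar>w j x\<bar> - t)) \<le> ennreal (t powr (1 - p)) * (\<integral>\<^sup>+g. ennreal (\<bar>c (\<pi> j g) x\<bar> powr p) \<partial>avg)"
        using w_Fubini(1)[OF j] AE_space
      proof eventually_elim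
        case (elim x)
        then have x: "x \<in> topspace Xs" by (simp add: space_nu)
        have ii: "integrable avg (\<lambda>g. max 0 (\<bar>c (\<pi> j g) x\<bar> - t))" using elim(1) by (intro integrable_max) auto
        have "\<bar>w j x\<bar> \<le> (\<integral>g. \<bar>c (\<pi> j g) x\<bar> \<partial>avg)" unfolding w_def using integral_norm_bound[of avg "\<lambda>g. c (\<pi> j g) x"] by simp
        then have "\<bar>w j x\<bar> - t \<le> (\<integral>g. \<bar>c (\<pi> j g) x\<bar> - t \<partial>avg)" using elim(1) by simp
        also have "\<dots> \<le> (\<integral>g. max 0 (\<bar>c (\<pi> j g) x\<bar> - t) \<partial>avg)" using elim(1) ii by (intro integral_mono) auto
        finally have "max 0 (\<bar>w j x\<bar> - t) \<le> (\<integral>g. max 0 (\<bar>c (\<pi> j g) x\<bar> - t) \<partial>avg)" by simp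
        then have "ennreal (max 0 (\<bar>w j x\<bar> - t)) \<le> ennreal (\<integral>g. max 0 (\<bar>c (\<pi> j g) x\<bar> - t) \<partial>avg)" by (rule ennreal_leI)
        also have "\<dots> = (\<integral>\<^sup>+g. ennreal (max 0 (\<bar>c (\<pi> j g) x\<bar> - t)) \<partial>avg)"
          using ii by (intro nn_integral_eq_integral[symmetric]) auto
        also have "\<dots> \<le> (\<integral>\<^sup>+g. ennreal (t powr (1 - p)) * ennreal (\<bar>c (\<pi> j g) x\<bar> powr p) \<partial>avg)"
        proof (rule nn_integral_mono)
          fix g
          show "ennreal (max 0 (\<bar>c (\<pi> j g) x\<bar> - t)) \<le> ennreal (t powr (1 - p)) * ennreal (\<bar>c (\<pi> j g) x\<bar> powr p)"
            using ennreal_leI[OF pt[of "c (\<pi> j g) x"]] by (simp add: ennreal_mult)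
        qed
        also have "\<dots> = ennreal (t powr (1 - p)) * (\<integral>\<^sup>+g. ennreal (\<bar>c (\<pi> j g) x\<bar> powr p) \<partial>avg)"
          using slice_measurable(1)[OF m x] by (intro nn_integral_cmult) (simp add: measurable_avg)
        finally show ?case .
      qed
    qed
    also have "\<dots> = ennreal (t powr (1 - p)) * C"
      unfolding C_def using tau_additive_Tonelli(1)[OF tau_additive_nu tau_additive_avg m] by (intro nn_integral_cmult)
    also have "\<dots> = ennreal (enn2real C * t powr (1 - p))"
    proof -
      have "C = ennreal (enn2real C)" using C by simp
      then have "ennreal (t powr (1 - p)) * C = ennreal (t powr (1 - p)) * ennreal (enn2real C)" by (rule arg_cong)
      also have "\<dots> = ennreal (t powr (1 - p) * enn2real C)" by (rule ennreal_mult[symmetric]) auto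
      finally show ?thesis by (simp add: mult.commute)
    qed
    finally show ?thesis by (subst (asm) ennreal_le_iff) auto
  qed
  then show ?thesis unfolding tail_def by blast
qed

text \<open>The affine averages over two factors commute, evaluated at the zero vector. By the
  cocycle identity each side is a double average of \<open>c\<close> over products of elements of
  the two factors, taken in opposite orders.\<close>

lemma w_swap:
  assumes i: "i \<in> {1..n}" and j: "j \<in> {1..n}"
  shows "AE x in \<nu>. P i (w j) x + w i x = P j (w i) x + w j x"
proof -
  define \<phi> where "\<phi> l x = (\<integral>\<^sup>+h. ennreal \<bar>c (\<pi> l h) x\<bar> \<partial>avg)" for l x
  have mc: "(\<lambda>(x, g). ennreal \<bar>c (\<pi> l g) x\<bar>) \<in> borel_measurable (borel_of (prod_topology Xs T))" if "l \<in> {1..n}" for l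
    using cpi_borel[OF that] by (simp add: case_prod_unfold)
  have \<phi>b: "\<phi> l \<in> borel_measurable (borel_of Xs)" if "l \<in> {1..n}" for l
    using tau_additive_Tonelli(1)[OF tau_additive_nu tau_additive_avg mc[OF that]] unfolding \<phi>_def by (simp add: measurable_nu)
  have \<phi>fin: "AE x in \<nu>. \<phi> l x \<noteq> \<infinity>" if l: "l \<in> {1..n}" for l
  proof (rule nn_integral_PInf_AE)
    show "\<phi> l \<in> borel_measurable \<nu>" using \<phi>b[OF l] by (simp add: measurable_nu)
    show "(\<integral>\<^sup>+x. \<phi> l x \<partial>\<nu>) \<noteq> \<infinity>" using c_abs_avg[OF l] by (simp add: \<phi>_def[abs_def])
  qed
  have \<phi>fin2: "AE x in \<nu>. (\<integral>\<^sup>+g. \<phi> l (inv (\<pi> k g) <# x) \<partial>avg) \<noteq> \<infinity>" if k: "k \<in> {1..n}" and l: "l \<in> {1..n}" for k l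
  proof (rule nn_integral_PInf_AE)
    show "(\<lambda>x. \<integral>\<^sup>+g. \<phi> l (inv (\<pi> k g) <# x) \<partial>avg) \<in> borel_measurable \<nu>"
      using nn_integral_shift(2)[OF k \<phi>b[OF l]] by (simp add: measurable_nu)
    show "(\<integral>\<^sup>+x. \<integral>\<^sup>+g. \<phi> l (inv (\<pi> k g) <# x) \<partial>avg \<partial>\<nu>) \<noteq> \<infinity>"
      unfolding nn_integral_shift(1)[OF k \<phi>b[OF l]] using c_abs_avg[OF l] by (simp add: \<phi>_def[abs_def])
  qed
  \<comment> \<open>The finiteness conditions hold for almost every \<open>x\<close>; isolating them
    here lets \<open>average_swap\<close> be applied at a fixed point, in both orders of the
    indices.\<close>
  have D: "P k (w l) x + w k x = (\<integral>g. \<integral>h. c (\<pi> k g \<otimes> \<pi> l h) x \<partial>avg \<partial>avg) \<and>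
      (\<integral>\<^sup>+g. \<integral>\<^sup>+h. ennreal \<bar>c (\<pi> k g \<otimes> \<pi> l h) x\<bar> \<partial>avg \<partial>avg) < \<infinity>"
    if k: "k \<in> {1..n}" and l: "l \<in> {1..n}" and x: "x \<in> topspace Xs"
      and f1: "\<phi> k x \<noteq> \<infinity>" and f2: "(\<integral>\<^sup>+g. \<phi> l (inv (\<pi> k g) <# x) \<partial>avg) \<noteq> \<infinity>"
      and f3: "integrable avg (\<lambda>g. w l (inv (\<pi> k g) <# x))" and f4: "integrable avg (\<lambda>g. c (\<pi> k g) x)" for k l x
  proof
    have sb: "(\<lambda>g. \<phi> l (inv (\<pi> k g) <# x)) \<in> borel_measurable avg"
      unfolding measurable_avg by (rule slice_borel[OF k \<phi>b[OF l] x])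
    have cb: "(\<lambda>h. c (\<pi> l h) y) \<in> borel_measurable avg" if "y \<in> topspace Xs" for y
      unfolding measurable_avg using that
      by (intro c_compose continuous_map_proj[OF l] continuous_map_id[unfolded id_def]) auto
    have ckb: "(\<lambda>h. c (\<pi> k h) x) \<in> borel_measurable avg"
      unfolding measurable_avg using x
      by (intro c_compose continuous_map_proj[OF k] continuous_map_id[unfolded id_def]) auto
    have yX: "inv (\<pi> k g) <# x \<in> topspace Xs" if "g \<in> carrier G" for g using that k x by (intro act_closed) auto
    have ceq: "c (\<pi> k g \<otimes> \<pi> l h) x = c (\<pi> k g) x + c (\<pi> l h) (inv (\<pi> k g) <# x)" if "g \<in> carrier G" "h \<in> carrier G" for g h
      using that k l x by (intro c_mult) auto
    have "AE g in avg. \<phi> l (inv (\<pi> k g) <# x) \<noteq> \<infinity>"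
      by (rule nn_integral_PInf_AE[OF sb f2])
    then have "AE g in avg. (\<integral>h. c (\<pi> k g \<otimes> \<pi> l h) x \<partial>avg) = c (\<pi> k g) x + w l (inv (\<pi> k g) <# x)"
      using AE_space
    proof eventually_elim
      case (elim g)
      then have g: "g \<in> carrier G" by (simp add: space_avg)
      have ih: "integrable avg (\<lambda>h. c (\<pi> l h) (inv (\<pi> k g) <# x))"
        using elim(1) cb[OF yX[OF g]] by (simp add: integrable_iff_bounded \<phi>_def less_top)
      have "(\<integral>h. c (\<pi> k g \<otimes> \<pi> l h) x \<partial>avg) = (\<integral>h. c (\<pi> k g) x + c (\<pi> l h) (inv (\<pi> k g) <# x) \<partial>avg)"
        by (intro Bochner_Integration.integral_cong refl) (simp add: space_avg ceq g)
      also have "\<dots> = c (\<pi> k g) x + w l (inv (\<pi> k g) <# x)" using ih by (simp add: w_def)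
      finally show ?case .
    qed
    moreover have "(\<lambda>g. \<integral>h. c (\<pi> k g \<otimes> \<pi> l h) x \<partial>avg) \<in> borel_measurable avg"
    proof (rule tau_additive_integral_measurable[OF tau_additive_avg tau_additive_avg])
      show "(\<lambda>(g, h). c (\<pi> k g \<otimes> \<pi> l h) x) \<in> borel_measurable (borel_of (prod_topology T T))"
        unfolding case_prod_unfold using x
        by (intro c_compose continuous_intros_group continuous_map_proj k l) auto
    qed
    ultimately have "(\<integral>g. \<integral>h. c (\<pi> k g \<otimes> \<pi> l h) x \<partial>avg \<partial>avg) = (\<integral>g. c (\<pi> k g) x + w l (inv (\<pi> k g) <# x) \<partial>avg)"
      using f3 f4 by (intro integral_cong_AE) auto
    also have "\<dots> = w k x + P k (w l) x" using f3 f4 by (simp add: w_def P_def)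
    finally show "P k (w l) x + w k x = (\<integral>g. \<integral>h. c (\<pi> k g \<otimes> \<pi> l h) x \<partial>avg \<partial>avg)" by simp
    have "(\<integral>\<^sup>+g. \<integral>\<^sup>+h. ennreal \<bar>c (\<pi> k g \<otimes> \<pi> l h) x\<bar> \<partial>avg \<partial>avg) \<le> (\<integral>\<^sup>+g. ennreal \<bar>c (\<pi> k g) x\<bar> + \<phi> l (inv (\<pi> k g) <# x) \<partial>avg)"
    proof (rule nn_integral_mono)
      fix g assume "g \<in> space avg"
      then have g: "g \<in> carrier G" by (simp add: space_avg)
      have "(\<integral>\<^sup>+h. ennreal \<bar>c (\<pi> k g \<otimes> \<pi> l h) x\<bar> \<partial>avg) \<le> (\<integral>\<^sup>+h. ennreal \<bar>c (\<pi> k g) x\<bar> + ennreal \<bar>c (\<pi> l h) (inv (\<pi> k g) <# x)\<bar> \<partial>avg)"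
      proof (rule nn_integral_mono)
        fix h assume "h \<in> space avg"
        then have h: "h \<in> carrier G" by (simp add: space_avg)
        have "ennreal \<bar>c (\<pi> k g \<otimes> \<pi> l h) x\<bar> \<le> ennreal (\<bar>c (\<pi> k g) x\<bar> + \<bar>c (\<pi> l h) (inv (\<pi> k g) <# x)\<bar>)"
          unfolding ceq[OF g h] by (rule ennreal_leI) (rule abs_triangle_ineq)
        then show "ennreal \<bar>c (\<pi> k g \<otimes> \<pi> l h) x\<bar> \<le> ennreal \<bar>c (\<pi> k g) x\<bar> + ennreal \<bar>c (\<pi> l h) (inv (\<pi> k g) <# x)\<bar>"
          by (simp add: ennreal_plus)
      qed
      also have "\<dots> = ennreal \<bar>c (\<pi> k g) x\<bar> + \<phi> l (inv (\<pi> k g) <# x)"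
        using cb[OF yX[OF g]] by (subst nn_integral_add) (auto simp: \<phi>_def emeasure_avg_space)
      finally show "(\<integral>\<^sup>+h. ennreal \<bar>c (\<pi> k g \<otimes> \<pi> l h) x\<bar> \<partial>avg) \<le> ennreal \<bar>c (\<pi> k g) x\<bar> + \<phi> l (inv (\<pi> k g) <# x)" .
    qed
    also have "\<dots> = \<phi> k x + (\<integral>\<^sup>+g. \<phi> l (inv (\<pi> k g) <# x) \<partial>avg)"
      using ckb sb by (subst nn_integral_add) (auto simp: \<phi>_def)
    also have "\<dots> < \<infinity>" using f1 f2 by (simp add: less_top[symmetric])
    finally show "(\<integral>\<^sup>+g. \<integral>\<^sup>+h. ennreal \<bar>c (\<pi> k g \<otimes> \<pi> l h) x\<bar> \<partial>avg \<partial>avg) < \<infinity>" .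
  qed
  show ?thesis
    using \<phi>fin[OF i] \<phi>fin2[OF i j] P_Fubini(1)[OF i w_Fubini(2)[OF j]] w_Fubini(1)[OF i]
      \<phi>fin[OF j] \<phi>fin2[OF j i] P_Fubini(1)[OF j w_Fubini(2)[OF i]] w_Fubini(1)[OF j] AE_space
  proof eventually_elim
    case (elim x)
    then have x: "x \<in> topspace Xs" by (simp add: space_nu)
    note 1 = D[OF i j x elim(1-4)] and 2 = D[OF j i x elim(5-8)]
    show ?case using average_swap[OF i j x c_borel conjunct2[OF 1]] 1 2 by simp
  qed
qed

definition wbar :: "'a set \<Rightarrow> real" where
  "wbar x = (\<Sum>j=1..n. w j x) / real n"

lemma wbar: "integrable \<nu> wbar" "(\<integral>x. wbar x \<partial>\<nu>) = 0" "tail p wbar"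
proof -
  show "integrable \<nu> wbar"
    unfolding wbar_def by (intro integrable_divide Bochner_Integration.integrable_sum w_Fubini(2)) auto
  show "(\<integral>x. wbar x \<partial>\<nu>) = 0"
    unfolding wbar_def using w_Fubini(2,3) by simp
  show "tail p wbar"
    unfolding wbar_def[abs_def] by (rule tail_average) (auto intro: w_Fubini(2) w_tail)
qed

text \<open>Averaging \<open>w_swap\<close> over one index equates \<open>P j wbar - wbar\<close>
  with \<open>A (w j) - w j\<close>, which is what makes the defect of the partial sums
  telescope.\<close>

lemma P_wbar:
  assumes j: "j \<in> {1..n}"
  shows "AE x in \<nu>. P j wbar x = A (w j) x + wbar x - w j x"
proof -
  have "AE x in \<nu>. P j (\<lambda>x. (\<Sum>i=1..n. w i x) / real n) x = (\<Sum>i=1..n. P j (w i) x) / real n"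
    by (rule P_average[OF j]) (rule w_Fubini(2))
  moreover have "AE x in \<nu>. \<forall>i\<in>{1..n}. P j (w i) x + w j x = P i (w j) x + w i x"
    by (rule AE_all_index) (rule w_swap[OF j])
  ultimately show ?thesis
  proof eventually_elim
    case (elim x)
    have "(\<Sum>i=1..n. P j (w i) x) = (\<Sum>i=1..n. P i (w j) x + w i x - w j x)"
      using elim(2) by (intro sum.cong) (auto simp: algebra_simps)
    also have "\<dots> = (\<Sum>i=1..n. P i (w j) x) + (\<Sum>i=1..n. w i x) - real n * w j x"
      by (simp add: sum.distrib sum_subtractf)
    finally show ?case
      using elim(1) n_pos unfolding wbar_def[abs_def] by (simp add: A_def add_divide_distrib diff_divide_distrib)
  qed
qed

text \<open>Up to null sets, the \<open>k\<close>-th iterate at zero of the mean affine map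
  \<open>v \<mapsto> A v + wbar\<close>.\<close>

definition psum :: "nat \<Rightarrow> 'a set \<Rightarrow> real" where
  "psum k x = (\<Sum>i<k. (A ^^ i) wbar x)"

lemma psum_integrable: "integrable \<nu> (psum k)"
  unfolding psum_def by (intro Bochner_Integration.integrable_sum Apow_integrable wbar)

text \<open>\<open>P j\<close> commutes with powers of \<open>A\<close>, so the next term changes
  the defect by \<open>A ^^ k\<close> applied to \<open>P j wbar - wbar\<close>. By
  \<open>P_wbar\<close> this is a difference of consecutive powers applied to
  \<open>w j\<close>.\<close>

lemma psum_defect:
  assumes j: "j \<in> {1..n}"
  shows "AE x in \<nu>. P j (psum k) x + w j x - psum k x = (A ^^ k) (w j) x"
proof (induction k)
  case 0
  show ?case by (rule AE_I2) (simp add: psum_def[abs_def] P_def)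
next
  case (Suc k)
  have wj: "integrable \<nu> (w j)" by (rule w_Fubini(2)[OF j])
  have Ak: "integrable \<nu> ((A ^^ k) wbar)" by (rule Apow_integrable[OF wbar(1)])
  have Pw: "integrable \<nu> (P j wbar)" by (rule P_Fubini(2)[OF j wbar(1)])
  have ps: "psum (Suc k) = (\<lambda>x. psum k x + (A ^^ k) wbar x)" by (auto simp: psum_def)
  have "AE x in \<nu>. P j (psum (Suc k)) x = P j (psum k) x + P j ((A ^^ k) wbar) x"
    unfolding ps by (rule P_add[OF j psum_integrable Ak])
  moreover have "AE x in \<nu>. (A ^^ k) (P j wbar) x = (A ^^ k) (\<lambda>x. (A (w j) x + wbar x) - w j x) x"
    using P_wbar[OF j] by (intro Apow_cong_AE Pw) (use A_integrable[OF wj] wj wbar(1) in auto)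
  moreover have "AE x in \<nu>. (A ^^ k) (\<lambda>x. (A (w j) x + wbar x) - w j x) x = (A ^^ k) (\<lambda>x. A (w j) x + wbar x) x - (A ^^ k) (w j) x"
    by (rule Apow_diff) (use A_integrable[OF wj] wj wbar(1) in auto)
  moreover have "AE x in \<nu>. (A ^^ k) (\<lambda>x. A (w j) x + wbar x) x = (A ^^ k) (A (w j)) x + (A ^^ k) wbar x"
    by (rule Apow_add) (use A_integrable[OF wj] wbar(1) in auto)
  ultimately show ?case
    using Suc.IH P_Apow_commute[OF j wbar(1), of k]
    by eventually_elim (simp add: ps funpow_swap1)
qed

text \<open>The series converges in \<open>L\<^sup>1\<close>, \<open>P j\<close> is a contraction
  there, and the defects \<open>(A ^^ k) (w j)\<close> tend to \<open>0\<close>. So the limit is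
  fixed by the affine average over each factor, not merely by their mean.\<close>

lemma fixed_point:
  obtains u where "integrable \<nu> u" "\<forall>j\<in>{1..n}. AE x in \<nu>. P j u x + w j x = u x"
proof -
  define u where "u x = suminf (\<lambda>k. (A ^^ k) wbar x)" for x
  define a where "a k = (\<integral>x. \<bar>(A ^^ k) wbar x\<bar> \<partial>\<nu>)" for k
  have sm: "summable a" unfolding a_def by (rule Apow_summable[OF r p wbar])
  have Ak: "integrable \<nu> ((A ^^ k) wbar)" for k by (rule Apow_integrable[OF wbar(1)])
  note S = integral_abs_suminf_le[OF Ak sm[unfolded a_def]]
  have u: "integrable \<nu> u" unfolding u_def by (rule S(2))
  have rest: "(\<integral>x. \<bar>u x - psum k x\<bar> \<partial>\<nu>) \<le> suminf (\<lambda>i. a (i + k))" for k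
  proof -
    have smk: "summable (\<lambda>i. \<integral>x. \<bar>(A ^^ (i + k)) wbar x\<bar> \<partial>\<nu>)"
      using summable_ignore_initial_segment[OF sm, of k] by (simp add: a_def)
    note Sk = integral_abs_suminf_le[of \<nu> "\<lambda>i. (A ^^ (i + k)) wbar", OF Ak smk]
    have "AE x in \<nu>. \<bar>u x - psum k x\<bar> = \<bar>suminf (\<lambda>i. (A ^^ (i + k)) wbar x)\<bar>"
      using S(1)
    proof eventually_elim
      case (elim x)
      then show ?case using suminf_split_initial_segment[OF elim, of k] by (simp add: u_def psum_def)
    qed
    then have "(\<integral>x. \<bar>u x - psum k x\<bar> \<partial>\<nu>) = (\<integral>x. \<bar>suminf (\<lambda>i. (A ^^ (i + k)) wbar x)\<bar> \<partial>\<nu>)"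
      using u psum_integrable[of k] Sk(2) by (intro integral_cong_AE) auto
    then show ?thesis using Sk(3) by (simp add: a_def)
  qed
  have restlim: "(\<lambda>k. suminf (\<lambda>i. a (i + k))) \<longlonglongrightarrow> 0"
    by (rule suminf_exist_split2[OF sm])
  have "AE x in \<nu>. P j u x + w j x = u x" if j: "j \<in> {1..n}" for j
  proof -
    have wj: "integrable \<nu> (w j)" by (rule w_Fubini(2)[OF j])
    define d where "d x = P j u x + w j x - u x" for x
    have d: "integrable \<nu> d" unfolding d_def using P_Fubini(2)[OF j u] wj u by simp
    define b where "b k = (\<integral>x. \<bar>(A ^^ k) (w j) x\<bar> \<partial>\<nu>)" for k
    have blim: "b \<longlonglongrightarrow> 0" unfolding b_def
      by (rule summable_LIMSEQ_zero) (rule Apow_summable[OF r p wj w_Fubini(3)[OF j] w_tail[OF j]])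
    have le: "(\<integral>x. \<bar>d x\<bar> \<partial>\<nu>) \<le> 2 * suminf (\<lambda>i. a (i + k)) + b k" for k
    proof -
      define e where "e x = u x - psum k x" for x
      have e: "integrable \<nu> e" unfolding e_def using u psum_integrable by simp
      have "AE x in \<nu>. \<bar>d x\<bar> \<le> \<bar>P j e x\<bar> + \<bar>(A ^^ k) (w j) x\<bar> + \<bar>e x\<bar>"
        using P_diff[OF j u psum_integrable[of k]] psum_defect[OF j, of k]
        unfolding e_def[abs_def] by eventually_elim (simp add: d_def)
      then have "(\<integral>x. \<bar>d x\<bar> \<partial>\<nu>) \<le> (\<integral>x. \<bar>P j e x\<bar> + \<bar>(A ^^ k) (w j) x\<bar> + \<bar>e x\<bar> \<partial>\<nu>)"
        using d e P_Fubini(2)[OF j e] Apow_integrable[OF wj, of k] by (intro integral_mono_AE) auto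
      also have "\<dots> = (\<integral>x. \<bar>P j e x\<bar> \<partial>\<nu>) + b k + (\<integral>x. \<bar>e x\<bar> \<partial>\<nu>)"
        using e P_Fubini(2)[OF j e] Apow_integrable[OF wj, of k] by (simp add: b_def)
      also have "\<dots> \<le> 2 * (\<integral>x. \<bar>e x\<bar> \<partial>\<nu>) + b k" using P_Fubini(4)[OF j e] by simp
      also have "(\<integral>x. \<bar>e x\<bar> \<partial>\<nu>) \<le> suminf (\<lambda>i. a (i + k))" unfolding e_def by (rule rest)
      finally show ?thesis by simp
    qed
    have "(\<lambda>k. 2 * suminf (\<lambda>i. a (i + k)) + b k) \<longlonglongrightarrow> 2 * 0 + 0"
      by (intro tendsto_intros restlim blim)
    then have "(\<integral>x. \<bar>d x\<bar> \<partial>\<nu>) \<le> 0" using le by (intro LIMSEQ_le_const) auto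
    from AE_zero_if_integral_abs[OF d this] show ?thesis by eventually_elim (simp add: d_def)
  qed
  then show ?thesis using that[OF u] by blast
qed

proposition coboundary:
  obtains u where "integrable \<nu> u" "\<forall>g\<in>carrier G. AE x in \<nu>. u (inv g <# x) + c g x = u x"
proof -
  obtain u where u: "integrable \<nu> u" and fixed: "\<forall>j\<in>{1..n}. AE x in \<nu>. P j u x + w j x = u x"
    by (rule fixed_point)
  have ub: "u \<in> borel_measurable (borel_of Xs)" by (rule integrable_borel[OF u])
  have proj: "AE x in \<nu>. u (inv (\<pi> i g) <# x) + c (\<pi> i g) x = u x" if i: "i \<in> {1..n}" and g: "g \<in> carrier G" for i g
  proof -
    define a where "a = \<pi> i g"
    have a: "a \<in> carrier G" "inv a \<in> carrier G" using i g by (auto simp: a_def)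
    define v where "v x = u (inv a <# x) + c a x - u x" for x
    have ua: "integrable \<nu> (\<lambda>x. u (inv a <# x))" by (rule integrable_act[OF a(2) u])
    have ca: "integrable \<nu> (c a)" by (rule c_integrable[OF a(1)])
    have uca: "integrable \<nu> (\<lambda>x. u (inv a <# x) + c a x)" using ua ca by simp
    have v: "integrable \<nu> v" unfolding v_def using uca u by simp
    \<comment> \<open>The average over factor \<open>j\<close> commutes with \<open>a\<close>, so
      \<open>u\<close> and its affine translate by \<open>a\<close> are both fixed by the affine
      average; their difference is then fixed by the linear one. Fact \<open>4\<close> is the
      cocycle identity expanded for the two orders of the same product.\<close>
    have fix_v: "AE x in \<nu>. P j v x = v x" if j: "j \<in> {1..n}" "j \<noteq> i" for j
    proof -
      have comm: "\<pi> j h \<otimes> a = a \<otimes> \<pi> j h" if "h \<in> carrier G" for h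
        unfolding a_def using proj_commute[OF j(1) i j(2) that g] .
      have 1: "AE x in \<nu>. P j v x = P j (\<lambda>x. u (inv a <# x) + c a x) x - P j u x"
        unfolding v_def[abs_def] by (rule P_diff[OF j(1) uca u])
      have 2: "AE x in \<nu>. P j (\<lambda>x. u (inv a <# x) + c a x) x = P j (\<lambda>x. u (inv a <# x)) x + P j (c a) x"
        by (rule P_add[OF j(1) ua ca])
      have fj: "AE x in \<nu>. P j u x + w j x = u x" using fixed j(1) by blast
      have 3: "P j (\<lambda>x. u (inv a <# x)) x = P j u (inv a <# x)" if x: "x \<in> topspace Xs" for x
        unfolding P_def
      proof (intro Bochner_Integration.integral_cong refl)
        fix h assume "h \<in> space avg"
        then have h: "h \<in> carrier G" by (simp add: space_avg)
        have "inv a <# (inv (\<pi> j h) <# x) = inv (\<pi> j h \<otimes> a) <# x" using a h j x by (simp add: act_act inv_mult_group)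
        also have "\<dots> = inv (\<pi> j h) <# (inv a <# x)" unfolding comm[OF h] using a h j x by (simp add: act_act inv_mult_group)
        finally show "u (inv a <# (inv (\<pi> j h) <# x)) = u (inv (\<pi> j h) <# (inv a <# x))" by simp
      qed
      have 4: "AE x in \<nu>. P j (c a) x = c a x + w j (inv a <# x) - w j x"
        using w_Fubini(1)[OF j(1)] AE_act[OF a(2) w_Fubini(1)[OF j(1)]] AE_space
      proof eventually_elim
        case (elim x)
        then have x: "x \<in> topspace Xs" by (simp add: space_nu)
        have "P j (c a) x = (\<integral>h. c a x + c (\<pi> j h) (inv a <# x) - c (\<pi> j h) x \<partial>avg)"
          unfolding P_def
        proof (intro Bochner_Integration.integral_cong refl)
          fix h assume "h \<in> space avg"
          then have h: "h \<in> carrier G" by (simp add: space_avg)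
          have "c (\<pi> j h) x + c a (inv (\<pi> j h) <# x) = c (\<pi> j h \<otimes> a) x"
            using a h j x by (intro c_mult[symmetric]) auto
          also have "\<dots> = c a x + c (\<pi> j h) (inv a <# x)"
            unfolding comm[OF h] using a h j x by (intro c_mult) auto
          finally show "c a (inv (\<pi> j h) <# x) = c a x + c (\<pi> j h) (inv a <# x) - c (\<pi> j h) x" by simp
        qed
        then show ?case using elim by (simp add: w_def)
      qed
      show ?thesis
        using 1 2 4 fj AE_act[OF a(2) fj] AE_space
      proof eventually_elim
        case (elim x)
        then have "P j (\<lambda>x. u (inv a <# x)) x = P j u (inv a <# x)" using 3 by (simp add: space_nu)
        then show ?case using elim by (simp add: v_def)
      qed
    qed
    have "AE x in \<nu>. v (inv (\<pi> j k) <# x) = v x" if "j \<in> {1..n}" "j \<noteq> i" "k \<in> carrier G" for j k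
      by (rule fixed_imp_invariant[OF that(1) v fix_v[OF that(1,2)] that(3)])
    from ergodic[OF i integrable_borel[OF v] this] obtain \<kappa> where \<kappa>: "AE x in \<nu>. v x = \<kappa>" by blast
    \<comment> \<open>Translation keeps the integral of \<open>u\<close>, and \<open>c a\<close> has
      mean zero; this determines the constant value of \<open>v\<close>.\<close>
    have "(\<integral>x. v x \<partial>\<nu>) = 0"
      unfolding v_def using ua ca u c_mean[OF a(1)] integral_act[OF a(2) ub] by simp
    moreover have "(\<integral>x. v x \<partial>\<nu>) = (\<integral>x. \<kappa> \<partial>\<nu>)" using \<kappa> v by (intro integral_cong_AE) auto
    ultimately have "\<kappa> = 0" using V_pos by simp
    with \<kappa> show ?thesis by (auto simp: v_def a_def elim: eventually_mono)
  qed
  have "AE x in \<nu>. u (inv g <# x) + c g x = u x" if g: "g \<in> carrier G" for g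
  proof (rule decompose_induct[OF g])
    have "c \<one> x = 0" if "x \<in> topspace Xs" for x
      using c_mult[OF one_closed one_closed that] that by (simp add: act_one)
    then show "AE x in \<nu>. u (inv \<one> <# x) + c \<one> x = u x" by (intro AE_I2) (simp add: space_nu act_one)
    show "AE x in \<nu>. u (inv (\<pi> j g) <# x) + c (\<pi> j g) x = u x" if "j \<in> {1..n}" for j by (rule proj[OF that g])
    fix a b assume a: "a \<in> carrier G" and b: "b \<in> carrier G"
      and IHa: "AE x in \<nu>. u (inv a <# x) + c a x = u x" and IHb: "AE x in \<nu>. u (inv b <# x) + c b x = u x"
    have ai: "inv a \<in> carrier G" using a by simp
    from AE_act[OF ai IHb] IHa AE_space
    show "AE x in \<nu>. u (inv (a \<otimes> b) <# x) + c (a \<otimes> b) x = u x"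
    proof eventually_elim
      case (elim x)
      then have x: "x \<in> topspace Xs" by (simp add: space_nu)
      have "inv (a \<otimes> b) <# x = inv b <# (inv a <# x)" using a b x by (simp add: act_act inv_mult_group)
      then show ?case using elim c_mult[OF a b x] by simp
    qed
  qed
  then show ?thesis using that[OF u] by blast
qed

end

section \<open>Extending homomorphisms\<close>

context group_lattice
begin

text \<open>If an orbit of a unit vector has diameter above \<open>e\<close>, so has the distance
  between its translates by some \<open>a\<close> and \<open>b\<close>. Translating back by
  \<open>b\<close> turns this into a displacement by \<open>inv b \<otimes> a\<close>, so
  \<open>K\<close> consists of such quotients; the identity is added for functions of norm zero.
  Real functions are viewed as complex ones after normalisation.\<close>

lemma weakly_cocompact_gap:
  assumes "\<not> almost_has_invariant_vectors T (L2_0_functions \<nu>) (L2_seminorm \<nu>) (coset_translation G)"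
  obtains K \<epsilon> where "compactin T K" "0 < \<epsilon>"
    "\<forall>w. w \<in> borel_measurable (borel_of Xs) \<longrightarrow> integrable \<nu> (\<lambda>x. (w x)\<^sup>2) \<longrightarrow> (\<integral>x. w x \<partial>\<nu>) = 0 \<longrightarrow>
      (\<exists>k\<in>K. ennreal (\<epsilon> * (\<integral>x. (w x)\<^sup>2 \<partial>\<nu>)) \<le> (\<integral>\<^sup>+x. ennreal ((w (inv k <# x) - w x)\<^sup>2) \<partial>\<nu>))"
proof -
  obtain K0 where K0: "compactin T K0"
    "(INF v \<in> {v \<in> L2_0_functions \<nu>. L2_seminorm \<nu> v = 1}. diam_wrt (L2_seminorm \<nu>) ((\<lambda>g. coset_translation G g v) ` K0)) \<noteq> 0"
    using assms unfolding almost_has_invariant_vectors_def by blast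
  define I where "I = (INF v \<in> {v \<in> L2_0_functions \<nu>. L2_seminorm \<nu> v = 1}. diam_wrt (L2_seminorm \<nu>) ((\<lambda>g. coset_translation G g v) ` K0))"
  have "0 < I" using K0(2) by (simp add: I_def zero_less_iff_neq_zero)
  \<comment> \<open>The infimum may be infinite, so a finite positive number below it is
    taken.\<close>
  then obtain e0 where e0: "0 < e0" "e0 < I" using dense by blast
  define e where "e = enn2real e0"
  have "e0 < \<infinity>" using e0(2) by (metis infinity_ennreal_def less_top order.strict_trans2 top_greatest top.not_eq_extremum)
  then have e: "ennreal e = e0" "0 < e" using e0(1) by (auto simp: e_def enn2real_positive_iff)
  have K0s: "K0 \<subseteq> carrier G" using compactin_subset_topspace[OF K0(1)] by simp
  define K where "K = insert \<one> ((\<lambda>(x, y). x \<otimes> y) ` ((\<lambda>x. inv x) ` K0 \<times> K0))"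
  have K: "compactin T K"
  proof -
    have "compactin T ({\<one>} \<union> (\<lambda>(x, y). x \<otimes> y) ` ((\<lambda>x. inv x) ` K0 \<times> K0))"
      by (intro compactin_Un compactin_mult compactin_inv K0(1)) simp
    then show ?thesis by (simp add: K_def)
  qed
  have "\<exists>k\<in>K. ennreal (e\<^sup>2 * (\<integral>x. (w x)\<^sup>2 \<partial>\<nu>)) \<le> (\<integral>\<^sup>+x. ennreal ((w (inv k <# x) - w x)\<^sup>2) \<partial>\<nu>)"
    if wb: "w \<in> borel_measurable (borel_of Xs)" and w2: "integrable \<nu> (\<lambda>x. (w x)\<^sup>2)" and w0: "(\<integral>x. w x \<partial>\<nu>) = 0" for w
  proof (cases "(\<integral>x. (w x)\<^sup>2 \<partial>\<nu>) = 0")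
    case True
    then show ?thesis by (intro bexI[of _ \<one>]) (auto simp: K_def)
  next
    case False
    define N where "N = (\<integral>x. (w x)\<^sup>2 \<partial>\<nu>)"
    have N: "N > 0" using False by (simp add: N_def less_le)
    have wn[measurable]: "w \<in> borel_measurable \<nu>" using wb by (simp add: measurable_nu)
    define v where "v x = complex_of_real (w x / sqrt N)" for x
    have cv: "(cmod (v x))\<^sup>2 = (w x)\<^sup>2 / N" for x using N by (simp add: v_def norm_divide power_divide)
    have vm: "v \<in> borel_measurable \<nu>" unfolding v_def by measurable
    have "v \<in> L2_functions \<nu>" using vm w2 by (simp add: L2_functions_def cv)
    moreover have "(LINT x|\<nu>. v x * cnj c) = 0" for c
    proof -
      have "(LINT x|\<nu>. v x * cnj c) = (LINT x|\<nu>. v x) * cnj c" by simp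
      also have "(LINT x|\<nu>. v x) = complex_of_real (\<integral>x. w x / sqrt N \<partial>\<nu>)"
        unfolding v_def by (rule integral_complex_of_real)
      also have "(\<integral>x. w x / sqrt N \<partial>\<nu>) = 0" using w0 by simp
      finally show ?thesis by simp
    qed
    ultimately have v0: "v \<in> L2_0_functions \<nu>" by (auto simp only: L2_0_functions_def mem_Collect_eq)
    have "(LINT x|\<nu>. (cmod (v x))\<^sup>2) = 1" unfolding cv using N by (simp add: N_def)
    then have v1: "L2_seminorm \<nu> v = 1" by (simp add: L2_seminorm_def)
    have "I \<le> diam_wrt (L2_seminorm \<nu>) ((\<lambda>g. coset_translation G g v) ` K0)"
      unfolding I_def by (rule INF_lower) (use v0 v1 in simp)
    then have "ennreal e < diam_wrt (L2_seminorm \<nu>) ((\<lambda>g. coset_translation G g v) ` K0)"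
      using e0(2) e(1) by simp
    then obtain a b where ab: "a \<in> K0" "b \<in> K0"
      "ennreal e < ennreal (L2_seminorm \<nu> (coset_translation G a v - coset_translation G b v))"
      unfolding diam_wrt_def less_SUP_iff by auto
    have ac: "a \<in> carrier G" and bc: "b \<in> carrier G" using ab K0s by auto
    define H where "H x = (w (inv a <# x) - w (inv b <# x))\<^sup>2" for x
    have H_nonneg: "0 \<le> H x" for x by (simp add: H_def)
    have cH: "(cmod ((coset_translation G a v - coset_translation G b v) x))\<^sup>2 = H x / N" for x
    proof -
      have "(coset_translation G a v - coset_translation G b v) x = complex_of_real ((w (inv a <# x) - w (inv b <# x)) / sqrt N)"
        by (simp add: coset_translation_def v_def diff_divide_distrib)
      then have "cmod ((coset_translation G a v - coset_translation G b v) x) = \<bar>(w (inv a <# x) - w (inv b <# x)) / sqrt N\<bar>"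
        by (simp only: norm_of_real)
      then show ?thesis using N by (simp add: H_def power_divide)
    qed
    have "e < sqrt (LINT x|\<nu>. H x / N)" using ab(3) e(2) unfolding L2_seminorm_def cH
      by (subst (asm) ennreal_less_iff) auto
    then have "e\<^sup>2 < (LINT x|\<nu>. H x / N)" using e(2) by (metis less_imp_le real_less_rsqrt real_sqrt_less_iff real_sqrt_unique)
    then have "e\<^sup>2 * N \<le> (\<integral>x. H x \<partial>\<nu>)" using N by (simp add: pos_less_divide_eq less_imp_le)
    moreover have Hi: "integrable \<nu> H"
    proof (rule Bochner_Integration.integrable_bound)
      have "integrable \<nu> (\<lambda>x. (w (inv a <# x))\<^sup>2)" "integrable \<nu> (\<lambda>x. (w (inv b <# x))\<^sup>2)"
        using integrable_act[OF _ w2, of "inv a"] integrable_act[OF _ w2, of "inv b"] ac bc by auto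
      then show "integrable \<nu> (\<lambda>x. 2 * (w (inv a <# x))\<^sup>2 + 2 * (w (inv b <# x))\<^sup>2)" by simp
      have "(\<lambda>x. w (inv a <# x)) \<in> borel_measurable \<nu>" "(\<lambda>x. w (inv b <# x)) \<in> borel_measurable \<nu>"
        using measurable_compose[OF act_measurable wn] ac bc by auto
      then show "H \<in> borel_measurable \<nu>" unfolding H_def by measurable
      have "(s - t)\<^sup>2 \<le> 2 * s\<^sup>2 + 2 * t\<^sup>2" for s t :: real
        using zero_le_power2[of "s + t"] by (simp add: power2_eq_square algebra_simps)
      then show "AE x in \<nu>. norm (H x) \<le> norm (2 * (w (inv a <# x))\<^sup>2 + 2 * (w (inv b <# x))\<^sup>2)"
        by (auto simp: H_def)
    qed
    ultimately have "ennreal (e\<^sup>2 * N) \<le> (\<integral>\<^sup>+x. ennreal (H x) \<partial>\<nu>)"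
      by (subst nn_integral_eq_integral[OF Hi]) (auto simp: H_nonneg intro: ennreal_leI)
    also have "\<dots> = (\<integral>\<^sup>+x. ennreal (H (b <# x)) \<partial>\<nu>)"
      by (rule nn_integral_act[OF bc, symmetric]) (use Hi in \<open>auto simp: measurable_nu[symmetric]\<close>)
    also have "\<dots> = (\<integral>\<^sup>+x. ennreal ((w (inv (inv b \<otimes> a) <# x) - w x)\<^sup>2) \<partial>\<nu>)"
      by (rule nn_integral_cong) (use ac bc in \<open>simp add: H_def space_nu act_act act_one inv_mult_group\<close>)
    finally show ?thesis using ab(1,2) unfolding N_def by (intro bexI[of _ "inv b \<otimes> a"]) (auto simp: K_def)
  qed
  then show ?thesis using e(2) by (intro that[OF K, of "e\<^sup>2"]) auto
qed

text \<open>Some \<open>L m\<close> has positive measure, so by the Steinhaus lemma the homomorphism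
  is bounded on a neighbourhood of the identity. Restricting to elements whose \<open>i\<close>-th
  power lies in that neighbourhood divides the bound by \<open>i\<close>.\<close>

lemma borel_hom_continuous:
  fixes \<psi> :: "'a \<Rightarrow> real"
  assumes \<psi>: "\<psi> \<in> borel_measurable (borel_of T)"
    and hom: "\<And>g h. g \<in> carrier G \<Longrightarrow> h \<in> carrier G \<Longrightarrow> \<psi> (g \<otimes> h) = \<psi> g + \<psi> h"
  shows "continuous_map T euclideanreal \<psi>"
proof -
  define L where "L m = {y \<in> carrier G. \<bar>\<psi> y\<bar> \<le> real m}" for m :: nat
  have L: "L m \<in> sets (borel_of T)" for m
  proof -
    have "L m = \<psi> -` {- real m..real m} \<inter> space (borel_of T)" by (auto simp: L_def abs_le_iff)
    then show ?thesis using measurable_sets[OF \<psi>, of "{- real m..real m}"] by simp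
  qed
  have "\<exists>m. emeasure haar (L m) \<noteq> 0"
  proof (rule ccontr)
    assume "\<nexists>m. emeasure haar (L m) \<noteq> 0"
    then have "(\<Union>m. L m) \<in> null_sets haar" using L by (intro null_sets_UN) (auto simp: null_sets_def sets_haar)
    moreover have "(\<Union>m. L m) = space haar"
      using real_arch_simple by (auto simp: L_def space_haar)
    ultimately show False using haar_nonzero by (simp add: null_sets_def)
  qed
  then obtain m where m: "emeasure haar (L m) \<noteq> 0" by blast
  obtain U where U: "openin T U" "\<one> \<in> U" "\<And>k. k \<in> U \<Longrightarrow> emeasure haar {y \<in> L m. y \<otimes> k \<in> L m} \<noteq> 0"
    using steinhaus[OF L m] by metis
  define M where "M = 2 * real m + 1"
  have M: "M > 0" by (simp add: M_def)
  have bound: "\<bar>\<psi> k\<bar> < M" if k: "k \<in> U" for k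
  proof -
    have "{y \<in> L m. y \<otimes> k \<in> L m} \<noteq> {}" using U(3)[OF k] by (metis emeasure_empty)
    then obtain y where y: "y \<in> L m" "y \<otimes> k \<in> L m" by blast
    have "k \<in> carrier G" using k openin_subset[OF U(1)] by auto
    then have "\<psi> (y \<otimes> k) = \<psi> y + \<psi> k" using y by (intro hom) (auto simp: L_def)
    then show ?thesis using y by (auto simp: L_def M_def)
  qed
  have pow: "\<psi> (k [^] (i::nat)) = real i * \<psi> k" if "k \<in> carrier G" for k i
  proof (induction i)
    case 0
    have "\<psi> (\<one> \<otimes> \<one>) = \<psi> \<one> + \<psi> \<one>" by (rule hom) auto
    then show ?case by simp
  next
    case (Suc i)
    then show ?case using hom[of "k [^] i" k] that by (simp add: algebra_simps)
  qed
  have cont_pow: "continuous_map T T (\<lambda>k. k [^] (i::nat))" for i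
    by (induction i) (auto intro!: continuous_map_mult continuous_map_id[unfolded id_def])
  have nbhd: "\<exists>V. openin T V \<and> \<one> \<in> V \<and> (\<forall>k\<in>V. \<bar>\<psi> k\<bar> < e)" if e: "e > 0" for e
  proof -
    obtain i :: nat where i: "M / e < real i" using reals_Archimedean2 by blast
    then have i0: "0 < real i" using M e by (meson divide_pos_pos order.strict_trans)
    define V where "V = {k \<in> topspace T. k [^] i \<in> U}"
    have "openin T V" unfolding V_def by (rule openin_continuous_map_preimage[OF cont_pow U(1)])
    moreover have "\<one> \<in> V" using U(2) by (simp add: V_def)
    moreover have "\<bar>\<psi> k\<bar> < e" if k: "k \<in> V" for k
    proof -
      have "real i * \<bar>\<psi> k\<bar> < M" using bound[of "k [^] i"] pow[of k i] k by (auto simp: V_def abs_mult)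
      also have "M < real i * e" using i e by (simp add: pos_divide_less_eq)
      finally show ?thesis using i0 by simp
    qed
    ultimately show ?thesis by blast
  qed
  show ?thesis
    unfolding continuous_map_def
  proof (intro conjI allI impI)
    fix O' assume "openin euclideanreal O'"
    then have O': "open O'" by simp
    show "openin T {x \<in> topspace T. \<psi> x \<in> O'}"
    proof (subst openin_subopen, intro ballI)
      fix x assume "x \<in> {x \<in> topspace T. \<psi> x \<in> O'}"
      then have x: "x \<in> carrier G" "\<psi> x \<in> O'" by auto
      then obtain e where e: "e > 0" "\<And>z. \<bar>z - \<psi> x\<bar> < e \<Longrightarrow> z \<in> O'"
        using O' unfolding open_real by blast
      obtain V where V: "openin T V" "\<one> \<in> V" "\<forall>k\<in>V. \<bar>\<psi> k\<bar> < e" using nbhd[OF e(1)] by blast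
      have "openin T ((\<lambda>u. x \<otimes> u) ` V)" by (rule openin_left_translate[OF x(1) V(1)])
      moreover have "x \<in> (\<lambda>u. x \<otimes> u) ` V" using x V(2) by (metis imageI r_one)
      moreover have "(\<lambda>u. x \<otimes> u) ` V \<subseteq> {x \<in> topspace T. \<psi> x \<in> O'}"
      proof
        fix z assume "z \<in> (\<lambda>u. x \<otimes> u) ` V"
        then obtain k where k: "k \<in> V" "z = x \<otimes> k" by blast
        then have "k \<in> carrier G" using openin_subset[OF V(1)] by auto
        then show "z \<in> {x \<in> topspace T. \<psi> x \<in> O'}" using k V(3) x e(2) by (auto simp: hom)
      qed
      ultimately show "\<exists>Ta. openin T Ta \<and> x \<in> Ta \<and> Ta \<subseteq> {x \<in> topspace T. \<psi> x \<in> O'}" by blast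
    qed
  qed auto
qed

text \<open>The cocycle with primitive \<open>f\<close>. It lives on cosets when right translation
  by an element of \<Gamma> changes \<open>f\<close> by a constant.\<close>

definition difference :: "('a \<Rightarrow> real) \<Rightarrow> 'a \<Rightarrow> 'a set \<Rightarrow> real" where
  "difference f g = descend (\<lambda>y. f (inv g \<otimes> y) - f y)"

text \<open>Common ground for the uniform case and the case of integrable word length:
  \<open>chi g\<close> is the element of \<Gamma> that moves \<open>g\<close> into
  \<open>D\<close>.\<close>

definition fundamental_domain :: "'a set \<Rightarrow> ('a \<Rightarrow> 'a) \<Rightarrow> bool" where
  "fundamental_domain D chi \<longleftrightarrow> D \<in> sets (borel_of T) \<and> (\<forall>g\<in>carrier G. \<exists>!\<gamma>. \<gamma> \<in> \<Gamma> \<and> g \<otimes> \<gamma> \<in> D) \<and>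
     (\<forall>g\<in>carrier G. chi g \<in> \<Gamma> \<and> g \<otimes> chi g \<in> D)"

lemma fundamental_domainD:
  assumes "fundamental_domain D chi"
  shows "D \<in> sets (borel_of T)" and "D \<subseteq> carrier G"
    and "y \<in> carrier G \<Longrightarrow> chi y \<in> \<Gamma>" and "y \<in> carrier G \<Longrightarrow> y \<otimes> chi y \<in> D"
    and "y \<in> carrier G \<Longrightarrow> \<gamma> \<in> \<Gamma> \<Longrightarrow> y \<otimes> \<gamma> \<in> D \<Longrightarrow> chi y = \<gamma>"
    and "y \<in> D \<Longrightarrow> chi y = \<one>"
    and "y \<in> carrier G \<Longrightarrow> \<gamma> \<in> \<Gamma> \<Longrightarrow> chi (y \<otimes> \<gamma>) = inv \<gamma> \<otimes> chi y"
proof -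
  show D: "D \<in> sets (borel_of T)" using assms by (simp add: fundamental_domain_def)
  show Ds: "D \<subseteq> carrier G" using sets.sets_into_space[OF D] by simp
  show chi: "y \<in> carrier G \<Longrightarrow> chi y \<in> \<Gamma>" "y \<in> carrier G \<Longrightarrow> y \<otimes> chi y \<in> D" for y
    using assms by (auto simp: fundamental_domain_def)
  show u: "y \<in> carrier G \<Longrightarrow> \<gamma> \<in> \<Gamma> \<Longrightarrow> y \<otimes> \<gamma> \<in> D \<Longrightarrow> chi y = \<gamma>" for y \<gamma>
    using assms chi unfolding fundamental_domain_def by blast
  show "y \<in> D \<Longrightarrow> chi y = \<one>"
    using Ds subgroup.one_closed[OF subgroup_Gamma] by (intro u) auto
  assume y: "y \<in> carrier G" and \<gamma>: "\<gamma> \<in> \<Gamma>"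
  have "inv \<gamma> \<otimes> chi y \<in> \<Gamma>"
    using subgroup_Gamma \<gamma> chi(1)[OF y] by (meson subgroup.m_closed subgroup.m_inv_closed)
  moreover have "(y \<otimes> \<gamma>) \<otimes> (inv \<gamma> \<otimes> chi y) = y \<otimes> chi y"
    using y Gamma_carrier[OF \<gamma>] Gamma_carrier[OF chi(1)[OF y]]
    by (simp add: m_assoc) (simp add: m_assoc[symmetric])
  ultimately show "chi (y \<otimes> \<gamma>) = inv \<gamma> \<otimes> chi y"
    using y Gamma_carrier[OF \<gamma>] chi(2)[OF y] by (intro u) auto
qed

text \<open>Every coset meets \<open>D\<close> exactly once, and there \<open>chi\<close> is the
  identity, so of the two terms of the difference only the one at \<open>inv g \<otimes> y\<close>
  survives; unfolding turns the integral over cosets into one over \<open>D\<close>. Measurability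
  comes from countability of \<Gamma>.\<close>

lemma fundamental_domain_function:
  assumes fd: "fundamental_domain D chi"
    and \<phi>: "\<And>\<gamma> \<delta>. \<gamma> \<in> \<Gamma> \<Longrightarrow> \<delta> \<in> \<Gamma> \<Longrightarrow> \<phi> (\<gamma> \<otimes> \<delta>) = \<phi> \<gamma> + (\<phi> \<delta> :: real)"
  shows "(\<lambda>y. \<phi> (chi y)) \<in> borel_measurable (borel_of T)"
    and "y \<in> carrier G \<Longrightarrow> \<gamma> \<in> \<Gamma> \<Longrightarrow> \<phi> (chi (y \<otimes> \<gamma>)) = \<phi> (chi y) - \<phi> \<gamma>"
    and "g \<in> carrier G \<Longrightarrow> (\<integral>\<^sup>+x. ennreal (\<bar>difference (\<lambda>y. \<phi> (chi y)) g x\<bar> powr p) \<partial>\<nu>) =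
      (\<integral>\<^sup>+y. ennreal (\<bar>\<phi> (chi (inv g \<otimes> y))\<bar> powr p) * indicator D y \<partial>haar)"
    and "g \<in> carrier G \<Longrightarrow> (\<lambda>y. ennreal (\<bar>\<phi> (chi (inv g \<otimes> y))\<bar> powr p) * indicator D y) \<in> borel_measurable (borel_of T)"
proof -
  note D = fundamental_domainD[OF fd]
  have one: "\<one> \<in> \<Gamma>" by (rule subgroup.one_closed[OF subgroup_Gamma])
  have \<phi>1: "\<phi> \<one> = 0" using \<phi>[OF one one] by simp
  have \<phi>i: "\<phi> (inv \<gamma>) = - \<phi> \<gamma>" if "\<gamma> \<in> \<Gamma>" for \<gamma>
  proof -
    have "\<phi> (inv \<gamma> \<otimes> \<gamma>) = \<phi> (inv \<gamma>) + \<phi> \<gamma>" by (rule \<phi>) (use that subgroup.m_inv_closed[OF subgroup_Gamma] in auto)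
    then show ?thesis using \<phi>1 Gamma_carrier[OF that] by simp
  qed
  let ?f = "\<lambda>y. \<phi> (chi y)"
  show fb: "?f \<in> borel_measurable (borel_of T)"
  proof (rule measurableI)
    fix B :: "real set" assume "B \<in> sets borel"
    have tr: "{y \<in> carrier G. y \<otimes> \<gamma> \<in> D} \<in> sets (borel_of T)" if "\<gamma> \<in> \<Gamma>" for \<gamma>
    proof -
      have "(\<lambda>y. y \<otimes> \<gamma>) \<in> measurable (borel_of T) (borel_of T)"
        using Gamma_carrier[OF that] by (intro continuous_map_measurable continuous_intros_group continuous_map_const_carrier) auto
      from measurable_sets[OF this D(1)] show ?thesis by (simp add: vimage_def Int_def conj_commute)
    qed
    have "?f -` B \<inter> space (borel_of T) = (\<Union>\<gamma>\<in>{\<gamma>\<in>\<Gamma>. \<phi> \<gamma> \<in> B}. {y \<in> carrier G. y \<otimes> \<gamma> \<in> D})"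
      using D(3,4,5) by auto
    also have "\<dots> \<in> sets (borel_of T)"
      using countable_Gamma tr by (intro sets.countable_UN') (auto intro: countable_subset)
    finally show "?f -` B \<inter> space (borel_of T) \<in> sets (borel_of T)" .
  qed simp
  show eq: "\<phi> (chi (y \<otimes> \<gamma>)) = \<phi> (chi y) - \<phi> \<gamma>" if "y \<in> carrier G" "\<gamma> \<in> \<Gamma>" for y \<gamma>
    using that D(3) \<phi>i by (simp add: D(7) \<phi> subgroup.m_inv_closed[OF subgroup_Gamma])
  assume g: "g \<in> carrier G"
  have fg: "(\<lambda>y. ?f (inv g \<otimes> y)) \<in> borel_measurable (borel_of T)"
    using g by (intro borel_compose[OF fb] continuous_intros_group continuous_map_const_carrier) auto
  show meas: "(\<lambda>y. ennreal (\<bar>\<phi> (chi (inv g \<otimes> y))\<bar> powr p) * indicator D y) \<in> borel_measurable (borel_of T)"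
    using fg D(1) by measurable
  have dq: "difference ?f g (q y) = ?f (inv g \<otimes> y) - ?f y" if "y \<in> carrier G" for y
    unfolding difference_def
    by (rule descend_q[of "\<lambda>y. ?f (inv g \<otimes> y) - ?f y", OF _ that])
      (use g Gamma_carrier in \<open>simp add: eq m_assoc[symmetric]\<close>)
  have "(\<integral>\<^sup>+y. ennreal (\<bar>\<phi> (chi (inv g \<otimes> y))\<bar> powr p) * indicator D y \<partial>count_space x) = ennreal (\<bar>difference ?f g x\<bar> powr p)"
    if x: "x \<in> topspace Xs" for x
  proof -
    obtain z where z: "z \<in> carrier G" "x = q z" using x by (auto simp: topspace_X)
    define y where "y = z \<otimes> chi z"
    have y: "y \<in> D" "y \<in> carrier G" "q y = x" "y \<in> x"
      using D(2-4) z Gamma_carrier q_self[of y] by (auto simp: y_def)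
    have inj: "inj_on q D"
    proof (rule inj_onI)
      fix a b assume ab: "a \<in> D" "b \<in> D" "q a = q b"
      then have c: "a \<in> carrier G" "b \<in> carrier G" using D(2) by auto
      then have "inv a \<otimes> b \<in> \<Gamma>" using ab(3) q_eq_iff by simp
      moreover have "a \<otimes> (inv a \<otimes> b) = b" using c by (simp add: m_assoc[symmetric])
      ultimately have "chi a = inv a \<otimes> b" using D(5)[OF c(1)] ab(2) by simp
      then have "inv a \<otimes> b = \<one>" using D(6)[OF ab(1)] by simp
      then show "a = b" using c by (metis inv_closed inv_equality inv_inv)
    qed
    have "(\<integral>\<^sup>+y. ennreal (\<bar>\<phi> (chi (inv g \<otimes> y))\<bar> powr p) * indicator D y \<partial>count_space x) = ennreal (\<bar>\<phi> (chi (inv g \<otimes> y))\<bar> powr p)"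
      by (rule fibre_sum_inj(1)[OF inj D(2) x y(1,4)])
    also have "\<phi> (chi (inv g \<otimes> y)) = difference ?f g x" using dq[OF y(2)] D(6)[OF y(1)] \<phi>1 y(3) by simp
    finally show ?thesis .
  qed
  then have "(\<integral>\<^sup>+x. \<integral>\<^sup>+y. ennreal (\<bar>\<phi> (chi (inv g \<otimes> y))\<bar> powr p) * indicator D y \<partial>count_space x \<partial>\<nu>) =
     (\<integral>\<^sup>+x. ennreal (\<bar>difference ?f g x\<bar> powr p) \<partial>\<nu>)"
    by (intro nn_integral_cong) (simp add: space_nu)
  then show "(\<integral>\<^sup>+x. ennreal (\<bar>difference ?f g x\<bar> powr p) \<partial>\<nu>) =
      (\<integral>\<^sup>+y. ennreal (\<bar>\<phi> (chi (inv g \<otimes> y))\<bar> powr p) * indicator D y \<partial>haar)"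
    using nn_integral_haar[OF meas] by simp
qed

text \<open>By compactness finitely many \<open>W i\<close> project onto the coset space. Each coset
  is represented in the first \<open>W i\<close> that it meets, exactly once because
  \<open>q\<close> is injective there.\<close>

lemma uniform_fundamental_domain:
  assumes "uniform_subgroup G T \<Gamma>"
  obtains D chi K where "fundamental_domain D chi" "compactin T K" "D \<subseteq> K"
proof -
  have cs: "compactin Xs (topspace Xs)"
    using assms by (simp add: uniform_subgroup_def compact_space_def)
  have "\<exists>\<F>. finite \<F> \<and> \<F> \<subseteq> range (\<lambda>i. q ` W i) \<and> topspace Xs \<subseteq> \<Union>\<F>"
  proof (rule compactinD[OF cs])
    show "topspace Xs \<subseteq> \<Union>(range (\<lambda>i. q ` W i))" using W_Union by (force simp: topspace_X)
    show "openin Xs U" if "U \<in> range (\<lambda>i. q ` W i)" for U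
      using that open_map_q W_open by (auto simp: open_map_def)
  qed
  then obtain \<F> where \<F>: "finite \<F>" "\<F> \<subseteq> range (\<lambda>i. q ` W i)" "topspace Xs \<subseteq> \<Union>\<F>" by blast
  obtain F where F: "finite F" "\<F> = (\<lambda>i. q ` W i) ` F" using finite_subset_image[OF \<F>(1,2)] by blast
  obtain m where m: "\<forall>i\<in>F. i < m" using finite_nat_set_iff_bounded F(1) by blast
  define E where "E i = W i \<inter> {y \<in> topspace T. q y \<in> topspace Xs - (\<Union>j<i. q ` W j)}" for i
  define D where "D = (\<Union>i<m. E i)"
  have Eb: "E i \<in> sets (borel_of T)" for i
  proof -
    have "q ` W j \<in> sets (borel_of Xs)" for j using q_image_borel W_borel by blast
    then have "topspace Xs - (\<Union>j<i. q ` W j) \<in> sets (borel_of Xs)"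
      using sets.compl_sets[of "\<Union>j<i. q ` W j" "borel_of Xs"] by auto
    from measurable_sets[OF q_measurable this]
    have "{y \<in> topspace T. q y \<in> topspace Xs - (\<Union>j<i. q ` W j)} \<in> sets (borel_of T)"
      by (simp add: vimage_def Int_def conj_commute)
    then show ?thesis unfolding E_def using W_borel by blast
  qed
  have Db: "D \<in> sets (borel_of T)" unfolding D_def using Eb by blast
  have ex: "\<exists>!\<gamma>. \<gamma> \<in> \<Gamma> \<and> g \<otimes> \<gamma> \<in> D" if g: "g \<in> carrier G" for g
  proof -
    have "q g \<in> topspace Xs" using g by (simp add: topspace_X)
    then obtain i0 where i0: "i0 \<in> F" "q g \<in> q ` W i0" using \<F>(3) F(2) by auto
    define i where "i = (LEAST i. q g \<in> q ` W i)"
    have i: "q g \<in> q ` W i" unfolding i_def using i0(2) by (rule LeastI)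
    have il: "i \<le> i0" unfolding i_def using i0(2) by (rule Least_le)
    have imin: "q g \<notin> q ` W j" if "j < i" for j using that not_less_Least unfolding i_def by blast
    obtain y where y: "q g = q y" "y \<in> W i" using i by (rule imageE)
    have yc: "y \<in> carrier G" using y(2) openin_subset[OF W_open[of i]] by auto
    have yE: "y \<in> E i" unfolding E_def using y imin yc by (auto simp: topspace_X)
    have yD: "y \<in> D" unfolding D_def using yE m i0(1) il by (meson UN_I le_less_trans lessThan_iff)
    show ?thesis
    proof (rule ex1I[of _ "inv g \<otimes> y"])
      have "inv g \<otimes> y \<in> \<Gamma>" using q_eq_iff[OF g yc] y(1) by simp
      moreover have "g \<otimes> (inv g \<otimes> y) = y" using g yc by (simp add: m_assoc[symmetric])
      ultimately show "inv g \<otimes> y \<in> \<Gamma> \<and> g \<otimes> (inv g \<otimes> y) \<in> D" using yD by simp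
      fix \<gamma> assume \<gamma>: "\<gamma> \<in> \<Gamma> \<and> g \<otimes> \<gamma> \<in> D"
      then obtain j where j: "j < m" "g \<otimes> \<gamma> \<in> E j" unfolding D_def by blast
      have gc: "\<gamma> \<in> carrier G" using \<gamma> Gamma_carrier by blast
      have qg: "q (g \<otimes> \<gamma>) = q g" using g \<gamma> by simp
      have Wj: "g \<otimes> \<gamma> \<in> W j" and nj: "\<And>l. l < j \<Longrightarrow> q g \<notin> q ` W l" using j(2) qg by (auto simp: E_def)
      have "q g \<in> q ` W j" using Wj qg by (metis imageI)
      then have "j = i" using nj imin i by (metis linorder_neqE_nat)
      then have "g \<otimes> \<gamma> = y" using inj_onD[OF W_inj[of i], of "g \<otimes> \<gamma>" y] Wj y qg by simp
      then show "\<gamma> = inv g \<otimes> y" using g gc by (auto simp: m_assoc[symmetric])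
    qed
  qed
  define chi where "chi g = (THE \<gamma>. \<gamma> \<in> \<Gamma> \<and> g \<otimes> \<gamma> \<in> D)" for g
  have chi: "chi g \<in> \<Gamma> \<and> g \<otimes> chi g \<in> D" if "g \<in> carrier G" for g
    unfolding chi_def by (rule theI'[OF ex[OF that]])
  obtain Ki where Ki: "\<And>i. compactin T (Ki i)" "\<And>i. W i \<subseteq> Ki i" using W_compact by metis
  have "compactin T (\<Union>(Ki ` {..<m}))" using Ki(1) by (intro compactin_Union) auto
  moreover have "D \<subseteq> \<Union>(Ki ` {..<m})" using Ki(2) unfolding D_def E_def by blast
  moreover have "fundamental_domain D chi" unfolding fundamental_domain_def using Db ex chi by blast
  ultimately show ?thesis using that by blast
qed

text \<open>For \<open>y\<close> in \<open>D\<close>, the element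
  \<open>chi (inv g \<otimes> y)\<close> is a product \<open>inv x \<otimes> (g \<otimes> z)\<close>
  with \<open>x\<close> and \<open>z\<close> in the compact set \<open>K\<close>. Such products form
  a compact set, which contains finitely many elements of \<Gamma>, so \<open>\<phi>\<close> is
  bounded on them.\<close>

lemma uniform_function:
  assumes u: "uniform_subgroup G T \<Gamma>"
    and \<phi>: "\<And>\<gamma> \<delta>. \<gamma> \<in> \<Gamma> \<Longrightarrow> \<delta> \<in> \<Gamma> \<Longrightarrow> \<phi> (\<gamma> \<otimes> \<delta>) = \<phi> \<gamma> + (\<phi> \<delta> :: real)" and p: "0 \<le> p"
  obtains f where "f \<in> borel_measurable (borel_of T)"
    "\<forall>y\<in>carrier G. \<forall>\<gamma>\<in>\<Gamma>. f (y \<otimes> \<gamma>) = f y - \<phi> \<gamma>"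
    "\<forall>g\<in>carrier G. (\<integral>\<^sup>+x. ennreal (\<bar>difference f g x\<bar> powr p) \<partial>\<nu>) < \<infinity>"
proof -
  obtain D chi K where DK: "fundamental_domain D chi" "compactin T K" "D \<subseteq> K"
    by (rule uniform_fundamental_domain[OF u])
  note D = fundamental_domainD[OF DK(1)]
  note F = fundamental_domain_function[where \<phi> = \<phi>, OF DK(1) \<phi>]
  have Ks: "K \<subseteq> carrier G" using compactin_subset_topspace[OF DK(2)] by simp
  have fin: "(\<integral>\<^sup>+x. ennreal (\<bar>difference (\<lambda>y. \<phi> (chi y)) g x\<bar> powr p) \<partial>\<nu>) < \<infinity>" if g: "g \<in> carrier G" for g
  proof -
    define L where "L = (\<lambda>(x, y). x \<otimes> y) ` ((\<lambda>x. inv x) ` K \<times> (\<lambda>(x, y). x \<otimes> y) ` ({g} \<times> K))"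
    have "compactin T L" unfolding L_def using g by (intro compactin_mult compactin_inv DK(2)) simp
    then have fL: "finite (L \<inter> \<Gamma>)" by (rule finite_compact_Int_Gamma)
    define B where "B = Max (insert 0 ((\<lambda>\<gamma>. \<bar>\<phi> \<gamma>\<bar>) ` (L \<inter> \<Gamma>)))"
    have B: "\<bar>\<phi> \<gamma>\<bar> \<le> B" if "\<gamma> \<in> L" "\<gamma> \<in> \<Gamma>" for \<gamma>
      unfolding B_def using fL that by (intro Max_ge) auto
    have "(\<integral>\<^sup>+y. ennreal (\<bar>\<phi> (chi (inv g \<otimes> y))\<bar> powr p) * indicator D y \<partial>haar) \<le> (\<integral>\<^sup>+y. ennreal (B powr p) * indicator K y \<partial>haar)"
    proof (rule nn_integral_mono)
      fix y assume "y \<in> space haar"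
      show "ennreal (\<bar>\<phi> (chi (inv g \<otimes> y))\<bar> powr p) * indicator D y \<le> ennreal (B powr p) * indicator K y"
      proof (cases "y \<in> D")
        case True
        then have yc: "y \<in> carrier G" and yK: "y \<in> K" using D(2) DK(3) by auto
        define \<gamma> where "\<gamma> = chi (inv g \<otimes> y)"
        have gy: "inv g \<otimes> y \<in> carrier G" using g yc by simp
        have \<gamma>: "\<gamma> \<in> \<Gamma>" "(inv g \<otimes> y) \<otimes> \<gamma> \<in> K" using D(3,4)[OF gy] DK(3) by (auto simp: \<gamma>_def)
        have gc: "\<gamma> \<in> carrier G" by (rule Gamma_carrier[OF \<gamma>(1)])
        have "\<gamma> = inv y \<otimes> (g \<otimes> ((inv g \<otimes> y) \<otimes> \<gamma>))"
        proof -
          have "g \<otimes> ((inv g \<otimes> y) \<otimes> \<gamma>) = y \<otimes> \<gamma>" using g yc gc by (simp add: m_assoc[symmetric])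
          then show ?thesis using yc gc by (simp add: m_assoc[symmetric])
        qed
        moreover have "inv y \<otimes> (g \<otimes> ((inv g \<otimes> y) \<otimes> \<gamma>)) \<in> L"
          unfolding L_def using yK \<gamma>(2) by force
        ultimately have "\<gamma> \<in> L" by simp
        then have "\<bar>\<phi> \<gamma>\<bar> powr p \<le> B powr p" using B \<gamma>(1) p by (intro powr_mono2) auto
        then show ?thesis using True yK by (simp add: \<gamma>_def ennreal_leI)
      qed simp
    qed
    also have "\<dots> = ennreal (B powr p) * emeasure haar K"
      using compact_borel[OF DK(2)] by (intro nn_integral_cmult_indicator) (simp add: sets_haar)
    also have "\<dots> < \<infinity>" using haar_compact_finite[OF DK(2)] by (simp add: ennreal_mult_less_top)
    finally show ?thesis by (subst F(3)[OF _ _ g]) auto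
  qed
  show ?thesis
  proof (rule that[of "\<lambda>y. \<phi> (chi y)"])
    show "(\<lambda>y. \<phi> (chi y)) \<in> borel_measurable (borel_of T)" by (rule F(1))
    show "\<forall>y\<in>carrier G. \<forall>\<gamma>\<in>\<Gamma>. \<phi> (chi (y \<otimes> \<gamma>)) = \<phi> (chi y) - \<phi> \<gamma>" using F(2) by blast
    show "\<forall>g\<in>carrier G. (\<integral>\<^sup>+x. ennreal (\<bar>difference (\<lambda>y. \<phi> (chi y)) g x\<bar> powr p) \<partial>\<nu>) < \<infinity>" using fin by blast
  qed
qed

lemma generate_word:
  assumes S: "S \<subseteq> carrier G" and "\<gamma> \<in> generate G S"
  shows "\<exists>ws. set ws \<subseteq> S \<union> (\<lambda>s. inv s) ` S \<and> foldr (\<lambda>x y. x \<otimes> y) ws \<one> = \<gamma>"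
  using assms(2)
proof induction
  case one
  show ?case by (intro exI[of _ "[]"]) simp
next
  case (incl h)
  then show ?case using S by (intro exI[of _ "[h]"]) auto
next
  case (inv h)
  then show ?case using S by (intro exI[of _ "[inv h]"]) auto
next
  case (eng h1 h2)
  then obtain ws1 ws2 where ws: "set ws1 \<subseteq> S \<union> (\<lambda>s. inv s) ` S" "foldr (\<lambda>x y. x \<otimes> y) ws1 \<one> = h1"
    "set ws2 \<subseteq> S \<union> (\<lambda>s. inv s) ` S" "foldr (\<lambda>x y. x \<otimes> y) ws2 \<one> = h2" by blast
  have h2: "h2 \<in> carrier G" using eng(2) generate_in_carrier[OF S] by blast
  have c: "S \<union> (\<lambda>s. inv s) ` S \<subseteq> carrier G" using S by auto
  have "foldr (\<lambda>x y. x \<otimes> y) ws h2 = foldr (\<lambda>x y. x \<otimes> y) ws \<one> \<otimes> h2 \<and> foldr (\<lambda>x y. x \<otimes> y) ws \<one> \<in> carrier G"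
    if "set ws \<subseteq> S \<union> (\<lambda>s. inv s) ` S" for ws
    using that
  proof (induction ws)
    case (Cons a ws)
    then have "a \<in> carrier G" using c by auto
    then show ?case using Cons h2 by (simp add: m_assoc)
  qed (use h2 in simp)
  then have "foldr (\<lambda>x y. x \<otimes> y) (ws1 @ ws2) \<one> = h1 \<otimes> h2" using ws by simp
  then show ?case using ws by (intro exI[of _ "ws1 @ ws2"]) auto
qed

text \<open>This is how integrability of the word length turns into integrability of the cocycle:
  additivity along a shortest word bounds \<open>\<phi>\<close> by the largest value on a generator
  or its inverse.\<close>

lemma hom_le_word_length:
  assumes S: "finite S" "S \<subseteq> \<Gamma>" "generate G S = \<Gamma>"
    and \<phi>: "\<And>\<gamma> \<delta>. \<gamma> \<in> \<Gamma> \<Longrightarrow> \<delta> \<in> \<Gamma> \<Longrightarrow> \<phi> (\<gamma> \<otimes> \<delta>) = \<phi> \<gamma> + (\<phi> \<delta> :: real)"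
  obtains C where "0 \<le> C" "\<forall>\<gamma>\<in>\<Gamma>. \<bar>\<phi> \<gamma>\<bar> \<le> C * real (word_length G S \<gamma>)"
proof -
  have Sc: "S \<subseteq> carrier G" using S(2) Gamma_carrier by blast
  have one: "\<one> \<in> \<Gamma>" by (rule subgroup.one_closed[OF subgroup_Gamma])
  have \<phi>1: "\<phi> \<one> = 0" using \<phi>[OF one one] by simp
  have inv\<Gamma>: "\<gamma> \<in> \<Gamma> \<Longrightarrow> inv \<gamma> \<in> \<Gamma>" for \<gamma> by (rule subgroup.m_inv_closed[OF subgroup_Gamma])
  define C where "C = Max (insert 0 ((\<lambda>s. \<bar>\<phi> s\<bar>) ` (S \<union> (\<lambda>s. inv s) ` S)))"
  have C0: "0 \<le> C" unfolding C_def using S(1) by (intro Max_ge) auto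
  have C: "\<bar>\<phi> s\<bar> \<le> C" if "s \<in> S \<union> (\<lambda>s. inv s) ` S" for s
    unfolding C_def using S(1) that by (intro Max_ge) auto
  have word: "foldr (\<lambda>x y. x \<otimes> y) ws \<one> \<in> \<Gamma> \<and> \<bar>\<phi> (foldr (\<lambda>x y. x \<otimes> y) ws \<one>)\<bar> \<le> C * real (length ws)"
    if "set ws \<subseteq> S \<union> (\<lambda>s. inv s) ` S" for ws
    using that
  proof (induction ws)
    case Nil
    then show ?case using one \<phi>1 by simp
  next
    case (Cons s ws)
    then have s: "s \<in> \<Gamma>" "\<bar>\<phi> s\<bar> \<le> C" using S(2) inv\<Gamma> C by auto
    then show ?case using Cons subgroup.m_closed[OF subgroup_Gamma] by (auto simp: \<phi> algebra_simps)
  qed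
  have "\<bar>\<phi> \<gamma>\<bar> \<le> C * real (word_length G S \<gamma>)" if \<gamma>: "\<gamma> \<in> \<Gamma>" for \<gamma>
  proof -
    have "\<exists>k ws. length ws = k \<and> set ws \<subseteq> S \<union> (\<lambda>s. inv s) ` S \<and> foldr (\<lambda>x y. x \<otimes> y) ws \<one> = \<gamma>"
      using generate_word[OF Sc] \<gamma> S(3) by blast
    then have "\<exists>ws. length ws = word_length G S \<gamma> \<and> set ws \<subseteq> S \<union> (\<lambda>s. inv s) ` S \<and> foldr (\<lambda>x y. x \<otimes> y) ws \<one> = \<gamma>"
      unfolding word_length_def by (rule LeastI_ex)
    then show ?thesis using word by metis
  qed
  then show ?thesis using that[OF C0] by blast
qed

lemma p_integrable_function:
  assumes pint: "p_integrable G T \<Gamma> p"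
    and \<phi>: "\<And>\<gamma> \<delta>. \<gamma> \<in> \<Gamma> \<Longrightarrow> \<delta> \<in> \<Gamma> \<Longrightarrow> \<phi> (\<gamma> \<otimes> \<delta>) = \<phi> \<gamma> + (\<phi> \<delta> :: real)" and p: "0 \<le> p"
  obtains f where "f \<in> borel_measurable (borel_of T)"
    "\<forall>y\<in>carrier G. \<forall>\<gamma>\<in>\<Gamma>. f (y \<otimes> \<gamma>) = f y - \<phi> \<gamma>"
    "\<forall>g\<in>carrier G. (\<integral>\<^sup>+x. ennreal (\<bar>difference f g x\<bar> powr p) \<partial>\<nu>) < \<infinity>"
proof (cases "uniform_subgroup G T \<Gamma>")
  case True
  show ?thesis by (rule uniform_function[where \<phi> = \<phi>, OF True \<phi> p]) (use that in auto)
next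
  case False
  then obtain S \<mu> D chi where S: "finite S" "S \<subseteq> \<Gamma>" "generate G S = \<Gamma>" and \<mu>: "haar_measure G T \<mu>"
    and D: "borel_fundamental_domain G T \<mu> \<Gamma> D" and chi: "domain_cocycle G \<Gamma> D chi"
    and fin: "\<forall>g \<in> carrier G. (\<integral>\<^sup>+h\<in>D. ennreal (real (word_length G S (chi (inv g \<otimes> h))) powr p) \<partial>\<mu>) < \<infinity>"
    using pint unfolding p_integrable_def by blast
  have inv\<Gamma>: "\<gamma> \<in> \<Gamma> \<Longrightarrow> inv \<gamma> \<in> \<Gamma>" for \<gamma> by (rule subgroup.m_inv_closed[OF subgroup_Gamma])
  have fd: "fundamental_domain D chi"
    unfolding fundamental_domain_def
  proof (intro conjI ballI)
    show "D \<in> sets (borel_of T)" using D by (simp add: borel_fundamental_domain_def)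
    fix g assume g: "g \<in> carrier G"
    show "\<exists>!\<gamma>. \<gamma> \<in> \<Gamma> \<and> g \<otimes> \<gamma> \<in> D" using D g by (simp add: borel_fundamental_domain_def)
    show c: "chi g \<in> \<Gamma>" using chi g by (auto simp: domain_cocycle_def)
    have cc: "chi g \<in> carrier G" by (rule Gamma_carrier[OF c])
    have "chi (g \<otimes> inv (inv (chi g))) = inv (chi g) \<otimes> chi g"
      using chi g inv\<Gamma>[OF c] unfolding domain_cocycle_def by blast
    then have "chi (g \<otimes> chi g) = \<one>" using cc by simp
    then show "g \<otimes> chi g \<in> D" using chi g cc unfolding domain_cocycle_def by blast
  qed
  note F = fundamental_domain_function[where \<phi> = \<phi>, OF fd \<phi>]
  obtain C where C: "0 \<le> C" "\<forall>\<gamma>\<in>\<Gamma>. \<bar>\<phi> \<gamma>\<bar> \<le> C * real (word_length G S \<gamma>)"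
    by (rule hom_le_word_length[where \<phi> = \<phi>, OF S \<phi>]) auto
  have finite: "(\<integral>\<^sup>+x. ennreal (\<bar>difference (\<lambda>y. \<phi> (chi y)) g x\<bar> powr p) \<partial>\<nu>) < \<infinity>" if g: "g \<in> carrier G" for g
  proof -
    have s\<mu>: "sets \<mu> = sets (borel_of T)" using \<mu> by (simp add: haar_measure_def radon_measure_def)
    have sp\<mu>: "space \<mu> = carrier G" using sets_eq_imp_space_eq[OF s\<mu>] by simp
    define L where "L h = ennreal (real (word_length G S (chi (inv g \<otimes> h))) powr p) * indicator D h" for h
    have Lfin: "(\<integral>\<^sup>+h. L h \<partial>\<mu>) < \<infinity>" using fin g by (simp add: L_def)
    have Fm: "(\<lambda>y. ennreal (\<bar>\<phi> (chi (inv g \<otimes> y))\<bar> powr p) * indicator D y) \<in> borel_measurable (borel_of T)"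
      by (rule F(4)[OF _ _ g])
    have "(\<integral>\<^sup>+y. ennreal (\<bar>\<phi> (chi (inv g \<otimes> y))\<bar> powr p) * indicator D y \<partial>\<mu>) < \<infinity>"
    proof (cases "C = 0")
      case True
      have "(\<integral>\<^sup>+y. ennreal (\<bar>\<phi> (chi (inv g \<otimes> y))\<bar> powr p) * indicator D y \<partial>\<mu>) = (\<integral>\<^sup>+y. 0 \<partial>\<mu>)"
      proof (rule nn_integral_cong)
        fix y assume "y \<in> space \<mu>"
        then have "chi (inv g \<otimes> y) \<in> \<Gamma>" using g by (intro fundamental_domainD(3)[OF fd]) (simp add: sp\<mu>)
        then have "\<bar>\<phi> (chi (inv g \<otimes> y))\<bar> \<le> 0" using C(2) True by fastforce
        then show "ennreal (\<bar>\<phi> (chi (inv g \<otimes> y))\<bar> powr p) * indicator D y = 0" by simp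
      qed
      then show ?thesis by simp
    next
      case False
      \<comment> \<open>The constant divides the integrand on the left instead of multiplying
        \<open>L\<close>, since moving it across the integral needs measurability, which has been
        established on the left. Hence the separate treatment of \<open>C = 0\<close>.\<close>
      define k where "k = ennreal (C powr p)"
      have k: "k \<noteq> 0" "k < \<infinity>" using False C(1) by (auto simp: k_def)
      have le: "ennreal (\<bar>\<phi> (chi (inv g \<otimes> y))\<bar> powr p) * indicator D y / k \<le> L y" if y: "y \<in> space \<mu>" for y
      proof -
        have "chi (inv g \<otimes> y) \<in> \<Gamma>" using g y by (intro fundamental_domainD(3)[OF fd]) (simp add: sp\<mu>)
        then have "\<bar>\<phi> (chi (inv g \<otimes> y))\<bar> powr p \<le> (C * real (word_length G S (chi (inv g \<otimes> y)))) powr p"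
          using C(2) p by (intro powr_mono2) auto
        also have "\<dots> = C powr p * real (word_length G S (chi (inv g \<otimes> y))) powr p"
          using C(1) by (simp add: powr_mult)
        finally have "ennreal (\<bar>\<phi> (chi (inv g \<otimes> y))\<bar> powr p) \<le> k * ennreal (real (word_length G S (chi (inv g \<otimes> y))) powr p)"
          unfolding k_def by (simp add: ennreal_mult[symmetric] ennreal_leI)
        then have "ennreal (\<bar>\<phi> (chi (inv g \<otimes> y))\<bar> powr p) * indicator D y \<le> L y * k"
          unfolding L_def by (auto simp: indicator_def mult.commute)
        then have "ennreal (\<bar>\<phi> (chi (inv g \<otimes> y))\<bar> powr p) * indicator D y / k \<le> L y * k / k"
          by (rule divide_right_mono_ennreal)
        then show ?thesis using k by (simp add: mult_divide_eq_ennreal)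
      qed
      have "(\<integral>\<^sup>+y. ennreal (\<bar>\<phi> (chi (inv g \<otimes> y))\<bar> powr p) * indicator D y \<partial>\<mu>) / k
          = (\<integral>\<^sup>+y. ennreal (\<bar>\<phi> (chi (inv g \<otimes> y))\<bar> powr p) * indicator D y / k \<partial>\<mu>)"
        using Fm by (intro nn_integral_divide[symmetric]) (simp add: measurable_cong_sets[OF s\<mu> refl])
      also have "\<dots> \<le> (\<integral>\<^sup>+y. L y \<partial>\<mu>)" by (rule nn_integral_mono[OF le])
      also note Lfin
      finally show ?thesis using k by (auto simp: less_top[symmetric] ennreal_divide_eq_top_iff)
    qed
    from haar_unique_finite[OF \<mu> Fm this] show ?thesis by (subst F(3)[OF _ _ g]) auto
  qed
  show ?thesis
  proof (rule that[of "\<lambda>y. \<phi> (chi y)"])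
    show "(\<lambda>y. \<phi> (chi y)) \<in> borel_measurable (borel_of T)" by (rule F(1))
    show "\<forall>y\<in>carrier G. \<forall>\<gamma>\<in>\<Gamma>. \<phi> (chi (y \<otimes> \<gamma>)) = \<phi> (chi y) - \<phi> \<gamma>" using F(2) by blast
    show "\<forall>g\<in>carrier G. (\<integral>\<^sup>+x. ennreal (\<bar>difference (\<lambda>y. \<phi> (chi y)) g x\<bar> powr p) \<partial>\<nu>) < \<infinity>" using finite by blast
  qed
qed

end

text \<open>\<open>f\<close> is a primitive of the cocycle upstairs. The locale is entered twice:
  for the given homomorphism, and again once the mean of its cocycle has been removed.\<close>

locale equivariant_function = lattice_product G T \<Gamma> \<nu> n \<pi>
  for G :: "'a monoid" (structure) and T :: "'a topology" and \<Gamma> :: "'a set" and \<nu> :: "'a set measure"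
    and n :: nat and \<pi> :: "nat \<Rightarrow> 'a \<Rightarrow> 'a" +
  fixes f \<phi> :: "'a \<Rightarrow> real" and p :: real
  assumes p1: "1 < p"
    and f_borel: "f \<in> borel_measurable (borel_of T)"
    and f_equivariant: "y \<in> carrier G \<Longrightarrow> \<gamma> \<in> \<Gamma> \<Longrightarrow> f (y \<otimes> \<gamma>) = f y - \<phi> \<gamma>"
    and f_integrable: "g \<in> carrier G \<Longrightarrow> (\<integral>\<^sup>+x. ennreal (\<bar>difference f g x\<bar> powr p) \<partial>\<nu>) < \<infinity>"
begin

abbreviation c :: "'a \<Rightarrow> 'a set \<Rightarrow> real" where "c \<equiv> difference f"

lemma c_q: "g \<in> carrier G \<Longrightarrow> y \<in> carrier G \<Longrightarrow> c g (q y) = f (inv g \<otimes> y) - f y"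
  unfolding difference_def
  by (rule descend_q[of "\<lambda>y. f (inv g \<otimes> y) - f y"])
    (use Gamma_carrier in \<open>simp_all add: f_equivariant m_assoc[symmetric]\<close>)

lemma c_borel: "case_prod c \<in> borel_measurable (borel_of (prod_topology T Xs))"
proof (rule measurable_descend2)
  have "(\<lambda>p. f (inv (fst p) \<otimes> snd p) - f (snd p)) \<in> borel_measurable (borel_of (prod_topology T T))"
    by (intro borel_measurable_diff borel_compose[OF f_borel] continuous_intros_group)
  then show "(\<lambda>(s, y). c s (q y)) \<in> borel_measurable (borel_of (prod_topology T T))"
    by (subst measurable_cong[where g = "\<lambda>p. f (inv (fst p) \<otimes> snd p) - f (snd p)"]) (auto simp: c_q)
qed

lemma c_slice: "g \<in> carrier G \<Longrightarrow> c g \<in> borel_measurable (borel_of Xs)"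
  using slice_measurable(1)[OF c_borel, of g] by simp

lemma c_mult:
  assumes "g \<in> carrier G" "h \<in> carrier G" "x \<in> topspace Xs"
  shows "c (g \<otimes> h) x = c g x + c h (inv g <# x)"
proof -
  obtain y where y: "y \<in> carrier G" "x = q y" using assms(3) by (auto simp: topspace_X)
  show ?thesis using assms(1,2) y by (simp add: act_q c_q inv_mult_group m_assoc)
qed

lemma c_integrable:
  assumes g: "g \<in> carrier G"
  shows "integrable \<nu> (c g)"
proof (rule Bochner_Integration.integrable_bound)
  have "integrable \<nu> (\<lambda>x. \<bar>c g x\<bar> powr p)"
    using f_integrable[OF g] c_slice[OF g] by (simp add: integrable_iff_bounded measurable_nu)
  then show "integrable \<nu> (\<lambda>x. 1 + \<bar>c g x\<bar> powr p)" by simp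
  show "c g \<in> borel_measurable \<nu>" using c_slice[OF g] by (simp add: measurable_nu)
  have "\<bar>y\<bar> \<le> 1 + \<bar>y\<bar> powr p" for y :: real
  proof (cases "\<bar>y\<bar> \<le> 1")
    case False
    then have "\<bar>y\<bar> powr 1 \<le> \<bar>y\<bar> powr p" using p1 by (intro powr_mono) auto
    then show ?thesis using False by simp
  qed (simp add: add_increasing2)
  then show "AE x in \<nu>. norm (c g x) \<le> norm (1 + \<bar>c g x\<bar> powr p)" by auto
qed

text \<open>If all differences of \<open>f\<close> have mean zero, then \<open>f\<close> can be corrected by a function on
  \<open>G/\<Gamma>\<close> so as to become constant.\<close>

lemma mean_zero_imp_trivial:
  assumes K: "compactin T K" "0 < \<epsilon>"
    and gap: "\<And>w. w \<in> borel_measurable (borel_of Xs) \<Longrightarrow> integrable \<nu> (\<lambda>x. (w x)\<^sup>2) \<Longrightarrow>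
      (\<integral>x. w x \<partial>\<nu>) = 0 \<Longrightarrow> \<exists>k\<in>K. ennreal (\<epsilon> * (\<integral>x. (w x)\<^sup>2 \<partial>\<nu>)) \<le> (\<integral>\<^sup>+x. ennreal ((w (inv k <# x) - w x)\<^sup>2) \<partial>\<nu>)"
    and mean: "\<And>g. g \<in> carrier G \<Longrightarrow> (\<integral>x. c g x \<partial>\<nu>) = 0"
    and \<gamma>: "\<gamma> \<in> \<Gamma>"
  shows "\<phi> \<gamma> = 0"
proof -
  define l where "l g = (\<integral>\<^sup>+x. ennreal (\<bar>c g x\<bar> powr p) \<partial>\<nu>)" for g
  have l[measurable]: "l \<in> borel_measurable (borel_of T)"
  proof -
    have "(\<lambda>(g, x). ennreal (\<bar>c g x\<bar> powr p)) \<in> borel_measurable (borel_of (prod_topology T Xs))"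
      using c_borel unfolding case_prod_unfold by measurable
    from tau_additive_Tonelli(1)[OF tau_additive_haar tau_additive_nu this] show ?thesis
      unfolding l_def[abs_def] by (simp add: measurable_haar)
  qed
  have lpi: "(\<lambda>g. l (\<pi> j g)) \<in> borel_measurable (borel_of T)" if "j \<in> {1..n}" for j
    by (intro borel_compose[OF l] proj_continuous that)
  \<comment> \<open>Summing over the factors lets a single density control the cocycle on all of
    them.\<close>
  define L where "L g = (\<Sum>j=1..n. l (\<pi> j g))" for g
  have L: "L \<in> borel_measurable (borel_of T)" unfolding L_def using lpi by (intro borel_measurable_sum) auto
  have Lfin: "L g < \<infinity>" if "g \<in> carrier G" for g
    unfolding L_def using that f_integrable by (simp add: l_def ennreal_sum_less_top)
  obtain \<rho> where \<rho>: "\<rho> \<in> borel_measurable (borel_of T)" "\<forall>g\<in>carrier G. 0 < \<rho> g \<and> \<rho> g < \<infinity>"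
    "(\<integral>\<^sup>+g. \<rho> g \<partial>haar) = 1" "(\<integral>\<^sup>+g. \<rho> g * L g \<partial>haar) < \<infinity>"
    using averaging_density[OF L Lfin] by metis
  interpret averaging G T \<Gamma> \<nu> n \<pi> \<rho>
    by unfold_locales (use \<rho> in auto)
  obtain r where r: "0 < r" "r < 1" "\<forall>v. v \<in> borel_measurable (borel_of Xs) \<longrightarrow> integrable \<nu> (\<lambda>x. (v x)\<^sup>2) \<longrightarrow>
      (\<integral>x. v x \<partial>\<nu>) = 0 \<longrightarrow> integrable \<nu> (\<lambda>x. (A v x)\<^sup>2) \<and> (\<integral>x. (A v x)\<^sup>2 \<partial>\<nu>) \<le> r * (\<integral>x. (v x)\<^sup>2 \<partial>\<nu>)"
    by (rule spectral_gap[OF K gap])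
  have avg_fin: "(\<integral>\<^sup>+g. \<integral>\<^sup>+x. ennreal (\<bar>c (\<pi> j g) x\<bar> powr p) \<partial>\<nu> \<partial>avg) < \<infinity>" if j: "j \<in> {1..n}" for j
  proof -
    have "(\<integral>\<^sup>+g. l (\<pi> j g) \<partial>avg) = (\<integral>\<^sup>+g. \<rho> g * l (\<pi> j g) \<partial>haar)"
      unfolding avg_def using lpi[OF j] \<rho>(1) by (intro nn_integral_density) (auto simp: measurable_haar)
    also have "\<dots> \<le> (\<integral>\<^sup>+g. \<rho> g * L g \<partial>haar)"
    proof (intro nn_integral_mono mult_left_mono)
      fix g
      show "l (\<pi> j g) \<le> L g" unfolding L_def using j by (intro member_le_sum) auto
    qed simp
    finally show ?thesis using \<rho>(4) by (simp add: l_def)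
  qed
  interpret averaging_cocycle G T \<Gamma> \<nu> n \<pi> \<rho> c p r
    by unfold_locales (use p1 r c_borel c_mult c_integrable mean avg_fin in \<open>auto simp: gap_constant_def\<close>)
  obtain u where u: "integrable \<nu> u" "\<forall>g\<in>carrier G. AE x in \<nu>. u (inv g <# x) + c g x = u x"
    by (rule coboundary)
  have ub: "u \<in> borel_measurable (borel_of Xs)" by (rule integrable_borel[OF u(1)])
  \<comment> \<open>The correction \<open>u\<close> makes \<open>F\<close> left invariant, hence
    constant almost everywhere. Since \<open>q\<close> does not distinguish \<open>y\<close> from
    \<open>y \<otimes> \<gamma>\<close>, comparing the two values of \<open>F\<close> leaves
    \<open>\<phi> \<gamma>\<close>.\<close>
  define F where "F y = f y + u (q y)" for y
  have F: "F \<in> borel_measurable (borel_of T)"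
    unfolding F_def by (intro borel_measurable_add f_borel borel_compose_X[OF ub continuous_q])
  have "AE y in haar. F (inv g \<otimes> y) = F y" if g: "g \<in> carrier G" for g
  proof -
    have "(\<lambda>x. u (inv g <# x) + c g x) \<in> borel_measurable (borel_of Xs)"
      using g by (intro borel_measurable_add act_borel[OF ub] c_slice) auto
    from borel_measurable_eq[OF this ub]
    have "{x \<in> topspace Xs. u (inv g <# x) + c g x = u x} \<in> sets (borel_of Xs)" by simp
    from AE_haar_iff[OF this] u(2) g have "AE y in haar. u (inv g <# q y) + c g (q y) = u (q y)" by simp
    then show ?thesis using AE_space
      by eventually_elim (use g in \<open>simp add: F_def space_haar act_q c_q\<close>)
  qed
  from left_invariant_function_constant[OF F this] obtain \<kappa> where \<kappa>: "AE y in haar. F y = \<kappa>" by blast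
  have "AE y in haar. F y = \<kappa> \<and> F (y \<otimes> \<gamma>) = \<kappa>"
    using \<kappa> haar_AE_right[OF \<kappa> Gamma_carrier[OF \<gamma>]] by eventually_elim simp
  then obtain y where y: "y \<in> carrier G" "F y = \<kappa>" "F (y \<otimes> \<gamma>) = \<kappa>" using haar_AE_ex by blast
  then show ?thesis using \<gamma> by (simp add: F_def f_equivariant)
qed

lemma extension:
  assumes K: "compactin T K" "0 < \<epsilon>"
    and gap: "\<And>w. w \<in> borel_measurable (borel_of Xs) \<Longrightarrow> integrable \<nu> (\<lambda>x. (w x)\<^sup>2) \<Longrightarrow>
      (\<integral>x. w x \<partial>\<nu>) = 0 \<Longrightarrow> \<exists>k\<in>K. ennreal (\<epsilon> * (\<integral>x. (w x)\<^sup>2 \<partial>\<nu>)) \<le> (\<integral>\<^sup>+x. ennreal ((w (inv k <# x) - w x)\<^sup>2) \<partial>\<nu>)"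
  obtains \<psi> where "continuous_map T euclideanreal \<psi>"
    "\<forall>g\<in>carrier G. \<forall>h\<in>carrier G. \<psi> (g \<otimes> h) = \<psi> g + \<psi> h" "\<forall>\<gamma>\<in>\<Gamma>. \<psi> \<gamma> = \<phi> \<gamma>"
proof -
  have V: "0 < measure \<nu> (space \<nu>)" using nu_nonzero by (simp add: emeasure_eq_measure zero_less_measure_iff)
  \<comment> \<open>Normalised because the mass of \<open>\<nu>\<close> is arbitrary. Additivity
    follows from the cocycle identity, since translation does not change the mean of its second
    summand.\<close>
  define \<psi> where "\<psi> g = (\<integral>x. c g x \<partial>\<nu>) / measure \<nu> (space \<nu>)" for g
  have hom: "\<psi> (g \<otimes> h) = \<psi> g + \<psi> h" if g: "g \<in> carrier G" and h: "h \<in> carrier G" for g h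
  proof -
    have gi: "inv g \<in> carrier G" using g by simp
    have "(\<integral>x. c (g \<otimes> h) x \<partial>\<nu>) = (\<integral>x. c g x + c h (inv g <# x) \<partial>\<nu>)"
      by (rule Bochner_Integration.integral_cong) (use g h in \<open>auto simp: space_nu c_mult\<close>)
    also have "\<dots> = (\<integral>x. c g x \<partial>\<nu>) + (\<integral>x. c h x \<partial>\<nu>)"
      using c_integrable[OF g] integrable_act[OF gi c_integrable[OF h]] integral_act[OF gi c_slice[OF h]] by simp
    finally show ?thesis by (simp add: \<psi>_def add_divide_distrib)
  qed
  have \<psi>b: "\<psi> \<in> borel_measurable (borel_of T)"
    using tau_additive_integral_measurable[OF tau_additive_haar tau_additive_nu c_borel]
    unfolding \<psi>_def[abs_def] by (simp add: measurable_haar)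
  have \<psi>1: "\<psi> \<one> = 0" using hom[OF one_closed one_closed] by simp
  have \<psi>i: "\<psi> (inv g) = - \<psi> g" if "g \<in> carrier G" for g
    using hom[of "inv g" g] that \<psi>1 by simp
  \<comment> \<open>Adding \<open>\<psi>\<close> to \<open>f\<close> subtracts
    \<open>\<psi> g\<close> from the cocycle; the sign comes from \<open>inv g\<close> in
    \<open>difference\<close>.\<close>
  define f' where "f' y = f y + \<psi> y" for y
  define \<phi>' where "\<phi>' \<gamma> = \<phi> \<gamma> - \<psi> \<gamma>" for \<gamma>
  have f'_eq: "f' (y \<otimes> \<gamma>) = f' y - \<phi>' \<gamma>" if "y \<in> carrier G" "\<gamma> \<in> \<Gamma>" for y \<gamma>
    using that Gamma_carrier by (simp add: f'_def \<phi>'_def f_equivariant hom)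
  have d: "difference f' g x = c g x - \<psi> g" if g: "g \<in> carrier G" and x: "x \<in> topspace Xs" for g x
  proof -
    obtain y where y: "y \<in> carrier G" "x = q y" using x by (auto simp: topspace_X)
    have "difference f' g (q y) = f' (inv g \<otimes> y) - f' y"
      unfolding difference_def
      by (rule descend_q[of "\<lambda>y. f' (inv g \<otimes> y) - f' y"])
        (use g y Gamma_carrier in \<open>simp_all add: f'_eq m_assoc[symmetric]\<close>)
    then show ?thesis using g y by (simp add: c_q f'_def hom \<psi>i)
  qed
  interpret E: equivariant_function G T \<Gamma> \<nu> n \<pi> f' \<phi>' p
  proof
    show "f' \<in> borel_measurable (borel_of T)" unfolding f'_def by (intro borel_measurable_add f_borel \<psi>b)
    fix g assume g: "g \<in> carrier G"
    \<comment> \<open>A crude power inequality, enough to keep the \<open>p\<close>-th power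
      integrable when a constant is subtracted.\<close>
    have pw: "\<bar>s - t\<bar> powr p \<le> 2 powr p * \<bar>s\<bar> powr p + 2 powr p * \<bar>t\<bar> powr p" for s t :: real
    proof -
      have "\<bar>s - t\<bar> powr p \<le> (2 * max \<bar>s\<bar> \<bar>t\<bar>) powr p" using p1 by (intro powr_mono2) auto
      also have "\<dots> = 2 powr p * (max \<bar>s\<bar> \<bar>t\<bar>) powr p" by (simp add: powr_mult)
      also have "\<dots> \<le> 2 powr p * (\<bar>s\<bar> powr p + \<bar>t\<bar> powr p)"
        by (intro mult_left_mono) (auto simp: max_def)
      finally show ?thesis by (simp add: algebra_simps)
    qed
    have "(\<integral>\<^sup>+x. ennreal (\<bar>difference f' g x\<bar> powr p) \<partial>\<nu>) \<le>
        (\<integral>\<^sup>+x. ennreal (2 powr p) * ennreal (\<bar>c g x\<bar> powr p) + ennreal (2 powr p * \<bar>\<psi> g\<bar> powr p) \<partial>\<nu>)"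
    proof (rule nn_integral_mono)
      fix x assume "x \<in> space \<nu>"
      then show "ennreal (\<bar>difference f' g x\<bar> powr p) \<le> ennreal (2 powr p) * ennreal (\<bar>c g x\<bar> powr p) + ennreal (2 powr p * \<bar>\<psi> g\<bar> powr p)"
        using ennreal_leI[OF pw[of "c g x" "\<psi> g"]] by (simp add: d g space_nu ennreal_plus ennreal_mult)
    qed
    also have "\<dots> = ennreal (2 powr p) * (\<integral>\<^sup>+x. ennreal (\<bar>c g x\<bar> powr p) \<partial>\<nu>) + ennreal (2 powr p * \<bar>\<psi> g\<bar> powr p) * emeasure \<nu> (space \<nu>)"
      using c_slice[OF g] by (subst nn_integral_add) (auto simp: measurable_nu nn_integral_cmult)
    also have "\<dots> < \<infinity>"
      using f_integrable[OF g] emeasure_finite[of "space \<nu>", unfolded less_top]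
      by (simp add: ennreal_mult_less_top less_top ennreal_less_top)
    finally show "(\<integral>\<^sup>+x. ennreal (\<bar>difference f' g x\<bar> powr p) \<partial>\<nu>) < \<infinity>" .
  qed (use p1 f'_eq in auto)
  have "\<psi> \<gamma> = \<phi> \<gamma>" if \<gamma>: "\<gamma> \<in> \<Gamma>" for \<gamma>
  proof -
    have "\<phi>' \<gamma> = 0"
    proof (rule E.mean_zero_imp_trivial[OF K gap _ \<gamma>])
      fix g assume g: "g \<in> carrier G"
      have "(\<integral>x. difference f' g x \<partial>\<nu>) = (\<integral>x. c g x - \<psi> g \<partial>\<nu>)"
        by (rule Bochner_Integration.integral_cong) (use g in \<open>auto simp: space_nu d\<close>)
      also have "\<dots> = 0" using c_integrable[OF g] V by (simp add: \<psi>_def)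
      finally show "(\<integral>x. difference f' g x \<partial>\<nu>) = 0" .
    qed
    then show ?thesis by (simp add: \<phi>'_def)
  qed
  then show ?thesis using that[OF borel_hom_continuous[OF \<psi>b hom]] hom by blast
qed

end

section \<open>Finite products of topological groups\<close>

text \<open>The retraction of the product onto the copy of its \<open>j\<close>-th factor inside it;
  this is what the abstract \<open>\<pi> j\<close> stands for.\<close>

definition coordinate :: "nat \<Rightarrow> (nat \<Rightarrow> 'a monoid) \<Rightarrow> nat \<Rightarrow> (nat \<Rightarrow> 'a) \<Rightarrow> nat \<Rightarrow> 'a" where
  "coordinate n Gi j g = (\<lambda>i\<in>{1..n}. if i = j then g i else \<one>\<^bsub>Gi i\<^esub>)"

context
  fixes n :: nat and Gi :: "nat \<Rightarrow> 'a monoid" and Ti :: "nat \<Rightarrow> 'a topology"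
  assumes factors: "\<And>i. i \<in> {1..n} \<Longrightarrow> topological_group (Gi i) (Ti i)"
begin

lemma factor_group: "i \<in> {1..n} \<Longrightarrow> group (Gi i)"
  and factor_topspace: "i \<in> {1..n} \<Longrightarrow> topspace (Ti i) = carrier (Gi i)"
  using factors by (auto simp: topological_group_def)

lemma topological_group_product:
  "topological_group (product_group {1..n} Gi) (product_topology Ti {1..n})"
proof -
  have tg: "top_group (Gi i) (Ti i)" if "i \<in> {1..n}" for i using factors[OF that] by unfold_locales
  have top: "topspace (product_topology Ti {1..n}) = carrier (product_group {1..n} Gi)"
    using factor_topspace by (auto simp: PiE_def Pi_def)
  have proj: "continuous_map (product_topology Ti {1..n}) (Ti i) (\<lambda>x. x i)" if "i \<in> {1..n}" for i
    using that by (rule continuous_map_product_projection)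
  show ?thesis
    unfolding topological_group_def
  proof (intro conjI)
    show "group (product_group {1..n} Gi)" using factor_group by (rule product_group)
    show "topspace (product_topology Ti {1..n}) = carrier (product_group {1..n} Gi)" by (rule top)
    show "continuous_map (prod_topology (product_topology Ti {1..n}) (product_topology Ti {1..n}))
        (product_topology Ti {1..n}) (\<lambda>(x, y). x \<otimes>\<^bsub>product_group {1..n} Gi\<^esub> y)"
      unfolding continuous_map_componentwise case_prod_unfold
    proof (intro conjI ballI)
      fix i assume i: "i \<in> {1..n}"
      have "continuous_map (prod_topology (product_topology Ti {1..n}) (product_topology Ti {1..n})) (Ti i) (\<lambda>p. fst p i \<otimes>\<^bsub>Gi i\<^esub> snd p i)"
        using continuous_map_compose[OF continuous_map_fst proj[OF i]] continuous_map_compose[OF continuous_map_snd proj[OF i]]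
        by (intro top_group.continuous_map_mult[OF tg[OF i]]) (auto simp: o_def)
      then show "continuous_map (prod_topology (product_topology Ti {1..n}) (product_topology Ti {1..n})) (Ti i)
          (\<lambda>x. (fst x \<otimes>\<^bsub>product_group {1..n} Gi\<^esub> snd x) i)"
        using i by simp
    qed auto
    have "continuous_map (product_topology Ti {1..n}) (product_topology Ti {1..n}) (\<lambda>x. \<lambda>i\<in>{1..n}. inv\<^bsub>Gi i\<^esub> x i)"
      unfolding continuous_map_componentwise
    proof (intro conjI ballI)
      fix i assume i: "i \<in> {1..n}"
      have "continuous_map (product_topology Ti {1..n}) (Ti i) (\<lambda>x. inv\<^bsub>Gi i\<^esub> x i)"
        by (rule top_group.continuous_map_inv[OF tg[OF i] proj[OF i]])
      then show "continuous_map (product_topology Ti {1..n}) (Ti i) (\<lambda>x. (\<lambda>i\<in>{1..n}. inv\<^bsub>Gi i\<^esub> x i) i)"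
        using i by simp
    qed auto
    then show "continuous_map (product_topology Ti {1..n}) (product_topology Ti {1..n}) (\<lambda>x. inv\<^bsub>product_group {1..n} Gi\<^esub> x)"
    proof (rule continuous_map_eq)
      fix x assume "x \<in> topspace (product_topology Ti {1..n})"
      then have "x \<in> carrier (product_group {1..n} Gi)" using top by simp
      then show "(\<lambda>i\<in>{1..n}. inv\<^bsub>Gi i\<^esub> x i) = inv\<^bsub>product_group {1..n} Gi\<^esub> x"
        using inv_product_group[of x "{1..n}" Gi] factor_group by simp
    qed
  qed
qed

lemma lattice_product_coordinate:
  assumes lat: "group_lattice (product_group {1..n} Gi) (product_topology Ti {1..n}) \<Gamma> \<nu>"
    and irr: "irreducible_in_product {1..n} Ti \<Gamma>" and n: "n \<ge> 1"
  shows "lattice_product (product_group {1..n} Gi) (product_topology Ti {1..n}) \<Gamma> \<nu> n (coordinate n Gi)"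
proof -
  interpret group_lattice "product_group {1..n} Gi" "product_topology Ti {1..n}" \<Gamma> \<nu> by (rule lat)
  let ?G = "product_group {1..n} Gi" and ?T = "product_topology Ti {1..n}"
  have carr: "x \<in> carrier ?G \<longleftrightarrow> x \<in> extensional {1..n} \<and> (\<forall>i\<in>{1..n}. x i \<in> carrier (Gi i))" for x
    by (auto simp: PiE_iff)
  have closed: "coordinate n Gi j g \<in> carrier ?G" if "g \<in> carrier ?G" for j g
    using that factor_group by (auto simp: coordinate_def carr group.is_monoid monoid.one_closed)
  have unit: "\<one>\<^bsub>Gi i\<^esub> \<in> carrier (Gi i)" if "i \<in> {1..n}" for i
    using factor_group[OF that] by (simp add: group.is_monoid monoid.one_closed)
  have lone: "\<one>\<^bsub>Gi i\<^esub> \<otimes>\<^bsub>Gi i\<^esub> a = a" and rone: "a \<otimes>\<^bsub>Gi i\<^esub> \<one>\<^bsub>Gi i\<^esub> = a" if "i \<in> {1..n}" "a \<in> carrier (Gi i)" for i a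
    using factor_group[OF that(1)] that(2) by (simp_all add: group.is_monoid monoid.l_one monoid.r_one)
  show ?thesis
  proof
    show "n \<ge> 1" by (rule n)
    fix i assume i: "i \<in> {1..n}"
    show "coordinate n Gi i \<in> hom ?G ?G"
    proof (rule homI)
      fix x y assume xy: "x \<in> carrier ?G" "y \<in> carrier ?G"
      show "coordinate n Gi i x \<in> carrier ?G" by (rule closed[OF xy(1)])
      show "coordinate n Gi i (x \<otimes>\<^bsub>?G\<^esub> y) = coordinate n Gi i x \<otimes>\<^bsub>?G\<^esub> coordinate n Gi i y"
        by (rule ext) (auto simp: coordinate_def lone unit)
    qed
    show "continuous_map ?T ?T (coordinate n Gi i)"
      unfolding continuous_map_componentwise
    proof (intro conjI ballI)
      show "coordinate n Gi i ` topspace ?T \<subseteq> extensional {1..n}" by (auto simp: coordinate_def)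
      fix k assume k: "k \<in> {1..n}"
      show "continuous_map ?T (Ti k) (\<lambda>x. coordinate n Gi i x k)"
      proof (cases "k = i")
        case True
        then show ?thesis using continuous_map_product_projection[OF k, of Ti] k by (simp add: coordinate_def)
      next
        case False
        then show ?thesis using k unit[OF k] factor_topspace[OF k] by (simp add: coordinate_def)
      qed
    qed
    show "coordinate n Gi i (coordinate n Gi i g) = coordinate n Gi i g" for g
      by (rule ext) (auto simp: coordinate_def)
    show "coordinate n Gi i g \<otimes>\<^bsub>?G\<^esub> coordinate n Gi j h = coordinate n Gi j h \<otimes>\<^bsub>?G\<^esub> coordinate n Gi i g"
      if "j \<in> {1..n}" "i \<noteq> j" "g \<in> carrier ?G" "h \<in> carrier ?G" for j g h
    proof
      fix k
      show "(coordinate n Gi i g \<otimes>\<^bsub>?G\<^esub> coordinate n Gi j h) k = (coordinate n Gi j h \<otimes>\<^bsub>?G\<^esub> coordinate n Gi i g) k"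
        using that(1,2) lone[of k "g k"] rone[of k "g k"] lone[of k "h k"] rone[of k "h k"] that(3,4)[unfolded carr]
        by (auto simp: coordinate_def)
    qed
    show "\<exists>\<gamma>\<in>\<Gamma>. \<exists>b\<in>carrier ?G. coordinate n Gi i b = \<one>\<^bsub>?G\<^esub> \<and> \<gamma> \<otimes>\<^bsub>?G\<^esub> b \<in> U"
      if U: "openin ?T U" "U \<noteq> {}" for U
    proof -
      \<comment> \<open>Coordinate projections are open, so the dense projection of \<Gamma> meets
        that of \<open>U\<close>. Two points that agree in coordinate \<open>i\<close> differ by an
        element that is trivial there.\<close>
      have "openin (Ti i) ((\<lambda>x. x i) ` U)"
        using open_map_product_projection[OF i, of Ti] U(1) unfolding open_map_def by blast
      moreover have "(\<lambda>x. x i) ` U \<noteq> {}" using U(2) by simp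
      moreover have "Ti i closure_of ((\<lambda>x. x i) ` \<Gamma>) = topspace (Ti i)"
        using irr i by (simp add: irreducible_in_product_def)
      ultimately have "(\<lambda>x. x i) ` \<Gamma> \<inter> (\<lambda>x. x i) ` U \<noteq> {}"
        unfolding dense_intersects_open by blast
      then obtain \<gamma> z where \<gamma>: "\<gamma> \<in> \<Gamma>" "z \<in> U" "\<gamma> i = z i" by auto
      have gc: "\<gamma> \<in> carrier ?G" by (rule Gamma_carrier[OF \<gamma>(1)])
      have zc: "z \<in> carrier ?G" using \<gamma>(2) openin_subset[OF U(1)] topspace_eq by blast
      define b where "b = inv\<^bsub>?G\<^esub> \<gamma> \<otimes>\<^bsub>?G\<^esub> z"
      have bc: "b \<in> carrier ?G" unfolding b_def using gc zc by (intro m_closed inv_closed)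
      have "\<gamma> \<otimes>\<^bsub>?G\<^esub> b = z" unfolding b_def using gc zc by (metis inv_closed m_assoc r_inv l_one)
      moreover have "coordinate n Gi i b = \<one>\<^bsub>?G\<^esub>"
      proof
        fix k
        have "b i = \<one>\<^bsub>Gi i\<^esub>"
        proof -
          have "(inv\<^bsub>?G\<^esub> \<gamma>) i = (\<lambda>i\<in>{1..n}. inv\<^bsub>Gi i\<^esub> (\<gamma> i)) i"
            by (rule fun_cong[OF inv_product_group]) (use gc factor_group in auto)
          then have "b i = inv\<^bsub>Gi i\<^esub> (\<gamma> i) \<otimes>\<^bsub>Gi i\<^esub> z i"
            unfolding b_def using i by (simp del: inv_product_group)
          moreover have "z i \<in> carrier (Gi i)" using zc[unfolded carr] i by blast
          ultimately show ?thesis using \<gamma>(3) group.l_inv[OF factor_group[OF i]] by simp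
        qed
        then show "coordinate n Gi i b k = \<one>\<^bsub>?G\<^esub> k" by (simp add: coordinate_def)
      qed
      ultimately show ?thesis using \<gamma>(1,2) bc by (intro bexI[of _ \<gamma>] bexI[of _ b]) auto
    qed
  next
    fix g assume g: "g \<in> carrier ?G"
    \<comment> \<open>Generalised to arbitrary lists without repetition so that the induction goes
      through; a repeated index would multiply its coordinate twice.\<close>
    have "foldr (\<lambda>j h. coordinate n Gi j g \<otimes>\<^bsub>?G\<^esub> h) js \<one>\<^bsub>?G\<^esub> = (\<lambda>i\<in>{1..n}. if i \<in> set js then g i else \<one>\<^bsub>Gi i\<^esub>)"
      if "distinct js" for js
      using that
    proof (induction js)
      case (Cons j js)
      have "distinct js" using Cons.prems by simp
      note IH = Cons.IH[OF this]
      show ?case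
      proof
        fix k
        show "foldr (\<lambda>j h. coordinate n Gi j g \<otimes>\<^bsub>?G\<^esub> h) (j # js) \<one>\<^bsub>?G\<^esub> k = (\<lambda>i\<in>{1..n}. if i \<in> set (j # js) then g i else \<one>\<^bsub>Gi i\<^esub>) k"
          unfolding foldr.simps o_def IH
          using Cons.prems g[unfolded carr] lone[of k] rone[of k "g k"] unit[of k] by (auto simp: coordinate_def)
      qed
    qed simp
    from this[of "[1..<Suc n]"]
    have "foldr (\<lambda>j h. coordinate n Gi j g \<otimes>\<^bsub>?G\<^esub> h) [1..<Suc n] \<one>\<^bsub>?G\<^esub> = (\<lambda>i\<in>{1..n}. if i \<in> set [1..<Suc n] then g i else \<one>\<^bsub>Gi i\<^esub>)"
      by (simp only: distinct_upt)
    also have "\<dots> = g"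
    proof
      fix k
      have "set [1..<Suc n] = {1..n}" by auto
      then show "(\<lambda>i\<in>{1..n}. if i \<in> set [1..<Suc n] then g i else \<one>\<^bsub>Gi i\<^esub>) k = g k"
        using g by (simp only: carr) (auto simp: extensional_def)
    qed
    finally show "foldr (\<lambda>j h. coordinate n Gi j g \<otimes>\<^bsub>?G\<^esub> h) [1..<Suc n] \<one>\<^bsub>?G\<^esub> = g" .
  qed
qed

end

theorem theorem8p4:
  fixes n :: nat
    and Gi :: "nat \<Rightarrow> 'a monoid" and Ti :: "nat \<Rightarrow> 'a topology"
    and G :: "(nat \<Rightarrow> 'a) monoid" and T :: "(nat \<Rightarrow> 'a) topology"
    and \<Gamma> :: "(nat \<Rightarrow> 'a) set" and p :: real
  assumes n: "n \<ge> 2"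
    and factors: "\<And>i. i \<in> {1..n} \<Longrightarrow> topological_group (Gi i) (Ti i)"
    and G: "G = product_group {1..n} Gi"
    and T: "T = product_topology Ti {1..n}"
    and "Hausdorff_space T"
    and "locally_compact_space T"
    and "sigma_compact_space T"
    and lattice: "lattice_subgroup G T \<Gamma>"
    and irreducible: "irreducible_in_product {1..n} Ti \<Gamma>"
    and weakly_cocompact: "weakly_cocompact G T \<Gamma>"
    and p: "p > 1"
    and integrable: "p_integrable G T \<Gamma> p"
  shows "\<forall>\<phi> \<in> hom (G\<lparr>carrier := \<Gamma>\<rparr>) real_group.
           \<exists>\<psi> \<in> hom G real_group.
             continuous_map T euclideanreal \<psi> \<and> (\<forall>\<gamma> \<in> \<Gamma>. \<psi> \<gamma> = \<phi> \<gamma>)"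
proof
  fix \<phi> assume "\<phi> \<in> hom (G\<lparr>carrier := \<Gamma>\<rparr>) real_group"
  then have \<phi>: "\<phi> (\<gamma> \<otimes>\<^bsub>G\<^esub> \<delta>) = \<phi> \<gamma> + \<phi> \<delta>" if "\<gamma> \<in> \<Gamma>" "\<delta> \<in> \<Gamma>" for \<gamma> \<delta>
    using that by (simp add: hom_def real_group_def)
  \<comment> \<open>The measure is taken from weak cocompactness, so that the spectral gap and the
    lift to Haar measure refer to the same \<open>\<nu>\<close>.\<close>
  obtain \<nu> where \<nu>: "invariant_measure_on_cosets G T \<Gamma> \<nu>"
    and noinv: "\<not> almost_has_invariant_vectors T (L2_0_functions \<nu>) (L2_seminorm \<nu>) (coset_translation G)"
    using weakly_cocompact unfolding weakly_cocompact_def by blast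
  have "discrete_subgroup G T \<Gamma>" using lattice by (simp add: lattice_subgroup_def)
  moreover have "topological_group G T" unfolding G T by (rule topological_group_product[OF factors])
  ultimately interpret group_lattice G T \<Gamma> \<nu>
    by unfold_locales (use assms(5-7) \<nu> in auto)
  have "lattice_product G T \<Gamma> \<nu> n (coordinate n Gi)"
    unfolding G T
    by (rule lattice_product_coordinate[OF factors _ irreducible])
      (use n group_lattice_axioms in \<open>auto simp: G T\<close>)
  then interpret lattice_product G T \<Gamma> \<nu> n "coordinate n Gi" .
  obtain K \<epsilon> where K: "compactin T K" "0 < \<epsilon>"
    "\<forall>w. w \<in> borel_measurable (borel_of Xs) \<longrightarrow> integrable \<nu> (\<lambda>x. (w x)\<^sup>2) \<longrightarrow> (\<integral>x. w x \<partial>\<nu>) = 0 \<longrightarrow>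
      (\<exists>k\<in>K. ennreal (\<epsilon> * (\<integral>x. (w x)\<^sup>2 \<partial>\<nu>)) \<le> (\<integral>\<^sup>+x. ennreal ((w (inv\<^bsub>G\<^esub> k <#\<^bsub>G\<^esub> x) - w x)\<^sup>2) \<partial>\<nu>))"
    by (rule weakly_cocompact_gap[OF noinv])
  obtain f where f: "f \<in> borel_measurable (borel_of T)"
    "\<forall>y\<in>carrier G. \<forall>\<gamma>\<in>\<Gamma>. f (y \<otimes>\<^bsub>G\<^esub> \<gamma>) = f y - \<phi> \<gamma>"
    "\<forall>g\<in>carrier G. (\<integral>\<^sup>+x. ennreal (\<bar>difference f g x\<bar> powr p) \<partial>\<nu>) < \<infinity>"
    by (rule p_integrable_function[where \<phi> = \<phi>, OF integrable \<phi>]) (use p in auto)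
  interpret equivariant_function G T \<Gamma> \<nu> n "coordinate n Gi" f \<phi> p
    by unfold_locales (use p f in auto)
  obtain \<psi> where \<psi>: "continuous_map T euclideanreal \<psi>"
    "\<forall>g\<in>carrier G. \<forall>h\<in>carrier G. \<psi> (g \<otimes>\<^bsub>G\<^esub> h) = \<psi> g + \<psi> h" "\<forall>\<gamma>\<in>\<Gamma>. \<psi> \<gamma> = \<phi> \<gamma>"
    by (rule extension[OF K(1,2)]) (use K(3) in auto)
  have "\<psi> \<in> hom G real_group" using \<psi>(2) by (simp add: hom_def real_group_def)
  then show "\<exists>\<psi> \<in> hom G real_group. continuous_map T euclideanreal \<psi> \<and> (\<forall>\<gamma> \<in> \<Gamma>. \<psi> \<gamma> = \<phi> \<gamma>)"
    using \<psi> by blast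
qed

end
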